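(* Let $a$ be a real-valued, quadratic, homogeneous polynomial on $\mathbb{R}^{2d}$ and let $\sigma \in M^{\infty,1}(\mathbb{R}^{2d}) \cap C^2(\mathbb{R}^{2d})$ be real-valued with bounded second order derivatives. Consider the Hamiltonian $\mathcal{H}(x,p) := a(x,p) + \sigma(x,p)$, let $H := \mathcal{H}^w$ be its Weyl quantization, and let $(\Phi_t)_{t\in\mathbb{R}}$ be the Hamiltonian flow of $\mathcal{H}$. Let $g \in M^1(\mathbb{R}^d)$ and $\Lambda \subseteq \mathbb{R}^{2d}$ be such that $\mathcal{G}(g,\Lambda)$ is a Gabor frame. Then there exists $t_0>0$ such that for all $t\in[-t_0,t_0]$, the system $\mathcal{G}(e^{-itH}g, \Phi_t(\Lambda))$ is a Gabor frame.
   Context: Time-frequency shifts: for $z=(x,\xi)\in\mathbb{R}^d\times\mathbb{R}^d$ and $f:\mathbb{R}^d\to\mathbb{C}$, $\rho(z)f(s) := e^{-\pi i x\cdot\xi} e^{2\pi i \xi\cdot s} f(s-x)$. Short-time Fourier transform with window $g\in L^2(\mathbb{R}^d)$: $V_g f(x,\xi) := \langle f, e^{\pi i x\cdot \xi}\rho(x,\xi) g\rangle$. With $\phi(x)=2^{d/4}e^{-\pi|x|^2}$, the Feichtinger algebra is $M^1(\mathbb{R}^d) := \{f\in L^2(\mathbb{R}^d): \|f\|_{M^1}:=\|V_\phi f\|_{L^1(\mathbb{R}^{2d})}<\infty\}$. For a fixed nonzero Schwartz window $g$ on $\mathbb{R}^{2d}$, the Sjöstrand class $M^{\infty,1}(\mathbb{R}^{2d})$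 is the set of tempered distributions $\sigma$ on $\mathbb{R}^{2d}$ with $\int_{\mathbb{R}^{2d}} \sup_{z\in\mathbb{R}^{2d}} |V_g\sigma(z,\zeta)|\,d\zeta<\infty$ (independent of the choice of $g$). Weyl quantization of a symbol $\sigma$ on $\mathbb{R}^d\times\mathbb{R}^d$: $\sigma^w f(x) := \int_{\mathbb{R}^d\times\mathbb{R}^d} \sigma\big(\tfrac{x+y}{2},\xi\big) e^{2\pi i (x-y)\cdot\xi} f(y)\,dy\,d\xi$; $e^{-itH}$ denotes the Schrödinger propagator generated by $H$ (solution operator of $i\partial_t u = Hu$, $u(0)=f$). The Hamiltonian flow $\Phi_t(x,p)$ is the flow of Hamilton's equations $\dot x = \partial_p\mathcal{H}(x,p)$, $\dot p = -\partial_x\mathcal{H}(x,p)$, with $\Phi_0=\mathrm{id}$. For $g\in L^2(\mathbb{R}^d)$ and $\Lambda\subseteq\mathbb{R}^{2d}$, the Gabor system is $\mathcal{G}(g,\Lambda):=\{\rho(\lambda)g:\lambda\in\Lambda\}$; it is a Gabor frame if there are $A,B>0$ with $A\|f\|_2^2\le\sum_{\lambda\in\Lambda}|\langle f,\rho(\lambda)g\rangle|^2\le B\|f\|_2^2$ for all $f\in L^2(\mathbb{R}^d)$ ($A,B$ are frame bounds). *)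

theory Defs
  imports "HOL-Analysis.Analysis"
begin

section \<open>L^2 basics (functions modulo nothing; a.e. issues handled explicitly)\<close>

definition sq_int :: "('a::euclidean_space \<Rightarrow> complex) \<Rightarrow> bool" where
  "sq_int f \<longleftrightarrow> f \<in> borel_measurable lborel \<and> integrable lborel (\<lambda>x. (cmod (f x))\<^sup>2)"

definition l2norm :: "('a::euclidean_space \<Rightarrow> complex) \<Rightarrow> real" where
  "l2norm f = sqrt (\<integral>x. (cmod (f x))\<^sup>2 \<partial>lborel)"

definition l2inner :: "('a::euclidean_space \<Rightarrow> complex) \<Rightarrow> ('a \<Rightarrow> complex) \<Rightarrow> complex" where
  "l2inner f g = (\<integral>x. f x * cnj (g x) \<partial>lborel)"

definition tfs :: "'a::euclidean_space \<times> 'a \<Rightarrow> ('a \<Rightarrow> complex) \<Rightarrow> 'a \<Rightarrow> complex" where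
  "tfs z f s = cis (- pi * (fst z \<bullet> snd z)) * cis (2 * pi * (snd z \<bullet> s)) * f (s - fst z)"

definition stft :: "('a::euclidean_space \<Rightarrow> complex) \<Rightarrow> ('a \<Rightarrow> complex) \<Rightarrow> 'a \<times> 'a \<Rightarrow> complex" where
  "stft g f z = l2inner f (\<lambda>s. cis (pi * (fst z \<bullet> snd z)) * tfs z g s)"

definition gauss :: "'a::euclidean_space \<Rightarrow> complex" where
  "gauss x = complex_of_real (2 powr (real DIM('a) / 4) * exp (- pi * (norm x)\<^sup>2))"

definition M1 :: "('a::euclidean_space \<Rightarrow> complex) \<Rightarrow> bool" where
  "M1 f \<longleftrightarrow> sq_int f \<and> integrable lborel (\<lambda>z. cmod (stft gauss f z))"

text \<open>Sjoestrand class M^{infty,1} for a (function) symbol on a Euclidean space, with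
  the Gaussian window (a fixed nonzero Schwartz function); the pairing defining the
  STFT is required to exist as a Lebesgue integral.\<close>
definition sjostrand :: "('a::euclidean_space \<Rightarrow> complex) \<Rightarrow> bool" where
  "sjostrand s \<longleftrightarrow> s \<in> borel_measurable lborel \<and>
     (\<forall>z. integrable lborel (\<lambda>w. s w * cnj (cis (pi * (fst z \<bullet> snd z)) * tfs z gauss w))) \<and>
     (\<integral>\<^sup>+ \<zeta>. (SUP z. ennreal (cmod (stft gauss s (z, \<zeta>)))) \<partial>lborel) < \<infinity>"

definition gabor_frame :: "('a::euclidean_space \<Rightarrow> complex) \<Rightarrow> ('a \<times> 'a) set \<Rightarrow> bool" where
  "gabor_frame g \<Lambda> \<longleftrightarrow> sq_int g \<and>
     (\<exists>A B. A > 0 \<and> B > 0 \<and>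
       (\<forall>f. sq_int f \<longrightarrow>
          ennreal (A * (l2norm f)\<^sup>2) \<le> (\<integral>\<^sup>+ l. ennreal ((cmod (l2inner f (tfs l g)))\<^sup>2) \<partial>count_space \<Lambda>)
        \<and> (\<integral>\<^sup>+ l. ennreal ((cmod (l2inner f (tfs l g)))\<^sup>2) \<partial>count_space \<Lambda>) \<le> ennreal (B * (l2norm f)\<^sup>2)))"

definition quad_hom_poly :: "((real^'n) \<times> (real^'n) \<Rightarrow> real) \<Rightarrow> bool" where
  "quad_hom_poly a \<longleftrightarrow> (\<exists>A B C :: 'n \<Rightarrow> 'n \<Rightarrow> real. \<forall>x p.
     a (x, p) = (\<Sum>i\<in>UNIV. \<Sum>j\<in>UNIV. A i j * x$i * x$j + B i j * x$i * p$j + C i j * p$i * p$j))"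

definition C2_bounded_second :: "('a::euclidean_space \<Rightarrow> real) \<Rightarrow> bool" where
  "C2_bounded_second s \<longleftrightarrow> (\<exists>(D1 :: 'a \<Rightarrow> ('a \<Rightarrow>\<^sub>L real)) (D2 :: 'a \<Rightarrow> ('a \<Rightarrow>\<^sub>L ('a \<Rightarrow>\<^sub>L real))).
     (\<forall>z. (s has_derivative blinfun_apply (D1 z)) (at z)) \<and>
     (\<forall>z. (D1 has_derivative blinfun_apply (D2 z)) (at z)) \<and>
     continuous_on UNIV D2 \<and> bounded (range D2))"

text \<open>Given the derivative D of the Hamiltonian at a point, the Hamiltonian vector
  field (d_p H, - d_x H).\<close>
definition ham_vf :: "((real^'n) \<times> (real^'n) \<Rightarrow> real) \<Rightarrow> (real^'n) \<times> (real^'n)" where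
  "ham_vf D = ((\<chi> i. D (0, axis i 1)), - (\<chi> i. D (axis i 1, 0)))"

definition hamiltonian_flow ::
  "((real^'n) \<times> (real^'n) \<Rightarrow> real) \<Rightarrow> (real \<Rightarrow> (real^'n) \<times> (real^'n) \<Rightarrow> (real^'n) \<times> (real^'n)) \<Rightarrow> bool" where
  "hamiltonian_flow H \<Phi> \<longleftrightarrow> (\<forall>z. \<Phi> 0 z = z) \<and>
     (\<forall>z t. \<exists>D. (H has_derivative D) (at (\<Phi> t z)) \<and>
              ((\<lambda>s. \<Phi> s z) has_vector_derivative ham_vf D) (at t))"

definition partial_dir :: "'n \<Rightarrow> (real^'n \<Rightarrow> complex) \<Rightarrow> real^'n \<Rightarrow> complex" where
  "partial_dir i f x = vector_derivative (\<lambda>t. f (x + t *\<^sub>R axis i 1)) (at 0)"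

fun iter_partial :: "'n list \<Rightarrow> (real^'n \<Rightarrow> complex) \<Rightarrow> real^'n \<Rightarrow> complex" where
  "iter_partial [] f = f"
| "iter_partial (i # is) f = partial_dir i (iter_partial is f)"

definition schwartz :: "(real^'n \<Rightarrow> complex) \<Rightarrow> bool" where
  "schwartz f \<longleftrightarrow>
     (\<forall>is x i. (\<lambda>t. iter_partial is f (x + t *\<^sub>R axis i 1)) differentiable (at 0)) \<and>
     (\<forall>is (k::nat). bounded (range (\<lambda>x. (1 + norm x) ^ k * cmod (iter_partial is f x))))"

definition wigner :: "(real^'n \<Rightarrow> complex) \<Rightarrow> (real^'n \<Rightarrow> complex) \<Rightarrow> (real^'n) \<times> (real^'n) \<Rightarrow> complex" where
  "wigner f h z = (\<integral>t. f (fst z + (1/2) *\<^sub>R t) * cnj (h (fst z - (1/2) *\<^sub>R t)) * cis (- 2 * pi * (t \<bullet> snd z)) \<partial>lborel)"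

text \<open>Weak form of the Weyl quantization: < H^w f, h > = int H W(f,h).\<close>
definition weyl_form :: "((real^'n) \<times> (real^'n) \<Rightarrow> real) \<Rightarrow> (real^'n \<Rightarrow> complex) \<Rightarrow> (real^'n \<Rightarrow> complex) \<Rightarrow> complex" where
  "weyl_form H f h = (\<integral>z. complex_of_real (H z) * wigner f h z \<partial>lborel)"

text \<open>U is the Schroedinger propagator e^{-itH}, H = Hsym^w: a strongly continuous
  one-parameter unitary group on L^2 (acting on representatives, compatible with a.e.
  equality), whose generator extends -iH on Schwartz functions, i.e. for Schwartz f,
  (U t f - f)/t -> -i H f in L^2, where H f is the L^2 function with
  < H f, h > = weyl_form Hsym f h for all Schwartz h.\<close>
definition schrodinger_propagator ::
  "((real^'n) \<times> (real^'n) \<Rightarrow> real) \<Rightarrow> (real \<Rightarrow> (real^'n \<Rightarrow> complex) \<Rightarrow> (real^'n \<Rightarrow> complex)) \<Rightarrow> bool" where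
  "schrodinger_propagator Hsym U \<longleftrightarrow>
     (\<forall>t f. sq_int f \<longrightarrow> sq_int (U t f)) \<and>
     (\<forall>t f g. sq_int f \<longrightarrow> sq_int g \<longrightarrow> (AE x in lborel. f x = g x) \<longrightarrow>
         (AE x in lborel. U t f x = U t g x)) \<and>
     (\<forall>t f g c. sq_int f \<longrightarrow> sq_int g \<longrightarrow>
         (AE x in lborel. U t (\<lambda>y. f y + c * g y) x = U t f x + c * U t g x)) \<and>
     (\<forall>t f. sq_int f \<longrightarrow> l2norm (U t f) = l2norm f) \<and>
     (\<forall>f. sq_int f \<longrightarrow> (AE x in lborel. U 0 f x = f x)) \<and>
     (\<forall>s t f. sq_int f \<longrightarrow> (AE x in lborel. U (s + t) f x = U s (U t f) x)) \<and>
     (\<forall>f s. sq_int f \<longrightarrow> ((\<lambda>t. l2norm (\<lambda>x. U t f x - U s f x)) \<longlongrightarrow> 0) (at s)) \<and>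
     (\<forall>f. schwartz f \<longrightarrow> (\<exists>k. sq_int k \<and> (\<forall>h. schwartz h \<longrightarrow> l2inner k h = weyl_form Hsym f h) \<and>
         ((\<lambda>t. l2norm (\<lambda>x. (U t f x - f x) / complex_of_real t + \<i> * k x)) \<longlongrightarrow> 0) (at 0)))"

end

theory Submission
  imports Defs "HOL-Probability.Probability"
begin

text \<open>Two facts are combined. First, a frame with window in \<open>M\<^sup>1\<close> is stable under perturbations of the
  window that are small in \<open>M\<^sup>1\<close> together with deformations \<open>\<Psi>\<close> of the point set for which
  \<open>\<Psi> - id\<close> has a small Lipschitz constant: on a ball of large radius in phase space such a \<open>\<Psi>\<close> is
  nearly a translation, which only multiplies the frame coefficients of a localized function by phases, and averaging
  over the centres of the balls recovers the global lower bound. The Hamiltonian flow is such a deformation by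
  Gronwall's inequality. Second, \<open>U t g\<close> tends to \<open>g\<close> in \<open>M\<^sup>1\<close>: along the linear flow \<open>S t\<close> of the quadratic part
  (rescaled by the \<open>2\<pi>\<close> of the Weyl calculus), the coefficient \<open>\<langle>U t g, wp (S t w)\<rangle>\<close> has a derivative bounded by
  a convolution of the coefficients with an integrable kernel, because the unbounded terms of the Weyl symbol cancel. Duhamel's
  formula bounds the \<open>M\<^sup>1\<close> norm of \<open>U t g\<close> by a quantity tending to that of \<open>g\<close>, and Scheffe's lemma upgrades
  pointwise convergence of the coefficients to convergence in the mean.\<close>

text \<open>Two obstacles shape the argument. The displacement \<open>\<Psi> l - l\<close> may be
  unbounded, so no perturbation estimate covers all of \<open>\<Lambda>\<close> at once; only its
  oscillation over a ball of radius R, about \<delta> R, is small. R is therefore fixed first, so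
  large that the commutators of the cutoff with the reproducing kernel (of order 1/R) are absorbed
  by the frame bound, and \<delta> is chosen afterwards. This needs quantitative decay, which a
  window in M^1 does not have: it is replaced by a superposition of wave packets centred in a ball,
  and the error is charged to a Bessel bound that sees \<open>\<Lambda>\<close> only through the
  number of points per ball. The hypothesis on \<open>U\<close> is purely an L^2 statement: nothing
  says in advance that \<open>U t g\<close> is in M^1, and its derivative is known on Schwartz
  functions only. All information is hence drawn from pairings with wave packets, which are
  Schwartz, and the Gronwall argument runs not on a possibly infinite L^1 norm but on integrals
  against weights bounded by 1 and of finite mass. The flow \<open>S\<close> in that argument and
  the flow of the points are never compared; for short times both are close to the identity.\<close>

abbreviation nn_lborel :: "('a::euclidean_space \<Rightarrow> ennreal) \<Rightarrow> ennreal"  (binder \<open>NNBINT \<close> 10)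
  where "nn_lborel f \<equiv> integral\<^sup>N lborel f"

section \<open>Square-integrable functions\<close>

lemma borel_measurable_cnj [measurable (raw)]:
  "f \<in> borel_measurable M \<Longrightarrow> (\<lambda>x. cnj (f x)) \<in> borel_measurable M"
  by (rule measurable_compose[OF _ borel_measurable_continuous_onI]) (auto intro!: continuous_intros)

lemma sq_intD:
  assumes "sq_int f"
  shows "f \<in> borel_measurable borel" "integrable lborel (\<lambda>x. (cmod (f x))\<^sup>2)"
  using assms by (auto simp: sq_int_def)

lemma sq_int_mult_integrable:
  assumes "sq_int f" "sq_int g"
  shows "integrable lborel (\<lambda>x. f x * cnj (g x))"
proof (rule Bochner_Integration.integrable_bound)
  show "integrable lborel (\<lambda>x. (cmod (f x))\<^sup>2 + (cmod (g x))\<^sup>2)"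
    using assms by (auto simp: sq_int_def)
  show "(\<lambda>x. f x * cnj (g x)) \<in> borel_measurable lborel"
    using sq_intD(1)[OF assms(1)] sq_intD(1)[OF assms(2)] by (simp add: borel_measurable_times)
  show "AE x in lborel. norm (f x * cnj (g x)) \<le> norm ((cmod (f x))\<^sup>2 + (cmod (g x))\<^sup>2)"
  proof (rule AE_I2)
    fix x
    have "cmod (f x) * cmod (g x) \<le> (cmod (f x))\<^sup>2 + (cmod (g x))\<^sup>2"
      using sum_squares_bound[of "cmod (f x)" "cmod (g x)"] mult_nonneg_nonneg[of "cmod (f x)" "cmod (g x)"]
      by (simp del: mult_nonneg_nonneg zero_le_mult_iff)
    then show "norm (f x * cnj (g x)) \<le> norm ((cmod (f x))\<^sup>2 + (cmod (g x))\<^sup>2)"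
      by (simp add: norm_mult)
  qed
qed

lemma sq_int_scale:
  assumes "sq_int f"
  shows "sq_int (\<lambda>x. c * f x)"
  using assms by (auto simp: sq_int_def norm_mult power_mult_distrib)

lemma sq_int_add:
  assumes "sq_int f" "sq_int g"
  shows "sq_int (\<lambda>x. f x + g x)"
  unfolding sq_int_def
proof
  have [measurable]: "f \<in> borel_measurable borel" "g \<in> borel_measurable borel"
    using assms by (auto simp: sq_int_def)
  show "(\<lambda>x. f x + g x) \<in> borel_measurable lborel" by simp
  show "integrable lborel (\<lambda>x. (cmod (f x + g x))\<^sup>2)"
  proof (rule Bochner_Integration.integrable_bound)
    show "integrable lborel (\<lambda>x. 2 * (cmod (f x))\<^sup>2 + 2 * (cmod (g x))\<^sup>2)"
      using assms by (auto simp: sq_int_def)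
    show "AE x in lborel. norm ((cmod (f x + g x))\<^sup>2) \<le> norm (2 * (cmod (f x))\<^sup>2 + 2 * (cmod (g x))\<^sup>2)"
    proof (rule AE_I2)
      fix x
      have "(cmod (f x + g x))\<^sup>2 \<le> (cmod (f x) + cmod (g x))\<^sup>2"
        by (intro power_mono norm_triangle_ineq) simp
      also have "\<dots> \<le> 2 * (cmod (f x))\<^sup>2 + 2 * (cmod (g x))\<^sup>2"
        using zero_le_power2[of "cmod (f x) - cmod (g x)"] by (simp add: power2_eq_square algebra_simps)
      finally show "norm ((cmod (f x + g x))\<^sup>2) \<le> norm (2 * (cmod (f x))\<^sup>2 + 2 * (cmod (g x))\<^sup>2)" by simp
    qed
  qed simp
qed

lemma sq_int_diff:
  assumes "sq_int f" "sq_int g"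
  shows "sq_int (\<lambda>x. f x - g x)"
  using sq_int_add[OF assms(1) sq_int_scale[OF assms(2), of "-1"]] by simp

lemma sq_int_cong_norm:
  assumes "sq_int f" "g \<in> borel_measurable borel" "\<And>x. cmod (g x) \<le> cmod (f x)"
  shows "sq_int g"
  unfolding sq_int_def
proof
  show "integrable lborel (\<lambda>x. (cmod (g x))\<^sup>2)"
    by (rule Bochner_Integration.integrable_bound[OF sq_intD(2)[OF assms(1)]])
      (use assms in \<open>auto intro!: power_mono\<close>)
qed (use assms in simp)

lemma l2norm_nonneg [simp]: "0 \<le> l2norm f"
  by (simp add: l2norm_def)

lemma l2norm_sq: "(l2norm f)\<^sup>2 = (LBINT x. (cmod (f x))\<^sup>2)"
  by (simp add: l2norm_def)

lemma l2inner_self: "l2inner f f = complex_of_real ((l2norm f)\<^sup>2)"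
proof -
  have "l2inner f f = (LBINT x. complex_of_real ((cmod (f x))\<^sup>2))"
    unfolding l2inner_def by (simp only: complex_norm_square)
  then show ?thesis by (simp add: l2norm_sq del: of_real_power)
qed

lemma l2inner_cnj: "cnj (l2inner f g) = l2inner g f"
  unfolding l2inner_def by (subst Bochner_Integration.integral_cnj[symmetric]) (simp add: mult.commute)

lemma l2inner_add_left:
  assumes "sq_int f" "sq_int g" "sq_int h"
  shows "l2inner (\<lambda>x. f x + g x) h = l2inner f h + l2inner g h"
  using sq_int_mult_integrable[OF assms(1,3)] sq_int_mult_integrable[OF assms(2,3)]
  by (simp add: l2inner_def distrib_right)

lemma l2inner_scale_left: "l2inner (\<lambda>x. c * f x) h = c * l2inner f h"
  by (simp add: l2inner_def mult.assoc)

lemma l2inner_scale_right: "l2inner h (\<lambda>x. c * f x) = cnj c * l2inner h f"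
  by (simp add: l2inner_def mult.left_commute)

lemma l2inner_add_right:
  assumes "sq_int f" "sq_int g" "sq_int h"
  shows "l2inner h (\<lambda>x. f x + g x) = l2inner h f + l2inner h g"
  using sq_int_mult_integrable[OF assms(3,1)] sq_int_mult_integrable[OF assms(3,2)]
  by (simp add: l2inner_def distrib_left)

lemma l2inner_diff_left:
  assumes "sq_int f" "sq_int g" "sq_int h"
  shows "l2inner (\<lambda>x. f x - g x) h = l2inner f h - l2inner g h"
  using sq_int_mult_integrable[OF assms(1,3)] sq_int_mult_integrable[OF assms(2,3)]
  by (simp add: l2inner_def left_diff_distrib)

lemma l2inner_diff_right:
  assumes "sq_int f" "sq_int g" "sq_int h"
  shows "l2inner h (\<lambda>x. f x - g x) = l2inner h f - l2inner h g"
  using sq_int_mult_integrable[OF assms(3,1)] sq_int_mult_integrable[OF assms(3,2)]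
  by (simp add: l2inner_def right_diff_distrib)

lemma l2norm_scale: "l2norm (\<lambda>x. c * f x) = cmod c * l2norm f"
  by (simp add: l2norm_def norm_mult power_mult_distrib real_sqrt_mult)

lemma l2norm_add_sq:
  assumes "sq_int f" "sq_int g"
  shows "(l2norm (\<lambda>x. f x + g x))\<^sup>2 = (l2norm f)\<^sup>2 + (l2norm g)\<^sup>2 + 2 * Re (l2inner f g)"
proof -
  have "complex_of_real ((l2norm (\<lambda>x. f x + g x))\<^sup>2) = l2inner f f + l2inner g f + (l2inner f g + l2inner g g)"
    by (subst l2inner_self[symmetric])
      (simp add: l2inner_add_left l2inner_add_right assms sq_int_add)
  also have "\<dots> = complex_of_real ((l2norm f)\<^sup>2 + (l2norm g)\<^sup>2) + (l2inner f g + cnj (l2inner f g))"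
    by (simp add: l2inner_self l2inner_cnj)
  also have "l2inner f g + cnj (l2inner f g) = complex_of_real (2 * Re (l2inner f g))"
    by (simp add: complex_add_cnj)
  finally show ?thesis by (simp only: of_real_add[symmetric] of_real_eq_iff)
qed

text \<open>Functions are not identified almost everywhere, so a nonzero \<open>g\<close> may have
  norm 0. With b the inner product, the squared norm of f + r b g is a nonnegative quadratic in
  \<open>r\<close>. If \<open>l2norm g\<close> is 0 it is affine in \<open>r\<close>, which forces b
  = 0; otherwise its value at r = -1 / (l2norm g)^2, the minimizer, gives the claim.\<close>

lemma l2_Cauchy_Schwarz:
  assumes "sq_int f" "sq_int g"
  shows "cmod (l2inner f g) \<le> l2norm f * l2norm g"
proof -
  define b where "b = l2inner f g"
  have ineq: "0 \<le> (l2norm f)\<^sup>2 + r\<^sup>2 * (cmod b)\<^sup>2 * (l2norm g)\<^sup>2 + 2 * r * (cmod b)\<^sup>2" for r :: real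
  proof -
    have "0 \<le> (l2norm (\<lambda>x. f x + (complex_of_real r * b) * g x))\<^sup>2" by simp
    also have "\<dots> = (l2norm f)\<^sup>2 + (cmod (complex_of_real r * b) * l2norm g)\<^sup>2 + 2 * Re (cnj (complex_of_real r * b) * b)"
      by (simp add: l2norm_add_sq assms sq_int_scale l2norm_scale l2inner_scale_right b_def)
    also have "Re (cnj (complex_of_real r * b) * b) = r * (cmod b)\<^sup>2"
      unfolding cmod_power2 by (simp add: power2_eq_square algebra_simps)
    finally show ?thesis by (simp add: norm_mult power_mult_distrib)
  qed
  show ?thesis
  proof (cases "l2norm g = 0")
    case True
    have "b = 0"
    proof (rule ccontr)
      assume "b \<noteq> 0"
      then have p: "(cmod b)\<^sup>2 > 0" by simp
      have "0 \<le> (l2norm f)\<^sup>2 + 2 * (- ((l2norm f)\<^sup>2 + 1) / (cmod b)\<^sup>2) * (cmod b)\<^sup>2"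
        using ineq[of "- ((l2norm f)\<^sup>2 + 1) / (cmod b)\<^sup>2"] True by simp
      also have "\<dots> = - (l2norm f)\<^sup>2 - 2" using p by (simp add: field_simps)
      finally show False using zero_le_power2[of "l2norm f"] by linarith
    qed
    then show ?thesis using b_def by simp
  next
    case False
    then have p: "(l2norm g)\<^sup>2 > 0" by simp
    have "0 \<le> (l2norm f)\<^sup>2 + (- 1 / (l2norm g)\<^sup>2)\<^sup>2 * (cmod b)\<^sup>2 * (l2norm g)\<^sup>2 + 2 * (- 1 / (l2norm g)\<^sup>2) * (cmod b)\<^sup>2"
      using ineq[of "- 1 / (l2norm g)\<^sup>2"] .
    also have "\<dots> = (l2norm f)\<^sup>2 - (cmod b)\<^sup>2 / (l2norm g)\<^sup>2"
      using p by (simp add: field_simps power2_eq_square)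
    finally have "(cmod b)\<^sup>2 \<le> (l2norm f * l2norm g)\<^sup>2"
      using p by (simp add: field_simps power_mult_distrib)
    then show ?thesis unfolding b_def by (rule power2_le_imp_le) simp
  qed
qed

lemma l2norm_triangle:
  assumes "sq_int f" "sq_int g"
  shows "l2norm (\<lambda>x. f x + g x) \<le> l2norm f + l2norm g"
proof (rule power2_le_imp_le)
  have "Re (l2inner f g) \<le> l2norm f * l2norm g"
    using l2_Cauchy_Schwarz[OF assms] complex_Re_le_cmod order_trans by blast
  then show "(l2norm (\<lambda>x. f x + g x))\<^sup>2 \<le> (l2norm f + l2norm g)\<^sup>2"
    unfolding l2norm_add_sq[OF assms] by (simp add: power2_sum)
qed simp

lemma l2norm_minus: "l2norm (\<lambda>x. f x - g x) = l2norm (\<lambda>x. g x - f x)"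
  by (simp add: l2norm_def norm_minus_commute)

lemma l2inner_cong_AE:
  assumes "AE x in lborel. f x = f' x" "AE x in lborel. g x = g' x"
    and "f \<in> borel_measurable borel" "f' \<in> borel_measurable borel"
    and "g \<in> borel_measurable borel" "g' \<in> borel_measurable borel"
  shows "l2inner f g = l2inner f' g'"
  unfolding l2inner_def
proof (rule integral_cong_AE)
  show "AE x in lborel. f x * cnj (g x) = f' x * cnj (g' x)"
    using assms(1,2) by eventually_elim simp
qed (use assms in \<open>auto simp: borel_measurable_times\<close>)

lemma l2norm_cong_AE:
  assumes "AE x in lborel. f x = f' x"
    and "f \<in> borel_measurable borel" "f' \<in> borel_measurable borel"
  shows "l2norm f = l2norm f'"
  unfolding l2norm_def
  by (intro arg_cong[where f=sqrt] integral_cong_AE) (use assms in auto)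

lemma nn_integral_l2norm:
  assumes "sq_int f"
  shows "(NNBINT x. ennreal ((cmod (f x))\<^sup>2)) = ennreal ((l2norm f)\<^sup>2)"
  unfolding l2norm_sq by (rule nn_integral_eq_integral) (use sq_intD[OF assms] in auto)

lemma sq_intI_nn:
  assumes "f \<in> borel_measurable borel" "(NNBINT x. ennreal ((cmod (f x))\<^sup>2)) < \<infinity>"
  shows "sq_int f"
  unfolding sq_int_def
  using assms by (auto intro!: integrableI_bounded)

section \<open>Translations, reflections and dilations of Lebesgue measure\<close>

lemma nn_integral_lborel_translate:
  fixes f :: "'a::euclidean_space \<Rightarrow> ennreal"
  assumes [measurable]: "f \<in> borel_measurable borel"
  shows "(NNBINT x. f (x + a)) = (NNBINT x. f x)"
  by (subst (2) lborel_distr_plus[of a, symmetric]) (simp add: nn_integral_distr add.commute)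

lemma lborel_eq_distr_uminus:
  "(lborel :: 'a::euclidean_space measure) = distr lborel borel uminus"
  using lborel_affine[of "-1::real" "0::'a"] by (simp add: density_1)

lemma nn_integral_lborel_uminus:
  fixes f :: "'a::euclidean_space \<Rightarrow> ennreal"
  assumes [measurable]: "f \<in> borel_measurable borel"
  shows "(NNBINT x. f (- x)) = (NNBINT x. f x)"
  by (subst (2) lborel_eq_distr_uminus) (simp add: nn_integral_distr)

lemma nn_integral_lborel_reflect:
  fixes f :: "'a::euclidean_space \<Rightarrow> ennreal"
  assumes [measurable]: "f \<in> borel_measurable borel"
  shows "(NNBINT x. f (a - x)) = (NNBINT x. f x)"
  using nn_integral_lborel_uminus[of "\<lambda>x. f (x + a)"] nn_integral_lborel_translate[of f a] by simp

text \<open>Free of measurability hypotheses: if \<open>f\<close> is not measurable then neither is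
  its translate, and both integrals are 0 by convention.\<close>

lemma integral_lborel_translate:
  fixes f :: "'a::euclidean_space \<Rightarrow> 'b::{banach, second_countable_topology}"
  shows "(LBINT x. f (x + a)) = (LBINT x. f x)"
proof (cases "f \<in> borel_measurable borel")
  case True
  then show ?thesis
    by (subst (2) lborel_distr_plus[of a, symmetric]) (simp add: integral_distr add.commute)
next
  case False
  have "(\<lambda>x. f (x + a)) \<notin> borel_measurable borel"
  proof
    assume "(\<lambda>x. f (x + a)) \<in> borel_measurable borel"
    from measurable_compose[OF _ this, of "\<lambda>x. x - a" borel] have "f \<in> borel_measurable borel" by simp
    then show False using False by simp
  qed
  then show ?thesis
    using False by (subst (1 2) not_integrable_integral_eq) (auto dest: borel_measurable_integrable)
qed

lemma integrable_lborel_translate: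
  fixes f :: "'a::euclidean_space \<Rightarrow> 'b::{banach, second_countable_topology}"
  assumes "integrable lborel f"
  shows "integrable lborel (\<lambda>x. f (x + a))"
proof -
  have m: "f \<in> borel_measurable borel" using assms by auto
  have "integrable (distr lborel borel ((+) a)) f" using assms by (simp add: lborel_distr_plus)
  then show ?thesis by (subst (asm) integrable_distr_eq) (use m in \<open>auto simp: add.commute\<close>)
qed

lemma integrable_lborel_scaleR:
  fixes f :: "'a::euclidean_space \<Rightarrow> 'b::{banach, second_countable_topology}"
  assumes "integrable lborel f" "c > 0"
  shows "integrable lborel (\<lambda>x. f (c *\<^sub>R x))"
proof -
  have [measurable]: "f \<in> borel_measurable borel" using assms by auto
  have "integrable (density (distr lborel borel (\<lambda>x::'a. c *\<^sub>R x)) (\<lambda>_. ennreal (c ^ DIM('a)))) f"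
    using assms lborel_affine[of c "0::'a"] by simp
  then have "integrable (distr lborel borel (\<lambda>x::'a. c *\<^sub>R x)) (\<lambda>x. c ^ DIM('a) *\<^sub>R f x)"
    by (subst (asm) integrable_density) (use assms in auto)
  then have "integrable (distr lborel borel (\<lambda>x::'a. c *\<^sub>R x)) (\<lambda>x. (1 / c ^ DIM('a)) *\<^sub>R c ^ DIM('a) *\<^sub>R f x)"
    by (rule integrable_scaleR_right)
  then have "integrable (distr lborel borel (\<lambda>x::'a. c *\<^sub>R x)) f" using assms by simp
  then show ?thesis by (subst (asm) integrable_distr_eq) auto
qed

lemma integral_lborel_scaleR:
  fixes f :: "'a::euclidean_space \<Rightarrow> 'b::{banach, second_countable_topology}"
  assumes [measurable]: "f \<in> borel_measurable borel" and "c > 0"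
  shows "(LBINT x. f x) = c ^ DIM('a) *\<^sub>R (LBINT x. f (c *\<^sub>R x))"
  using assms(2)
  by (subst lborel_affine[of c "0::'a"])
    (simp_all add: integral_density integral_distr)

section \<open>Gaussian integrals\<close>

lemma borel_measurable_cis [measurable (raw)]:
  "f \<in> borel_measurable M \<Longrightarrow> (\<lambda>x. cis (f x)) \<in> borel_measurable M"
  by (rule measurable_compose[OF _ borel_measurable_continuous_onI]) (auto intro!: continuous_intros)

text \<open>This is the characteristic function of the standard normal law after the dilation by
  \<open>c = sqrt (2 * pi)\<close>.\<close>

lemma gauss_FT_real:
  fixes b :: real
  shows "integrable lborel (\<lambda>x::real. complex_of_real (exp (- pi * x\<^sup>2)) * cis (2 * pi * (b * x)))"
    and "(LBINT x. complex_of_real (exp (- pi * x\<^sup>2)) * cis (2 * pi * (b * x))) = complex_of_real (exp (- pi * b\<^sup>2))"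
proof -
  define c where "c = sqrt (2 * pi)"
  define t where "t = c * b"
  have c: "c > 0" "c\<^sup>2 = 2 * pi" by (auto simp: c_def)
  have int: "integrable lborel (\<lambda>x. complex_of_real (std_normal_density x) * iexp (t * x))"
  proof (rule Bochner_Integration.integrable_bound)
    show "integrable lborel std_normal_density"
      by (simp add: integrable_normal_density)
  qed (auto simp: norm_mult)
  have I: "(LBINT x. complex_of_real (std_normal_density x) * iexp (t * x)) = complex_of_real (exp (- (t\<^sup>2) / 2))"
  proof -
    have "char std_normal_distribution t = (LBINT x. std_normal_density x *\<^sub>R iexp (t * x))"
      unfolding char_def
      by (subst integral_density) (auto simp: normal_density_nonneg)
    then show ?thesis by (simp add: char_std_normal_distribution scaleR_conv_of_real)
  qed
  have eq: "complex_of_real (std_normal_density (c * x)) * iexp (t * (c * x)) =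
      complex_of_real (1 / c) * (complex_of_real (exp (- pi * x\<^sup>2)) * cis (2 * pi * (b * x)))" for x
  proof -
    have "std_normal_density (c * x) = (1 / c) * exp (- pi * x\<^sup>2)"
      using c by (simp add: std_normal_density_def power_mult_distrib c_def[symmetric])
    moreover have "t * (c * x) = 2 * pi * (b * x)"
      using c(2) by (simp add: t_def power2_eq_square algebra_simps)
    ultimately show ?thesis by (simp only: cis_conv_exp) simp
  qed
  have "integrable lborel (\<lambda>x. complex_of_real (1 / c) * (complex_of_real (exp (- pi * x\<^sup>2)) * cis (2 * pi * (b * x))))"
    using lborel_integrable_real_affine[OF int, of c 0] c by (simp only: eq add_0)
  then have "integrable lborel (\<lambda>x. complex_of_real c * (complex_of_real (1 / c) * (complex_of_real (exp (- pi * x\<^sup>2)) * cis (2 * pi * (b * x)))))"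
    by (rule integrable_mult_right)
  then show "integrable lborel (\<lambda>x::real. complex_of_real (exp (- pi * x\<^sup>2)) * cis (2 * pi * (b * x)))"
    using c by simp
  have "complex_of_real (exp (- (t\<^sup>2) / 2)) = c *\<^sub>R (LBINT x. complex_of_real (std_normal_density (c * x)) * iexp (t * (c * x)))"
    unfolding I[symmetric] using lborel_integral_real_affine[of c "\<lambda>x. complex_of_real (std_normal_density x) * iexp (t * x)" 0] c by simp
  also have "\<dots> = (LBINT x. complex_of_real (exp (- pi * x\<^sup>2)) * cis (2 * pi * (b * x)))"
    unfolding eq using c by (simp add: scaleR_conv_of_real)
  finally show "(LBINT x. complex_of_real (exp (- pi * x\<^sup>2)) * cis (2 * pi * (b * x))) = complex_of_real (exp (- pi * b\<^sup>2))"
    using c by (simp add: t_def power_mult_distrib)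
qed

lemma cis_sum: "finite A \<Longrightarrow> cis (\<Sum>i\<in>A. f i) = (\<Prod>i\<in>A. cis (f i))"
  by (induction A rule: finite_induct) (auto simp: cis_mult[symmetric])

lemma norm_sq_Basis: "(norm (u::'a::euclidean_space))\<^sup>2 = (\<Sum>i\<in>Basis. (u \<bullet> i)\<^sup>2)"
  unfolding power2_norm_eq_inner by (simp add: euclidean_inner[of u u] power2_eq_square)

text \<open>Lebesgue measure is the image of a product measure over the basis, and Gaussian and
  character both factor over the coordinates, so the one-dimensional formula multiplies up.\<close>

lemma gauss_FT_unit:
  fixes b :: "'a::euclidean_space"
  shows "integrable lborel (\<lambda>u. complex_of_real (exp (- pi * (norm u)\<^sup>2)) * cis (2 * pi * (b \<bullet> u)))"
    and "(LBINT u. complex_of_real (exp (- pi * (norm u)\<^sup>2)) * cis (2 * pi * (b \<bullet> u))) = complex_of_real (exp (- pi * (norm b)\<^sup>2))"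
proof -
  interpret product_sigma_finite "\<lambda>i::'a. lborel :: real measure" by standard
  define F where "F i x = complex_of_real (exp (- pi * x\<^sup>2)) * cis (2 * pi * ((b \<bullet> i) * x))" for i :: 'a and x :: real
  have prod: "complex_of_real (exp (- pi * (norm u)\<^sup>2)) * cis (2 * pi * (b \<bullet> u)) = (\<Prod>i\<in>Basis. F i (u \<bullet> i))" for u
    unfolding F_def prod.distrib norm_sq_Basis euclidean_inner[of b u]
    by (simp add: sum_distrib_left exp_sum cis_sum)
  have [measurable]: "F i \<in> borel_measurable borel" for i
    unfolding F_def by measurable
  have coord: "(\<Sum>b'\<in>Basis. (x b' :: real) *\<^sub>R b') \<bullet> i = x i" if "i \<in> Basis" for x and i :: 'a
    using that by (simp add: inner_sum_left inner_Basis if_distrib sum.delta cong: if_cong)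
  have F: "integrable lborel (F i)" "(LBINT x. F i x) = complex_of_real (exp (- pi * (b \<bullet> i)\<^sup>2))" for i
    unfolding F_def using gauss_FT_real[of "b \<bullet> i"] by auto
  have D: "(lborel :: 'a measure) = distr (Pi\<^sub>M Basis (\<lambda>_. lborel)) borel (\<lambda>x. \<Sum>b\<in>Basis. x b *\<^sub>R b)"
    unfolding lborel_def[where 'a='a] lborel_eq_real ..
  have meas: "(\<lambda>x. \<Sum>b\<in>Basis. x b *\<^sub>R b) \<in> measurable (Pi\<^sub>M (Basis::'a set) (\<lambda>_. lborel :: real measure)) (borel :: 'a measure)"
    by measurable
  have "integrable (Pi\<^sub>M Basis (\<lambda>_. lborel)) (\<lambda>x. \<Prod>i\<in>(Basis::'a set). F i (x i))"
    by (rule product_integrable_prod) (auto intro: F)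
  then have "integrable (Pi\<^sub>M Basis (\<lambda>_. lborel)) (\<lambda>x. \<Prod>i\<in>(Basis::'a set). F i ((\<Sum>b\<in>Basis. x b *\<^sub>R b) \<bullet> i))"
    by (simp add: coord cong: prod.cong)
  then show "integrable lborel (\<lambda>u. complex_of_real (exp (- pi * (norm u)\<^sup>2)) * cis (2 * pi * (b \<bullet> u)))"
    unfolding prod by (subst D, subst integrable_distr_eq[OF meas]) auto
  have "(LBINT u. (\<Prod>i\<in>Basis. F i (u \<bullet> i))) = (\<integral>x. (\<Prod>i\<in>(Basis::'a set). F i ((\<Sum>b\<in>Basis. x b *\<^sub>R b) \<bullet> i)) \<partial>(Pi\<^sub>M Basis (\<lambda>_. lborel)))"
    by (subst D, subst integral_distr[OF meas]) auto
  also have "\<dots> = (\<integral>x. (\<Prod>i\<in>(Basis::'a set). F i (x i)) \<partial>(Pi\<^sub>M Basis (\<lambda>_. lborel)))"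
    by (simp add: coord cong: prod.cong)
  also have "\<dots> = (\<Prod>i\<in>Basis. (LBINT x. F i x))"
    by (rule product_integral_prod) (auto intro: F)
  also have "\<dots> = complex_of_real (exp (- pi * (norm b)\<^sup>2))"
    by (simp add: F norm_sq_Basis sum_distrib_left exp_sum)
  finally show "(LBINT u. complex_of_real (exp (- pi * (norm u)\<^sup>2)) * cis (2 * pi * (b \<bullet> u))) = complex_of_real (exp (- pi * (norm b)\<^sup>2))"
    unfolding prod .
qed

lemma gauss_FT:
  fixes b :: "'a::euclidean_space"
  assumes r: "r > 0"
  shows "integrable lborel (\<lambda>u. complex_of_real (exp (- pi * r * (norm u)\<^sup>2)) * cis (2 * pi * (b \<bullet> u)))"
    and "(LBINT u. complex_of_real (exp (- pi * r * (norm u)\<^sup>2)) * cis (2 * pi * (b \<bullet> u)))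
      = complex_of_real ((1 / sqrt r) ^ DIM('a) * exp (- pi * (norm b)\<^sup>2 / r))"
proof -
  define c where "c = sqrt r"
  have c: "c > 0" "c\<^sup>2 = r" using r by (auto simp: c_def)
  define b' where "b' = (1 / c) *\<^sub>R b"
  have eq: "complex_of_real (exp (- pi * (norm (c *\<^sub>R u))\<^sup>2)) * cis (2 * pi * (b' \<bullet> (c *\<^sub>R u)))
    = complex_of_real (exp (- pi * r * (norm u)\<^sup>2)) * cis (2 * pi * (b \<bullet> u))" for u
    using c by (simp add: b'_def power_mult_distrib mult.assoc)
  show "integrable lborel (\<lambda>u. complex_of_real (exp (- pi * r * (norm u)\<^sup>2)) * cis (2 * pi * (b \<bullet> u)))"
    using integrable_lborel_scaleR[OF gauss_FT_unit(1)[of b'] c(1)] unfolding eq .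
  have "complex_of_real (exp (- pi * (norm b')\<^sup>2)) = c ^ DIM('a) *\<^sub>R (LBINT u. complex_of_real (exp (- pi * r * (norm u)\<^sup>2)) * cis (2 * pi * (b \<bullet> u)))"
    unfolding gauss_FT_unit(2)[of b', symmetric]
    by (subst integral_lborel_scaleR[OF _ c(1)]) (simp_all only: eq, measurable)
  moreover have "(norm b')\<^sup>2 = (norm b)\<^sup>2 / r"
    using c by (simp add: b'_def power_divide)
  ultimately have "complex_of_real (1 / c ^ DIM('a)) * complex_of_real (exp (- pi * (norm b)\<^sup>2 / r)) =
     (LBINT u. complex_of_real (exp (- pi * r * (norm u)\<^sup>2)) * cis (2 * pi * (b \<bullet> u)))"
    using c by (simp add: scaleR_conv_of_real field_simps)
  then show "(LBINT u. complex_of_real (exp (- pi * r * (norm u)\<^sup>2)) * cis (2 * pi * (b \<bullet> u)))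
      = complex_of_real ((1 / sqrt r) ^ DIM('a) * exp (- pi * (norm b)\<^sup>2 / r))"
    by (simp add: c_def power_divide)
qed

lemma gauss_integral:
  assumes r: "r > 0"
  shows "integrable lborel (\<lambda>u::'a::euclidean_space. exp (- pi * r * (norm u)\<^sup>2))"
    and "(LBINT u. exp (- pi * r * (norm (u::'a))\<^sup>2)) = (1 / sqrt r) ^ DIM('a)"
proof -
  have i: "integrable lborel (\<lambda>u::'a. complex_of_real (exp (- pi * r * (norm u)\<^sup>2)))"
    and e: "(LBINT u. complex_of_real (exp (- pi * r * (norm (u::'a))\<^sup>2))) = complex_of_real ((1 / sqrt r) ^ DIM('a))"
    using gauss_FT[OF r, of "0::'a"] by simp_all
  show "integrable lborel (\<lambda>u::'a::euclidean_space. exp (- pi * r * (norm u)\<^sup>2))"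
    using integrable_norm[OF i] by simp
  show "(LBINT u. exp (- pi * r * (norm (u::'a))\<^sup>2)) = (1 / sqrt r) ^ DIM('a)"
    using e by (simp only: integral_complex_of_real of_real_eq_iff)
qed

lemma integrable_exp_norm_sq:
  assumes "a > 0"
  shows "integrable lborel (\<lambda>u::'a::euclidean_space. exp (- a * (norm u)\<^sup>2))"
  using gauss_integral(1)[of "a / pi"] assms by simp

text \<open>Bound 1 + t by exp t and complete the square: the linear exponent k t is absorbed by
  half of the quadratic one, at the price of the constant k^2 / (2 a).\<close>

lemma power_times_exp_le:
  fixes t a :: real
  assumes "a > 0" "t \<ge> 0"
  shows "(1 + t) ^ k * exp (- a * t\<^sup>2) \<le> exp ((real k)\<^sup>2 / (2 * a)) * exp (- (a / 2) * t\<^sup>2)"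
proof -
  have "(1 + t) ^ k \<le> exp t ^ k" using assms by (intro power_mono) auto
  also have "\<dots> = exp (real k * t)" by (simp add: exp_of_nat_mult)
  finally have "(1 + t) ^ k * exp (- a * t\<^sup>2) \<le> exp (real k * t) * exp (- a * t\<^sup>2)" by simp
  also have "\<dots> = exp (real k * t - a * t\<^sup>2)" by (simp add: exp_add[symmetric])
  also have "\<dots> \<le> exp ((real k)\<^sup>2 / (2 * a) + - (a / 2) * t\<^sup>2)"
  proof -
    have "0 \<le> (real k - a * t)\<^sup>2 / (2 * a)" using assms by simp
    also have "\<dots> = (real k)\<^sup>2 / (2 * a) - real k * t + a / 2 * t\<^sup>2"
      using assms by (simp add: power2_eq_square field_simps)
    finally show ?thesis by (simp add: algebra_simps)
  qed
  finally show ?thesis by (simp only: exp_add)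
qed

lemma integrable_power_exp_norm_sq:
  assumes "a > 0"
  shows "integrable lborel (\<lambda>u::'a::euclidean_space. (1 + norm u) ^ k * exp (- a * (norm u)\<^sup>2))"
proof (rule Bochner_Integration.integrable_bound)
  show "integrable lborel (\<lambda>u::'a. exp ((real k)\<^sup>2 / (2 * a)) * exp (- (a / 2) * (norm u)\<^sup>2))"
    using assms by (intro integrable_mult_right integrable_exp_norm_sq) simp
  show "AE u::'a in lborel. norm ((1 + norm u) ^ k * exp (- a * (norm u)\<^sup>2)) \<le> norm (exp ((real k)\<^sup>2 / (2 * a)) * exp (- (a / 2) * (norm u)\<^sup>2))"
    using power_times_exp_le[OF assms, of "norm (_::'a)" k] by (intro AE_I2) (simp add: abs_mult)
qed simp

section \<open>Continuity of translation in the mean\<close>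

text \<open>Sequential, because the limits below come from dominated convergence along
  sequences.\<close>

definition translation_continuous :: "('a::euclidean_space \<Rightarrow> 'b::{banach, second_countable_topology}) \<Rightarrow> bool" where
  "translation_continuous f \<longleftrightarrow>
     (\<forall>v. v \<longlonglongrightarrow> 0 \<longrightarrow> (\<lambda>n. (LBINT x. norm (f (x + v n) - f x))) \<longlonglongrightarrow> 0)"

text \<open>Three-epsilon argument: by translation invariance the approximation error has the same
  size before and after the shift.\<close>

lemma translation_continuous_approx:
  fixes f :: "'a::euclidean_space \<Rightarrow> 'b::{banach, second_countable_topology}"
  assumes f: "integrable lborel f"
    and approx: "\<And>e. e > 0 \<Longrightarrow> \<exists>s. integrable lborel s \<and> translation_continuous s \<and> (LBINT x. norm (s x - f x)) < e"
  shows "translation_continuous f"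
  unfolding translation_continuous_def
proof (intro allI impI)
  fix v :: "nat \<Rightarrow> 'a" assume v: "v \<longlonglongrightarrow> 0"
  show "(\<lambda>n. (LBINT x. norm (f (x + v n) - f x))) \<longlonglongrightarrow> 0"
  proof (rule LIMSEQ_I)
    fix e :: real assume "e > 0"
    then obtain s where s: "integrable lborel s" "translation_continuous s"
        and se: "(LBINT x. norm (s x - f x)) < e / 4"
      using approx[of "e / 4"] by auto
    have "(\<lambda>n. (LBINT x. norm (s (x + v n) - s x))) \<longlonglongrightarrow> 0"
      using s(2) v by (auto simp: translation_continuous_def)
    then have "\<forall>\<^sub>F n in sequentially. (LBINT x. norm (s (x + v n) - s x)) < e / 4"
      by (rule order_tendstoD(2)) (use \<open>e > 0\<close> in simp)
    then obtain N where N: "\<And>n. n \<ge> N \<Longrightarrow> (LBINT x. norm (s (x + v n) - s x)) < e / 4"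
      unfolding eventually_sequentially by blast
    have "norm (LBINT x. norm (f (x + v n) - f x)) < e" if "n \<ge> N" for n
    proof -
      define w where "w x = norm (s x - f x)" for x
      have w: "integrable lborel w" unfolding w_def using s f by auto
      note tr = integrable_lborel_translate
      have "(LBINT x. norm (f (x + v n) - f x)) \<le> (LBINT x. w (x + v n) + norm (s (x + v n) - s x) + w x)"
      proof (rule integral_mono)
        fix x
        have "f (x + v n) - f x = - (s (x + v n) - f (x + v n)) + (s (x + v n) - s x) + (s x - f x)" by simp
        also have "norm \<dots> \<le> norm (s (x + v n) - f (x + v n)) + norm (s (x + v n) - s x) + norm (s x - f x)"
          by (intro order_trans[OF norm_triangle_ineq] add_mono) (auto simp: norm_minus_commute)
        finally show "norm (f (x + v n) - f x) \<le> w (x + v n) + norm (s (x + v n) - s x) + w x"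
          by (simp add: w_def)
      qed (use f s w tr[OF f] tr[OF s(1)] tr[OF w] in auto)
      also have "\<dots> = (LBINT x. w x) + (LBINT x. norm (s (x + v n) - s x)) + (LBINT x. w x)"
        using w s tr[OF s(1)] tr[OF w] by (simp add: integral_lborel_translate[of w])
      also have "\<dots> < e / 4 + e / 4 + e / 4"
        using N[OF that] se by (intro add_strict_mono) (auto simp: w_def)
      finally show ?thesis using \<open>e > 0\<close> by simp
    qed
    then show "\<exists>N. \<forall>n\<ge>N. norm ((LBINT x. norm (f (x + v n) - f x)) - 0) < e" by auto
  qed
qed

text \<open>Openness gives pointwise convergence at the points of \<open>S\<close> only, and this
  suffices: \<open>S\<close> and its translate have equal mass, so the mass gained equals the mass
  lost, and the L^1 distance is twice the mass lost. Nothing has to be known at the boundary of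
  \<open>S\<close>.\<close>

lemma translation_continuous_open_indicator:
  fixes S :: "'a::euclidean_space set" and c :: "'b::{banach, second_countable_topology}"
  assumes S: "open S" "emeasure lborel S < \<infinity>"
  shows "translation_continuous (\<lambda>x. indicator S x *\<^sub>R c)"
  unfolding translation_continuous_def
proof (intro allI impI)
  fix v :: "nat \<Rightarrow> 'a" assume v: "v \<longlonglongrightarrow> 0"
  define I where "I = (indicator S :: 'a \<Rightarrow> real)"
  have [measurable]: "S \<in> sets borel" using S(1) by simp
  have I: "integrable lborel I" unfolding I_def using S by (intro integrable_real_indicator) auto
  have [measurable]: "I \<in> borel_measurable borel" unfolding I_def by simp
  have bd: "\<bar>I x * (1 - I y)\<bar> \<le> I x" for x y by (simp add: I_def indicator_def)
  have lim: "(\<lambda>n. (LBINT x. I x * (1 - I (x + v n)))) \<longlonglongrightarrow> (\<integral>x. 0 \<partial>(lborel::'a measure))"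
  proof (rule integral_dominated_convergence)
    show "AE x in lborel. (\<lambda>n. I x * (1 - I (x + v n))) \<longlonglongrightarrow> 0"
    proof (rule AE_I2)
      fix x
      show "(\<lambda>n. I x * (1 - I (x + v n))) \<longlonglongrightarrow> 0"
      proof (cases "x \<in> S")
        case True
        have "(\<lambda>n. x + v n) \<longlonglongrightarrow> x + 0" by (intro tendsto_intros v)
        then have "\<forall>\<^sub>F n in sequentially. x + v n \<in> S"
          using topological_tendstoD[OF _ S(1)] True by auto
        then show ?thesis by (intro tendsto_eventually, elim eventually_mono) (simp add: I_def)
      qed (simp add: I_def)
    qed
    show "AE x in lborel. norm (I x * (1 - I (x + v n))) \<le> I x" for n
      using bd by auto
  qed (use I in auto)
  have "(LBINT x. norm (indicator S (x + v n) *\<^sub>R c - indicator S x *\<^sub>R c))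
      = norm c * (2 * (LBINT x. I x * (1 - I (x + v n))))" for n
  proof -
    have i1: "integrable lborel (\<lambda>x. I x * (1 - I (x + v n)))"
      by (rule Bochner_Integration.integrable_bound[OF I]) (use bd in \<open>auto intro!: AE_I2 simp: order_trans[OF bd]\<close>)
    have i2: "integrable lborel (\<lambda>x. I (x + v n))" by (rule integrable_lborel_translate[OF I])
    have "(LBINT x. norm (indicator S (x + v n) *\<^sub>R c - indicator S x *\<^sub>R c))
      = (LBINT x. norm c * (2 * (I x * (1 - I (x + v n))) + (I (x + v n) - I x)))"
      by (intro Bochner_Integration.integral_cong) (auto simp: I_def indicator_def)
    also have "\<dots> = norm c * (2 * (LBINT x. I x * (1 - I (x + v n))) + ((LBINT x. I (x + v n)) - (LBINT x. I x)))"
      using i1 i2 I by simp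
    finally show ?thesis by (simp add: integral_lborel_translate[of I])
  qed
  moreover have "(\<lambda>n. norm c * (2 * (LBINT x. I x * (1 - I (x + v n))))) \<longlonglongrightarrow> norm c * (2 * 0)"
    using lim by (intro tendsto_intros) simp
  ultimately show "(\<lambda>n. (LBINT x. norm (indicator S (x + v n) *\<^sub>R c - indicator S x *\<^sub>R c))) \<longlonglongrightarrow> 0"
    by simp
qed

lemma translation_continuous_add:
  fixes f g :: "'a::euclidean_space \<Rightarrow> 'b::{banach, second_countable_topology}"
  assumes f: "integrable lborel f" "translation_continuous f"
    and g: "integrable lborel g" "translation_continuous g"
  shows "translation_continuous (\<lambda>x. f x + g x)"
  unfolding translation_continuous_def
proof (intro allI impI)
  fix v :: "nat \<Rightarrow> 'a" assume v: "v \<longlonglongrightarrow> 0"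
  have "(\<lambda>n. (LBINT x. norm (f (x + v n) - f x)) + (LBINT x. norm (g (x + v n) - g x))) \<longlonglongrightarrow> 0 + 0"
    using f(2) g(2) v unfolding translation_continuous_def by (intro tendsto_add) auto
  then have lim: "(\<lambda>n. (LBINT x. norm (f (x + v n) - f x)) + (LBINT x. norm (g (x + v n) - g x))) \<longlonglongrightarrow> 0" by simp
  show "(\<lambda>n. (LBINT x. norm (f (x + v n) + g (x + v n) - (f x + g x)))) \<longlonglongrightarrow> 0"
  proof (rule tendsto_sandwich[OF _ _ tendsto_const lim])
    show "\<forall>\<^sub>F n in sequentially. (LBINT x. norm (f (x + v n) + g (x + v n) - (f x + g x)))
       \<le> (LBINT x. norm (f (x + v n) - f x)) + (LBINT x. norm (g (x + v n) - g x))"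
    proof (rule always_eventually, rule allI)
      fix n
      note tr = integrable_lborel_translate[OF f(1), of "v n"] integrable_lborel_translate[OF g(1), of "v n"]
      have "(LBINT x. norm (f (x + v n) + g (x + v n) - (f x + g x)))
          \<le> (LBINT x. norm (f (x + v n) - f x) + norm (g (x + v n) - g x))"
        by (rule integral_mono) (use tr f g in \<open>auto simp: norm_diff_triangle_ineq\<close>)
      also have "\<dots> = (LBINT x. norm (f (x + v n) - f x)) + (LBINT x. norm (g (x + v n) - g x))"
        using tr f g by simp
      finally show "(LBINT x. norm (f (x + v n) + g (x + v n) - (f x + g x)))
       \<le> (LBINT x. norm (f (x + v n) - f x)) + (LBINT x. norm (g (x + v n) - g x))" .
    qed
  qed simp
qed

text \<open>Induction over integrable functions; for the indicator of a Borel set, outer regularity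
  supplies an open superset with small excess, which reduces to the open case.\<close>

lemma translation_continuous_integrable:
  fixes f :: "'a::euclidean_space \<Rightarrow> 'b::{banach, second_countable_topology}"
  assumes "integrable lborel f"
  shows "translation_continuous f"
  using assms
proof (induction rule: integrable_induct)
  case (base A c)
  then have A[measurable]: "A \<in> sets borel" and Af: "emeasure lborel A < \<infinity>" by auto
  have ci: "integrable lborel (\<lambda>x. indicator A x *\<^sub>R c)"
    using base by (intro integrable_indicator) auto
  show ?case
  proof (rule translation_continuous_approx[OF ci])
    fix e :: real assume "e > 0"
    \<comment> \<open>The added 1 covers \<open>c = 0\<close>.\<close>
    define d where "d = e / (norm c + 1)"
    have d: "d > 0" using \<open>e > 0\<close> unfolding d_def by (intro divide_pos_pos) (auto simp: add_nonneg_pos)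
    have "A \<in> sets lebesgue" by (simp add: A)
    then obtain T where T: "open T" "A \<subseteq> T" "emeasure lebesgue (T - A) < ennreal d"
      using sets_lebesgue_outer_open[OF _ d] by metis
    have [measurable]: "T \<in> sets borel" using T(1) by simp
    have TA: "emeasure lborel (T - A) < ennreal d" using T(3) by simp
    have "emeasure lborel T \<le> emeasure lborel (T - A) + emeasure lborel A"
      using T(2) emeasure_subadditive[of "T - A" lborel A] by (simp add: Un_absorb2)
    also have "\<dots> < \<infinity>"
      using TA Af by (simp add: ennreal_add_less_top less_top[symmetric]) (use TA in \<open>auto simp: top_unique\<close>)
    finally have Tf: "emeasure lborel T < \<infinity>" .
    have "(LBINT x. norm (indicator T x *\<^sub>R c - indicator A x *\<^sub>R c)) = (LBINT x. norm c * indicator (T - A) x)"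
      using T(2) by (intro Bochner_Integration.integral_cong) (auto simp: indicator_def)
    also have "\<dots> = norm c * measure lborel (T - A)" by simp
    also have "\<dots> \<le> norm c * d"
    proof (intro mult_left_mono)
      have "measure lborel (T - A) = enn2real (emeasure lborel (T - A))" by (simp add: measure_def)
      also have "\<dots> \<le> enn2real (ennreal d)" using TA by (intro enn2real_mono) auto
      finally show "measure lborel (T - A) \<le> d" using d by simp
    qed simp
    also have "\<dots> < (norm c + 1) * d" using d by (simp add: distrib_right)
    also have "\<dots> = e" by (simp add: d_def add_nonneg_eq_0_iff)
    finally show "\<exists>s. integrable lborel s \<and> translation_continuous s \<and> (LBINT x. norm (s x - indicator A x *\<^sub>R c)) < e"
      using Tf T(1) by (intro exI[of _ "\<lambda>x. indicator T x *\<^sub>R c"] conjI translation_continuous_open_indicator integrable_indicator) auto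
  qed
next
  case (add f g)
  then show ?case by (intro translation_continuous_add)
next
  case (lim f s)
  show ?case
  proof (rule translation_continuous_approx[OF lim.hyps(4)])
    fix e :: real assume "e > 0"
    have m[measurable]: "f \<in> borel_measurable borel" "\<And>i. s i \<in> borel_measurable borel"
      using lim.hyps(1,4) by (auto dest: borel_measurable_integrable)
    have "(\<lambda>i. (LBINT x. norm (s i x - f x))) \<longlonglongrightarrow> (\<integral>x. 0 \<partial>(lborel::'a measure))"
    proof (rule integral_dominated_convergence)
      show "integrable lborel (\<lambda>x. 3 * norm (f x))" using lim.hyps(4) by simp
      show "AE x in lborel. (\<lambda>i. norm (s i x - f x)) \<longlonglongrightarrow> 0"
        using lim.hyps(2) by (auto intro!: AE_I2 tendsto_norm_zero LIM_zero)
      show "AE x in lborel. norm (norm (s i x - f x)) \<le> 3 * norm (f x)" for i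
      proof (rule AE_I2)
        fix x
        have "norm (s i x - f x) \<le> norm (s i x) + norm (f x)" by (rule norm_triangle_ineq4)
        then show "norm (norm (s i x - f x)) \<le> 3 * norm (f x)" using lim.hyps(3)[of x i] by simp
      qed
    qed auto
    then have "(\<lambda>i. (LBINT x. norm (s i x - f x))) \<longlonglongrightarrow> 0" by simp
    then have "\<forall>\<^sub>F i in sequentially. (LBINT x. norm (s i x - f x)) < e"
      using order_tendstoD(2) \<open>e > 0\<close> by fastforce
    then obtain i where "(LBINT x. norm (s i x - f x)) < e"
      by (meson eventually_sequentially order_refl)
    then show "\<exists>s. integrable lborel s \<and> translation_continuous s \<and> (LBINT x. norm (s x - f x)) < e"
      using lim.hyps(1) lim.IH by blast
  qed
qed

text \<open>The map sending a to |a| a takes L^2 functions to L^1 functions, and this says that its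
  inverse is Hoelder of order 1/2, which carries L^1 statements back to L^2. The reason is
  monotonicity: pairing |a| a - |b| b with a - b gives (|a| + |b|) |a - b|^2 / 2 plus the
  nonnegative term (|a|^2 - |b|^2) (|a| - |b|) / 2.\<close>

lemma norm_diff_sq_le:
  fixes a b :: complex
  shows "(cmod (a - b))\<^sup>2 \<le> 2 * cmod (cmod a * a - cmod b * b)"
proof (cases "a = b")
  case False
  define p where "p = cmod a * a - cmod b * b"
  define x y where "x = cmod a" and "y = cmod b"
  have "cmod p * cmod (a - b) \<ge> Re (p * cnj (a - b))"
    using complex_Re_le_cmod[of "p * cnj (a - b)"] by (simp add: norm_mult del: complex_cnj_diff)
  moreover have "Re (p * cnj (a - b)) = (x + y) * (cmod (a - b))\<^sup>2 / 2 + (x\<^sup>2 - y\<^sup>2) * (x - y) / 2"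
  proof -
    have x2: "x\<^sup>2 = (Re a)\<^sup>2 + (Im a)\<^sup>2" and y2: "y\<^sup>2 = (Re b)\<^sup>2 + (Im b)\<^sup>2"
      by (simp_all add: x_def y_def cmod_power2)
    have "Re (p * cnj (a - b)) = x * ((Re a)\<^sup>2 + (Im a)\<^sup>2) + y * ((Re b)\<^sup>2 + (Im b)\<^sup>2) - (x + y) * (Re a * Re b + Im a * Im b)"
      by (simp add: p_def x_def y_def power2_eq_square algebra_simps)
    moreover have "(cmod (a - b))\<^sup>2 = (Re a)\<^sup>2 + (Im a)\<^sup>2 + ((Re b)\<^sup>2 + (Im b)\<^sup>2) - 2 * (Re a * Re b + Im a * Im b)"
      unfolding cmod_power2 by (simp add: power2_eq_square algebra_simps)
    ultimately show ?thesis unfolding x2[symmetric] y2[symmetric]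
      by (simp only:) (simp add: power2_eq_square field_simps)
  qed
  moreover have "(x\<^sup>2 - y\<^sup>2) * (x - y) \<ge> 0"
  proof -
    have "(x\<^sup>2 - y\<^sup>2) * (x - y) = (x + y) * (x - y)\<^sup>2" by (simp add: power2_eq_square algebra_simps)
    also have "\<dots> \<ge> 0" by (simp add: x_def y_def)
    finally show ?thesis .
  qed
  moreover have "(x + y) * (cmod (a - b))\<^sup>2 \<ge> cmod (a - b) * (cmod (a - b))\<^sup>2"
    by (intro mult_right_mono) (auto simp: x_def y_def norm_triangle_ineq4)
  ultimately have "cmod (a - b) * (cmod (a - b))\<^sup>2 \<le> (2 * cmod p) * cmod (a - b)" by linarith
  then show ?thesis using False by (simp add: p_def mult.commute)
qed simp

text \<open>Applies the L^1 statement to the integrable function |f| f and returns to L^2 by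
  \<open>norm_diff_sq_le\<close>.\<close>

lemma l2_translation_continuous:
  fixes f :: "'a::euclidean_space \<Rightarrow> complex"
  assumes f: "sq_int f" and v: "v \<longlonglongrightarrow> 0"
  shows "(\<lambda>n. l2norm (\<lambda>x. f (x + v n) - f x)) \<longlonglongrightarrow> 0"
proof -
  define h where "h x = complex_of_real (cmod (f x)) * f x" for x
  have [measurable]: "f \<in> borel_measurable borel" using f by (rule sq_intD)
  have [measurable]: "h \<in> borel_measurable borel" unfolding h_def by measurable
  have h: "integrable lborel h"
    by (rule Bochner_Integration.integrable_bound[OF sq_intD(2)[OF f]])
      (auto simp: h_def norm_mult power2_eq_square)
  have "(\<lambda>n. (LBINT x. norm (h (x + v n) - h x))) \<longlonglongrightarrow> 0"
    using translation_continuous_integrable[OF h] v by (simp add: translation_continuous_def)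
  then have lim: "(\<lambda>n. 2 * (LBINT x. norm (h (x + v n) - h x))) \<longlonglongrightarrow> 0"
    using tendsto_mult_right_zero by blast
  have "(\<lambda>n. (l2norm (\<lambda>x. f (x + v n) - f x))\<^sup>2) \<longlonglongrightarrow> 0"
  proof (rule tendsto_sandwich[OF _ _ tendsto_const lim])
    show "\<forall>\<^sub>F n in sequentially. (l2norm (\<lambda>x. f (x + v n) - f x))\<^sup>2 \<le> 2 * (LBINT x. norm (h (x + v n) - h x))"
    proof (rule always_eventually, rule allI)
      fix n
      have hi: "integrable lborel (\<lambda>x. 2 * norm (h (x + v n) - h x))"
        using h integrable_lborel_translate[OF h] by auto
      have le: "(cmod (f (x + v n) - f x))\<^sup>2 \<le> 2 * norm (h (x + v n) - h x)" for x
        unfolding h_def by (rule norm_diff_sq_le)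
      have "(l2norm (\<lambda>x. f (x + v n) - f x))\<^sup>2 \<le> (LBINT x. 2 * norm (h (x + v n) - h x))"
        unfolding l2norm_sq
      proof (rule integral_mono[OF _ hi le])
        show "integrable lborel (\<lambda>x. (cmod (f (x + v n) - f x))\<^sup>2)"
          by (rule Bochner_Integration.integrable_bound[OF hi]) (use le in auto)
      qed
      then show "(l2norm (\<lambda>x. f (x + v n) - f x))\<^sup>2 \<le> 2 * (LBINT x. norm (h (x + v n) - h x))" by simp
    qed
  qed simp
  from tendsto_real_sqrt[OF this] show ?thesis by simp
qed

section \<open>Time-frequency shifts of the Gaussian\<close>

lemma Fubini_complex:
  fixes f :: "'a::euclidean_space \<Rightarrow> 'b::euclidean_space \<Rightarrow> complex"
  assumes [measurable]: "(\<lambda>(x, y). f x y) \<in> borel_measurable (borel \<Otimes>\<^sub>M borel)"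
    and w: "integrable lborel w"
    and i: "\<And>x. integrable lborel (f x)"
    and b: "\<And>x. (LBINT y. cmod (f x y)) \<le> w x"
  shows "(LBINT x. (LBINT y. f x y)) = (LBINT y. (LBINT x. f x y))"
proof -
  have "integrable (lborel \<Otimes>\<^sub>M lborel) (\<lambda>(x, y). f x y)"
  proof (rule lborel_pair.Fubini_integrable)
    show "integrable lborel (\<lambda>x. (LBINT y. norm (case (x, y) of (x, y) \<Rightarrow> f x y)))"
      by (rule Bochner_Integration.integrable_bound[OF w]) (use b in \<open>auto intro!: AE_I2 order_trans[OF b abs_ge_self] simp: integral_nonneg_AE\<close>)
  qed (use i in auto)
  from lborel_pair.Fubini_integral[OF this] show ?thesis by simp
qed

lemma gauss_normalize: "(2 powr (real n / 4))\<^sup>2 * (1 / sqrt 2) ^ n = 1"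
proof -
  have "(1 / sqrt 2) ^ n = 2 powr (- (real n / 2))"
  proof -
    have "1 / sqrt 2 = 2 powr (- (1 / 2))" by (simp add: powr_minus_divide powr_half_sqrt)
    then have "(1 / sqrt 2) ^ n = (2 powr (- (1 / 2))) powr (real n)" by (simp add: powr_realpow)
    also have "\<dots> = 2 powr (- (real n / 2))" by (simp add: powr_powr)
    finally show ?thesis .
  qed
  moreover have "(2 powr (real n / 4))\<^sup>2 = 2 powr (real n / 2)"
    by (simp add: power2_eq_square powr_add[symmetric])
  ultimately show ?thesis by (simp add: powr_add[symmetric])
qed

lemma borel_measurable_gauss [measurable]: "(gauss :: 'a::euclidean_space \<Rightarrow> complex) \<in> borel_measurable borel"
  unfolding gauss_def by measurable

lemma norm_gauss_sq:
  "(cmod (gauss (x::'a::euclidean_space)))\<^sup>2 = (2 powr (real DIM('a) / 4))\<^sup>2 * exp (- pi * 2 * (norm x)\<^sup>2)"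
proof -
  have "(exp (- pi * (norm x)\<^sup>2))\<^sup>2 = exp (- pi * 2 * (norm x)\<^sup>2)"
    by (simp add: power2_eq_square exp_add[symmetric])
  then show ?thesis unfolding gauss_def by (simp add: norm_mult power_mult_distrib)
qed

lemma sq_int_gauss: "sq_int (gauss :: 'a::euclidean_space \<Rightarrow> complex)"
  unfolding sq_int_def norm_gauss_sq using gauss_integral(1)[of 2, where 'a='a] by simp

lemma l2norm_gauss: "l2norm (gauss :: 'a::euclidean_space \<Rightarrow> complex) = 1"
proof -
  have "(l2norm (gauss :: 'a \<Rightarrow> complex))\<^sup>2 = 1"
    unfolding l2norm_sq norm_gauss_sq using gauss_integral[of 2, where 'a='a] gauss_normalize[of "DIM('a)"] by simp
  then show ?thesis using l2norm_nonneg[of "gauss :: 'a \<Rightarrow> complex"] by (simp add: power2_eq_1_iff)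
qed

section \<open>The symplectic form, time-frequency shifts and Gaussian wave packets\<close>

definition sympl :: "'a::euclidean_space \<times> 'a \<Rightarrow> 'a \<times> 'a \<Rightarrow> real" where
  "sympl z w = snd z \<bullet> fst w - fst z \<bullet> snd w"

lemma sympl_add_left: "sympl (z + z') w = sympl z w + sympl z' w"
  and sympl_add_right: "sympl w (z + z') = sympl w z + sympl w z'"
  and sympl_diff_left: "sympl (z - z') w = sympl z w - sympl z' w"
  and sympl_diff_right: "sympl w (z - z') = sympl w z - sympl w z'"
  and sympl_minus_left: "sympl (- z) w = - sympl z w"
  and sympl_minus_right: "sympl w (- z) = - sympl w z"
  and sympl_scale_left: "sympl (c *\<^sub>R z) w = c * sympl z w"
  and sympl_scale_right: "sympl w (c *\<^sub>R z) = c * sympl w z"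
  by (simp_all add: sympl_def inner_left_distrib inner_right_distrib inner_diff_left inner_diff_right algebra_simps)

lemmas sympl_simps = sympl_add_left sympl_add_right sympl_diff_left sympl_diff_right
  sympl_minus_left sympl_minus_right sympl_scale_left sympl_scale_right

lemma sympl_self [simp]: "sympl z z = 0"
  by (simp add: sympl_def inner_commute)

lemma sympl_swap: "sympl w z = - sympl z w"
  by (simp add: sympl_def inner_commute)

definition sympl_J :: "'a::euclidean_space \<times> 'a \<Rightarrow> 'a \<times> 'a" where
  "sympl_J z = (snd z, - fst z)"

lemma sympl_eq_inner: "sympl z w = sympl_J z \<bullet> w"
  by (cases w) (simp add: sympl_def sympl_J_def)

lemma sympl_J_inner: "sympl_J z \<bullet> sympl_J w = z \<bullet> w"
  by (cases z; cases w) (simp add: sympl_J_def)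

lemma norm_sympl_J [simp]: "norm (sympl_J z) = norm z"
  by (simp add: norm_eq_sqrt_inner sympl_J_inner)

lemma abs_sympl_le: "\<bar>sympl z w\<bar> \<le> norm z * norm w"
  using Cauchy_Schwarz_ineq2[of "sympl_J z" w] by (simp add: sympl_eq_inner)

lemma tfs_0 [simp]: "tfs 0 f = f"
  by (simp add: tfs_def fun_eq_iff)

lemma cis_cong: "a = b \<Longrightarrow> cis a = cis b" by simp

text \<open>The Weyl commutation relation. The symmetric phase built into \<open>tfs\<close> is what
  makes the cocycle equal to the symplectic form.\<close>

lemma tfs_tfs: "tfs z (tfs w f) = (\<lambda>s. cis (pi * sympl z w) * tfs (z + w) f s)"
proof
  fix s
  obtain x \<xi> where z: "z = (x, \<xi>)" by (cases z)
  obtain x' \<xi>' where w: "w = (x', \<xi>')" by (cases w)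
  have "cis (- pi * (x \<bullet> \<xi>)) * cis (2 * pi * (\<xi> \<bullet> s)) * (cis (- pi * (x' \<bullet> \<xi>')) * cis (2 * pi * (\<xi>' \<bullet> (s - x))))
    = cis (pi * sympl z w) * (cis (- pi * ((x + x') \<bullet> (\<xi> + \<xi>'))) * cis (2 * pi * ((\<xi> + \<xi>') \<bullet> s)))"
    unfolding cis_mult
    by (rule cis_cong) (simp add: z w sympl_def algebra_simps inner_commute)
  then show "tfs z (tfs w f) s = cis (pi * sympl z w) * tfs (z + w) f s"
    by (simp add: tfs_def z w diff_diff_eq mult.assoc)
qed

lemma borel_measurable_tfs [measurable (raw)]:
  assumes [measurable]: "f \<in> borel_measurable borel"
  shows "tfs z f \<in> borel_measurable borel"
  unfolding tfs_def by measurable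

lemma cmod_tfs [simp]: "cmod (tfs z f s) = cmod (f (s - fst z))"
  by (simp add: tfs_def norm_mult)

lemma sq_int_tfs: "sq_int f \<Longrightarrow> sq_int (tfs z f)"
  using integrable_lborel_translate[of "\<lambda>x. (cmod (f x))\<^sup>2" "- fst z"]
  by (auto simp: sq_int_def intro: borel_measurable_tfs)

lemma l2inner_tfs_tfs: "l2inner (tfs z f) (tfs z g) = l2inner f g"
proof -
  have "tfs z f s * cnj (tfs z g s) = f (s + - fst z) * cnj (g (s + - fst z))" for s
  proof -
    have "tfs z f s * cnj (tfs z g s)
       = (cis (- pi * (fst z \<bullet> snd z)) * cnj (cis (- pi * (fst z \<bullet> snd z)))) * (cis (2 * pi * (snd z \<bullet> s)) * cnj (cis (2 * pi * (snd z \<bullet> s)))) * (f (s - fst z) * cnj (g (s - fst z)))"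
      by (simp only: tfs_def complex_cnj_mult ac_simps)
    then show ?thesis by (simp add: cis_cnj cis_mult)
  qed
  then show ?thesis
    unfolding l2inner_def by (simp only: integral_lborel_translate[of "\<lambda>s. f s * cnj (g s)" "- fst z"])
qed

lemma l2norm_tfs [simp]: "l2norm (tfs z f) = l2norm f"
  unfolding l2norm_def using integral_lborel_translate[of "\<lambda>s. (cmod (f s))\<^sup>2" "- fst z"] by simp

lemma tfs_diff: "tfs z (\<lambda>x. f x - g x) = (\<lambda>x. tfs z f x - tfs z g x)"
  by (simp add: tfs_def fun_eq_iff algebra_simps)

lemma l2inner_tfs_left: "l2inner (tfs z f) g = l2inner f (tfs (- z) g)"
proof -
  have "tfs z (tfs (- z) g) = g" unfolding tfs_tfs by (simp add: sympl_minus_right)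
  then show ?thesis using l2inner_tfs_tfs[of z f "tfs (- z) g"] by simp
qed

definition wp :: "'a::euclidean_space \<times> 'a \<Rightarrow> 'a \<Rightarrow> complex" where
  "wp z = tfs z gauss"

lemma sq_int_wp: "sq_int (wp z)" and l2norm_wp [simp]: "l2norm (wp z) = 1"
  by (simp_all add: wp_def sq_int_tfs sq_int_gauss l2norm_gauss)

lemma norm_prod_sq: "(norm (z::'a::euclidean_space \<times> 'a))\<^sup>2 = (norm (fst z))\<^sup>2 + (norm (snd z))\<^sup>2"
  by (cases z) (simp add: norm_Pair)

text \<open>Shifting the variable to the midpoint x / 2 of the two centres decouples the integrand:
  by the parallelogram law the product of the Gaussians is a constant in x times a centred Gaussian
  of double rate, and the phases combine to a pure character.\<close>

lemma l2inner_wp_gauss: "l2inner (wp z) gauss = complex_of_real (exp (- (pi / 2) * (norm z)\<^sup>2))"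
proof -
  obtain x \<xi> where z: "z = (x, \<xi>)" by (cases z)
  define k where "k = (2 powr (real DIM('a) / 4))\<^sup>2"
  have eq: "wp z (u + (1/2) *\<^sub>R x) * cnj (gauss (u + (1/2) *\<^sub>R x)) =
      complex_of_real (k * exp (- (pi / 2) * (norm x)\<^sup>2)) * (complex_of_real (exp (- pi * 2 * (norm u)\<^sup>2)) * cis (2 * pi * (\<xi> \<bullet> u)))" for u
  proof -
    have e: "(norm (u + (1/2) *\<^sub>R x - x))\<^sup>2 + (norm (u + (1/2) *\<^sub>R x))\<^sup>2 = 2 * (norm u)\<^sup>2 + (norm x)\<^sup>2 / 2"
      unfolding power2_norm_eq_inner
      by (simp add: inner_left_distrib inner_right_distrib inner_diff_left inner_diff_right inner_commute field_simps)
    have p: "cis (- pi * (x \<bullet> \<xi>)) * cis (2 * pi * (\<xi> \<bullet> (u + (1/2) *\<^sub>R x))) = cis (2 * pi * (\<xi> \<bullet> u))"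
      unfolding cis_mult by (rule cis_cong) (simp add: inner_right_distrib inner_commute algebra_simps)
    have "exp (- pi * (norm (u + (1/2) *\<^sub>R x - x))\<^sup>2) * exp (- pi * (norm (u + (1/2) *\<^sub>R x))\<^sup>2)
       = exp (- pi * ((norm (u + (1/2) *\<^sub>R x - x))\<^sup>2 + (norm (u + (1/2) *\<^sub>R x))\<^sup>2))"
      by (simp add: exp_add[symmetric] algebra_simps)
    also have "\<dots> = exp (- (pi / 2) * (norm x)\<^sup>2) * exp (- pi * 2 * (norm u)\<^sup>2)"
      unfolding e by (simp add: exp_add[symmetric] algebra_simps)
    finally have r: "exp (- pi * (norm (u + (1/2) *\<^sub>R x - x))\<^sup>2) * exp (- pi * (norm (u + (1/2) *\<^sub>R x))\<^sup>2)
       = exp (- (pi / 2) * (norm x)\<^sup>2) * exp (- pi * 2 * (norm u)\<^sup>2)" .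
    have "wp z (u + (1/2) *\<^sub>R x) * cnj (gauss (u + (1/2) *\<^sub>R x)) =
       (cis (- pi * (x \<bullet> \<xi>)) * cis (2 * pi * (\<xi> \<bullet> (u + (1/2) *\<^sub>R x)))) *
       complex_of_real (k * (exp (- pi * (norm (u + (1/2) *\<^sub>R x - x))\<^sup>2) * exp (- pi * (norm (u + (1/2) *\<^sub>R x))\<^sup>2)))"
      unfolding wp_def tfs_def gauss_def z k_def power2_eq_square[of "2 powr _"]
      by (simp only: fst_conv snd_conv complex_cnj_mult complex_cnj_complex_of_real of_real_mult ac_simps)
    also have "\<dots> = complex_of_real (k * exp (- (pi / 2) * (norm x)\<^sup>2)) * (complex_of_real (exp (- pi * 2 * (norm u)\<^sup>2)) * cis (2 * pi * (\<xi> \<bullet> u)))"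
      unfolding p r by (simp only: of_real_mult ac_simps)
    finally show ?thesis .
  qed
  have "l2inner (wp z) gauss = (LBINT u. wp z (u + (1/2) *\<^sub>R x) * cnj (gauss (u + (1/2) *\<^sub>R x)))"
    unfolding l2inner_def using integral_lborel_translate[of "\<lambda>s. wp z s * cnj (gauss s)" "(1/2) *\<^sub>R x"] by simp
  also have "\<dots> = complex_of_real (k * exp (- (pi / 2) * (norm x)\<^sup>2)) * complex_of_real ((1 / sqrt 2) ^ DIM('a) * exp (- pi * (norm \<xi>)\<^sup>2 / 2))"
    unfolding eq integral_mult_right_zero by (subst gauss_FT(2)) auto
  also have "\<dots> = complex_of_real ((k * (1 / sqrt 2) ^ DIM('a)) * (exp (- (pi / 2) * (norm x)\<^sup>2) * exp (- pi * (norm \<xi>)\<^sup>2 / 2)))"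
    by simp
  also have "\<dots> = complex_of_real (exp (- (pi / 2) * (norm z)\<^sup>2))"
    unfolding k_def gauss_normalize by (simp add: norm_prod_sq z exp_add[symmetric] algebra_simps del: of_real_mult)
  finally show ?thesis .
qed

lemma l2inner_wp_wp:
  "l2inner (wp z) (wp w) = cis (pi * sympl z w) * complex_of_real (exp (- (pi / 2) * (norm (z - w))\<^sup>2))"
proof -
  have "l2inner (wp z) (wp w) = l2inner (tfs (- w) (wp z)) gauss"
    unfolding wp_def l2inner_tfs_left[of "- w"] by simp
  also have "tfs (- w) (wp z) = (\<lambda>s. cis (pi * sympl z w) * wp (z - w) s)"
    unfolding wp_def tfs_tfs by (simp add: sympl_minus_left sympl_swap[of w z])
  finally show ?thesis by (simp add: l2inner_scale_left l2inner_wp_gauss)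
qed

text \<open>Differs from \<open>stft gauss\<close> by a unimodular factor only, hence describes the
  same class M^1; without that factor time-frequency shifts act by translation and a symplectic
  phase.\<close>

definition gstft :: "('a::euclidean_space \<Rightarrow> complex) \<Rightarrow> 'a \<times> 'a \<Rightarrow> complex" where
  "gstft f z = l2inner f (wp z)"

lemma cmod_gstft_le: "sq_int f \<Longrightarrow> cmod (gstft f z) \<le> l2norm f"
  using l2_Cauchy_Schwarz[OF _ sq_int_wp, of f z] by (simp add: gstft_def)

lemma gstft_diff: "sq_int f \<Longrightarrow> sq_int g \<Longrightarrow> gstft (\<lambda>x. f x - g x) z = gstft f z - gstft g z"
  by (simp add: gstft_def l2inner_diff_left sq_int_wp)

lemma gstft_tfs: "gstft (tfs w f) z = cis (pi * sympl w z) * gstft f (z - w)"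
proof -
  have "tfs (- w) (wp z) = (\<lambda>s. cis (- (pi * sympl w z)) * wp (z - w) s)"
    unfolding wp_def tfs_tfs by (simp add: sympl_minus_left)
  then show ?thesis
    unfolding gstft_def l2inner_tfs_left by (simp add: l2inner_scale_right cis_cnj)
qed

lemma l2norm_wp_diff_tendsto:
  "((\<lambda>z. l2norm (\<lambda>x. wp z x - wp w x)) \<longlongrightarrow> 0) (at w)"
proof -
  have eq: "(l2norm (\<lambda>x. wp z x - wp w x))\<^sup>2 = 2 - 2 * (cos (pi * sympl z w) * exp (- (pi / 2) * (norm (z - w))\<^sup>2))" for z
  proof -
    have "(l2norm (\<lambda>x. wp z x + (-1) * wp w x))\<^sup>2 = 2 + 2 * Re (l2inner (wp z) (\<lambda>x. (-1) * wp w x))"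
      using l2norm_add_sq[OF sq_int_wp sq_int_scale[OF sq_int_wp], of z "-1" w] l2norm_scale[of "-1" "wp w"]
      by simp
    then show ?thesis by (simp add: l2inner_scale_right[of _ "-1", simplified] l2inner_wp_wp)
  qed
  have c: "((\<lambda>z. sympl z w) \<longlongrightarrow> sympl w w) (at w)"
    unfolding sympl_def by (intro tendsto_intros)
  have "((\<lambda>z. 2 - 2 * (cos (pi * sympl z w) * exp (- (pi / 2) * (norm (z - w))\<^sup>2))) \<longlongrightarrow>
      2 - 2 * (cos (pi * sympl w w) * exp (- (pi / 2) * (norm (w - w))\<^sup>2))) (at w)"
    by (intro tendsto_intros c)
  then have "((\<lambda>z. (l2norm (\<lambda>x. wp z x - wp w x))\<^sup>2) \<longlongrightarrow> 0) (at w)"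
    unfolding eq by simp
  from tendsto_real_sqrt[OF this] show ?thesis by simp
qed

lemma continuous_on_gstft:
  assumes f: "sq_int f"
  shows "continuous_on UNIV (gstft f)"
proof -
  have "(gstft f \<longlongrightarrow> gstft f w) (at w)" for w
  proof (rule Lim_null_comparison[THEN LIM_zero_cancel])
    show "\<forall>\<^sub>F z in at w. cmod (gstft f z - gstft f w) \<le> l2norm f * l2norm (\<lambda>x. wp z x - wp w x)"
    proof (rule always_eventually, rule allI)
      fix z
      have "gstft f z - gstft f w = l2inner f (\<lambda>x. wp z x - wp w x)"
        by (simp add: gstft_def l2inner_diff_right sq_int_wp f)
      then show "cmod (gstft f z - gstft f w) \<le> l2norm f * l2norm (\<lambda>x. wp z x - wp w x)"
        using l2_Cauchy_Schwarz[OF f sq_int_diff[OF sq_int_wp sq_int_wp], of z w] by simp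
    qed
    show "((\<lambda>z. l2norm f * l2norm (\<lambda>x. wp z x - wp w x)) \<longlongrightarrow> 0) (at w)"
      using tendsto_mult_right_zero[OF l2norm_wp_diff_tendsto] by blast
  qed
  then show ?thesis by (simp add: continuous_on_def)
qed

lemma borel_measurable_gstft:
  "sq_int f \<Longrightarrow> gstft f \<in> borel_measurable borel"
  by (rule borel_measurable_continuous_onI[OF continuous_on_gstft])

section \<open>Plancherel and Moyal identities\<close>

lemma integral_cmod_mult_le:
  assumes f: "sq_int f" and g: "sq_int g"
  shows "(LBINT x. cmod (f x) * cmod (g x)) \<le> l2norm f * l2norm g"
proof -
  have [measurable]: "f \<in> borel_measurable borel" "g \<in> borel_measurable borel"
    using f g by (auto dest: sq_intD)
  have s: "sq_int (\<lambda>x. complex_of_real (cmod (f x)))" "sq_int (\<lambda>x. complex_of_real (cmod (g x)))"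
    by (rule sq_int_cong_norm[OF f]; simp) (rule sq_int_cong_norm[OF g]; simp)
  have "l2inner (\<lambda>x. complex_of_real (cmod (f x))) (\<lambda>x. complex_of_real (cmod (g x)))
      = complex_of_real (LBINT x. cmod (f x) * cmod (g x))"
    unfolding l2inner_def by (simp flip: of_real_mult)
  then have "\<bar>(LBINT x. cmod (f x) * cmod (g x))\<bar> \<le> l2norm f * l2norm g"
    using l2_Cauchy_Schwarz[OF s] by (simp add: l2norm_def)
  then show ?thesis by linarith
qed

lemma sq_int_translate: "sq_int f \<Longrightarrow> sq_int (\<lambda>x. f (x + a))"
  using integrable_lborel_translate[of "\<lambda>x. (cmod (f x))\<^sup>2" a] by (auto simp: sq_int_def)

lemma l2norm_translate: "l2norm (\<lambda>x. f (x + a)) = l2norm f"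
  unfolding l2norm_def using integral_lborel_translate[of "\<lambda>x. (cmod (f x))\<^sup>2" a] by simp

text \<open>The squared transform is damped by a Gaussian of rate r. As r decreases to 0 the damped
  integral increases to the left-hand side; by Fubini and \<open>gauss_FT\<close> it also equals a
  Gaussian mean, at scale sqrt r, of the autocorrelation of \<open>h\<close>, which tends to its
  value at 0, the squared norm.\<close>

lemma plancherel:
  fixes h :: "'a::euclidean_space \<Rightarrow> complex"
  assumes h: "integrable lborel h" "sq_int h"
  defines "ft \<equiv> \<lambda>\<xi>. (LBINT s. h s * cis (- 2 * pi * (\<xi> \<bullet> s)))"
  shows "(NNBINT \<xi>. ennreal ((cmod (ft \<xi>))\<^sup>2)) = ennreal ((l2norm h)\<^sup>2)"
proof -
  have [measurable]: "h \<in> borel_measurable borel" using h(2) by (rule sq_intD)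
  define M where "M = (LBINT s. cmod (h s))"
  have M: "M \<ge> 0" unfolding M_def by simp
  have ihc: "integrable lborel (\<lambda>s. h s * cis (c s))" if [measurable]: "c \<in> borel_measurable borel" for c :: "'a \<Rightarrow> real"
    by (rule Bochner_Integration.integrable_bound[OF integrable_norm[OF h(1)]]) (auto simp: norm_mult)
  have [measurable]: "ft \<in> borel_measurable borel"
    unfolding ft_def by measurable
  have ftM: "cmod (ft \<xi>) \<le> M" for \<xi>
  proof -
    have "cmod (ft \<xi>) \<le> (LBINT s. cmod (h s * cis (- 2 * pi * (\<xi> \<bullet> s))))"
      unfolding ft_def by (rule integral_norm_bound)
    then show ?thesis by (simp add: M_def norm_mult)
  qed
  define G where "G r \<xi> = exp (- pi * r * (norm (\<xi>::'a))\<^sup>2)" for r \<xi>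
  have Gpos [simp]: "G r \<xi> > 0" "G r \<xi> \<ge> 0" "\<bar>G r \<xi>\<bar> = G r \<xi>" for r \<xi> by (auto simp: G_def)
  have [measurable]: "G r \<in> borel_measurable borel" for r unfolding G_def by measurable
  have Gint: "integrable lborel (G r)" if "r > 0" for r
    unfolding G_def using gauss_integral(1)[OF that] .
  \<comment> \<open>The autocorrelation; its continuity at 0 is continuity of translations in
    L^2.\<close>
  define A where "A u = (LBINT s. h s * cnj (h (s + u)))" for u
  have [measurable]: "A \<in> borel_measurable borel" unfolding A_def by measurable
  have I: "complex_of_real (LBINT \<xi>. (cmod (ft \<xi>))\<^sup>2 * G r \<xi>) = (LBINT v. complex_of_real (G 1 v) * A (sqrt r *\<^sub>R v))"
    if r: "r > 0" for r
  proof -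
    \<comment> \<open>Inverting the damped transform gives back not \<open>h s\<close> but a
      Gaussian mean of \<open>h\<close> around \<open>s\<close> at scale sqrt r; this is
      \<open>K1\<close>.\<close>
    define K where "K s = (LBINT \<xi>. ft \<xi> * complex_of_real (G r \<xi>) * cis (2 * pi * (\<xi> \<bullet> s)))" for s
    have K1: "K s = (LBINT v. h (s + sqrt r *\<^sub>R v) * complex_of_real (G 1 v))" for s
    proof -
      have "K s = (LBINT \<xi>. (LBINT s'. h s' * cis (- 2 * pi * (\<xi> \<bullet> s')) * (complex_of_real (G r \<xi>) * cis (2 * pi * (\<xi> \<bullet> s)))))"
        unfolding K_def ft_def mult.assoc by (simp only: integral_mult_left_zero[symmetric]) (simp only: mult.assoc)
      also have "\<dots> = (LBINT s'. (LBINT \<xi>. h s' * cis (- 2 * pi * (\<xi> \<bullet> s')) * (complex_of_real (G r \<xi>) * cis (2 * pi * (\<xi> \<bullet> s)))))"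
      proof (rule Fubini_complex[where w="\<lambda>\<xi>. M * G r \<xi>"])
        show "integrable lborel (\<lambda>\<xi>. M * G r \<xi>)" using Gint[OF r] by simp
        show "integrable lborel (\<lambda>s'. h s' * cis (- 2 * pi * (\<xi> \<bullet> s')) * (complex_of_real (G r \<xi>) * cis (2 * pi * (\<xi> \<bullet> s))))" for \<xi>
          by (rule integrable_mult_left) (intro ihc, measurable)
        show "(LBINT s'. cmod (h s' * cis (- 2 * pi * (\<xi> \<bullet> s')) * (complex_of_real (G r \<xi>) * cis (2 * pi * (\<xi> \<bullet> s))))) \<le> M * G r \<xi>" for \<xi>
          by (simp add: norm_mult M_def)
      qed measurable
      also have "\<dots> = (LBINT s'. h s' * complex_of_real ((1 / sqrt r) ^ DIM('a) * exp (- pi * (norm (s - s'))\<^sup>2 / r)))"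
      proof (rule Bochner_Integration.integral_cong[OF refl])
        fix s'
        have "h s' * cis (- 2 * pi * (\<xi> \<bullet> s')) * (complex_of_real (G r \<xi>) * cis (2 * pi * (\<xi> \<bullet> s)))
            = h s' * (complex_of_real (exp (- pi * r * (norm \<xi>)\<^sup>2)) * cis (2 * pi * ((s - s') \<bullet> \<xi>)))" for \<xi>
        proof -
          have e: "cis (- 2 * pi * (\<xi> \<bullet> s')) * cis (2 * pi * (\<xi> \<bullet> s)) = cis (2 * pi * ((s - s') \<bullet> \<xi>))"
            unfolding cis_mult by (rule cis_cong) (simp add: inner_diff_left inner_commute algebra_simps)
          have "h s' * cis (- 2 * pi * (\<xi> \<bullet> s')) * (complex_of_real (G r \<xi>) * cis (2 * pi * (\<xi> \<bullet> s)))
              = h s' * (complex_of_real (G r \<xi>) * (cis (- 2 * pi * (\<xi> \<bullet> s')) * cis (2 * pi * (\<xi> \<bullet> s))))"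
            by (simp only: ac_simps)
          then show ?thesis by (simp only: e G_def)
        qed
        then show "(LBINT \<xi>. h s' * cis (- 2 * pi * (\<xi> \<bullet> s')) * (complex_of_real (G r \<xi>) * cis (2 * pi * (\<xi> \<bullet> s))))
           = h s' * complex_of_real ((1 / sqrt r) ^ DIM('a) * exp (- pi * (norm (s - s'))\<^sup>2 / r))"
          by (simp only: integral_mult_right_zero gauss_FT(2)[OF r])
      qed
      also have "\<dots> = (LBINT y. h (y + s) * complex_of_real ((1 / sqrt r) ^ DIM('a) * exp (- pi * (norm y)\<^sup>2 / r)))"
        using integral_lborel_translate[of "\<lambda>s'. h s' * complex_of_real ((1 / sqrt r) ^ DIM('a) * exp (- pi * (norm (s - s'))\<^sup>2 / r))" s]
        by simp
      also have "\<dots> = (sqrt r) ^ DIM('a) *\<^sub>R (LBINT v. h (sqrt r *\<^sub>R v + s) * complex_of_real ((1 / sqrt r) ^ DIM('a) * exp (- pi * (norm (sqrt r *\<^sub>R v))\<^sup>2 / r)))"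
        by (rule integral_lborel_scaleR) (use r in auto)
      also have "\<dots> = (LBINT v. (sqrt r) ^ DIM('a) *\<^sub>R (h (sqrt r *\<^sub>R v + s) * complex_of_real ((1 / sqrt r) ^ DIM('a) * exp (- pi * (norm (sqrt r *\<^sub>R v))\<^sup>2 / r))))"
        by simp
      also have "\<dots> = (LBINT v. h (s + sqrt r *\<^sub>R v) * complex_of_real (G 1 v))"
        using r by (intro Bochner_Integration.integral_cong) (auto simp: G_def power_mult_distrib scaleR_conv_of_real power_divide add.commute)
      finally show ?thesis .
    qed
    have "complex_of_real (LBINT \<xi>. (cmod (ft \<xi>))\<^sup>2 * G r \<xi>) = (LBINT \<xi>. complex_of_real ((cmod (ft \<xi>))\<^sup>2 * G r \<xi>))"
      by (rule integral_complex_of_real[symmetric])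
    also have "\<dots> = (LBINT \<xi>. ft \<xi> * (cnj (ft \<xi>) * complex_of_real (G r \<xi>)))"
      by (simp only: of_real_mult complex_norm_square mult.assoc)
    also have "\<dots> = (LBINT \<xi>. (LBINT s. h s * cis (- 2 * pi * (\<xi> \<bullet> s)) * (cnj (ft \<xi>) * complex_of_real (G r \<xi>))))"
      by (subst (1) ft_def) (simp only: integral_mult_left_zero)
    also have "\<dots> = (LBINT s. (LBINT \<xi>. h s * cis (- 2 * pi * (\<xi> \<bullet> s)) * (cnj (ft \<xi>) * complex_of_real (G r \<xi>))))"
    proof (rule Fubini_complex[where w="\<lambda>\<xi>. M * (M * G r \<xi>)"])
      show "integrable lborel (\<lambda>\<xi>. M * (M * G r \<xi>))" using Gint[OF r] by simp
      show "integrable lborel (\<lambda>s. h s * cis (- 2 * pi * (\<xi> \<bullet> s)) * (cnj (ft \<xi>) * complex_of_real (G r \<xi>)))" for \<xi>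
        by (rule integrable_mult_left) (intro ihc, measurable)
      show "(LBINT s. cmod (h s * cis (- 2 * pi * (\<xi> \<bullet> s)) * (cnj (ft \<xi>) * complex_of_real (G r \<xi>)))) \<le> M * (M * G r \<xi>)" for \<xi>
        using ftM[of \<xi>] M by (auto simp: norm_mult M_def[symmetric] intro!: mult_left_mono mult_right_mono)
    qed measurable
    also have "\<dots> = (LBINT s. h s * cnj (K s))"
    proof (rule Bochner_Integration.integral_cong[OF refl])
      fix s
      have "h s * cis (- 2 * pi * (\<xi> \<bullet> s)) * (cnj (ft \<xi>) * complex_of_real (G r \<xi>)) = h s * cnj (ft \<xi> * complex_of_real (G r \<xi>) * cis (2 * pi * (\<xi> \<bullet> s)))" for \<xi>
        by (simp add: cis_cnj)
      then show "(LBINT \<xi>. h s * cis (- 2 * pi * (\<xi> \<bullet> s)) * (cnj (ft \<xi>) * complex_of_real (G r \<xi>))) = h s * cnj (K s)"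
        unfolding K_def by (simp only: integral_mult_right_zero Bochner_Integration.integral_cnj)
    qed
    also have "\<dots> = (LBINT s. (LBINT v. h s * cnj (h (s + sqrt r *\<^sub>R v)) * complex_of_real (G 1 v)))"
      unfolding K1 Bochner_Integration.integral_cnj[symmetric] integral_mult_right_zero[symmetric]
      by (simp only: complex_cnj_mult complex_cnj_complex_of_real mult.assoc)
    also have "\<dots> = (LBINT v. (LBINT s. h s * cnj (h (s + sqrt r *\<^sub>R v)) * complex_of_real (G 1 v)))"
    proof (rule Fubini_complex[symmetric, where w="\<lambda>v. (l2norm h)\<^sup>2 * G 1 v"])
      show "integrable lborel (\<lambda>v. (l2norm h)\<^sup>2 * G 1 v)" using Gint[of 1] by simp
      show "integrable lborel (\<lambda>s. h s * cnj (h (s + sqrt r *\<^sub>R v)) * complex_of_real (G 1 v))" for v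
        by (intro integrable_mult_left sq_int_mult_integrable sq_int_translate h)
      show "(LBINT s. cmod (h s * cnj (h (s + sqrt r *\<^sub>R v)) * complex_of_real (G 1 v))) \<le> (l2norm h)\<^sup>2 * G 1 v" for v
        using integral_cmod_mult_le[OF h(2) sq_int_translate[OF h(2)], of "sqrt r *\<^sub>R v"]
        by (simp add: norm_mult l2norm_translate power2_eq_square)
    qed measurable
    also have "\<dots> = (LBINT v. complex_of_real (G 1 v) * A (sqrt r *\<^sub>R v))"
      unfolding A_def by (simp add: mult.commute)
    finally show ?thesis .
  qed
  \<comment> \<open>A decreasing sequence, so that the damping factors increase and monotone
    convergence applies without knowing that the limit is finite.\<close>
  define r where "r n = 1 / (real n + 1)" for n :: nat
  have r: "r n > 0" for n by (simp add: r_def)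
  have rlim: "r \<longlonglongrightarrow> 0" unfolding r_def by real_asymp
  have Abound: "cmod (A u) \<le> (l2norm h)\<^sup>2" for u
    using l2_Cauchy_Schwarz[OF h(2) sq_int_translate[OF h(2)], of u]
    by (simp add: A_def l2inner_def l2norm_translate power2_eq_square)
  have Alim: "(\<lambda>n. A (u n)) \<longlonglongrightarrow> complex_of_real ((l2norm h)\<^sup>2)" if u: "u \<longlonglongrightarrow> 0" for u
  proof (rule Lim_null_comparison[THEN LIM_zero_cancel])
    show "\<forall>\<^sub>F n in sequentially. cmod (A (u n) - complex_of_real ((l2norm h)\<^sup>2)) \<le> l2norm h * l2norm (\<lambda>x. h (x + u n) - h x)"
    proof (rule always_eventually, rule allI)
      fix n
      have "A (u n) - complex_of_real ((l2norm h)\<^sup>2) = l2inner h (\<lambda>x. h (x + u n) - h x)"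
        unfolding l2inner_diff_right[OF sq_int_translate[OF h(2)] h(2) h(2)] l2inner_self[symmetric]
        by (simp add: A_def l2inner_def)
      then show "cmod (A (u n) - complex_of_real ((l2norm h)\<^sup>2)) \<le> l2norm h * l2norm (\<lambda>x. h (x + u n) - h x)"
        using l2_Cauchy_Schwarz[OF h(2) sq_int_diff[OF sq_int_translate[OF h(2)] h(2)]] by simp
    qed
    show "(\<lambda>n. l2norm h * l2norm (\<lambda>x. h (x + u n) - h x)) \<longlonglongrightarrow> 0"
      using tendsto_mult_right_zero[OF l2_translation_continuous[OF h(2) u]] by blast
  qed
  have "(\<lambda>n. (LBINT v. complex_of_real (G 1 v) * A (sqrt (r n) *\<^sub>R v))) \<longlonglongrightarrow> (LBINT v. complex_of_real (G 1 v) * complex_of_real ((l2norm h)\<^sup>2))"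
  proof (rule integral_dominated_convergence[where w="\<lambda>v. (l2norm h)\<^sup>2 * G 1 v"])
    show "integrable lborel (\<lambda>v. (l2norm h)\<^sup>2 * G 1 v)" using Gint[of 1] by simp
    show "AE v in lborel. (\<lambda>n. complex_of_real (G 1 v) * A (sqrt (r n) *\<^sub>R v)) \<longlonglongrightarrow> complex_of_real (G 1 v) * complex_of_real ((l2norm h)\<^sup>2)"
    proof (rule AE_I2)
      fix v :: 'a
      have "(\<lambda>n. sqrt (r n) *\<^sub>R v) \<longlonglongrightarrow> sqrt 0 *\<^sub>R v"
        by (intro tendsto_intros rlim)
      then show "(\<lambda>n. complex_of_real (G 1 v) * A (sqrt (r n) *\<^sub>R v)) \<longlonglongrightarrow> complex_of_real (G 1 v) * complex_of_real ((l2norm h)\<^sup>2)"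
        by (intro tendsto_mult tendsto_const Alim) simp
    qed
    show "AE v in lborel. norm (complex_of_real (G 1 v) * A (sqrt (r n) *\<^sub>R v)) \<le> (l2norm h)\<^sup>2 * G 1 v" for n
      using Abound by (auto simp: norm_mult mult.commute intro!: AE_I2 mult_right_mono)
  qed measurable
  moreover have "(LBINT v. complex_of_real (G 1 v) * complex_of_real ((l2norm h)\<^sup>2)) = complex_of_real ((l2norm h)\<^sup>2)"
  proof -
    have "(LBINT v. G 1 v) = 1" unfolding G_def using gauss_integral(2)[of 1, where 'a='a] by simp
    then show ?thesis by (simp only: integral_mult_left_zero integral_complex_of_real) simp
  qed
  ultimately have "(\<lambda>n. complex_of_real (LBINT \<xi>. (cmod (ft \<xi>))\<^sup>2 * G (r n) \<xi>)) \<longlonglongrightarrow> complex_of_real ((l2norm h)\<^sup>2)"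
    by (simp only: I[OF r])
  then have lim1: "(\<lambda>n. (LBINT \<xi>. (cmod (ft \<xi>))\<^sup>2 * G (r n) \<xi>)) \<longlonglongrightarrow> (l2norm h)\<^sup>2"
    by (simp only: tendsto_of_real_iff)
  have nn: "(NNBINT \<xi>. ennreal ((cmod (ft \<xi>))\<^sup>2 * G (r n) \<xi>)) = ennreal (LBINT \<xi>. (cmod (ft \<xi>))\<^sup>2 * G (r n) \<xi>)" for n
  proof (rule nn_integral_eq_integral)
    show "integrable lborel (\<lambda>\<xi>. (cmod (ft \<xi>))\<^sup>2 * G (r n) \<xi>)"
    proof (rule Bochner_Integration.integrable_bound)
      show "integrable lborel (\<lambda>\<xi>. M\<^sup>2 * G (r n) \<xi>)" using Gint[OF r] by simp
      show "AE \<xi> in lborel. norm ((cmod (ft \<xi>))\<^sup>2 * G (r n) \<xi>) \<le> norm (M\<^sup>2 * G (r n) \<xi>)"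
        using ftM by (auto intro!: AE_I2 mult_right_mono power_mono simp: abs_mult)
    qed measurable
  qed simp
  have "(\<lambda>n. (NNBINT \<xi>. ennreal ((cmod (ft \<xi>))\<^sup>2 * G (r n) \<xi>))) \<longlonglongrightarrow> (NNBINT \<xi>. ennreal ((cmod (ft \<xi>))\<^sup>2))"
  proof (rule nn_integral_LIMSEQ)
    show "incseq (\<lambda>n \<xi>. ennreal ((cmod (ft \<xi>))\<^sup>2 * G (r n) \<xi>))"
    proof (rule incseq_SucI, rule le_funI)
      fix n and \<xi> :: 'a
      have "r (Suc n) \<le> r n" by (simp add: r_def field_simps)
      then have "r (Suc n) * (pi * (norm \<xi>)\<^sup>2) \<le> r n * (pi * (norm \<xi>)\<^sup>2)" by (intro mult_right_mono) auto
      then have "G (r n) \<xi> \<le> G (r (Suc n)) \<xi>" by (simp add: G_def algebra_simps)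
      then show "ennreal ((cmod (ft \<xi>))\<^sup>2 * G (r n) \<xi>) \<le> ennreal ((cmod (ft \<xi>))\<^sup>2 * G (r (Suc n)) \<xi>)"
        by (intro ennreal_leI mult_left_mono) auto
    qed
    show "(\<lambda>n. ennreal ((cmod (ft \<xi>))\<^sup>2 * G (r n) \<xi>)) \<longlonglongrightarrow> ennreal ((cmod (ft \<xi>))\<^sup>2)" for \<xi>
    proof (rule tendsto_ennrealI)
      have "(\<lambda>n. (cmod (ft \<xi>))\<^sup>2 * exp (- pi * r n * (norm \<xi>)\<^sup>2)) \<longlonglongrightarrow> (cmod (ft \<xi>))\<^sup>2 * exp (- pi * 0 * (norm \<xi>)\<^sup>2)"
        by (intro tendsto_intros rlim)
      then show "(\<lambda>n. (cmod (ft \<xi>))\<^sup>2 * G (r n) \<xi>) \<longlonglongrightarrow> (cmod (ft \<xi>))\<^sup>2" by (simp add: G_def)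
    qed
  qed measurable
  moreover have "(\<lambda>n. (NNBINT \<xi>. ennreal ((cmod (ft \<xi>))\<^sup>2 * G (r n) \<xi>))) \<longlonglongrightarrow> ennreal ((l2norm h)\<^sup>2)"
    unfolding nn by (rule tendsto_ennrealI[OF lim1])
  ultimately show ?thesis by (rule LIMSEQ_unique)
qed

text \<open>For fixed position x, the coefficients as a function of frequency are up to a phase the
  Fourier transform of \<open>f\<close> times the shifted Gaussian. That product is both integrable
  and square integrable, so Plancherel applies; Tonelli and the normalization of
  \<open>gauss\<close> finish.\<close>

lemma nn_integral_gstft_sq:
  fixes f :: "'a::euclidean_space \<Rightarrow> complex"
  assumes f: "sq_int f"
  shows "(NNBINT z. ennreal ((cmod (gstft f z))\<^sup>2)) = ennreal ((l2norm f)\<^sup>2)"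
proof -
  have [measurable]: "f \<in> borel_measurable borel" using f by (rule sq_intD)
  have [measurable]: "gstft f \<in> borel_measurable borel" using borel_measurable_gstft[OF f] .
  define h where "h x s = f s * cnj (gauss (s - x))" for x s :: 'a
  have hm[measurable]: "h x \<in> borel_measurable borel" for x unfolding h_def by measurable
  have gt: "sq_int (\<lambda>s. gauss (s - x))" for x :: 'a
    using sq_int_translate[OF sq_int_gauss, of "- x"] by simp
  have gb: "cmod (gauss x) \<le> 2 powr (real DIM('a) / 4)" for x :: 'a
    by (simp add: gauss_def norm_mult)
  have h1: "integrable lborel (h x)" for x
    unfolding h_def by (rule sq_int_mult_integrable[OF f gt])
  have h2: "sq_int (h x)" for x
  proof (rule sq_int_cong_norm[OF sq_int_scale[OF f, of "complex_of_real (2 powr (real DIM('a) / 4))"] hm])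
    show "cmod (h x s) \<le> cmod (complex_of_real (2 powr (real DIM('a) / 4)) * f s)" for s
      using mult_left_mono[OF gb[of "s - x"], of "cmod (f s)"] by (simp add: h_def norm_mult mult.commute)
  qed
  have V: "cmod (gstft f (x, \<xi>)) = cmod (LBINT s. h x s * cis (- 2 * pi * (\<xi> \<bullet> s)))" for x \<xi>
  proof -
    have "f s * cnj (wp (x, \<xi>) s) = cis (pi * (x \<bullet> \<xi>)) * (h x s * cis (- 2 * pi * (\<xi> \<bullet> s)))" for s
      by (simp add: wp_def tfs_def h_def cis_cnj)
    then have "gstft f (x, \<xi>) = cis (pi * (x \<bullet> \<xi>)) * (LBINT s. h x s * cis (- 2 * pi * (\<xi> \<bullet> s)))"
      unfolding gstft_def l2inner_def by (simp only: integral_mult_right_zero)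
    then show ?thesis by (simp add: norm_mult)
  qed
  have "(NNBINT z. ennreal ((cmod (gstft f z))\<^sup>2)) = (NNBINT x. (NNBINT \<xi>. ennreal ((cmod (gstft f (x, \<xi>)))\<^sup>2)))"
    unfolding lborel_prod[symmetric] by (rule lborel.nn_integral_fst[symmetric]) (subst lborel_prod, measurable)
  also have "\<dots> = (NNBINT x. (NNBINT s. ennreal ((cmod (h x s))\<^sup>2)))"
    unfolding V plancherel[OF h1 h2] nn_integral_l2norm[OF h2] ..
  also have "\<dots> = (NNBINT s. (NNBINT x. ennreal ((cmod (h x s))\<^sup>2)))"
    by (rule lborel_pair.Fubini') (simp add: h_def, measurable)
  also have "\<dots> = (NNBINT s. ennreal ((cmod (f s))\<^sup>2) * (NNBINT x. ennreal ((cmod (gauss (s - x)))\<^sup>2)))"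
    by (intro nn_integral_cong) (simp add: h_def norm_mult power_mult_distrib ennreal_mult nn_integral_cmult)
  also have "\<dots> = (NNBINT s. ennreal ((cmod (f s))\<^sup>2))"
    using nn_integral_lborel_reflect[of "\<lambda>x::'a. ennreal ((cmod (gauss x))\<^sup>2)"] nn_integral_l2norm[OF sq_int_gauss, where 'a='a]
    by (simp add: l2norm_gauss)
  finally show ?thesis using nn_integral_l2norm[OF f] by simp
qed

lemma sq_int_gstft: "sq_int f \<Longrightarrow> sq_int (gstft f)"
  by (rule sq_intI_nn) (auto simp: borel_measurable_gstft nn_integral_gstft_sq)

lemma l2norm_gstft: "sq_int f \<Longrightarrow> l2norm (gstft f) = l2norm f"
proof -
  assume f: "sq_int f"
  have "ennreal ((l2norm (gstft f))\<^sup>2) = ennreal ((l2norm f)\<^sup>2)"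
    using nn_integral_l2norm[OF sq_int_gstft[OF f]] nn_integral_gstft_sq[OF f] by simp
  then show ?thesis by (simp add: power2_eq_iff_nonneg)
qed

text \<open>Polarization of the norm identity; the factors c = 1 and c = \<i> recover the real and
  the imaginary part.\<close>

lemma l2inner_gstft:
  assumes f: "sq_int f" and g: "sq_int g"
  shows "l2inner (gstft f) (gstft g) = l2inner f g"
proof -
  have R: "Re (c * l2inner (gstft f) (gstft g)) = Re (c * l2inner f g)" for c
  proof -
    have cf: "sq_int (\<lambda>x. c * f x)" by (rule sq_int_scale[OF f])
    have lin: "gstft (\<lambda>x. c * f x + g x) = (\<lambda>z. c * gstft f z + gstft g z)"
      by (simp add: fun_eq_iff gstft_def l2inner_add_left cf g sq_int_wp l2inner_scale_left)
    have "(l2norm (\<lambda>z. c * gstft f z + gstft g z))\<^sup>2 = (l2norm (\<lambda>x. c * f x + g x))\<^sup>2"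
      unfolding lin[symmetric] by (simp add: l2norm_gstft sq_int_add cf g)
    then show ?thesis
      by (simp add: l2norm_add_sq l2norm_scale l2inner_scale_left l2norm_gstft sq_int_gstft sq_int_scale f g cf)
  qed
  show ?thesis
    using R[of 1] R[of "\<i>"] by (intro complex_eqI) auto
qed

section \<open>Synthesis and Bessel bounds\<close>

text \<open>Ordinary Cauchy-Schwarz for the measure with density \<open>T\<close>.\<close>

lemma Cauchy_Schwarz_kernel:
  fixes f T :: "'a \<Rightarrow> ennreal"
  assumes [measurable]: "f \<in> borel_measurable M" "T \<in> borel_measurable M"
  shows "(\<integral>\<^sup>+x. f x * T x \<partial>M)\<^sup>2 \<le> (\<integral>\<^sup>+x. T x \<partial>M) * (\<integral>\<^sup>+x. (f x)\<^sup>2 * T x \<partial>M)"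
proof -
  have "(\<integral>\<^sup>+x. f x * 1 \<partial>density M T)\<^sup>2 \<le> (\<integral>\<^sup>+x. (f x)\<^sup>2 \<partial>density M T) * (\<integral>\<^sup>+x. 1\<^sup>2 \<partial>density M T)"
    by (rule Cauchy_Schwarz_nn_integral) auto
  moreover have "(\<integral>\<^sup>+x. f x * 1 \<partial>density M T) = (\<integral>\<^sup>+x. f x * T x \<partial>M)"
    "(\<integral>\<^sup>+x. (f x)\<^sup>2 \<partial>density M T) = (\<integral>\<^sup>+x. (f x)\<^sup>2 * T x \<partial>M)"
    "(\<integral>\<^sup>+x. 1\<^sup>2 \<partial>density M T) = (\<integral>\<^sup>+x. T x \<partial>M)"
    by (subst nn_integral_density; simp add: mult.commute)+
  ultimately show ?thesis by (simp only: mult.commute)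
qed

text \<open>The adjoint of \<open>gstft\<close>, evaluated pointwise. Wave packets are bounded, so
  for integrable \<open>H\<close> the integral converges at every point and no L^2 limit is
  involved.\<close>

definition synth :: "('a::euclidean_space \<times> 'a \<Rightarrow> complex) \<Rightarrow> 'a \<Rightarrow> complex" where
  "synth H x = (LBINT q. H q * wp q x)"

lemma borel_measurable_wp_pair [measurable (raw)]:
  assumes [measurable]: "f \<in> borel_measurable M" "g \<in> borel_measurable M"
  shows "(\<lambda>x. wp (f x) (g x)) \<in> borel_measurable M"
proof -
  have [measurable]: "(\<lambda>x. fst (f x)) \<in> borel_measurable M" "(\<lambda>x. snd (f x)) \<in> borel_measurable M"
    by (rule measurable_compose[OF assms(1)]; intro borel_measurable_continuous_onI continuous_intros)+
  have [measurable]: "(\<lambda>x. gauss (g x - fst (f x))) \<in> borel_measurable M"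
    by (rule measurable_compose[OF _ borel_measurable_gauss]) measurable
  show ?thesis unfolding wp_def tfs_def by measurable
qed

lemma norm_integral_le_nn:
  fixes f :: "'a \<Rightarrow> complex"
  shows "ennreal (cmod (\<integral>x. f x \<partial>M)) \<le> (\<integral>\<^sup>+x. ennreal (cmod (f x)) \<partial>M)"
proof (cases "integrable M f")
  case True
  have "ennreal (cmod (\<integral>x. f x \<partial>M)) \<le> ennreal (\<integral>x. cmod (f x) \<partial>M)"
    by (rule ennreal_leI[OF integral_norm_bound])
  also have "\<dots> = (\<integral>\<^sup>+x. ennreal (cmod (f x)) \<partial>M)"
    using True by (intro nn_integral_eq_integral[symmetric]) auto
  finally show ?thesis .
qed (simp add: not_integrable_integral_eq)

lemma sq_int_synth:
  assumes H: "integrable lborel H"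
  shows "sq_int (synth H)"
proof (rule sq_intI_nn)
  have [measurable]: "H \<in> borel_measurable borel" using H by auto
  show [measurable]: "synth H \<in> borel_measurable borel"
    unfolding synth_def by measurable
  define N where "N = (NNBINT q. ennreal (cmod (H q)))"
  have N: "N < \<infinity>" using H unfolding N_def integrable_iff_bounded by simp
  have "ennreal ((cmod (synth H x))\<^sup>2) \<le> N * (NNBINT q. ennreal ((cmod (wp q x))\<^sup>2) * ennreal (cmod (H q)))" for x
  proof -
    have "ennreal ((cmod (synth H x))\<^sup>2) = (ennreal (cmod (synth H x)))\<^sup>2" by (simp add: ennreal_power)
    also have "\<dots> \<le> (NNBINT q. ennreal (cmod (H q * wp q x)))\<^sup>2"
      unfolding synth_def by (intro power_mono norm_integral_le_nn) simp
    also have "\<dots> = (NNBINT q. ennreal (cmod (wp q x)) * ennreal (cmod (H q)))\<^sup>2"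
      by (simp add: norm_mult ennreal_mult mult.commute)
    also have "\<dots> \<le> N * (NNBINT q. (ennreal (cmod (wp q x)))\<^sup>2 * ennreal (cmod (H q)))"
      unfolding N_def by (rule Cauchy_Schwarz_kernel) measurable
    finally show ?thesis by (simp add: ennreal_power)
  qed
  then have "(NNBINT x. ennreal ((cmod (synth H x))\<^sup>2)) \<le> (NNBINT x. N * (NNBINT q. ennreal ((cmod (wp q x))\<^sup>2) * ennreal (cmod (H q))))"
    by (intro nn_integral_mono)
  also have "\<dots> = N * (NNBINT x. (NNBINT q. ennreal ((cmod (wp q x))\<^sup>2) * ennreal (cmod (H q))))"
    by (rule nn_integral_cmult) measurable
  also have "(NNBINT x. (NNBINT q. ennreal ((cmod (wp q x))\<^sup>2) * ennreal (cmod (H q))))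
    = (NNBINT q. (NNBINT x. ennreal ((cmod (wp q x))\<^sup>2) * ennreal (cmod (H q))))"
    by (rule lborel_pair.Fubini') measurable
  also have "\<dots> = N"
    unfolding N_def by (intro nn_integral_cong) (simp add: nn_integral_multc nn_integral_l2norm[OF sq_int_wp])
  finally show "(NNBINT x. ennreal ((cmod (synth H x))\<^sup>2)) < \<infinity>"
    using N by (simp add: ennreal_mult_less_top le_less_trans)
qed

lemma l2inner_synth:
  assumes H: "integrable lborel H" and h: "sq_int h"
  shows "l2inner (synth H) h = (LBINT q. H q * cnj (gstft h q))"
proof -
  have [measurable]: "H \<in> borel_measurable borel" using H by auto
  have [measurable]: "h \<in> borel_measurable borel" using h by (rule sq_intD)
  have "l2inner (synth H) h = (LBINT x. (LBINT q. H q * (wp q x * cnj (h x))))"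
    unfolding l2inner_def synth_def by (simp only: integral_mult_left_zero[symmetric] mult.assoc)
  also have "\<dots> = (LBINT q. (LBINT x. H q * (wp q x * cnj (h x))))"
  proof (rule Fubini_complex[symmetric, where w="\<lambda>q. cmod (H q) * l2norm h"])
    show "integrable lborel (\<lambda>q. cmod (H q) * l2norm h)" using H by auto
    show "integrable lborel (\<lambda>x. H q * (wp q x * cnj (h x)))" for q
      by (intro integrable_mult_right sq_int_mult_integrable sq_int_wp h)
    show "(LBINT x. cmod (H q * (wp q x * cnj (h x)))) \<le> cmod (H q) * l2norm h" for q
      using mult_left_mono[OF integral_cmod_mult_le[OF sq_int_wp h, of q], of "cmod (H q)"]
      by (simp add: norm_mult)
  qed measurable
  also have "\<dots> = (LBINT q. H q * l2inner (wp q) h)"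
    by (simp add: l2inner_def)
  also have "\<dots> = (LBINT q. H q * cnj (gstft h q))"
    by (simp add: gstft_def l2inner_cnj)
  finally show ?thesis .
qed

lemma l2inner_eq_gstft:
  "sq_int f \<Longrightarrow> sq_int g \<Longrightarrow> l2inner f g = (LBINT v. gstft f v * cnj (gstft g v))"
  using l2inner_gstft[of f g] by (simp add: l2inner_def)

text \<open>The rate is a parameter because polynomial factors and shifts are absorbed again and
  again at the price of a smaller rate.\<close>

definition gexp :: "real \<Rightarrow> 'b::euclidean_space \<Rightarrow> real" where
  "gexp a p = exp (- a * (norm p)\<^sup>2)"

lemma gexp_pos [simp]: "0 < gexp a p" and gexp_nonneg [simp]: "0 \<le> gexp a p"
  by (simp_all add: gexp_def)

lemma gexp_minus [simp]: "gexp a (- p) = gexp a p"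
  by (simp add: gexp_def)

lemma gexp_diff_commute: "gexp a (p - q) = gexp a (q - p)"
  by (simp add: gexp_def norm_minus_commute)

lemma borel_measurable_gexp [measurable]: "gexp a \<in> borel_measurable borel"
  unfolding gexp_def by measurable

lemma gexp_antimono: "a \<le> b \<Longrightarrow> gexp b p \<le> gexp a p"
  by (simp add: gexp_def mult_right_mono)

lemma gexp_le_1: "a \<ge> 0 \<Longrightarrow> gexp a p \<le> 1"
  by (simp add: gexp_def)

lemma nn_integral_gexp_finite:
  "a > 0 \<Longrightarrow> (NNBINT p. ennreal (gexp a (p::'b::euclidean_space))) < \<infinity>"
  using integrable_exp_norm_sq[of a, where 'a='b] unfolding gexp_def integrable_iff_bounded by simp

lemma norm_add_gexp_le:
  assumes "a > 0"
  shows "(1 + norm p) ^ k * gexp a p \<le> exp ((real k)\<^sup>2 / (2 * a)) * gexp (a / 2) p"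
  unfolding gexp_def using power_times_exp_le[OF assms norm_ge_zero, of p k] .

lemma l2inner_wp_wp_gexp: "cmod (l2inner (wp z) (wp w)) = gexp (pi / 2) (z - w)"
  by (simp add: l2inner_wp_wp norm_mult gexp_def)

text \<open>Moyal's identity against \<open>wp p\<close>. It replaces point values of the
  coefficients by Gaussian averages, which is how an L^1 norm comes to control sums over discrete
  points.\<close>

lemma gstft_reproducing:
  assumes h: "sq_int h"
  shows "ennreal (cmod (gstft h p)) \<le> (NNBINT q. ennreal (cmod (gstft h q)) * ennreal (gexp (pi / 2) (p - q)))"
proof -
  have "gstft h p = (LBINT q. gstft h q * cnj (gstft (wp p) q))"
    unfolding gstft_def[of h p] by (rule l2inner_eq_gstft[OF h sq_int_wp])
  then have "ennreal (cmod (gstft h p)) \<le> (NNBINT q. ennreal (cmod (gstft h q * cnj (gstft (wp p) q))))"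
    by (simp only: norm_integral_le_nn)
  then show ?thesis
    by (simp add: gstft_def l2inner_wp_wp_gexp norm_mult ennreal_mult)
qed

lemma l2inner_tfs_bound:
  assumes f: "sq_int f" and h: "sq_int h"
  shows "ennreal (cmod (l2inner f (tfs m h))) \<le> (NNBINT v. ennreal (cmod (gstft f v)) * ennreal (cmod (gstft h (v - m))))"
proof -
  have "ennreal (cmod (l2inner f (tfs m h))) \<le> (NNBINT v. ennreal (cmod (gstft f v * cnj (gstft (tfs m h) v))))"
    unfolding l2inner_eq_gstft[OF f sq_int_tfs[OF h]] by (rule norm_integral_le_nn)
  then show ?thesis by (simp add: gstft_tfs norm_mult ennreal_mult)
qed

text \<open>Schur's test for a kernel between phase space and a discrete index set: one factor is
  the integral of \<open>T\<close>, the other a bound for its sums over the points.\<close>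

lemma sampling_bound:
  fixes \<mu> :: "'i \<Rightarrow> 'b::euclidean_space" and T F :: "'b \<Rightarrow> ennreal"
  assumes "countable \<Lambda>"
    and [measurable]: "F \<in> borel_measurable borel" "T \<in> borel_measurable borel"
    and n: "\<And>v. (\<integral>\<^sup>+l. T (v - \<mu> l) \<partial>count_space \<Lambda>) \<le> n"
  shows "(\<integral>\<^sup>+l. (NNBINT v. F v * T (v - \<mu> l))\<^sup>2 \<partial>count_space \<Lambda>)
    \<le> (NNBINT v. T v) * n * (NNBINT v. (F v)\<^sup>2)"
proof -
  have "(\<integral>\<^sup>+l. (NNBINT v. F v * T (v - \<mu> l))\<^sup>2 \<partial>count_space \<Lambda>)
     \<le> (\<integral>\<^sup>+l. (NNBINT v. T v) * (NNBINT v. (F v)\<^sup>2 * T (v - \<mu> l)) \<partial>count_space \<Lambda>)"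
  proof (rule nn_integral_mono)
    fix l
    have "(NNBINT v. T (v - \<mu> l)) = (NNBINT v. T v)"
      using nn_integral_lborel_translate[of T "- \<mu> l"] by simp
    then show "(NNBINT v. F v * T (v - \<mu> l))\<^sup>2 \<le> (NNBINT v. T v) * (NNBINT v. (F v)\<^sup>2 * T (v - \<mu> l))"
      using Cauchy_Schwarz_kernel[of F lborel "\<lambda>v. T (v - \<mu> l)"] by simp
  qed
  also have "\<dots> = (NNBINT v. T v) * (\<integral>\<^sup>+l. (NNBINT v. (F v)\<^sup>2 * T (v - \<mu> l)) \<partial>count_space \<Lambda>)"
    by (rule nn_integral_cmult) simp
  also have "(\<integral>\<^sup>+l. (NNBINT v. (F v)\<^sup>2 * T (v - \<mu> l)) \<partial>count_space \<Lambda>)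
     = (NNBINT v. (\<integral>\<^sup>+l. (F v)\<^sup>2 * T (v - \<mu> l) \<partial>count_space \<Lambda>))"
    by (rule nn_integral_count_space_nn_integral[symmetric, OF assms(1)]) measurable
  also have "\<dots> \<le> (NNBINT v. n * (F v)\<^sup>2)"
    by (intro nn_integral_mono, subst nn_integral_cmult) (simp_all add: mult.commute[of n] mult_left_mono n)
  also have "\<dots> = n * (NNBINT v. (F v)\<^sup>2)"
    by (rule nn_integral_cmult) measurable
  finally show ?thesis by (simp add: mult.assoc mult_left_mono)
qed

text \<open>Sums of |gstft h| over the points are not controlled by its L^1 norm. Majorizing it by
  its convolution \<open>T\<close> with a Gaussian repairs this: the sums of \<open>T\<close>
  inherit the overlap constant \<open>K\<close> of the Gaussian and the L^1 norm of the
  coefficients.\<close>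

lemma bessel_bound:
  fixes \<mu> :: "'i \<Rightarrow> 'a::euclidean_space \<times> 'a"
  assumes "countable \<Lambda>" and f: "sq_int f" and h: "sq_int h"
    and K: "\<And>v. (\<integral>\<^sup>+l. ennreal (gexp (pi / 2) (v - \<mu> l)) \<partial>count_space \<Lambda>) \<le> K"
  shows "(\<integral>\<^sup>+l. ennreal ((cmod (l2inner f (tfs (\<mu> l) h)))\<^sup>2) \<partial>count_space \<Lambda>)
    \<le> (NNBINT p. ennreal (gexp (pi / 2) (p :: 'a \<times> 'a))) * K * (NNBINT p. ennreal (cmod (gstft h p)))\<^sup>2 * ennreal ((l2norm f)\<^sup>2)"
proof -
  define N where "N = (NNBINT p. ennreal (cmod (gstft h p)))"
  define E where "E = (NNBINT p. ennreal (gexp (pi / 2) (p :: 'a \<times> 'a)))"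
  define T where "T p = (NNBINT q. ennreal (cmod (gstft h q)) * ennreal (gexp (pi / 2) (p - q)))" for p
  have [measurable]: "gstft h \<in> borel_measurable borel" "gstft f \<in> borel_measurable borel"
    using f h by (auto intro: borel_measurable_gstft)
  have [measurable]: "T \<in> borel_measurable borel" unfolding T_def by measurable
  have TN: "(NNBINT p. T p) = N * E"
  proof -
    have "(NNBINT p. T p) = (NNBINT q. (NNBINT p. ennreal (cmod (gstft h q)) * ennreal (gexp (pi / 2) (p - q))))"
      unfolding T_def by (rule lborel_pair.Fubini') measurable
    also have "\<dots> = (NNBINT q. ennreal (cmod (gstft h q)) * E)"
    proof (rule nn_integral_cong)
      fix q :: "'a \<times> 'a"
      have "(NNBINT p. ennreal (gexp (pi / 2) (p - q))) = E"
        unfolding E_def using nn_integral_lborel_translate[of "\<lambda>p::'a \<times> 'a. ennreal (gexp (pi / 2) p)" "- q"] by simp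
      then show "(NNBINT p. ennreal (cmod (gstft h q)) * ennreal (gexp (pi / 2) (p - q))) = ennreal (cmod (gstft h q)) * E"
        by (simp add: nn_integral_cmult)
    qed
    finally show ?thesis by (simp add: nn_integral_multc N_def)
  qed
  have TK: "(\<integral>\<^sup>+l. T (v - \<mu> l) \<partial>count_space \<Lambda>) \<le> K * N" for v
  proof -
    have "(\<integral>\<^sup>+l. T (v - \<mu> l) \<partial>count_space \<Lambda>) = (NNBINT q. (\<integral>\<^sup>+l. ennreal (cmod (gstft h q)) * ennreal (gexp (pi / 2) (v - q - \<mu> l)) \<partial>count_space \<Lambda>))"
      unfolding T_def by (subst nn_integral_count_space_nn_integral[OF assms(1)]) (simp_all add: algebra_simps)
    also have "\<dots> \<le> (NNBINT q. K * ennreal (cmod (gstft h q)))"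
      by (intro nn_integral_mono, subst nn_integral_cmult) (simp_all add: mult.commute[of K] mult_left_mono K)
    finally show ?thesis by (simp add: nn_integral_cmult N_def)
  qed
  have "(\<integral>\<^sup>+l. ennreal ((cmod (l2inner f (tfs (\<mu> l) h)))\<^sup>2) \<partial>count_space \<Lambda>)
     \<le> (\<integral>\<^sup>+l. (NNBINT v. ennreal (cmod (gstft f v)) * T (v - \<mu> l))\<^sup>2 \<partial>count_space \<Lambda>)"
  proof (rule nn_integral_mono)
    fix l
    have "ennreal (cmod (l2inner f (tfs (\<mu> l) h))) \<le> (NNBINT v. ennreal (cmod (gstft f v)) * T (v - \<mu> l))"
      using gstft_reproducing[OF h]
      by (intro order_trans[OF l2inner_tfs_bound[OF f h]] nn_integral_mono mult_left_mono) (auto simp: T_def)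
    then have "(ennreal (cmod (l2inner f (tfs (\<mu> l) h))))\<^sup>2 \<le> (NNBINT v. ennreal (cmod (gstft f v)) * T (v - \<mu> l))\<^sup>2"
      by (intro power_mono) auto
    then show "ennreal ((cmod (l2inner f (tfs (\<mu> l) h)))\<^sup>2) \<le> (NNBINT v. ennreal (cmod (gstft f v)) * T (v - \<mu> l))\<^sup>2"
      by (simp add: ennreal_power)
  qed
  also have "\<dots> \<le> (NNBINT v. T v) * (K * N) * (NNBINT v. (ennreal (cmod (gstft f v)))\<^sup>2)"
    by (rule sampling_bound[OF assms(1)]) (use TK in auto)
  also have "(NNBINT v. (ennreal (cmod (gstft f v)))\<^sup>2) = ennreal ((l2norm f)\<^sup>2)"
    using nn_integral_gstft_sq[OF f] by (simp add: ennreal_power)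
  finally show ?thesis
    unfolding TN N_def[symmetric] E_def[symmetric] by (simp add: power2_eq_square ac_simps)
qed

text \<open>Counts indices, not points, so that a deformed set can be handled as a family over the
  original \<open>\<Lambda>\<close> before the deformation is known to be injective.\<close>

definition ball_count_le :: "('i \<Rightarrow> 'b::euclidean_space) \<Rightarrow> 'i set \<Rightarrow> real \<Rightarrow> nat \<Rightarrow> bool" where
  "ball_count_le \<mu> \<Lambda> r M \<longleftrightarrow> (\<forall>v. finite {l\<in>\<Lambda>. norm (\<mu> l - v) < r} \<and> card {l\<in>\<Lambda>. norm (\<mu> l - v) < r} \<le> M)"

lemma ball_count_le_countable:
  fixes \<mu> :: "'i \<Rightarrow> 'b::euclidean_space"
  assumes "ball_count_le \<mu> \<Lambda> r M" "r > 0"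
  shows "countable \<Lambda>"
proof -
  obtain D :: "'b set" where D: "countable D" "\<And>X. open X \<Longrightarrow> X \<noteq> {} \<Longrightarrow> \<exists>d\<in>D. d \<in> X"
    using countable_dense_exists by blast
  have "\<Lambda> \<subseteq> (\<Union>d\<in>D. {l\<in>\<Lambda>. norm (\<mu> l - d) < r})"
  proof
    fix l assume l: "l \<in> \<Lambda>"
    have "ball (\<mu> l) r \<noteq> {}" using assms(2) by simp
    then obtain d where "d \<in> D" "d \<in> ball (\<mu> l) r" using D(2) open_ball by blast
    then show "l \<in> (\<Union>d\<in>D. {l\<in>\<Lambda>. norm (\<mu> l - d) < r})"
      using l by (auto simp: dist_norm)
  qed
  moreover have "countable (\<Union>d\<in>D. {l\<in>\<Lambda>. norm (\<mu> l - d) < r})"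
    using D(1) assms(1) by (intro countable_UN) (auto simp: ball_count_le_def countable_finite)
  ultimately show ?thesis by (rule countable_subset)
qed

text \<open>A Gaussian at p is at most a constant times the mean over a ball of radius r of a wider
  Gaussian; summing over the points then only counts how many balls overlap. The constant depends on
  \<open>a\<close>, \<open>r\<close> and \<open>M\<close> alone, hence is uniform over all
  deformations of \<open>\<Lambda>\<close>.\<close>

lemma overlap_bound:
  assumes r: "r > 0" and a: "a > 0"
  obtains K where "K \<ge> 0"
    "\<And>(\<mu> :: 'i \<Rightarrow> 'b::euclidean_space) \<Lambda> v. ball_count_le \<mu> \<Lambda> r M \<Longrightarrow>
       (\<integral>\<^sup>+l. ennreal (gexp a (v - \<mu> l)) \<partial>count_space \<Lambda>) \<le> ennreal K"
proof -
  define \<beta> where "\<beta> = measure lborel (ball (0::'b) r)"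
  have b: "\<beta> > 0" unfolding \<beta>_def using content_ball_pos[OF r, of "0::'b"] by simp
  define J where "J = (LBINT p. gexp (a / 2) (p::'b))"
  have J: "(NNBINT p. ennreal (gexp (a / 2) (p::'b))) = ennreal J" "J \<ge> 0"
    unfolding J_def gexp_def using integrable_exp_norm_sq[of "a / 2", where 'a='b] a
    by (auto intro!: nn_integral_eq_integral)
  define K where "K = exp (a * r\<^sup>2) / \<beta> * (J * real M)"
  have mb: "(\<lambda>q. ennreal (gexp (a / 2) q) * indicator (ball p r) q) \<in> borel_measurable (lborel :: 'b measure)" for p
  proof (rule borel_measurable_times_ennreal)
    show "(indicator (ball p r) :: 'b \<Rightarrow> ennreal) \<in> borel_measurable lborel"
      by (rule borel_measurable_indicator) simp
  qed measurable
  have ptw: "ennreal (gexp a p) \<le> ennreal (exp (a * r\<^sup>2) / \<beta>) * (NNBINT q. ennreal (gexp (a / 2) q) * indicator (ball p r) q)" for p :: 'b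
  proof -
    \<comment> \<open>Squared norms of points at distance r compare up to the factor 2 and an
      additive 2 r^2, so rate \<open>a\<close> at p pays for rate \<open>a / 2\<close> at q.\<close>
    have g: "gexp a p \<le> exp (a * r\<^sup>2) * gexp (a / 2) q" if "q \<in> ball p r" for q
    proof -
      have "norm q \<le> norm p + r" using that norm_triangle_ineq4[of p "p - q"] by (simp add: dist_norm)
      then have "(norm q)\<^sup>2 \<le> (norm p + r)\<^sup>2" by (intro power_mono) auto
      also have "\<dots> \<le> 2 * (norm p)\<^sup>2 + 2 * r\<^sup>2"
        using zero_le_power2[of "norm p - r"] by (simp add: power2_eq_square algebra_simps)
      finally have "a / 2 * (norm q)\<^sup>2 \<le> a / 2 * (2 * (norm p)\<^sup>2 + 2 * r\<^sup>2)" using a by (intro mult_left_mono) auto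
      then show ?thesis by (simp add: gexp_def exp_add[symmetric] algebra_simps)
    qed
    have "ennreal (gexp a p) = ennreal (1 / \<beta>) * (NNBINT q. ennreal (gexp a p) * indicator (ball p r) q)"
    proof -
      have "emeasure lborel (ball p r) = ennreal \<beta>"
        using emeasure_lborel_ball_finite[of p r] r
        by (simp add: \<beta>_def emeasure_eq_ennreal_measure content_ball)
      moreover have "(NNBINT q. ennreal (gexp a p) * indicator (ball p r) q) = ennreal (gexp a p) * emeasure lborel (ball p r)"
        by (rule nn_integral_cmult_indicator) simp
      ultimately show ?thesis using b by (simp add: ennreal_mult[symmetric])
    qed
    also have "\<dots> \<le> ennreal (1 / \<beta>) * (NNBINT q. ennreal (exp (a * r\<^sup>2)) * (ennreal (gexp (a / 2) q) * indicator (ball p r) q))"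
      by (intro mult_left_mono nn_integral_mono) (auto simp: indicator_def ennreal_mult[symmetric] intro!: ennreal_leI g)
    also have "\<dots> = ennreal (exp (a * r\<^sup>2) / \<beta>) * (NNBINT q. ennreal (gexp (a / 2) q) * indicator (ball p r) q)"
    proof -
      have e: "ennreal (exp (a * r\<^sup>2) / \<beta>) = ennreal (1 / \<beta>) * ennreal (exp (a * r\<^sup>2))"
        using b by (simp add: ennreal_mult[symmetric])
      show ?thesis unfolding e mult.assoc by (rule arg_cong, rule nn_integral_cmult, rule mb)
    qed
    finally show ?thesis .
  qed
  show thesis
  proof (rule that[of K])
    show "K \<ge> 0" using b J by (simp add: K_def)
    fix \<mu> :: "'i \<Rightarrow> 'b" and \<Lambda> v assume c: "ball_count_le \<mu> \<Lambda> r M"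
    note cnt = ball_count_le_countable[OF c r]
    have cntq: "(\<integral>\<^sup>+l. ennreal (gexp (a / 2) q) * indicator (ball (v - \<mu> l) r) q \<partial>count_space \<Lambda>) \<le> ennreal (gexp (a / 2) q) * ennreal (real M)" for q :: 'b
    proof -
      define S where "S = {l\<in>\<Lambda>. norm (\<mu> l - (v - q)) < r}"
      have S: "finite S" "card S \<le> M" using c by (auto simp: ball_count_le_def S_def)
      have "indicator (ball (v - \<mu> l) r) q = (indicator S l :: ennreal)" if "l \<in> \<Lambda>" for l
        using that by (auto simp: S_def indicator_def dist_norm algebra_simps norm_minus_commute)
      then have "(\<integral>\<^sup>+l. ennreal (gexp (a / 2) q) * indicator (ball (v - \<mu> l) r) q \<partial>count_space \<Lambda>)
          = (\<integral>\<^sup>+l. ennreal (gexp (a / 2) q) * indicator S l \<partial>count_space \<Lambda>)"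
        by (intro nn_integral_cong) simp
      also have "\<dots> = ennreal (gexp (a / 2) q) * of_nat (card S)"
        using S(1) by (subst nn_integral_cmult_indicator) (auto simp: S_def emeasure_count_space)
      also have "\<dots> \<le> ennreal (gexp (a / 2) q) * ennreal (real M)"
        using S(2) by (intro mult_left_mono) (auto simp flip: ennreal_of_nat_eq_real_of_nat)
      finally show "(\<integral>\<^sup>+l. ennreal (gexp (a / 2) q) * indicator (ball (v - \<mu> l) r) q \<partial>count_space \<Lambda>) \<le> ennreal (gexp (a / 2) q) * ennreal (real M)" .
    qed
    have "(\<integral>\<^sup>+l. ennreal (gexp a (v - \<mu> l)) \<partial>count_space \<Lambda>)
       \<le> (\<integral>\<^sup>+l. ennreal (exp (a * r\<^sup>2) / \<beta>) * (NNBINT q. ennreal (gexp (a / 2) q) * indicator (ball (v - \<mu> l) r) q) \<partial>count_space \<Lambda>)"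
      by (intro nn_integral_mono ptw)
    also have "\<dots> = ennreal (exp (a * r\<^sup>2) / \<beta>) * (NNBINT q. (\<integral>\<^sup>+l. ennreal (gexp (a / 2) q) * indicator (ball (v - \<mu> l) r) q \<partial>count_space \<Lambda>))"
      by (subst nn_integral_count_space_nn_integral[OF cnt mb]) (rule nn_integral_cmult, simp)
    also have "\<dots> \<le> ennreal (exp (a * r\<^sup>2) / \<beta>) * (NNBINT q. ennreal (gexp (a / 2) (q :: 'b)) * ennreal (real M))"
      by (intro mult_left_mono nn_integral_mono cntq) auto
    also have "\<dots> = ennreal K"
    proof -
      have "(NNBINT q. ennreal (gexp (a / 2) (q :: 'b)) * ennreal (real M)) = ennreal J * ennreal (real M)"
        unfolding J(1)[symmetric] by (rule nn_integral_multc) measurable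
      then show ?thesis using b J(2) by (simp add: K_def ennreal_mult[symmetric])
    qed
    finally show "(\<integral>\<^sup>+l. ennreal (gexp a (v - \<mu> l)) \<partial>count_space \<Lambda>) \<le> ennreal K" .
  qed
qed

text \<open>Near some point c the coefficients of \<open>g\<close> stay above \<open>m\<close>.
  Testing the upper frame bound on the unit vector \<open>wp (c + v)\<close>, every point of
  \<open>\<Lambda>\<close> within distance r of v contributes at least m^2, so at most B / m^2
  points fit.\<close>

lemma gabor_frame_ball_count:
  assumes fr: "gabor_frame (g :: 'a::euclidean_space \<Rightarrow> complex) \<Lambda>"
  obtains r M where "r > 0" "ball_count_le id \<Lambda> r M"
proof -
  obtain A B where g: "sq_int g" and AB: "A > 0" "B > 0"
    and fr': "\<And>f. sq_int f \<Longrightarrow> ennreal (A * (l2norm f)\<^sup>2) \<le> (\<integral>\<^sup>+l. ennreal ((cmod (l2inner f (tfs l g)))\<^sup>2) \<partial>count_space \<Lambda>)"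
      "\<And>f. sq_int f \<Longrightarrow> (\<integral>\<^sup>+l. ennreal ((cmod (l2inner f (tfs l g)))\<^sup>2) \<partial>count_space \<Lambda>) \<le> ennreal (B * (l2norm f)\<^sup>2)"
    using fr unfolding gabor_frame_def by blast
  \<comment> \<open>If all coefficients vanished, every frame coefficient would vanish too, against
    the lower bound for the Gaussian.\<close>
  have "\<exists>c. gstft g c \<noteq> 0"
  proof (rule ccontr)
    assume "\<nexists>c. gstft g c \<noteq> 0"
    then have z: "gstft g c = 0" for c by blast
    have "l2inner f (tfs l g) = 0" if "sq_int f" for f l
      unfolding l2inner_eq_gstft[OF that sq_int_tfs[OF g]] by (simp add: gstft_tfs z)
    then have "ennreal (A * 1) \<le> 0" using fr'(1)[OF sq_int_gauss] by (simp add: sq_int_gauss l2norm_gauss)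
    then show False using AB by simp
  qed
  then obtain c where c: "gstft g c \<noteq> 0" by blast
  define m where "m = cmod (gstft g c) / 2"
  have m: "m > 0" using c by (simp add: m_def)
  have "isCont (gstft g) c" using continuous_on_gstft[OF g] by (metis continuous_on_eq_continuous_at open_UNIV UNIV_I)
  then obtain r where r: "r > 0" "\<And>p. dist p c < r \<Longrightarrow> dist (gstft g p) (gstft g c) < m"
    using m unfolding continuous_at_eps_delta by blast
  have lower: "cmod (gstft g p) \<ge> m" if "norm (p - c) < r" for p
  proof -
    have "cmod (gstft g p - gstft g c) < m" using r(2)[of p] that by (simp add: dist_norm)
    moreover have "cmod (gstft g c) \<le> cmod (gstft g p) + cmod (gstft g p - gstft g c)"
      using norm_triangle_ineq4[of "gstft g p" "gstft g p - gstft g c"] by simp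
    ultimately show ?thesis by (simp add: m_def)
  qed
  have "finite {l\<in>\<Lambda>. norm (id l - v) < r} \<and> card {l\<in>\<Lambda>. norm (id l - v) < r} \<le> nat \<lfloor>B / m\<^sup>2\<rfloor>" for v
  proof -
    define S where "S = {l\<in>\<Lambda>. norm (id l - v) < r}"
    have "ennreal (m\<^sup>2) * emeasure (count_space \<Lambda>) S = (\<integral>\<^sup>+l. ennreal (m\<^sup>2) * indicator S l \<partial>count_space \<Lambda>)"
      by (subst nn_integral_cmult_indicator) (auto simp: S_def)
    also have "\<dots> \<le> (\<integral>\<^sup>+l. ennreal ((cmod (l2inner (wp (c + v)) (tfs l g)))\<^sup>2) \<partial>count_space \<Lambda>)"
    proof (rule nn_integral_mono)
      fix l
      have "cmod (l2inner (wp (c + v)) (tfs l g)) = cmod (gstft (tfs l g) (c + v))"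
        unfolding gstft_def by (subst l2inner_cnj[symmetric]) simp
      also have "\<dots> = cmod (gstft g (c + v - l))" by (simp add: gstft_tfs norm_mult)
      finally have e: "cmod (l2inner (wp (c + v)) (tfs l g)) = cmod (gstft g (c + v - l))" .
      have "m\<^sup>2 \<le> (cmod (gstft g (c + v - l)))\<^sup>2" if "l \<in> S"
        using that m lower[of "c + v - l"] by (intro power_mono) (auto simp: S_def norm_minus_commute)
      then show "ennreal (m\<^sup>2) * indicator S l \<le> ennreal ((cmod (l2inner (wp (c + v)) (tfs l g)))\<^sup>2)"
        unfolding e by (auto simp: indicator_def intro: ennreal_leI)
    qed
    also have "\<dots> \<le> ennreal B" using fr'(2)[OF sq_int_wp, of "c + v"] by simp
    finally have le: "ennreal (m\<^sup>2) * emeasure (count_space \<Lambda>) S \<le> ennreal B" .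
    have SL: "S \<subseteq> \<Lambda>" by (auto simp: S_def)
    have fin: "finite S"
    proof (rule ccontr)
      assume "infinite S"
      then have "ennreal (m\<^sup>2) * \<top> \<le> ennreal B" using le SL by (simp add: emeasure_count_space)
      then show False using m by (simp add: ennreal_mult_top top_unique)
    qed
    have "ennreal (m\<^sup>2 * real (card S)) \<le> ennreal B"
      using le SL fin by (simp add: emeasure_count_space ennreal_mult ennreal_of_nat_eq_real_of_nat)
    then have "real (card S) \<le> B / m\<^sup>2" using AB m by (simp add: ennreal_le_iff field_simps)
    then have "card S \<le> nat \<lfloor>B / m\<^sup>2\<rfloor>" by (simp add: le_nat_floor)
    then show ?thesis using fin by (simp add: S_def)
  qed
  then have "ball_count_le id \<Lambda> r (nat \<lfloor>B / m\<^sup>2\<rfloor>)" by (simp add: ball_count_le_def)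
  with r(1) that show thesis by blast
qed

section \<open>Localization in phase space\<close>

text \<open>A Lipschitz cutoff rather than an indicator: its variation between two points is at most
  their distance over \<open>R\<close>, and this factor 1 / R pays for every commutator
  below.\<close>

definition tent :: "real \<Rightarrow> 'b::euclidean_space \<Rightarrow> 'b \<Rightarrow> real" where
  "tent R y v = max 0 (1 - norm (v - y) / R)"

lemma tent_nonneg [simp]: "0 \<le> tent R y v"
  by (simp add: tent_def)

lemma tent_commute: "tent R y v = tent R v y"
  by (simp add: tent_def norm_minus_commute)

lemma borel_measurable_tent [measurable (raw)]:
  assumes [measurable]: "f \<in> borel_measurable M" "g \<in> borel_measurable M"
  shows "(\<lambda>x. tent R (f x) (g x)) \<in> borel_measurable M"
  unfolding tent_def by measurable

lemma tent_le_1: "R > 0 \<Longrightarrow> tent R y v \<le> 1"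
  by (simp add: tent_def)

lemma tent_nonzero: "R > 0 \<Longrightarrow> tent R y v \<noteq> 0 \<Longrightarrow> norm (v - y) < R"
  by (auto simp: tent_def max_def field_simps split: if_splits)

lemma tent_diff: "R > 0 \<Longrightarrow> \<bar>tent R y v - tent R y w\<bar> \<le> norm (v - w) / R"
proof -
  assume R: "R > 0"
  have "\<bar>tent R y v - tent R y w\<bar> \<le> \<bar>norm (w - y) / R - norm (v - y) / R\<bar>"
    unfolding tent_def by (auto simp: max_def)
  also have "\<dots> = \<bar>norm (w - y) - norm (v - y)\<bar> / R"
    using R by (simp add: diff_divide_distrib[symmetric])
  also have "\<dots> \<le> norm (v - w) / R"
    using R norm_triangle_ineq3[of "w - y" "v - y"] by (intro divide_right_mono) (auto simp: norm_minus_commute)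
  finally show ?thesis .
qed

text \<open>The variation is measured relative to the mass \<open>Z\<close> so that \<open>Z\<close>
  cancels in the final estimate. The difference lives on two balls of volume vol, and Z is at least
  vol / (4 * 2^dim) because the tent is at least 1/2 on the ball of half the radius; this produces 8
  * 2^dim.\<close>

lemma tent_mass:
  assumes R: "R > 0"
  obtains Z where "Z > 0"
    "\<And>v :: 'b::euclidean_space. (NNBINT y. ennreal ((tent R y v)\<^sup>2)) = ennreal Z"
    "\<And>v w :: 'b. (NNBINT y. ennreal ((tent R y v - tent R y w)\<^sup>2)) \<le> ennreal (8 * 2 ^ DIM('b) * Z * (norm (v - w) / R)\<^sup>2)"
proof -
  define vol where "vol = measure lborel (ball (0::'b) R)"
  have ebR: "emeasure lborel (ball (v::'b) s) = ennreal (measure lborel (ball (0::'b) s))" if "s > 0" for v s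
    using emeasure_lborel_ball_finite[of v s] that by (simp add: emeasure_eq_ennreal_measure content_ball)
  have half: "measure lborel (ball (0::'b) (R / 2)) = vol / 2 ^ DIM('b)"
    unfolding vol_def using R by (simp add: content_ball power_divide)
  have vol: "vol > 0" unfolding vol_def using content_ball_pos[OF R, of "0::'b"] by simp
  define I where "I = (NNBINT y. ennreal ((tent R y (0::'b))\<^sup>2))"
  have Iv: "(NNBINT y. ennreal ((tent R y v)\<^sup>2)) = I" for v :: 'b
  proof -
    have "(NNBINT y. ennreal ((tent R y v)\<^sup>2)) = (NNBINT y. ennreal ((tent R (y + - v) 0)\<^sup>2))"
      by (simp add: tent_def norm_minus_commute)
    then show ?thesis unfolding I_def using nn_integral_lborel_translate[of "\<lambda>y. ennreal ((tent R y (0::'b))\<^sup>2)" "- v"] by simp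
  qed
  have le1: "I \<le> ennreal vol"
  proof -
    have "I \<le> (NNBINT y. indicator (ball (0::'b) R) y)"
      unfolding I_def
    proof (intro nn_integral_mono)
      fix y :: 'b
      show "ennreal ((tent R y 0)\<^sup>2) \<le> indicator (ball 0 R) y"
        using tent_nonzero[OF R, of y 0] tent_le_1[OF R, of y 0]
        by (cases "tent R y 0 = 0") (auto simp: indicator_def dist_norm power_le_one)
    qed
    also have "\<dots> = ennreal vol" using ebR[OF R, of 0] by (simp add: vol_def)
    finally show ?thesis .
  qed
  have ge: "ennreal (vol / (4 * 2 ^ DIM('b))) \<le> I"
  proof -
    have "ennreal (vol / (4 * 2 ^ DIM('b))) = ennreal (1 / 4) * emeasure lborel (ball (0::'b) (R / 2))"
      using vol R by (subst ebR) (simp_all add: half ennreal_mult[symmetric] del: divide_divide_eq_left)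
    also have "\<dots> = (NNBINT y. ennreal (1 / 4) * indicator (ball (0::'b) (R / 2)) y)"
      by (rule nn_integral_cmult_indicator[symmetric]) simp
    also have "\<dots> \<le> I" unfolding I_def
    proof (intro nn_integral_mono)
      fix y :: 'b
      have "1 / 4 \<le> (tent R y 0)\<^sup>2" if "norm y < R / 2"
      proof -
        have "1 / 2 \<le> tent R y 0" using that R by (simp add: tent_def field_simps max_def)
        then have "(1 / 2)\<^sup>2 \<le> (tent R y 0)\<^sup>2" by (intro power_mono) auto
        then show ?thesis by (simp add: power2_eq_square)
      qed
      then show "ennreal (1 / 4) * indicator (ball 0 (R / 2)) y \<le> ennreal ((tent R y 0)\<^sup>2)"
        by (auto simp: indicator_def dist_norm intro!: ennreal_leI simp del: ennreal_divide_numeral)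
    qed
    finally show ?thesis .
  qed
  obtain Z where Z: "I = ennreal Z" "Z \<ge> 0"
    using le1 by (cases I) (auto simp: top_unique)
  have Zge: "vol \<le> 4 * 2 ^ DIM('b) * Z"
    using ge vol Z by (simp add: ennreal_le_iff field_simps)
  show thesis
  proof (rule that)
    have "0 < 4 * 2 ^ DIM('b) * Z" by (rule less_le_trans[OF vol Zge])
    then show "Z > 0" by (rule zero_less_mult_pos) simp
    show "(NNBINT y. ennreal ((tent R y v)\<^sup>2)) = ennreal Z" for v :: 'b
      using Iv Z by simp
    fix v w :: 'b
    define q where "q = (norm (v - w) / R)\<^sup>2"
    have "(NNBINT y. ennreal ((tent R y v - tent R y w)\<^sup>2)) \<le> (NNBINT y. ennreal q * (indicator (ball v R) y + indicator (ball w R) y))"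
    proof (intro nn_integral_mono)
      fix y
      have "(tent R y v - tent R y w)\<^sup>2 = \<bar>tent R y v - tent R y w\<bar>\<^sup>2" by simp
      also have "\<dots> \<le> q" unfolding q_def by (intro power_mono tent_diff[OF R]) simp
      finally have le: "(tent R y v - tent R y w)\<^sup>2 \<le> q" .
      show "ennreal ((tent R y v - tent R y w)\<^sup>2) \<le> ennreal q * (indicator (ball v R) y + indicator (ball w R) y)"
      proof (cases "y \<in> ball v R \<or> y \<in> ball w R")
        case True
        have "ennreal q * 1 \<le> ennreal q * (indicator (ball v R) y + indicator (ball w R) y)"
          using True by (intro mult_left_mono) (auto simp: indicator_def)
        then have "ennreal q \<le> ennreal q * (indicator (ball v R) y + indicator (ball w R) y)" by (simp only: mult_1_right)
        with ennreal_leI[OF le] show ?thesis by (rule order_trans)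
      next
        case False
        then have "tent R y v = 0" "tent R y w = 0"
          using tent_nonzero[OF R, of y v] tent_nonzero[OF R, of y w] by (auto simp: dist_norm)
        then show ?thesis by simp
      qed
    qed
    also have "\<dots> = ennreal q * (ennreal vol + ennreal vol)"
    proof -
      have im: "(\<lambda>y. indicator (ball u R) y :: ennreal) \<in> borel_measurable lborel" for u :: 'b
        by (rule borel_measurable_indicator) simp
      have "(NNBINT y. ennreal q * (indicator (ball v R) y + indicator (ball w R) y))
         = ennreal q * ((NNBINT y. indicator (ball v R) y) + (NNBINT y. indicator (ball w R) y))"
        by (subst nn_integral_cmult[OF borel_measurable_add[OF im im]], subst nn_integral_add[OF im im]) (rule refl)
      then show ?thesis using ebR[OF R, of v] ebR[OF R, of w] by (simp add: vol_def)
    qed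
    also have "\<dots> = ennreal (q * (2 * vol))"
      using vol by (simp add: ennreal_mult q_def flip: ennreal_plus)
    also have "\<dots> \<le> ennreal (8 * 2 ^ DIM('b) * Z * q)"
      using mult_left_mono[OF Zge, of "2 * q"] by (intro ennreal_leI) (simp add: q_def algebra_simps)
    finally show "(NNBINT y. ennreal ((tent R y v - tent R y w)\<^sup>2)) \<le> ennreal (8 * 2 ^ DIM('b) * Z * (norm (v - w) / R)\<^sup>2)"
      by (simp add: q_def)
  qed
qed

text \<open>Mean square over the centres y of the commutator of the cutoff with a Gaussian kernel.
  After Cauchy-Schwarz the y-integral gives |v - m|^2 / R^2 times Z; the quadratic factor is
  absorbed by halving the Gaussian rate.\<close>

lemma tent_commutator:
  fixes F :: "'b::euclidean_space \<Rightarrow> ennreal"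
  assumes \<alpha>: "\<alpha> > 0" and R: "R > 0" and Z: "Z \<ge> 0" "c \<ge> 0"
    and D: "\<And>v w :: 'b. (NNBINT y. ennreal ((tent R y v - tent R y w)\<^sup>2)) \<le> ennreal (c * Z * (norm (v - w) / R)\<^sup>2)"
    and [measurable]: "F \<in> borel_measurable borel"
  shows "(NNBINT y. (NNBINT v. F v * ennreal \<bar>tent R y v - tent R y m\<bar> * ennreal (gexp \<alpha> (v - m)))\<^sup>2)
    \<le> (NNBINT p. ennreal (gexp \<alpha> (p::'b))) * (ennreal (c * exp (2 / \<alpha>) * Z / R\<^sup>2) * (NNBINT v. (F v)\<^sup>2 * ennreal (gexp (\<alpha> / 2) (v - m))))"
proof -
  define J where "J = (NNBINT p. ennreal (gexp \<alpha> (p::'b)))"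
  have Jm: "(NNBINT v. ennreal (gexp \<alpha> (v - m))) = J"
    unfolding J_def using nn_integral_lborel_translate[of "\<lambda>p::'b. ennreal (gexp \<alpha> p)" "- m"] by simp
  have "(NNBINT y. (NNBINT v. F v * ennreal \<bar>tent R y v - tent R y m\<bar> * ennreal (gexp \<alpha> (v - m)))\<^sup>2)
    \<le> (NNBINT y. J * (NNBINT v. (F v * ennreal \<bar>tent R y v - tent R y m\<bar>)\<^sup>2 * ennreal (gexp \<alpha> (v - m))))"
    unfolding Jm[symmetric] by (intro nn_integral_mono Cauchy_Schwarz_kernel) measurable
  also have "\<dots> = J * (NNBINT y. (NNBINT v. (F v * ennreal \<bar>tent R y v - tent R y m\<bar>)\<^sup>2 * ennreal (gexp \<alpha> (v - m))))"
    by (rule nn_integral_cmult) measurable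
  also have "(NNBINT y. (NNBINT v. (F v * ennreal \<bar>tent R y v - tent R y m\<bar>)\<^sup>2 * ennreal (gexp \<alpha> (v - m))))
     = (NNBINT v. (NNBINT y. (F v * ennreal \<bar>tent R y v - tent R y m\<bar>)\<^sup>2 * ennreal (gexp \<alpha> (v - m))))"
    by (rule lborel_pair.Fubini') measurable
  also have "\<dots> \<le> (NNBINT v. ennreal (c * exp (2 / \<alpha>) * Z / R\<^sup>2) * ((F v)\<^sup>2 * ennreal (gexp (\<alpha> / 2) (v - m))))"
  proof (intro nn_integral_mono)
    fix v
    have "(NNBINT y. (F v * ennreal \<bar>tent R y v - tent R y m\<bar>)\<^sup>2 * ennreal (gexp \<alpha> (v - m)))
       = (NNBINT y. ((F v)\<^sup>2 * ennreal (gexp \<alpha> (v - m))) * ennreal ((tent R y v - tent R y m)\<^sup>2))"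
      by (intro nn_integral_cong) (simp add: power_mult_distrib ennreal_power ac_simps)
    also have "\<dots> = ((F v)\<^sup>2 * ennreal (gexp \<alpha> (v - m))) * (NNBINT y. ennreal ((tent R y v - tent R y m)\<^sup>2))"
      by (rule nn_integral_cmult) measurable
    also have "\<dots> \<le> ((F v)\<^sup>2 * ennreal (gexp \<alpha> (v - m))) * ennreal (c * Z * (norm (v - m) / R)\<^sup>2)"
      by (intro mult_left_mono D) simp
    also have "\<dots> = (F v)\<^sup>2 * ennreal (gexp \<alpha> (v - m) * (c * Z * (norm (v - m) / R)\<^sup>2))"
      using Z by (simp add: ennreal_mult mult.assoc)
    also have "\<dots> \<le> (F v)\<^sup>2 * ennreal (c * exp (2 / \<alpha>) * Z / R\<^sup>2 * gexp (\<alpha> / 2) (v - m))"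
    proof (intro mult_left_mono ennreal_leI)
      have "(norm (v - m))\<^sup>2 * gexp \<alpha> (v - m) \<le> (1 + norm (v - m))\<^sup>2 * gexp \<alpha> (v - m)"
        by (intro mult_right_mono power_mono) auto
      also have "\<dots> \<le> exp (2 / \<alpha>) * gexp (\<alpha> / 2) (v - m)"
        using norm_add_gexp_le[OF \<alpha>, of "v - m" 2] by simp
      finally have "(c * Z / R\<^sup>2) * ((norm (v - m))\<^sup>2 * gexp \<alpha> (v - m)) \<le> (c * Z / R\<^sup>2) * (exp (2 / \<alpha>) * gexp (\<alpha> / 2) (v - m))"
        using Z by (intro mult_left_mono) auto
      then show "gexp \<alpha> (v - m) * (c * Z * (norm (v - m) / R)\<^sup>2) \<le> c * exp (2 / \<alpha>) * Z / R\<^sup>2 * gexp (\<alpha> / 2) (v - m)"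
        by (simp add: power_divide ac_simps)
    qed simp
    finally have fin: "(NNBINT y. (F v * ennreal \<bar>tent R y v - tent R y m\<bar>)\<^sup>2 * ennreal (gexp \<alpha> (v - m)))
       \<le> (F v)\<^sup>2 * ennreal (c * exp (2 / \<alpha>) * Z / R\<^sup>2 * gexp (\<alpha> / 2) (v - m))" .
    show "(NNBINT y. (F v * ennreal \<bar>tent R y v - tent R y m\<bar>)\<^sup>2 * ennreal (gexp \<alpha> (v - m)))
       \<le> ennreal (c * exp (2 / \<alpha>) * Z / R\<^sup>2) * ((F v)\<^sup>2 * ennreal (gexp (\<alpha> / 2) (v - m)))"
    proof -
      have e: "ennreal (c * exp (2 / \<alpha>) * Z / R\<^sup>2 * gexp (\<alpha> / 2) (v - m)) = ennreal (c * exp (2 / \<alpha>) * Z / R\<^sup>2) * ennreal (gexp (\<alpha> / 2) (v - m))"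
        by (rule ennreal_mult) (use Z in auto)
      show ?thesis using fin unfolding e by (simp only: ac_simps)
    qed
  qed
  also have "\<dots> = ennreal (c * exp (2 / \<alpha>) * Z / R\<^sup>2) * (NNBINT v. (F v)\<^sup>2 * ennreal (gexp (\<alpha> / 2) (v - m)))"
    by (rule nn_integral_cmult) measurable
  finally show ?thesis unfolding J_def[symmetric] by (simp add: mult_left_mono)
qed

lemma ennreal_add_sq_le: "((x::ennreal) + y)\<^sup>2 \<le> 2 * (x\<^sup>2 + y\<^sup>2)"
proof (cases "x = \<top> \<or> y = \<top>")
  case True
  then show ?thesis by (auto simp: power2_eq_square ennreal_mult_top ennreal_top_mult)
next
  case False
  then obtain a b where ab: "x = ennreal a" "y = ennreal b" "a \<ge> 0" "b \<ge> 0"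
    by (metis ennreal_cases)
  have "(a + b)\<^sup>2 \<le> 2 * (a\<^sup>2 + b\<^sup>2)"
    using zero_le_power2[of "a - b"] by (simp add: power2_eq_square algebra_simps)
  then have "ennreal ((a + b)\<^sup>2) \<le> ennreal (2 * (a\<^sup>2 + b\<^sup>2))" by (rule ennreal_leI)
  then show ?thesis using ab by (simp add: ennreal_power[symmetric] ennreal_mult ennreal_plus)
qed

lemma ennreal_add3_sq_le: "((x::ennreal) + (y + z))\<^sup>2 \<le> 4 * (x\<^sup>2 + y\<^sup>2 + z\<^sup>2)"
proof -
  have "(x + (y + z))\<^sup>2 \<le> 2 * (x\<^sup>2 + (y + z)\<^sup>2)" by (rule ennreal_add_sq_le)
  also have "\<dots> \<le> 2 * (2 * x\<^sup>2 + 2 * (y\<^sup>2 + z\<^sup>2))"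
  proof (intro mult_left_mono add_mono ennreal_add_sq_le)
    have "1 * x\<^sup>2 \<le> 2 * x\<^sup>2" by (intro mult_right_mono) auto
    then show "x\<^sup>2 \<le> 2 * x\<^sup>2" by simp
  qed simp
  also have "\<dots> = 4 * (x\<^sup>2 + y\<^sup>2 + z\<^sup>2)" by (simp add: algebra_simps)
  finally show ?thesis .
qed

lemma borel_measurable_nn_integral_count_space:
  fixes f :: "'i \<Rightarrow> 'b \<Rightarrow> ennreal"
  assumes \<Lambda>: "countable \<Lambda>" and f: "\<And>l. l \<in> \<Lambda> \<Longrightarrow> f l \<in> borel_measurable M"
  shows "(\<lambda>x. \<integral>\<^sup>+l. f l x \<partial>count_space \<Lambda>) \<in> borel_measurable M"
proof (rule sigma_finite_measure.borel_measurable_nn_integral[OF sigma_finite_measure_count_space_countable[OF \<Lambda>]])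
  show "(\<lambda>(x, l). f l x) \<in> borel_measurable (M \<Otimes>\<^sub>M count_space \<Lambda>)"
  proof -
    have "(\<lambda>p. f (snd p) (fst p)) \<in> borel_measurable (M \<Otimes>\<^sub>M count_space \<Lambda>)"
      by (rule measurable_compose_countable'[where f="\<lambda>l p. f l (fst p)" and g=snd and I=\<Lambda>])
        (auto intro: measurable_compose[OF measurable_fst f] \<Lambda>)
    then show ?thesis by (simp add: case_prod_beta')
  qed
qed

text \<open>Banach's fixed point theorem for x mapped to y - (\<open>\<Psi>\<close> x - x). Every
  ball centre y is thereby \<open>\<Psi>\<close> x for some x, and near y the deformation is
  compared with the translation by y - x.\<close>

lemma near_identity_surj:
  fixes \<Psi> :: "'b::euclidean_space \<Rightarrow> 'b"
  assumes L: "\<And>z w. norm ((\<Psi> z - z) - (\<Psi> w - w)) \<le> \<delta> * norm (z - w)" and \<delta>: "\<delta> \<le> 1 / 2"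
  obtains x where "\<Psi> x = y"
proof -
  have "\<exists>!x. y - (\<Psi> x - x) = x"
  proof (rule banach_fix_type[of "1 / 2"])
    show "\<forall>a b. dist (y - (\<Psi> a - a)) (y - (\<Psi> b - b)) \<le> 1 / 2 * dist a b"
    proof (intro allI)
      fix a b
      have "dist (y - (\<Psi> a - a)) (y - (\<Psi> b - b)) = norm ((\<Psi> a - a) - (\<Psi> b - b))"
      proof -
        have "y - (\<Psi> a - a) - (y - (\<Psi> b - b)) = - ((\<Psi> a - a) - (\<Psi> b - b))" by simp
        then show ?thesis by (simp only: dist_norm norm_minus_cancel)
      qed
      also have "\<dots> \<le> 1 / 2 * norm (a - b)"
        by (rule order_trans[OF L mult_right_mono[OF \<delta>]]) simp
      finally show "dist (y - (\<Psi> a - a)) (y - (\<Psi> b - b)) \<le> 1 / 2 * dist a b" by (simp add: dist_norm)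
    qed
  qed auto
  then obtain x where "y - (\<Psi> x - x) = x" by blast
  then have "\<Psi> x = y" by (simp add: algebra_simps)
  then show thesis by (rule that)
qed

lemma near_identity_expand:
  fixes \<Psi> :: "'b::euclidean_space \<Rightarrow> 'b"
  assumes L: "\<And>z w. norm ((\<Psi> z - z) - (\<Psi> w - w)) \<le> \<delta> * norm (z - w)" and \<delta>: "\<delta> \<le> 1 / 2"
  shows "norm (z - w) \<le> 2 * norm (\<Psi> z - \<Psi> w)"
proof -
  have "z - w = (\<Psi> z - \<Psi> w) - ((\<Psi> z - z) - (\<Psi> w - w))" by simp
  then have "norm (z - w) \<le> norm (\<Psi> z - \<Psi> w) + norm ((\<Psi> z - z) - (\<Psi> w - w))"
    using norm_triangle_ineq4 by metis
  also have "\<dots> \<le> norm (\<Psi> z - \<Psi> w) + 1 / 2 * norm (z - w)"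
    by (intro add_left_mono order_trans[OF L mult_right_mono[OF \<delta>]]) simp
  finally show ?thesis by simp
qed

text \<open>Recentre at one of the points in the ball: two images within r / 4 of v are within r / 2
  of each other, so by \<open>near_identity_expand\<close> their preimages are within r. Hence the
  count \<open>M\<close> survives.\<close>

lemma near_identity_ball_count:
  fixes \<Psi> :: "'b::euclidean_space \<Rightarrow> 'b"
  assumes L: "\<And>z w. norm ((\<Psi> z - z) - (\<Psi> w - w)) \<le> \<delta> * norm (z - w)" and \<delta>: "\<delta> \<le> 1 / 2"
    and c: "ball_count_le id \<Lambda> r M"
  shows "ball_count_le \<Psi> \<Lambda> (r / 4) M"
  unfolding ball_count_le_def
proof
  fix v
  define S where "S = {l\<in>\<Lambda>. norm (\<Psi> l - v) < r / 4}"
  show "finite {l\<in>\<Lambda>. norm (\<Psi> l - v) < r / 4} \<and> card {l\<in>\<Lambda>. norm (\<Psi> l - v) < r / 4} \<le> M"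
  proof (cases "S = {}")
    case True
    show ?thesis unfolding S_def[symmetric] True by simp
  next
    case False
    then obtain l0 where l0: "l0 \<in> S" by blast
    define B where "B = {l\<in>\<Lambda>. norm (id l - l0) < r}"
    have B: "finite B" "card B \<le> M" using c by (auto simp: ball_count_le_def B_def)
    have "S \<subseteq> B"
    proof
      fix l assume l: "l \<in> S"
      have "norm (\<Psi> l - \<Psi> l0) \<le> norm (\<Psi> l - v) + norm (\<Psi> l0 - v)"
        using norm_triangle_ineq4[of "\<Psi> l - v" "\<Psi> l0 - v"] by simp
      also have "\<dots> < r / 4 + r / 4" using l l0 by (intro add_strict_mono) (auto simp: S_def)
      finally have "2 * norm (\<Psi> l - \<Psi> l0) < r" by simp
      then have "norm (l - l0) < r" using near_identity_expand[of \<Psi>, OF L \<delta>, of l l0] by simp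
      then show "l \<in> B" using l by (simp add: B_def S_def)
    qed
    then have "finite S" "card S \<le> card B" using B by (auto intro: finite_subset card_mono)
    then show ?thesis using B by (simp add: S_def)
  qed
qed

text \<open>The shift \<epsilon> may grow linearly in p, but with slope at most 2 \<delta>, and
  \<delta> R \<le> 1/4 gives norm p \<le> 2 norm (p - \<epsilon>) + 1. Undoing the shift lowers the
  rate from \<alpha> to \<alpha> / 8, absorbing the linear growth lowers it to \<alpha> /
  16.\<close>

lemma gexp_shift_bound:
  fixes p \<epsilon> :: "'b::euclidean_space"
  assumes \<alpha>: "\<alpha> > 0" and R: "R \<ge> 1" and \<delta>: "0 \<le> \<delta>" "\<delta> * R \<le> 1 / 4" and \<epsilon>: "norm \<epsilon> \<le> 2 * \<delta> * (norm p + R)"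
  shows "norm \<epsilon> * (gexp \<alpha> p + gexp \<alpha> (p - \<epsilon>)) \<le> \<delta> * R * (4 * exp (\<alpha> / 4) * exp (4 / \<alpha>)) * gexp (\<alpha> / 16) p"
proof -
  have \<delta>1: "\<delta> \<le> 1 / 4" using mult_left_mono[OF R \<delta>(1)] \<delta>(2) by simp
  have e1: "norm \<epsilon> \<le> 2 * (\<delta> * R) * (1 + norm p)"
  proof -
    have "norm p + R \<le> R * (1 + norm p)" using R mult_right_mono[OF R, of "norm p"] by (simp add: algebra_simps)
    then have "2 * \<delta> * (norm p + R) \<le> 2 * \<delta> * (R * (1 + norm p))" using \<delta>(1) by (intro mult_left_mono) auto
    then show ?thesis using \<epsilon> by (simp add: algebra_simps)
  qed
  have "norm p \<le> 2 * norm (p - \<epsilon>) + 1"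
  proof -
    have "norm p \<le> norm (p - \<epsilon>) + norm \<epsilon>" using norm_triangle_ineq[of "p - \<epsilon>" \<epsilon>] by simp
    moreover have "2 * \<delta> * norm p \<le> 1 / 2 * norm p" using \<delta>1 by (intro mult_right_mono) auto
    ultimately show ?thesis using \<epsilon> \<delta>(2) by (simp add: algebra_simps)
  qed
  then have "(norm p)\<^sup>2 \<le> (2 * norm (p - \<epsilon>) + 1)\<^sup>2" by (intro power_mono) auto
  also have "\<dots> \<le> 8 * (norm (p - \<epsilon>))\<^sup>2 + 2"
    using zero_le_power2[of "2 * norm (p - \<epsilon>) - 1"] by (simp add: power2_eq_square algebra_simps)
  finally have "\<alpha> / 8 * (norm p)\<^sup>2 \<le> \<alpha> / 8 * (8 * (norm (p - \<epsilon>))\<^sup>2 + 2)"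
    using \<alpha> by (intro mult_left_mono) auto
  then have g1: "gexp \<alpha> (p - \<epsilon>) \<le> exp (\<alpha> / 4) * gexp (\<alpha> / 8) p"
    by (simp add: gexp_def exp_add[symmetric] algebra_simps)
  have "gexp \<alpha> p \<le> 1 * gexp (\<alpha> / 8) p" using \<alpha> gexp_antimono[of "\<alpha> / 8" \<alpha> p] by simp
  also have "\<dots> \<le> exp (\<alpha> / 4) * gexp (\<alpha> / 8) p" using \<alpha> by (intro mult_right_mono) auto
  finally have "gexp \<alpha> p + gexp \<alpha> (p - \<epsilon>) \<le> 2 * exp (\<alpha> / 4) * gexp (\<alpha> / 8) p" using g1 by simp
  then have "norm \<epsilon> * (gexp \<alpha> p + gexp \<alpha> (p - \<epsilon>)) \<le> (2 * (\<delta> * R) * (1 + norm p)) * (2 * exp (\<alpha> / 4) * gexp (\<alpha> / 8) p)"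
    using e1 \<delta>(1) R by (intro mult_mono) (auto simp: add_nonneg_nonneg)
  also have "\<dots> = 4 * (\<delta> * R) * exp (\<alpha> / 4) * ((1 + norm p) ^ 1 * gexp (\<alpha> / 8) p)" by simp
  also have "\<dots> \<le> 4 * (\<delta> * R) * exp (\<alpha> / 4) * (exp ((real 1)\<^sup>2 / (2 * (\<alpha> / 8))) * gexp (\<alpha> / 8 / 2) p)"
    using \<alpha> \<delta>(1) R by (intro mult_left_mono norm_add_gexp_le) auto
  also have "\<dots> = \<delta> * R * (4 * exp (\<alpha> / 4) * exp (4 / \<alpha>)) * gexp (\<alpha> / 16) p" by simp
  finally show ?thesis .
qed

lemma sq_int_tent: "R > 0 \<Longrightarrow> sq_int (\<lambda>v. complex_of_real (tent R (y :: 'b::euclidean_space) v))"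
proof (rule sq_intI_nn)
  assume "R > 0"
  then obtain Z where "\<And>v :: 'b. (NNBINT y. ennreal ((tent R y v)\<^sup>2)) = ennreal Z"
    using tent_mass by metis
  then show "(NNBINT v. ennreal ((cmod (complex_of_real (tent R y v)))\<^sup>2)) < \<infinity>"
    by (simp add: tent_commute[of R y])
qed measurable

text \<open>Here m is a deformed point and m + \<epsilon> the same point moved by the translation
  that models the deformation near y. Up to a phase, the coefficient of the localized function at m
  + \<epsilon> is the cutoff times the coefficient of \<open>f\<close> at m, plus two errors: the
  commutator of the cutoff with the window, and the displacement of the window by
  \<epsilon>.\<close>

lemma localized_coefficient_bound:
  fixes \<gamma> :: "'a::euclidean_space \<Rightarrow> complex"
  assumes \<gamma>: "sq_int \<gamma>" and f: "sq_int f" and C: "C \<ge> 0" and \<alpha>: "\<alpha> > 0"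
    and V1: "\<And>p. cmod (gstft \<gamma> p) \<le> C * gexp \<alpha> p"
    and V2: "\<And>\<epsilon> p. cmod (gstft (\<lambda>x. \<gamma> x - tfs \<epsilon> \<gamma> x) p) \<le> C * norm \<epsilon> * (gexp \<alpha> p + gexp \<alpha> (p - \<epsilon>))"
    and R: "R \<ge> 1" and \<delta>: "0 \<le> \<delta>" "\<delta> * R \<le> 1 / 4" and \<epsilon>: "norm \<epsilon> \<le> 2 * \<delta> * norm (m - y)"
  defines "fy \<equiv> synth (\<lambda>v. complex_of_real (tent R y v) * gstft f v)"
  shows "ennreal (cmod (l2inner fy (tfs (m + \<epsilon>) \<gamma>)))
    \<le> ennreal (tent R y m * cmod (l2inner f (tfs m \<gamma>)))
      + (ennreal C * (NNBINT v. ennreal (cmod (gstft f v)) * ennreal \<bar>tent R y v - tent R y m\<bar> * ennreal (gexp \<alpha> (v - m)))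
      + (NNBINT v. (ennreal (tent R y v) * ennreal (cmod (gstft f v))) * ennreal (\<delta> * R * (C * (4 * exp (\<alpha> / 4) * exp (4 / \<alpha>))) * gexp (\<alpha> / 16) (v - m))))"
proof -
  define F where "F = gstft f"
  define H where "H v = complex_of_real (tent R y v) * F v" for v
  define \<theta> where "\<theta> = cis (pi * sympl m \<epsilon>)"
  define c2 where "c2 = C * (4 * exp (\<alpha> / 4) * exp (4 / \<alpha>))"
  have R0: "R > 0" using R by simp
  have F: "sq_int F" unfolding F_def by (rule sq_int_gstft[OF f])
  have [measurable]: "F \<in> borel_measurable borel" using F by (rule sq_intD)
  have H1: "integrable lborel H"
    using sq_int_mult_integrable[OF F sq_int_tent[OF R0, of y]] by (simp add: H_def[abs_def] mult.commute)
  have H2: "sq_int H"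
  proof (rule sq_int_cong_norm[OF F])
    show "H \<in> borel_measurable borel" unfolding H_def[abs_def] by measurable
    show "cmod (H v) \<le> cmod (F v)" for v
      using tent_le_1[OF R0, of y v] by (simp add: H_def norm_mult mult_left_le_one_le)
  qed
  have fy: "l2inner fy h = (LBINT v. H v * cnj (gstft h v))" if "sq_int h" for h
    unfolding fy_def using l2inner_synth[OF H1 that] by (simp add: H_def[abs_def] F_def)
  define V V' where "V = gstft (tfs m \<gamma>)" and "V' = gstft (tfs (m + \<epsilon>) \<gamma>)"
  have V: "sq_int V" and V': "sq_int V'" unfolding V_def V'_def by (auto intro!: sq_int_gstft sq_int_tfs \<gamma>)
  have diff: "cmod (V v - \<theta> * V' v) = cmod (gstft (\<lambda>x. \<gamma> x - tfs \<epsilon> \<gamma> x) (v - m))" for v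
  proof -
    have "tfs m (\<lambda>x. \<gamma> x - tfs \<epsilon> \<gamma> x) = (\<lambda>x. tfs m \<gamma> x - \<theta> * tfs (m + \<epsilon>) \<gamma> x)"
      unfolding tfs_diff by (simp add: fun_eq_iff tfs_tfs \<theta>_def)
    then have "gstft (tfs m (\<lambda>x. \<gamma> x - tfs \<epsilon> \<gamma> x)) v = gstft (tfs m \<gamma>) v - gstft (\<lambda>x. \<theta> * tfs (m + \<epsilon>) \<gamma> x) v"
      by (simp only: gstft_diff[OF sq_int_tfs[OF \<gamma>] sq_int_scale[OF sq_int_tfs[OF \<gamma>]]])
    also have "\<dots> = V v - \<theta> * V' v"
      by (simp add: V_def V'_def gstft_def l2inner_scale_left)
    finally show ?thesis by (metis gstft_tfs norm_mult norm_cis mult_1)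
  qed
  have Vb: "cmod (V v) \<le> C * gexp \<alpha> (v - m)" for v
    using V1[of "v - m"] by (simp add: V_def gstft_tfs norm_mult)
  \<comment> \<open>Telescoping: first the cutoff at v is exchanged for the cutoff at m, then the
    displaced window for the undisplaced one, where the cutoff at v is kept.\<close>
  have key: "cmod (H v * cnj (\<theta> * V' v) - complex_of_real (tent R y m) * F v * cnj (V v))
     \<le> C * (cmod (F v) * \<bar>tent R y v - tent R y m\<bar> * gexp \<alpha> (v - m)) + (tent R y v * cmod (F v)) * (\<delta> * R * c2 * gexp (\<alpha> / 16) (v - m))" for v
  proof -
    have "H v * cnj (\<theta> * V' v) - complex_of_real (tent R y m) * F v * cnj (V v)
      = complex_of_real (tent R y v - tent R y m) * F v * cnj (V v) - complex_of_real (tent R y v) * F v * cnj (V v - \<theta> * V' v)"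
      by (simp add: H_def algebra_simps)
    then have "cmod (H v * cnj (\<theta> * V' v) - complex_of_real (tent R y m) * F v * cnj (V v))
      \<le> cmod (complex_of_real (tent R y v - tent R y m) * F v * cnj (V v)) + cmod (complex_of_real (tent R y v) * F v * cnj (V v - \<theta> * V' v))"
      by (simp only: norm_triangle_ineq4)
    also have "\<dots> = \<bar>tent R y v - tent R y m\<bar> * cmod (F v) * cmod (V v) + tent R y v * cmod (F v) * cmod (V v - \<theta> * V' v)"
      by (simp add: norm_mult del: of_real_diff complex_cnj_diff)
    also have "\<dots> \<le> \<bar>tent R y v - tent R y m\<bar> * cmod (F v) * (C * gexp \<alpha> (v - m)) + tent R y v * cmod (F v) * (\<delta> * R * c2 * gexp (\<alpha> / 16) (v - m))"
    proof (intro add_mono mult_left_mono[OF Vb])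
      show "tent R y v * cmod (F v) * cmod (V v - \<theta> * V' v) \<le> tent R y v * cmod (F v) * (\<delta> * R * c2 * gexp (\<alpha> / 16) (v - m))"
      proof (cases "tent R y v = 0")
        case False
        \<comment> \<open>Only where the cutoff is alive is v within R of y, and there the distance
          of m from y is controlled by v - m, which the Gaussian can absorb.\<close>
        have "norm (m - y) \<le> norm (v - m) + norm (v - y)"
          using norm_triangle_ineq4[of "v - y" "v - m"] by simp
        also have "\<dots> \<le> norm (v - m) + R" using tent_nonzero[OF R0 False] by simp
        finally have "2 * \<delta> * norm (m - y) \<le> 2 * \<delta> * (norm (v - m) + R)" using \<delta>(1) by (intro mult_left_mono) auto
        then have \<epsilon>': "norm \<epsilon> \<le> 2 * \<delta> * (norm (v - m) + R)" using \<epsilon> by simp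
        have "cmod (V v - \<theta> * V' v) \<le> C * norm \<epsilon> * (gexp \<alpha> (v - m) + gexp \<alpha> (v - m - \<epsilon>))"
          unfolding diff by (rule V2)
        also have "\<dots> = C * (norm \<epsilon> * (gexp \<alpha> (v - m) + gexp \<alpha> (v - m - \<epsilon>)))" by simp
        also have "\<dots> \<le> C * (\<delta> * R * (4 * exp (\<alpha> / 4) * exp (4 / \<alpha>)) * gexp (\<alpha> / 16) (v - m))"
          by (intro mult_left_mono gexp_shift_bound \<alpha> R \<delta> \<epsilon>' C)
        also have "\<dots> = \<delta> * R * c2 * gexp (\<alpha> / 16) (v - m)" by (simp add: c2_def)
        finally show ?thesis by (intro mult_left_mono) auto
      qed simp
    qed auto
    finally show ?thesis by (simp add: algebra_simps)
  qed
  have i1: "integrable lborel (\<lambda>v. H v * cnj (\<theta> * V' v))"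
    by (rule sq_int_mult_integrable[OF H2 sq_int_scale[OF V']])
  have i2: "integrable lborel (\<lambda>v. complex_of_real (tent R y m) * F v * cnj (V v))"
    by (rule sq_int_mult_integrable[OF sq_int_scale[OF F] V])
  have e1: "(LBINT v. H v * cnj (\<theta> * V' v)) = cnj \<theta> * l2inner fy (tfs (m + \<epsilon>) \<gamma>)"
  proof -
    have "(LBINT v. H v * cnj (\<theta> * V' v)) = (LBINT v. cnj \<theta> * (H v * cnj (V' v)))"
      by (intro Bochner_Integration.integral_cong) auto
    then show ?thesis using fy[OF sq_int_tfs[OF \<gamma>], of "m + \<epsilon>"] by (simp add: V'_def)
  qed
  have e2: "(LBINT v. complex_of_real (tent R y m) * F v * cnj (V v)) = complex_of_real (tent R y m) * l2inner f (tfs m \<gamma>)"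
    unfolding l2inner_eq_gstft[OF f sq_int_tfs[OF \<gamma>]] F_def V_def by (simp add: mult.assoc)
  have "cmod (l2inner fy (tfs (m + \<epsilon>) \<gamma>)) = cmod (LBINT v. H v * cnj (\<theta> * V' v))"
    unfolding e1 by (simp add: norm_mult \<theta>_def)
  also have "\<dots> = cmod ((LBINT v. complex_of_real (tent R y m) * F v * cnj (V v))
      + (LBINT v. H v * cnj (\<theta> * V' v) - complex_of_real (tent R y m) * F v * cnj (V v)))"
    using i1 i2 by simp
  also have "\<dots> \<le> tent R y m * cmod (l2inner f (tfs m \<gamma>)) + cmod (LBINT v. H v * cnj (\<theta> * V' v) - complex_of_real (tent R y m) * F v * cnj (V v))"
    unfolding e2 by (rule order_trans[OF norm_triangle_ineq]) (simp add: norm_mult)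
  finally have "ennreal (cmod (l2inner fy (tfs (m + \<epsilon>) \<gamma>))) \<le> ennreal (tent R y m * cmod (l2inner f (tfs m \<gamma>)))
     + ennreal (cmod (LBINT v. H v * cnj (\<theta> * V' v) - complex_of_real (tent R y m) * F v * cnj (V v)))"
    by (simp flip: ennreal_plus)
  also have "\<dots> \<le> ennreal (tent R y m * cmod (l2inner f (tfs m \<gamma>)))
     + (NNBINT v. ennreal (cmod (H v * cnj (\<theta> * V' v) - complex_of_real (tent R y m) * F v * cnj (V v))))"
    by (intro add_left_mono norm_integral_le_nn)
  also have "\<dots> \<le> ennreal (tent R y m * cmod (l2inner f (tfs m \<gamma>)))
     + (NNBINT v. ennreal C * (ennreal (cmod (F v)) * ennreal \<bar>tent R y v - tent R y m\<bar> * ennreal (gexp \<alpha> (v - m)))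
       + (ennreal (tent R y v) * ennreal (cmod (F v))) * ennreal (\<delta> * R * c2 * gexp (\<alpha> / 16) (v - m)))"
  proof (intro add_left_mono nn_integral_mono)
    fix v
    have n: "0 \<le> \<delta> * R * c2 * gexp (\<alpha> / 16) (v - m)" using \<delta> R C by (simp add: c2_def)
    have "ennreal (cmod (H v * cnj (\<theta> * V' v) - complex_of_real (tent R y m) * F v * cnj (V v)))
      \<le> ennreal (C * (cmod (F v) * \<bar>tent R y v - tent R y m\<bar> * gexp \<alpha> (v - m)) + (tent R y v * cmod (F v)) * (\<delta> * R * c2 * gexp (\<alpha> / 16) (v - m)))"
      by (rule ennreal_leI[OF key])
    also have "\<dots> = ennreal C * (ennreal (cmod (F v)) * ennreal \<bar>tent R y v - tent R y m\<bar> * ennreal (gexp \<alpha> (v - m)))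
       + (ennreal (tent R y v) * ennreal (cmod (F v))) * ennreal (\<delta> * R * c2 * gexp (\<alpha> / 16) (v - m))"
      using C n by (simp only: ennreal_mult ennreal_plus mult_nonneg_nonneg abs_ge_zero norm_ge_zero gexp_nonneg tent_nonneg)
    finally show "ennreal (cmod (H v * cnj (\<theta> * V' v) - complex_of_real (tent R y m) * F v * cnj (V v))) \<le>
      ennreal C * (ennreal (cmod (F v)) * ennreal \<bar>tent R y v - tent R y m\<bar> * ennreal (gexp \<alpha> (v - m)))
       + (ennreal (tent R y v) * ennreal (cmod (F v))) * ennreal (\<delta> * R * c2 * gexp (\<alpha> / 16) (v - m))" .
  qed
  also have "\<dots> = ennreal (tent R y m * cmod (l2inner f (tfs m \<gamma>)))
      + (ennreal C * (NNBINT v. ennreal (cmod (F v)) * ennreal \<bar>tent R y v - tent R y m\<bar> * ennreal (gexp \<alpha> (v - m)))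
      + (NNBINT v. (ennreal (tent R y v) * ennreal (cmod (F v))) * ennreal (\<delta> * R * c2 * gexp (\<alpha> / 16) (v - m))))"
    by (subst nn_integral_add, measurable, subst nn_integral_cmult, measurable)
  finally show ?thesis by (simp only: F_def c2_def)
qed

text \<open>The cut-off coefficient function need not itself be a coefficient function;
  \<open>gstft fy\<close> is its image under the reproducing kernel. The two differ by the
  commutator of cutoff and kernel, which is the second term on the right.\<close>

lemma localization_norm_bound:
  fixes f :: "'a::euclidean_space \<Rightarrow> complex" and y :: "'a \<times> 'a"
  assumes f: "sq_int f" and R: "R > 0"
  defines "fy \<equiv> synth (\<lambda>v. complex_of_real (tent R y v) * gstft f v)"
  shows "sq_int fy"
    and "(NNBINT u. ennreal ((tent R y u)\<^sup>2) * (ennreal (cmod (gstft f u)))\<^sup>2)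
    \<le> 2 * (ennreal ((l2norm fy)\<^sup>2) + (NNBINT u. (NNBINT v. ennreal (cmod (gstft f v)) * ennreal \<bar>tent R y v - tent R y u\<bar> * ennreal (gexp (pi / 2) (v - u)))\<^sup>2))"
proof -
  define F where "F = gstft f"
  define H where "H v = complex_of_real (tent R y v) * F v" for v
  have F: "sq_int F" unfolding F_def by (rule sq_int_gstft[OF f])
  have [measurable]: "F \<in> borel_measurable borel" using F by (rule sq_intD)
  have H1: "integrable lborel H"
    using sq_int_mult_integrable[OF F sq_int_tent[OF R, of y]] by (simp add: H_def[abs_def] mult.commute)
  have fyH: "fy = synth H" by (simp add: fy_def H_def[abs_def] F_def)
  show sfy: "sq_int fy" unfolding fyH by (rule sq_int_synth[OF H1])
  define D where "D u = (NNBINT v. ennreal (cmod (F v)) * ennreal \<bar>tent R y v - tent R y u\<bar> * ennreal (gexp (pi / 2) (v - u)))" for u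
  have [measurable]: "D \<in> borel_measurable borel" unfolding D_def by measurable
  have [measurable]: "gstft fy \<in> borel_measurable borel" by (rule borel_measurable_gstft[OF sfy])
  have ptw: "ennreal (tent R y u) * ennreal (cmod (F u)) \<le> ennreal (cmod (gstft fy u)) + D u" for u
  proof -
    have i1: "integrable lborel (\<lambda>v. F v * cnj (gstft (wp u) v))"
      by (rule sq_int_mult_integrable[OF F sq_int_gstft[OF sq_int_wp]])
    have i2: "integrable lborel (\<lambda>v. H v * cnj (gstft (wp u) v))"
    proof (rule Bochner_Integration.integrable_bound[OF i1])
      have [measurable]: "gstft (wp u) \<in> borel_measurable borel" by (rule borel_measurable_gstft[OF sq_int_wp])
      show "(\<lambda>v. H v * cnj (gstft (wp u) v)) \<in> borel_measurable lborel" unfolding H_def by measurable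
      show "AE v in lborel. norm (H v * cnj (gstft (wp u) v)) \<le> norm (F v * cnj (gstft (wp u) v))"
        using tent_le_1[OF R, of y] by (intro AE_I2) (auto simp: H_def norm_mult intro!: mult_right_mono mult_left_le_one_le)
    qed
    have a: "gstft fy u = (LBINT v. H v * cnj (gstft (wp u) v))"
      unfolding fyH gstft_def[of "synth H"] by (rule l2inner_synth[OF H1 sq_int_wp])
    have b: "F u = (LBINT v. F v * cnj (gstft (wp u) v))"
      unfolding F_def by (subst (1) gstft_def) (rule l2inner_eq_gstft[OF f sq_int_wp])
    have "complex_of_real (tent R y u) * F u = gstft fy u + (LBINT v. complex_of_real (tent R y u) * (F v * cnj (gstft (wp u) v)) - H v * cnj (gstft (wp u) v))"
      unfolding a using i1 i2 b by simp
    then have "cmod (complex_of_real (tent R y u) * F u) \<le> cmod (gstft fy u) + cmod (LBINT v. complex_of_real (tent R y u) * (F v * cnj (gstft (wp u) v)) - H v * cnj (gstft (wp u) v))"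
      by (simp only: norm_triangle_ineq)
    then have "ennreal (tent R y u * cmod (F u)) \<le> ennreal (cmod (gstft fy u)) + ennreal (cmod (LBINT v. complex_of_real (tent R y u) * (F v * cnj (gstft (wp u) v)) - H v * cnj (gstft (wp u) v)))"
      by (simp add: norm_mult flip: ennreal_plus)
    also have "\<dots> \<le> ennreal (cmod (gstft fy u)) + (NNBINT v. ennreal (cmod (complex_of_real (tent R y u) * (F v * cnj (gstft (wp u) v)) - H v * cnj (gstft (wp u) v))))"
      by (intro add_left_mono norm_integral_le_nn)
    also have "(NNBINT v. ennreal (cmod (complex_of_real (tent R y u) * (F v * cnj (gstft (wp u) v)) - H v * cnj (gstft (wp u) v)))) = D u"
      unfolding D_def
    proof (intro nn_integral_cong)
      fix v
      have "complex_of_real (tent R y u) * (F v * cnj (gstft (wp u) v)) - H v * cnj (gstft (wp u) v) = complex_of_real (tent R y u - tent R y v) * F v * cnj (gstft (wp u) v)"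
        by (simp add: H_def algebra_simps)
      then have "cmod (complex_of_real (tent R y u) * (F v * cnj (gstft (wp u) v)) - H v * cnj (gstft (wp u) v)) = \<bar>tent R y u - tent R y v\<bar> * cmod (F v) * gexp (pi / 2) (u - v)"
        by (simp only: norm_mult norm_of_real complex_mod_cnj gstft_def l2inner_wp_wp_gexp)
      also have "\<dots> = cmod (F v) * \<bar>tent R y v - tent R y u\<bar> * gexp (pi / 2) (v - u)"
        by (simp add: abs_minus_commute gexp_diff_commute[of _ u])
      finally show "ennreal (cmod (complex_of_real (tent R y u) * (F v * cnj (gstft (wp u) v)) - H v * cnj (gstft (wp u) v))) = ennreal (cmod (F v)) * ennreal \<bar>tent R y v - tent R y u\<bar> * ennreal (gexp (pi / 2) (v - u))"
        by (simp add: ennreal_mult)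
    qed
    finally show ?thesis by (simp add: ennreal_mult)
  qed
  have "(NNBINT u. ennreal ((tent R y u)\<^sup>2) * (ennreal (cmod (F u)))\<^sup>2) \<le> (NNBINT u. 2 * ((ennreal (cmod (gstft fy u)))\<^sup>2 + (D u)\<^sup>2))"
  proof (intro nn_integral_mono)
    fix u
    have "ennreal ((tent R y u)\<^sup>2) * (ennreal (cmod (F u)))\<^sup>2 = (ennreal (tent R y u) * ennreal (cmod (F u)))\<^sup>2"
      by (simp add: power_mult_distrib ennreal_power)
    also have "\<dots> \<le> (ennreal (cmod (gstft fy u)) + D u)\<^sup>2" by (intro power_mono ptw) simp
    also have "\<dots> \<le> 2 * ((ennreal (cmod (gstft fy u)))\<^sup>2 + (D u)\<^sup>2)" by (rule ennreal_add_sq_le)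
    finally show "ennreal ((tent R y u)\<^sup>2) * (ennreal (cmod (F u)))\<^sup>2 \<le> 2 * ((ennreal (cmod (gstft fy u)))\<^sup>2 + (D u)\<^sup>2)" .
  qed
  also have "\<dots> = 2 * ((NNBINT u. (ennreal (cmod (gstft fy u)))\<^sup>2) + (NNBINT u. (D u)\<^sup>2))"
    by (subst nn_integral_cmult, measurable, subst nn_integral_add, measurable)
  also have "(NNBINT u. (ennreal (cmod (gstft fy u)))\<^sup>2) = ennreal ((l2norm fy)\<^sup>2)"
    using nn_integral_gstft_sq[OF sfy] by (simp add: ennreal_power)
  finally show "(NNBINT u. ennreal ((tent R y u)\<^sup>2) * (ennreal (cmod (gstft f u)))\<^sup>2)
    \<le> 2 * (ennreal ((l2norm fy)\<^sup>2) + (NNBINT u. (NNBINT v. ennreal (cmod (gstft f v)) * ennreal \<bar>tent R y v - tent R y u\<bar> * ennreal (gexp (pi / 2) (v - u)))\<^sup>2))"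
    by (simp only: D_def F_def)
qed

section \<open>Stability of Gabor frames under Lipschitz deformations\<close>

lemma nn_integral_gexp_real:
  assumes "a > 0"
  obtains e where "e \<ge> 0" "(NNBINT p. ennreal (gexp a (p::'b::euclidean_space))) = ennreal e"
  using nn_integral_gexp_finite[OF assms, where 'b='b]
  by (cases "(NNBINT p. ennreal (gexp a (p::'b)))") auto

lemma nn_integral_gexp_translate:
  "(NNBINT v. ennreal (gexp a (v - (m::'b::euclidean_space)))) = (NNBINT p. ennreal (gexp a (p::'b)))"
  using nn_integral_lborel_translate[of "\<lambda>p::'b. ennreal (gexp a p)" "- m"] by simp

lemma nn_integral_count_space_add:
  "(\<integral>\<^sup>+l. f l + g l \<partial>count_space \<Lambda>) = (\<integral>\<^sup>+l. f l \<partial>count_space \<Lambda>) + (\<integral>\<^sup>+l. g l \<partial>count_space \<Lambda>)"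
  by (rule nn_integral_add) auto

text \<open>For each y the assumed bound is applied to the translated set matching
  \<open>\<Psi>\<close> at y and to \<open>f\<close> localized around y; then everything is
  integrated over y. The assumption must be uniform in the translation \<open>s\<close>, because
  \<open>\<Psi>\<close> x - x is not bounded.\<close>

lemma deformed_lower_bound:
  fixes \<gamma> :: "'a::euclidean_space \<Rightarrow> complex" and \<Lambda> :: "('a \<times> 'a) set"
  assumes \<gamma>: "sq_int \<gamma>" and C: "C \<ge> 0" and \<alpha>: "\<alpha> > 0"
    and V1: "\<And>p. cmod (gstft \<gamma> p) \<le> C * gexp \<alpha> p"
    and V2: "\<And>\<epsilon> p. cmod (gstft (\<lambda>x. \<gamma> x - tfs \<epsilon> \<gamma> x) p) \<le> C * norm \<epsilon> * (gexp \<alpha> p + gexp \<alpha> (p - \<epsilon>))"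
    and A: "A > 0"
    and low: "\<And>s f. sq_int f \<Longrightarrow> ennreal (A * (l2norm f)\<^sup>2) \<le> (\<integral>\<^sup>+l. ennreal ((cmod (l2inner f (tfs (l + s) \<gamma>)))\<^sup>2) \<partial>count_space \<Lambda>)"
    and cnt: "ball_count_le id \<Lambda> r M" and r: "r > 0"
  obtains \<delta> where "\<delta> > 0" "\<delta> \<le> 1 / 2"
    "\<And>\<Psi> f. (\<And>z w. norm ((\<Psi> z - z) - (\<Psi> w - w)) \<le> \<delta> * norm (z - w)) \<Longrightarrow> sq_int f \<Longrightarrow>
       ennreal (A / 16 * (l2norm f)\<^sup>2) \<le> (\<integral>\<^sup>+l. ennreal ((cmod (l2inner f (tfs (\<Psi> l) \<gamma>)))\<^sup>2) \<partial>count_space \<Lambda>)"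
proof -
  note countable = ball_count_le_countable[OF cnt r]
  have r4: "r / 4 > 0" and \<alpha>16: "\<alpha> / 16 > 0" using r \<alpha> by auto
  \<comment> \<open>One overlap constant, at the smallest rate \<alpha> / 16 and for the separation
    r / 4 left after a deformation, serves all the sums below.\<close>
  obtain K where K: "K \<ge> 0"
    "\<And>(\<mu> :: 'a \<times> 'a \<Rightarrow> 'a \<times> 'a) \<Lambda> v. ball_count_le \<mu> \<Lambda> (r / 4) M \<Longrightarrow>
       (\<integral>\<^sup>+l. ennreal (gexp (\<alpha> / 16) (v - \<mu> l)) \<partial>count_space \<Lambda>) \<le> ennreal K"
    using overlap_bound[OF r4 \<alpha>16] by metis
  obtain e16 where e16: "e16 \<ge> 0" "(NNBINT p. ennreal (gexp (\<alpha> / 16) (p::'a \<times> 'a))) = ennreal e16"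
    using nn_integral_gexp_real[OF \<alpha>16] by metis
  obtain e1 where e1: "e1 \<ge> 0" "(NNBINT p. ennreal (gexp \<alpha> (p::'a \<times> 'a))) = ennreal e1"
    using nn_integral_gexp_real[OF \<alpha>] by metis
  have pi2: "pi / 2 > 0" "pi / 2 / 2 > 0" by auto
  obtain k1 where k1: "k1 \<ge> 0" "(NNBINT p. ennreal (gexp (pi / 2) (p::'a \<times> 'a))) = ennreal k1"
    using nn_integral_gexp_real[OF pi2(1)] by metis
  obtain k2 where k2: "k2 \<ge> 0" "(NNBINT p. ennreal (gexp (pi / 2 / 2) (p::'a \<times> 'a))) = ennreal k2"
    using nn_integral_gexp_real[OF pi2(2)] by metis
  define c0 where "c0 = (8 * 2 ^ DIM('a \<times> 'a) :: real)"
  have c0: "c0 \<ge> 0" by (simp add: c0_def)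
  define c2 where "c2 = C * (4 * exp (\<alpha> / 4) * exp (4 / \<alpha>))"
  have c2: "c2 \<ge> 0" using C by (simp add: c2_def)
  define kQ where "kQ = C\<^sup>2 * (e1 * (c0 * exp (2 / \<alpha>) * K))"
  define kP where "kP = c2\<^sup>2 * e16 * K"
  define kD where "kD = k1 * (c0 * exp (2 / (pi / 2)) * k2)"
  have kpos: "kQ \<ge> 0" "kP \<ge> 0" "kD \<ge> 0" using C e1 e16 k1 k2 K c0 by (auto simp: kQ_def kP_def kD_def)
  \<comment> \<open>Chosen so that the two commutator terms, of size 8 kQ / R^2 and 2 A kD / R^2,
    together use at most A / 4.\<close>
  define R where "R = 1 + (32 * kQ + 8 * A * kD) / A"
  have R: "R \<ge> 1" using kpos A by (simp add: R_def)
  have R0: "R > 0" using R by simp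
  have RR: "8 * kQ / R\<^sup>2 + 2 * A * kD / R\<^sup>2 \<le> A / 4"
  proof -
    have "8 * kQ + 2 * A * kD \<le> A / 4 * R" using A by (simp add: R_def field_simps)
    also have "\<dots> \<le> A / 4 * R\<^sup>2" using A R by (intro mult_left_mono) (auto simp: power2_eq_square)
    finally show ?thesis using R0 by (simp add: field_simps)
  qed
  \<comment> \<open>The first entry gives \<delta> R \<le> 1/4, the second makes the displacement
    error use at most another A / 4.\<close>
  define \<delta> where "\<delta> = min (1 / (4 * R)) (A / (32 * (kP + 1) * R))"
  have \<delta>0: "\<delta> > 0" using A R0 kpos by (simp add: \<delta>_def)
  have \<delta>R: "\<delta> * R \<le> 1 / 4"
  proof -
    have "\<delta> * R \<le> 1 / (4 * R) * R" using R0 by (intro mult_right_mono) (auto simp: \<delta>_def)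
    then show ?thesis using R0 by simp
  qed
  have "\<delta> * 1 \<le> \<delta> * R" using \<delta>0 R by (intro mult_left_mono) auto
  then have \<delta>2: "\<delta> \<le> 1 / 2" using \<delta>R by linarith
  have \<delta>P: "8 * kP * (\<delta> * R)\<^sup>2 \<le> A / 4"
  proof -
    have "(\<delta> * R)\<^sup>2 \<le> \<delta> * R" using \<delta>R \<delta>0 R0 by (simp add: power2_eq_square mult_left_le_one_le)
    also have "\<dots> \<le> A / (32 * (kP + 1) * R) * R" using R0 by (intro mult_right_mono) (auto simp: \<delta>_def)
    also have "\<dots> = A / (32 * (kP + 1))" using R0 by simp
    finally have "8 * kP * (\<delta> * R)\<^sup>2 \<le> 8 * kP * (A / (32 * (kP + 1)))" using kpos by (intro mult_left_mono) auto
    also have "\<dots> \<le> A / 4" using A kpos by (simp add: field_simps)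
    finally show ?thesis .
  qed
  obtain Z where Z1: "Z > 0"
    "\<And>v :: 'a \<times> 'a. (NNBINT y. ennreal ((tent R y v)\<^sup>2)) = ennreal Z"
    "\<And>v w :: 'a \<times> 'a. (NNBINT y. ennreal ((tent R y v - tent R y w)\<^sup>2)) \<le> ennreal (8 * 2 ^ DIM('a \<times> 'a) * Z * (norm (v - w) / R)\<^sup>2)"
    by (rule tent_mass[OF R0, where 'b="'a \<times> 'a"]) (rule that; blast)
  note Z = Z1(1) Z1(2) Z1(3)[folded c0_def]
  define qa where "qa = c0 * exp (2 / \<alpha>) * Z / R\<^sup>2"
  define qd where "qd = c0 * exp (2 / (pi / 2)) * Z / R\<^sup>2"
  have qa: "qa \<ge> 0" and qd: "qd \<ge> 0" using c0 Z(1) by (auto simp: qa_def qd_def)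
  show thesis
  proof (rule that[OF \<delta>0 \<delta>2])
    fix \<Psi> :: "'a \<times> 'a \<Rightarrow> 'a \<times> 'a" and f :: "'a \<Rightarrow> complex"
    assume L: "\<And>z w. norm ((\<Psi> z - z) - (\<Psi> w - w)) \<le> \<delta> * norm (z - w)" and f: "sq_int f"
    have ov: "(\<integral>\<^sup>+l. ennreal (gexp (\<alpha> / 16) (v - \<Psi> l)) \<partial>count_space \<Lambda>) \<le> ennreal K" for v
      by (rule K(2)) (rule near_identity_ball_count[of \<Psi>, OF L \<delta>2 cnt])
    define F where "F v = ennreal (cmod (gstft f v))" for v
    define N where "N = (l2norm f)\<^sup>2"
    have N0: "N \<ge> 0" by (simp add: N_def)
    have [measurable]: "F \<in> borel_measurable borel"
      unfolding F_def using borel_measurable_gstft[OF f] by measurable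
    have FN: "(NNBINT v. (F v)\<^sup>2) = ennreal N"
      using nn_integral_gstft_sq[OF f] by (simp add: F_def N_def ennreal_power)
    define c where "c l = cmod (l2inner f (tfs (\<Psi> l) \<gamma>))" for l
    define S where "S = (\<integral>\<^sup>+l. ennreal ((c l)\<^sup>2) \<partial>count_space \<Lambda>)"
    \<comment> \<open>The three parts of the localized coefficient: \<open>b\<close> carries the sum
      to be bounded from below, \<open>q\<close> is the commutator with the window, \<open>P\<close>
      the displacement error; \<open>D\<close> is the commutator with the reproducing
      kernel.\<close>
    define b where "b l y = ennreal (tent R y (\<Psi> l) * c l)" for l y
    define q where "q l y = ennreal C * (NNBINT v. F v * ennreal \<bar>tent R y v - tent R y (\<Psi> l)\<bar> * ennreal (gexp \<alpha> (v - \<Psi> l)))" for l y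
    define P where "P l y = (NNBINT v. (ennreal (tent R y v) * F v) * ennreal (\<delta> * R * c2 * gexp (\<alpha> / 16) (v - \<Psi> l)))" for l y
    define D where "D u y = (NNBINT v. F v * ennreal \<bar>tent R y v - tent R y u\<bar> * ennreal (gexp (pi / 2) (v - u)))" for u y :: "'a \<times> 'a"
    have [measurable]: "b l \<in> borel_measurable borel" "q l \<in> borel_measurable borel" "P l \<in> borel_measurable borel" for l
      unfolding b_def q_def P_def by measurable
    define G where "G l y = (b l y)\<^sup>2 + (q l y)\<^sup>2 + (P l y)\<^sup>2" for l y
    have Gm [measurable]: "G l \<in> borel_measurable borel" for l unfolding G_def by measurable
    have ptw: "ennreal A * (NNBINT u. ennreal ((tent R y u)\<^sup>2) * (F u)\<^sup>2) \<le> 8 * (\<integral>\<^sup>+l. G l y \<partial>count_space \<Lambda>) + 2 * ennreal A * (NNBINT u. (D u y)\<^sup>2)" for y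
    proof -
      define fy where "fy = synth (\<lambda>v. complex_of_real (tent R y v) * gstft f v)"
      have sfy: "sq_int fy" unfolding fy_def by (rule localization_norm_bound(1)[OF f R0])
      \<comment> \<open>The translation by y - x agrees with \<open>\<Psi>\<close> at x, so its
        deviation from \<open>\<Psi>\<close> at l is at most \<delta> times the distance of l from
        x.\<close>
      obtain x where x: "\<Psi> x = y" using near_identity_surj[of \<Psi>, OF L \<delta>2] by blast
      have "ennreal (A * (l2norm fy)\<^sup>2) \<le> (\<integral>\<^sup>+l. ennreal ((cmod (l2inner fy (tfs (l + (y - x)) \<gamma>)))\<^sup>2) \<partial>count_space \<Lambda>)"
        by (rule low[OF sfy])
      also have "\<dots> \<le> (\<integral>\<^sup>+l. 4 * G l y \<partial>count_space \<Lambda>)"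
      proof (intro nn_integral_mono)
        fix l
        define \<epsilon> where "\<epsilon> = l + (y - x) - \<Psi> l"
        have "\<epsilon> = - ((\<Psi> l - l) - (\<Psi> x - x))" by (simp add: \<epsilon>_def x)
        then have "norm \<epsilon> \<le> \<delta> * norm (l - x)" using L[of l x] by (simp only: norm_minus_cancel)
        also have "\<dots> \<le> \<delta> * (2 * norm (\<Psi> l - y))"
          using near_identity_expand[of \<Psi>, OF L \<delta>2, of l x] \<delta>0 by (intro mult_left_mono) (auto simp: x)
        finally have \<epsilon>: "norm \<epsilon> \<le> 2 * \<delta> * norm (\<Psi> l - y)" by simp
        have le: "\<Psi> l + \<epsilon> = l + (y - x)" by (simp add: \<epsilon>_def)
        have "ennreal (cmod (l2inner fy (tfs (l + (y - x)) \<gamma>))) \<le> b l y + (q l y + P l y)"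
          using localized_coefficient_bound[OF \<gamma> f C \<alpha> V1 V2 R less_imp_le[OF \<delta>0] \<delta>R \<epsilon>]
          unfolding le b_def q_def P_def F_def c_def c2_def fy_def .
        then have "(ennreal (cmod (l2inner fy (tfs (l + (y - x)) \<gamma>))))\<^sup>2 \<le> (b l y + (q l y + P l y))\<^sup>2"
          by (intro power_mono) auto
        also have "\<dots> \<le> 4 * G l y" unfolding G_def by (rule ennreal_add3_sq_le)
        finally show "ennreal ((cmod (l2inner fy (tfs (l + (y - x)) \<gamma>)))\<^sup>2) \<le> 4 * G l y" by (simp add: ennreal_power)
      qed
      also have "\<dots> = 4 * (\<integral>\<^sup>+l. G l y \<partial>count_space \<Lambda>)" by (rule nn_integral_cmult) simp
      finally have 1: "ennreal A * ennreal ((l2norm fy)\<^sup>2) \<le> 4 * (\<integral>\<^sup>+l. G l y \<partial>count_space \<Lambda>)"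
        using A by (simp add: ennreal_mult)
      have "ennreal A * (NNBINT u. ennreal ((tent R y u)\<^sup>2) * (F u)\<^sup>2) \<le> ennreal A * (2 * (ennreal ((l2norm fy)\<^sup>2) + (NNBINT u. (D u y)\<^sup>2)))"
        unfolding F_def D_def fy_def by (intro mult_left_mono localization_norm_bound(2)[OF f R0]) simp
      also have "\<dots> = 2 * (ennreal A * ennreal ((l2norm fy)\<^sup>2)) + 2 * ennreal A * (NNBINT u. (D u y)\<^sup>2)"
        by (simp only: distrib_left mult_ac)
      also have "\<dots> \<le> 2 * (4 * (\<integral>\<^sup>+l. G l y \<partial>count_space \<Lambda>)) + 2 * ennreal A * (NNBINT u. (D u y)\<^sup>2)"
        by (intro add_right_mono mult_left_mono 1) simp
      also have "2 * (4 * (\<integral>\<^sup>+l. G l y \<partial>count_space \<Lambda>)) = 8 * (\<integral>\<^sup>+l. G l y \<partial>count_space \<Lambda>)"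
        unfolding mult.assoc[symmetric] by simp
      finally show ?thesis .
    qed
    \<comment> \<open>Integrating over the centres turns the localized norms back into the global
      one, up to the factor Z that all other terms share.\<close>
    have mass: "(NNBINT y. (NNBINT v. ennreal ((tent R y v)\<^sup>2) * (F v)\<^sup>2)) = ennreal (Z * N)"
    proof -
      have "(NNBINT y. (NNBINT v. ennreal ((tent R y v)\<^sup>2) * (F v)\<^sup>2)) = (NNBINT v. (NNBINT y. ennreal ((tent R y v)\<^sup>2) * (F v)\<^sup>2))"
        by (rule lborel_pair.Fubini') measurable
      also have "\<dots> = (NNBINT v. ennreal Z * (F v)\<^sup>2)"
        by (intro nn_integral_cong) (subst nn_integral_multc, measurable, simp add: Z(2))
      also have "\<dots> = ennreal Z * (NNBINT v. (F v)\<^sup>2)" by (rule nn_integral_cmult) measurable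
      finally show ?thesis using Z(1) N0 by (simp add: FN ennreal_mult)
    qed
    have Sb: "(\<integral>\<^sup>+l. (NNBINT y. (b l y)\<^sup>2) \<partial>count_space \<Lambda>) = ennreal Z * S"
    proof -
      have "(NNBINT y. (b l y)\<^sup>2) = ennreal Z * ennreal ((c l)\<^sup>2)" for l
      proof -
        have "(NNBINT y. (b l y)\<^sup>2) = (NNBINT y. ennreal ((tent R y (\<Psi> l))\<^sup>2) * ennreal ((c l)\<^sup>2))"
          by (intro nn_integral_cong) (simp add: b_def c_def ennreal_power power_mult_distrib ennreal_mult)
        also have "\<dots> = (NNBINT y. ennreal ((tent R y (\<Psi> l))\<^sup>2)) * ennreal ((c l)\<^sup>2)"
          by (rule nn_integral_multc) measurable
        finally show ?thesis by (simp only: Z(2))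
      qed
      then show ?thesis unfolding S_def by (simp add: nn_integral_cmult)
    qed
    have Sq: "(\<integral>\<^sup>+l. (NNBINT y. (q l y)\<^sup>2) \<partial>count_space \<Lambda>) \<le> ennreal (kQ / R\<^sup>2 * (Z * N))"
    proof -
      define w where "w l = (NNBINT v. (F v)\<^sup>2 * ennreal (gexp (\<alpha> / 2) (v - \<Psi> l)))" for l
      have "(\<integral>\<^sup>+l. w l \<partial>count_space \<Lambda>) = (NNBINT v. (\<integral>\<^sup>+l. (F v)\<^sup>2 * ennreal (gexp (\<alpha> / 2) (v - \<Psi> l)) \<partial>count_space \<Lambda>))"
        unfolding w_def by (rule nn_integral_count_space_nn_integral[symmetric, OF countable]) measurable
      also have "\<dots> \<le> (NNBINT v. (F v)\<^sup>2 * ennreal K)"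
      proof (intro nn_integral_mono)
        fix v
        have "(\<integral>\<^sup>+l. (F v)\<^sup>2 * ennreal (gexp (\<alpha> / 2) (v - \<Psi> l)) \<partial>count_space \<Lambda>) \<le> (\<integral>\<^sup>+l. (F v)\<^sup>2 * ennreal (gexp (\<alpha> / 16) (v - \<Psi> l)) \<partial>count_space \<Lambda>)"
          using \<alpha> by (intro nn_integral_mono mult_left_mono ennreal_leI gexp_antimono) auto
        also have "\<dots> = (F v)\<^sup>2 * (\<integral>\<^sup>+l. ennreal (gexp (\<alpha> / 16) (v - \<Psi> l)) \<partial>count_space \<Lambda>)"
          by (rule nn_integral_cmult) simp
        also have "\<dots> \<le> (F v)\<^sup>2 * ennreal K" by (intro mult_left_mono ov) simp
        finally show "(\<integral>\<^sup>+l. (F v)\<^sup>2 * ennreal (gexp (\<alpha> / 2) (v - \<Psi> l)) \<partial>count_space \<Lambda>) \<le> (F v)\<^sup>2 * ennreal K" .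
      qed
      also have "\<dots> = ennreal N * ennreal K" unfolding FN[symmetric] by (rule nn_integral_multc) measurable
      finally have w: "(\<integral>\<^sup>+l. w l \<partial>count_space \<Lambda>) \<le> ennreal N * ennreal K" .
      have ql: "(NNBINT y. (q l y)\<^sup>2) \<le> ennreal (C\<^sup>2 * (e1 * (qa))) * w l" for l
      proof -
        have "(NNBINT y. (q l y)\<^sup>2) = (NNBINT y. (ennreal C)\<^sup>2 * (NNBINT v. F v * ennreal \<bar>tent R y v - tent R y (\<Psi> l)\<bar> * ennreal (gexp \<alpha> (v - \<Psi> l)))\<^sup>2)"
          unfolding q_def power_mult_distrib ..
        also have "\<dots> = (ennreal C)\<^sup>2 * (NNBINT y. (NNBINT v. F v * ennreal \<bar>tent R y v - tent R y (\<Psi> l)\<bar> * ennreal (gexp \<alpha> (v - \<Psi> l)))\<^sup>2)"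
          by (rule nn_integral_cmult) measurable
        also have "\<dots> \<le> (ennreal C)\<^sup>2 * (ennreal e1 * (ennreal (qa) * w l))"
          unfolding w_def e1(2)[symmetric] qa_def
          by (intro mult_left_mono tent_commutator \<alpha> R0 less_imp_le[OF Z(1)] c0 Z(3)) auto
        also have "\<dots> = ennreal (C\<^sup>2 * (e1 * (qa))) * w l"
          using C e1(1) qa by (simp add: ennreal_mult ennreal_power mult.assoc)
        finally show ?thesis .
      qed
      have "(\<integral>\<^sup>+l. (NNBINT y. (q l y)\<^sup>2) \<partial>count_space \<Lambda>) \<le> (\<integral>\<^sup>+l. ennreal (C\<^sup>2 * (e1 * (qa))) * w l \<partial>count_space \<Lambda>)"
        by (intro nn_integral_mono ql)
      also have "\<dots> = ennreal (C\<^sup>2 * (e1 * (qa))) * (\<integral>\<^sup>+l. w l \<partial>count_space \<Lambda>)"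
        by (rule nn_integral_cmult) simp
      also have "\<dots> \<le> ennreal (C\<^sup>2 * (e1 * (qa))) * (ennreal N * ennreal K)"
        by (intro mult_left_mono w) simp
      also have "\<dots> = ennreal (C\<^sup>2 * (e1 * (qa)) * (N * K))"
        using C e1(1) qa N0 K(1) by (simp add: ennreal_mult mult.assoc)
      also have "C\<^sup>2 * (e1 * (qa)) * (N * K) = kQ / R\<^sup>2 * (Z * N)"
        by (simp add: kQ_def qa_def)
      finally show ?thesis .
    qed
    have SP: "(\<integral>\<^sup>+l. (NNBINT y. (P l y)\<^sup>2) \<partial>count_space \<Lambda>) \<le> ennreal (kP * (\<delta> * R)\<^sup>2 * (Z * N))"
    proof -
      define \<eta> where "\<eta> = \<delta> * R * c2"
      have \<eta>: "\<eta> \<ge> 0" using \<delta>0 R0 c2 by (simp add: \<eta>_def)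
      have "(\<integral>\<^sup>+l. (NNBINT y. (P l y)\<^sup>2) \<partial>count_space \<Lambda>) = (NNBINT y. (\<integral>\<^sup>+l. (P l y)\<^sup>2 \<partial>count_space \<Lambda>))"
        by (rule nn_integral_count_space_nn_integral[symmetric, OF countable]) measurable
      also have "\<dots> \<le> (NNBINT y. ennreal (\<eta>\<^sup>2 * e16 * K) * (NNBINT v. ennreal ((tent R y v)\<^sup>2) * (F v)\<^sup>2))"
      proof (intro nn_integral_mono)
        fix y
        have T: "(NNBINT p. ennreal (\<eta> * gexp (\<alpha> / 16) (p :: 'a \<times> 'a))) = ennreal (\<eta> * e16)"
          using \<eta> e16 by (simp add: ennreal_mult nn_integral_cmult)
        \<comment> \<open>Schur's test at fixed y, with the cutoff kept beside the coefficients, so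
          that the integral over y is again \<open>mass\<close>.\<close>
        have "(\<integral>\<^sup>+l. (P l y)\<^sup>2 \<partial>count_space \<Lambda>) \<le> (NNBINT p. ennreal (\<eta> * gexp (\<alpha> / 16) (p :: 'a \<times> 'a))) * (ennreal \<eta> * ennreal K) * (NNBINT v. (ennreal (tent R y v) * F v)\<^sup>2)"
          unfolding P_def \<eta>_def[symmetric]
        proof (rule sampling_bound[OF countable])
          show "(\<integral>\<^sup>+l. ennreal (\<eta> * gexp (\<alpha> / 16) (v - \<Psi> l)) \<partial>count_space \<Lambda>) \<le> ennreal \<eta> * ennreal K" for v
            using \<eta> mult_left_mono[OF ov[of v], of "ennreal \<eta>"] by (simp add: ennreal_mult nn_integral_cmult)
        qed measurable
        also have "\<dots> = ennreal (\<eta>\<^sup>2 * e16 * K) * (NNBINT v. ennreal ((tent R y v)\<^sup>2) * (F v)\<^sup>2)"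
        proof -
          have "ennreal (\<eta> * e16) * (ennreal \<eta> * ennreal K) = ennreal (\<eta>\<^sup>2 * e16 * K)"
            using \<eta> e16 K by (simp add: ennreal_mult[symmetric] power2_eq_square ac_simps)
          moreover have "(NNBINT v. (ennreal (tent R y v) * F v)\<^sup>2) = (NNBINT v. ennreal ((tent R y v)\<^sup>2) * (F v)\<^sup>2)"
            by (simp add: power_mult_distrib ennreal_power)
          ultimately show ?thesis unfolding T by simp
        qed
        finally show "(\<integral>\<^sup>+l. (P l y)\<^sup>2 \<partial>count_space \<Lambda>) \<le> ennreal (\<eta>\<^sup>2 * e16 * K) * (NNBINT v. ennreal ((tent R y v)\<^sup>2) * (F v)\<^sup>2)" .
      qed
      also have "\<dots> = ennreal (\<eta>\<^sup>2 * e16 * K) * ennreal (Z * N)"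
        unfolding mass[symmetric] by (rule nn_integral_cmult) measurable
      also have "\<dots> = ennreal (\<eta>\<^sup>2 * e16 * K * (Z * N))"
        using e16 K Z(1) N0 by (simp add: ennreal_mult)
      also have "\<eta>\<^sup>2 * e16 * K * (Z * N) = kP * (\<delta> * R)\<^sup>2 * (Z * N)"
        by (simp add: kP_def \<eta>_def power_mult_distrib)
      finally show ?thesis .
    qed
    have SD: "(NNBINT y. (NNBINT u. (D u y)\<^sup>2)) \<le> ennreal (kD / R\<^sup>2 * (Z * N))"
    proof -
      have [measurable]: "(\<lambda>(y, u). (D u y)\<^sup>2) \<in> borel_measurable (borel \<Otimes>\<^sub>M borel)"
        unfolding D_def by measurable
      have "(NNBINT y. (NNBINT u. (D u y)\<^sup>2)) = (NNBINT u. (NNBINT y. (D u y)\<^sup>2))"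
        by (rule lborel_pair.Fubini') measurable
      also have "\<dots> \<le> (NNBINT u. ennreal (k1 * qd) * (NNBINT v. (F v)\<^sup>2 * ennreal (gexp (pi / 2 / 2) (v - u))))"
      proof (intro nn_integral_mono)
        fix u :: "'a \<times> 'a"
        have "(NNBINT y. (D u y)\<^sup>2) \<le> ennreal k1 * ((ennreal qd) * (NNBINT v. (F v)\<^sup>2 * ennreal (gexp (pi / 2 / 2) (v - u))))"
          unfolding D_def k1(2)[symmetric] qd_def
          by (intro tent_commutator pi2 R0 less_imp_le[OF Z(1)] c0 Z(3)) auto
        then show "(NNBINT y. (D u y)\<^sup>2) \<le> ennreal (k1 * qd) * (NNBINT v. (F v)\<^sup>2 * ennreal (gexp (pi / 2 / 2) (v - u)))"
          using k1(1) qd by (simp add: ennreal_mult mult.assoc)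
      qed
      also have "\<dots> = ennreal (k1 * qd) * (NNBINT u. (NNBINT v. (F v)\<^sup>2 * ennreal (gexp (pi / 2 / 2) (v - u))))"
        by (rule nn_integral_cmult) measurable
      also have "(NNBINT u. (NNBINT v. (F v)\<^sup>2 * ennreal (gexp (pi / 2 / 2) (v - u)))) = (NNBINT v. (NNBINT u. (F v)\<^sup>2 * ennreal (gexp (pi / 2 / 2) (v - u))))"
        by (rule lborel_pair.Fubini') measurable
      also have "\<dots> = (NNBINT v. (F v)\<^sup>2 * ennreal k2)"
      proof (intro nn_integral_cong)
        fix v :: "'a \<times> 'a"
        have "(NNBINT u. (F v)\<^sup>2 * ennreal (gexp (pi / 2 / 2) (v - u))) = (F v)\<^sup>2 * (NNBINT u. ennreal (gexp (pi / 2 / 2) (v - u)))"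
          by (rule nn_integral_cmult) measurable
        also have "(NNBINT u. ennreal (gexp (pi / 2 / 2) (v - u))) = ennreal k2"
          unfolding gexp_diff_commute[of _ v] nn_integral_gexp_translate k2(2) ..
        finally show "(NNBINT u. (F v)\<^sup>2 * ennreal (gexp (pi / 2 / 2) (v - u))) = (F v)\<^sup>2 * ennreal k2" .
      qed
      also have "\<dots> = ennreal N * ennreal k2" unfolding FN[symmetric] by (rule nn_integral_multc) measurable
      also have "ennreal (k1 * qd) * (ennreal N * ennreal k2) = ennreal (k1 * qd * (N * k2))"
        using k1(1) k2(1) qd N0 by (simp add: ennreal_mult mult.assoc)
      also have "k1 * qd * (N * k2) = kD / R\<^sup>2 * (Z * N)"
        by (simp add: kD_def qd_def)
      finally show ?thesis .
    qed
    have Dm: "(\<lambda>y. (NNBINT u. (D u y)\<^sup>2)) \<in> borel_measurable lborel"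
      unfolding D_def by measurable
    have GmL: "(\<lambda>y. \<integral>\<^sup>+l. G l y \<partial>count_space \<Lambda>) \<in> borel_measurable lborel"
      by (rule borel_measurable_nn_integral_count_space[OF countable]) simp
    have SG: "(NNBINT y. (\<integral>\<^sup>+l. G l y \<partial>count_space \<Lambda>)) \<le> ennreal Z * S + ennreal (kQ / R\<^sup>2 * (Z * N)) + ennreal (kP * (\<delta> * R)\<^sup>2 * (Z * N))"
    proof -
      have "(NNBINT y. (\<integral>\<^sup>+l. G l y \<partial>count_space \<Lambda>)) = (\<integral>\<^sup>+l. (NNBINT y. G l y) \<partial>count_space \<Lambda>)"
        by (rule nn_integral_count_space_nn_integral[OF countable]) simp
      also have "\<dots> = (\<integral>\<^sup>+l. (NNBINT y. (b l y)\<^sup>2) + (NNBINT y. (q l y)\<^sup>2) + (NNBINT y. (P l y)\<^sup>2) \<partial>count_space \<Lambda>)"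
      proof (intro nn_integral_cong)
        fix l
        show "(NNBINT y. G l y) = (NNBINT y. (b l y)\<^sup>2) + (NNBINT y. (q l y)\<^sup>2) + (NNBINT y. (P l y)\<^sup>2)"
          unfolding G_def by (simp add: nn_integral_add)
      qed
      also have "\<dots> = ennreal Z * S + (\<integral>\<^sup>+l. (NNBINT y. (q l y)\<^sup>2) \<partial>count_space \<Lambda>) + (\<integral>\<^sup>+l. (NNBINT y. (P l y)\<^sup>2) \<partial>count_space \<Lambda>)"
        unfolding nn_integral_count_space_add Sb ..
      also have "\<dots> \<le> ennreal Z * S + ennreal (kQ / R\<^sup>2 * (Z * N)) + ennreal (kP * (\<delta> * R)\<^sup>2 * (Z * N))"
        by (intro add_mono order_refl Sq SP)
      finally show ?thesis .
    qed
    have main: "ennreal (A * (Z * N)) \<le> 8 * (ennreal Z * S + ennreal (kQ / R\<^sup>2 * (Z * N)) + ennreal (kP * (\<delta> * R)\<^sup>2 * (Z * N))) + 2 * ennreal A * ennreal (kD / R\<^sup>2 * (Z * N))"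
    proof -
      have "ennreal (A * (Z * N)) = ennreal A * ennreal (Z * N)" using A Z(1) N0 by (simp add: ennreal_mult)
      also have "\<dots> = (NNBINT y. ennreal A * (NNBINT u. ennreal ((tent R y u)\<^sup>2) * (F u)\<^sup>2))"
        unfolding mass[symmetric] by (rule nn_integral_cmult[symmetric]) measurable
      also have "\<dots> \<le> (NNBINT y. 8 * (\<integral>\<^sup>+l. G l y \<partial>count_space \<Lambda>) + 2 * ennreal A * (NNBINT u. (D u y)\<^sup>2))"
        by (intro nn_integral_mono ptw)
      also have "\<dots> = 8 * (NNBINT y. (\<integral>\<^sup>+l. G l y \<partial>count_space \<Lambda>)) + 2 * ennreal A * (NNBINT y. (NNBINT u. (D u y)\<^sup>2))"
        using Dm GmL by (simp add: nn_integral_add nn_integral_cmult)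
      also have "\<dots> \<le> 8 * (ennreal Z * S + ennreal (kQ / R\<^sup>2 * (Z * N)) + ennreal (kP * (\<delta> * R)\<^sup>2 * (Z * N))) + 2 * ennreal A * ennreal (kD / R\<^sup>2 * (Z * N))"
        by (intro add_mono mult_left_mono SG SD) auto
      finally show ?thesis .
    qed
    have "ennreal (A / 16 * N) \<le> S"
    proof (cases S)
      case (real s)
      have k: "kQ / R\<^sup>2 * (Z * N) \<ge> 0" "kP * (\<delta> * R)\<^sup>2 * (Z * N) \<ge> 0" "kD / R\<^sup>2 * (Z * N) \<ge> 0"
        using kpos Z(1) N0 by auto
      have "8 * (ennreal Z * S + ennreal (kQ / R\<^sup>2 * (Z * N)) + ennreal (kP * (\<delta> * R)\<^sup>2 * (Z * N))) + 2 * ennreal A * ennreal (kD / R\<^sup>2 * (Z * N))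
         = ennreal (8 * (Z * s + kQ / R\<^sup>2 * (Z * N) + kP * (\<delta> * R)\<^sup>2 * (Z * N)) + 2 * A * (kD / R\<^sup>2 * (Z * N)))"
      proof -
        have n8: "(8::ennreal) = ennreal 8" and n2: "(2::ennreal) = ennreal 2" by simp_all
        show ?thesis unfolding n8 n2 real(2) using k real(1) Z(1) A
          by (simp only: ennreal_mult[symmetric] ennreal_plus[symmetric] mult_nonneg_nonneg add_nonneg_nonneg less_imp_le zero_le_numeral)
      qed
      moreover have "0 \<le> 8 * (Z * s + kQ / R\<^sup>2 * (Z * N) + kP * (\<delta> * R)\<^sup>2 * (Z * N)) + 2 * A * (kD / R\<^sup>2 * (Z * N))"
        using kpos N0 real(1) Z(1) A by (intro add_nonneg_nonneg mult_nonneg_nonneg) auto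
      ultimately have "A * (Z * N) \<le> 8 * (Z * s + kQ / R\<^sup>2 * (Z * N) + kP * (\<delta> * R)\<^sup>2 * (Z * N)) + 2 * A * (kD / R\<^sup>2 * (Z * N))"
        using main by (simp only: ennreal_le_iff)
      also have "\<dots> = 8 * Z * s + (8 * kQ / R\<^sup>2 + 2 * A * kD / R\<^sup>2) * (Z * N) + (8 * kP * (\<delta> * R)\<^sup>2) * (Z * N)"
        by (simp add: algebra_simps)
      also have "\<dots> \<le> 8 * Z * s + A / 4 * (Z * N) + A / 4 * (Z * N)"
        using Z(1) N0 by (intro add_mono order_refl mult_right_mono RR \<delta>P) auto
      \<comment> \<open>Half of A is spent on errors; the other half, divided by the 8 in front of
        the sum, leaves A / 16.\<close>
      finally have "Z * (A / 16 * N) \<le> Z * s" by (simp add: algebra_simps)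
      then have "A / 16 * N \<le> s" using Z(1) by simp
      then show ?thesis unfolding real(2) by (rule ennreal_leI)
    qed simp
    then show "ennreal (A / 16 * (l2norm f)\<^sup>2) \<le> (\<integral>\<^sup>+l. ennreal ((cmod (l2inner f (tfs (\<Psi> l) \<gamma>)))\<^sup>2) \<partial>count_space \<Lambda>)"
      by (simp add: S_def c_def N_def)
  qed
qed

text \<open>A Lipschitz estimate that keeps Gaussian decay at both end points. At distance at least
  1 the sum of the two values suffices; at smaller distance the norms of x and y differ by less than
  1, so each linear factor can be attached to its own Gaussian.\<close>

lemma gexp_diff_le:
  fixes x y :: "'b::euclidean_space"
  assumes c: "c > 0"
  shows "\<bar>gexp c x - gexp c y\<bar> \<le> 2 * (c + 1) * norm (x - y) * ((1 + norm x) * gexp c x + (1 + norm y) * gexp c y)"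
proof -
  define s where "s = (1 + norm x) * gexp c x + (1 + norm y) * gexp c y"
  have s1: "gexp c x + gexp c y \<le> s"
    unfolding s_def using mult_nonneg_nonneg[of "norm x" "gexp c x"] mult_nonneg_nonneg[of "norm y" "gexp c y"]
    by (simp add: distrib_right)
  have s0: "s \<ge> 0" by (simp add: s_def)
  show ?thesis
  proof (cases "norm (x - y) \<ge> 1")
    case True
    have "\<bar>gexp c x - gexp c y\<bar> \<le> gexp c x + gexp c y"
      by (simp add: abs_le_iff add_increasing add_increasing2)
    also have "\<dots> \<le> 1 * s" using s1 by simp
    also have "\<dots> \<le> (2 * (c + 1) * norm (x - y)) * s"
    proof (rule mult_right_mono[OF _ s0])
      have "1 * 1 \<le> (2 * (c + 1)) * norm (x - y)" using c True by (intro mult_mono) auto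
      then show "1 \<le> 2 * (c + 1) * norm (x - y)" by simp
    qed
    finally show ?thesis by (simp add: s_def)
  next
    case False
    have exp_lip: "\<bar>exp (- a) - exp (- b)\<bar> \<le> \<bar>a - b\<bar> * (exp (- a) + exp (- b))" for a b :: real
    proof -
      have one: "exp (- a) - exp (- b) \<le> \<bar>a - b\<bar> * (exp (- a) + exp (- b))" if "a \<le> b" for a b :: real
      proof -
        have "1 - exp (- (b - a)) \<le> b - a" using exp_ge_add_one_self[of "- (b - a)"] by linarith
        then have "exp (- a) * (1 - exp (- (b - a))) \<le> exp (- a) * (b - a)" by (intro mult_left_mono) auto
        then have "exp (- a) - exp (- b) \<le> exp (- a) * (b - a)" by (simp add: right_diff_distrib exp_add[symmetric])
        also have "\<dots> \<le> (exp (- a) + exp (- b)) * (b - a)" using that by (intro mult_right_mono) auto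
        finally show ?thesis using that by (simp add: mult.commute)
      qed
      show ?thesis
      proof (cases "a \<le> b")
        case True
        then show ?thesis using one[OF True] by simp
      next
        case False
        then show ?thesis using one[of b a] by (simp add: abs_minus_commute add.commute)
      qed
    qed
    have "\<bar>gexp c x - gexp c y\<bar> \<le> \<bar>c * (norm x)\<^sup>2 - c * (norm y)\<^sup>2\<bar> * (gexp c x + gexp c y)"
      using exp_lip[of "c * (norm x)\<^sup>2" "c * (norm y)\<^sup>2"] by (simp add: gexp_def)
    also have "\<bar>c * (norm x)\<^sup>2 - c * (norm y)\<^sup>2\<bar> = c * (\<bar>norm x - norm y\<bar> * (norm x + norm y))"
    proof -
      have "c * (norm x)\<^sup>2 - c * (norm y)\<^sup>2 = c * ((norm x - norm y) * (norm x + norm y))"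
        by (simp add: power2_eq_square algebra_simps)
      then show ?thesis using c by (simp add: abs_mult)
    qed
    also have "c * (\<bar>norm x - norm y\<bar> * (norm x + norm y)) * (gexp c x + gexp c y) \<le> c * (norm (x - y) * (norm x + norm y)) * (gexp c x + gexp c y)"
      using c by (intro mult_right_mono mult_left_mono norm_triangle_ineq3) auto
    also have "\<dots> = c * norm (x - y) * ((norm x + norm y) * gexp c x + (norm x + norm y) * gexp c y)"
      by (simp add: algebra_simps)
    also have "\<dots> \<le> c * norm (x - y) * ((2 * (1 + norm x)) * gexp c x + (2 * (1 + norm y)) * gexp c y)"
    proof (intro mult_left_mono add_mono mult_right_mono)
      have d: "\<bar>norm x - norm y\<bar> < 1" using norm_triangle_ineq3[of x y] False by linarith
      show "norm x + norm y \<le> 2 * (1 + norm x)" using d by (simp add: abs_less_iff)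
      show "norm x + norm y \<le> 2 * (1 + norm y)" using d by (simp add: abs_less_iff)
    qed (use c in auto)
    also have "\<dots> = 2 * c * norm (x - y) * s" by (simp add: s_def algebra_simps)
    also have "\<dots> \<le> 2 * (c + 1) * norm (x - y) * s" using s0 by (intro mult_right_mono) auto
    finally show ?thesis by (simp add: s_def)
  qed
qed

lemma norm_1_minus_cis_le: "cmod (1 - cis t) \<le> \<bar>t\<bar>"
proof -
  have "(cmod (1 - cis t))\<^sup>2 = 2 - 2 * cos t"
    unfolding cmod_power2 by (simp add: power2_eq_square algebra_simps)
  also have "\<dots> = (2 * sin (t / 2))\<^sup>2"
    using cos_double_sin[of "t / 2"] by (simp add: power2_eq_square)
  also have "\<dots> \<le> \<bar>t\<bar>\<^sup>2"
  proof -
    have "\<bar>2 * sin (t / 2)\<bar> \<le> \<bar>t\<bar>" using abs_sin_x_le_abs_x[of "t / 2"] by simp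
    then show ?thesis by (metis abs_ge_zero power2_abs power_mono)
  qed
  finally show ?thesis by (rule power2_le_imp_le) simp
qed

text \<open>Both estimates are proved for a single packet at q, uniformly for norm q \<le> Q, and
  then integrated against \<open>H\<close>. The rate falls from pi / 2 to pi / 4 when the linear
  factor is absorbed and to pi / 8 when the centre q is moved to the origin.\<close>

lemma truncated_window:
  fixes H :: "'a::euclidean_space \<times> 'a \<Rightarrow> complex"
  assumes H: "integrable lborel H" and Q: "Q \<ge> 0" and supp: "\<And>q. norm q > Q \<Longrightarrow> H q = 0"
  obtains C where "C \<ge> 0"
    "\<And>p. cmod (gstft (synth H) p) \<le> C * gexp (pi / 8) p"
    "\<And>\<epsilon> p. cmod (gstft (\<lambda>x. synth H x - tfs \<epsilon> (synth H) x) p) \<le> C * norm \<epsilon> * (gexp (pi / 8) p + gexp (pi / 8) (p - \<epsilon>))"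
proof -
  define N where "N = (LBINT q. cmod (H q))"
  have N: "N \<ge> 0" by (simp add: N_def)
  define e where "e = exp (1 / pi) * exp (pi / 4 * Q\<^sup>2)"
  have e: "e \<ge> 0" by (simp add: e_def)
  define c1 where "c1 = 2 * (pi / 2 + 1) + pi * (2 * Q + 1)"
  have c1: "c1 \<ge> 1" using Q by (simp add: c1_def add_increasing)
  have shift: "(1 + norm (q - p)) * gexp (pi / 2) (q - p) \<le> e * gexp (pi / 8) p" if "norm q \<le> Q" for q p :: "'a \<times> 'a"
  proof -
    have "(1 + norm (q - p)) ^ 1 * gexp (pi / 2) (q - p) \<le> exp ((real 1)\<^sup>2 / (2 * (pi / 2))) * gexp (pi / 2 / 2) (q - p)"
      by (rule norm_add_gexp_le) simp
    then have 1: "(1 + norm (q - p)) * gexp (pi / 2) (q - p) \<le> exp (1 / pi) * gexp (pi / 4) (q - p)" by simp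
    have "norm p \<le> norm (q - p) + Q" using norm_triangle_ineq4[of q "q - p"] that by simp
    then have "(norm p)\<^sup>2 \<le> (norm (q - p) + Q)\<^sup>2" by (intro power_mono) auto
    also have "\<dots> \<le> 2 * (norm (q - p))\<^sup>2 + 2 * Q\<^sup>2"
      using zero_le_power2[of "norm (q - p) - Q"] by (simp add: power2_eq_square algebra_simps)
    finally have "pi / 8 * (norm p)\<^sup>2 \<le> pi / 8 * (2 * (norm (q - p))\<^sup>2 + 2 * Q\<^sup>2)" by (intro mult_left_mono) auto
    then have "gexp (pi / 4) (q - p) \<le> exp (pi / 4 * Q\<^sup>2) * gexp (pi / 8) p"
      by (simp add: gexp_def exp_add[symmetric] algebra_simps)
    then have "exp (1 / pi) * gexp (pi / 4) (q - p) \<le> exp (1 / pi) * (exp (pi / 4 * Q\<^sup>2) * gexp (pi / 8) p)" by (intro mult_left_mono) auto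
    from order_trans[OF 1 this] show ?thesis by (simp only: e_def mult.assoc)
  qed
  have shift0: "gexp (pi / 2) (q - p) \<le> e * gexp (pi / 8) p" if "norm q \<le> Q" for q p :: "'a \<times> 'a"
  proof -
    have "1 * gexp (pi / 2) (q - p) \<le> (1 + norm (q - p)) * gexp (pi / 2) (q - p)" by (intro mult_right_mono) auto
    from order_trans[OF this shift[OF that, of p]] show ?thesis by simp
  qed
  have kern: "cmod (l2inner (wp q) (wp p) - cis (pi * sympl \<epsilon> p) * l2inner (wp q) (wp (p - \<epsilon>))) \<le> norm \<epsilon> * (c1 * e * (gexp (pi / 8) p + gexp (pi / 8) (p - \<epsilon>)))"
    if q: "norm q \<le> Q" for q p \<epsilon> :: "'a \<times> 'a"
  proof -
    define x where "x = q - p"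
    define y where "y = q - (p - \<epsilon>)"
    define t where "t = pi * sympl \<epsilon> (q + p)"
    \<comment> \<open>Collects the phases of the two overlaps, so that their difference splits into
      a difference of Gaussians and one explicit phase error t.\<close>
    have ph: "cis (pi * sympl \<epsilon> p) * cis (pi * sympl q (p - \<epsilon>)) = cis (pi * sympl q p) * cis t"
      unfolding cis_mult by (rule cis_cong) (simp add: t_def sympl_simps sympl_swap[of q \<epsilon>] algebra_simps)
    have "l2inner (wp q) (wp p) - cis (pi * sympl \<epsilon> p) * l2inner (wp q) (wp (p - \<epsilon>))
      = cis (pi * sympl q p) * complex_of_real (gexp (pi / 2) x) - (cis (pi * sympl \<epsilon> p) * cis (pi * sympl q (p - \<epsilon>))) * complex_of_real (gexp (pi / 2) y)"
      unfolding l2inner_wp_wp x_def y_def gexp_def by (simp only: mult.assoc)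
    also have "\<dots> = cis (pi * sympl q p) * (complex_of_real (gexp (pi / 2) x - gexp (pi / 2) y) + (1 - cis t) * complex_of_real (gexp (pi / 2) y))"
      unfolding ph by (simp add: algebra_simps)
    finally have "cmod (l2inner (wp q) (wp p) - cis (pi * sympl \<epsilon> p) * l2inner (wp q) (wp (p - \<epsilon>)))
      = cmod (complex_of_real (gexp (pi / 2) x - gexp (pi / 2) y) + (1 - cis t) * complex_of_real (gexp (pi / 2) y))"
      by (simp only: norm_mult norm_cis mult_1)
    also have "\<dots> \<le> \<bar>gexp (pi / 2) x - gexp (pi / 2) y\<bar> + \<bar>t\<bar> * gexp (pi / 2) y"
      using norm_1_minus_cis_le[of t]
      by (intro order_trans[OF norm_triangle_ineq] add_mono) (auto simp: norm_mult intro!: mult_right_mono simp del: of_real_diff)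
    also have "\<dots> \<le> 2 * (pi / 2 + 1) * norm \<epsilon> * ((1 + norm x) * gexp (pi / 2) x + (1 + norm y) * gexp (pi / 2) y) + (pi * (norm \<epsilon> * ((2 * Q + 1) * (1 + norm y)))) * gexp (pi / 2) y"
    proof (intro add_mono mult_right_mono)
      have "norm (x - y) = norm \<epsilon>" by (simp add: x_def y_def)
      then show "\<bar>gexp (pi / 2) x - gexp (pi / 2) y\<bar> \<le> 2 * (pi / 2 + 1) * norm \<epsilon> * ((1 + norm x) * gexp (pi / 2) x + (1 + norm y) * gexp (pi / 2) y)"
        using gexp_diff_le[of "pi / 2" x y] by simp
      \<comment> \<open>Here q + p = 2 q - y + \<epsilon>, and \<epsilon> pairs to 0 with itself; so
        the phase error is linear in \<epsilon> with a slope bounded by Q and norm y, the latter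
        absorbed by the Gaussian at y.\<close>
      have "sympl \<epsilon> (q + p) = sympl \<epsilon> (2 *\<^sub>R q - y)"
        by (simp add: y_def sympl_simps)
      then have "\<bar>sympl \<epsilon> (q + p)\<bar> \<le> norm \<epsilon> * norm (2 *\<^sub>R q - y)" by (simp only: abs_sympl_le)
      also have "\<dots> \<le> norm \<epsilon> * ((2 * Q + 1) * (1 + norm y))"
      proof (intro mult_left_mono)
        have "norm (2 *\<^sub>R q - y) \<le> 2 * Q + norm y"
          using norm_triangle_ineq4[of "2 *\<^sub>R q" y] q by simp
        also have "\<dots> \<le> (2 * Q + 1) * (1 + norm y)" using Q by (simp add: algebra_simps)
        finally show "norm (2 *\<^sub>R q - y) \<le> (2 * Q + 1) * (1 + norm y)" .
      qed simp
      finally show "\<bar>t\<bar> \<le> pi * (norm \<epsilon> * ((2 * Q + 1) * (1 + norm y)))" by (simp add: t_def abs_mult)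
    qed simp
    also have "\<dots> = norm \<epsilon> * (2 * (pi / 2 + 1) * ((1 + norm x) * gexp (pi / 2) x) + c1 * ((1 + norm y) * gexp (pi / 2) y))"
      by (simp add: c1_def algebra_simps)
    also have "\<dots> \<le> norm \<epsilon> * (c1 * (e * gexp (pi / 8) p) + c1 * (e * gexp (pi / 8) (p - \<epsilon>)))"
    proof (intro mult_left_mono add_mono)
      show "2 * (pi / 2 + 1) * ((1 + norm x) * gexp (pi / 2) x) \<le> c1 * (e * gexp (pi / 8) p)"
        by (rule mult_mono) (use shift[OF q, of p] Q c1 in \<open>auto simp: x_def c1_def\<close>)
      show "(1 + norm y) * gexp (pi / 2) y \<le> e * gexp (pi / 8) (p - \<epsilon>)"
        unfolding y_def by (rule shift[OF q])
    qed (use c1 in auto)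
    also have "\<dots> = norm \<epsilon> * (c1 * e * (gexp (pi / 8) p + gexp (pi / 8) (p - \<epsilon>)))" by (simp add: algebra_simps)
    finally show ?thesis .
  qed
  have ik: "integrable lborel (\<lambda>q. H q * l2inner (wp q) (wp p))" for p
  proof (rule Bochner_Integration.integrable_bound[OF H])
    have [measurable]: "H \<in> borel_measurable borel" using H by auto
    have [measurable]: "gstft (wp p) \<in> borel_measurable borel" by (rule borel_measurable_gstft[OF sq_int_wp])
    have "(\<lambda>q. H q * cnj (gstft (wp p) q)) \<in> borel_measurable lborel" by measurable
    then show "(\<lambda>q. H q * l2inner (wp q) (wp p)) \<in> borel_measurable lborel"
      by (simp add: gstft_def l2inner_cnj)
    show "AE q in lborel. norm (H q * l2inner (wp q) (wp p)) \<le> norm (H q)"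
      by (intro AE_I2) (simp add: norm_mult l2inner_wp_wp_gexp mult_left_le gexp_le_1)
  qed
  have val: "gstft (synth H) p = (LBINT q. H q * l2inner (wp q) (wp p))" for p
    unfolding gstft_def[of "synth H"] l2inner_synth[OF H sq_int_wp] by (simp add: gstft_def l2inner_cnj)
  have bnd: "cmod (LBINT q. H q * k q) \<le> c * N" if k: "\<And>q. norm q \<le> Q \<Longrightarrow> cmod (k q) \<le> c" and c: "c \<ge> 0"
    and i: "integrable lborel (\<lambda>q. H q * k q)" for k c
  proof -
    have "cmod (LBINT q. H q * k q) \<le> (LBINT q. c * cmod (H q))"
    proof (rule Bochner_Integration.integral_norm_bound_integral[OF i])
      show "integrable lborel (\<lambda>q. c * cmod (H q))" using H by auto
      show "norm (H q * k q) \<le> c * cmod (H q)" for q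
        using mult_right_mono[OF k[of q], of "cmod (H q)"] supp[of q] by (cases "norm q \<le> Q") (auto simp: norm_mult mult.commute)
    qed
    then show ?thesis by (simp add: N_def)
  qed
  show thesis
  proof (rule that)
    show "c1 * e * N \<ge> 0" using c1 e N by simp
    show "cmod (gstft (synth H) p) \<le> (c1 * e * N) * gexp (pi / 8) p" for p
    proof -
      have "cmod (gstft (synth H) p) \<le> (e * gexp (pi / 8) p) * N"
        unfolding val by (rule bnd[OF _ _ ik]) (use shift0[of _ p] e in \<open>auto simp: l2inner_wp_wp_gexp\<close>)
      also have "\<dots> \<le> (c1 * e * gexp (pi / 8) p) * N"
        using mult_right_mono[OF c1 e] by (intro mult_right_mono N) auto
      finally show ?thesis by (simp add: ac_simps)
    qed
    show "cmod (gstft (\<lambda>x. synth H x - tfs \<epsilon> (synth H) x) p) \<le> (c1 * e * N) * norm \<epsilon> * (gexp (pi / 8) p + gexp (pi / 8) (p - \<epsilon>))" for \<epsilon> p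
    proof -
      have i3: "integrable lborel (\<lambda>q. H q * (l2inner (wp q) (wp p) - cis (pi * sympl \<epsilon> p) * l2inner (wp q) (wp (p - \<epsilon>))))"
        using Bochner_Integration.integrable_diff[OF ik[of p] integrable_mult_right[OF ik[of "p - \<epsilon>"], of "cis (pi * sympl \<epsilon> p)"]]
        by (simp add: algebra_simps)
      have "gstft (\<lambda>x. synth H x - tfs \<epsilon> (synth H) x) p = gstft (synth H) p - cis (pi * sympl \<epsilon> p) * gstft (synth H) (p - \<epsilon>)"
        by (simp add: gstft_diff sq_int_synth[OF H] sq_int_tfs gstft_tfs)
      also have "\<dots> = (LBINT q. H q * (l2inner (wp q) (wp p) - cis (pi * sympl \<epsilon> p) * l2inner (wp q) (wp (p - \<epsilon>))))"
      proof -
        have "(LBINT q. H q * (l2inner (wp q) (wp p) - cis (pi * sympl \<epsilon> p) * l2inner (wp q) (wp (p - \<epsilon>))))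
           = (LBINT q. H q * l2inner (wp q) (wp p) - cis (pi * sympl \<epsilon> p) * (H q * l2inner (wp q) (wp (p - \<epsilon>))))"
          by (intro Bochner_Integration.integral_cong) (auto simp: algebra_simps)
        then show ?thesis using ik by (simp add: val)
      qed
      finally have "cmod (gstft (\<lambda>x. synth H x - tfs \<epsilon> (synth H) x) p) \<le> (norm \<epsilon> * (c1 * e * (gexp (pi / 8) p + gexp (pi / 8) (p - \<epsilon>)))) * N"
        using bnd[OF kern _ i3] c1 e by simp
      then show ?thesis by (simp add: ac_simps)
    qed
  qed
qed

lemma coefficient_sum_split:
  assumes f: "sq_int f" and g: "sq_int g" "sq_int h"
  shows "(\<integral>\<^sup>+l. ennreal ((cmod (l2inner f (tfs (\<mu> l) g)))\<^sup>2) \<partial>count_space \<Lambda>)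
    \<le> 2 * ((\<integral>\<^sup>+l. ennreal ((cmod (l2inner f (tfs (\<mu> l) h)))\<^sup>2) \<partial>count_space \<Lambda>)
      + (\<integral>\<^sup>+l. ennreal ((cmod (l2inner f (tfs (\<mu> l) (\<lambda>x. g x - h x))))\<^sup>2) \<partial>count_space \<Lambda>))"
proof -
  have "(\<integral>\<^sup>+l. ennreal ((cmod (l2inner f (tfs (\<mu> l) g)))\<^sup>2) \<partial>count_space \<Lambda>)
    \<le> (\<integral>\<^sup>+l. 2 * (ennreal ((cmod (l2inner f (tfs (\<mu> l) h)))\<^sup>2) + ennreal ((cmod (l2inner f (tfs (\<mu> l) (\<lambda>x. g x - h x))))\<^sup>2)) \<partial>count_space \<Lambda>)"
  proof (intro nn_integral_mono)
    fix l
    have "l2inner f (tfs (\<mu> l) g) = l2inner f (tfs (\<mu> l) h) + l2inner f (tfs (\<mu> l) (\<lambda>x. g x - h x))"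
      unfolding tfs_diff by (subst l2inner_diff_right) (auto intro!: sq_int_tfs f g)
    then have "cmod (l2inner f (tfs (\<mu> l) g)) \<le> cmod (l2inner f (tfs (\<mu> l) h)) + cmod (l2inner f (tfs (\<mu> l) (\<lambda>x. g x - h x)))"
      by (simp only: norm_triangle_ineq)
    then have "ennreal (cmod (l2inner f (tfs (\<mu> l) g))) \<le> ennreal (cmod (l2inner f (tfs (\<mu> l) h))) + ennreal (cmod (l2inner f (tfs (\<mu> l) (\<lambda>x. g x - h x))))"
      by (simp flip: ennreal_plus)
    then have "(ennreal (cmod (l2inner f (tfs (\<mu> l) g))))\<^sup>2 \<le> (ennreal (cmod (l2inner f (tfs (\<mu> l) h))) + ennreal (cmod (l2inner f (tfs (\<mu> l) (\<lambda>x. g x - h x)))))\<^sup>2"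
      by (intro power_mono) auto
    also note ennreal_add_sq_le
    finally show "ennreal ((cmod (l2inner f (tfs (\<mu> l) g)))\<^sup>2) \<le> 2 * (ennreal ((cmod (l2inner f (tfs (\<mu> l) h)))\<^sup>2) + ennreal ((cmod (l2inner f (tfs (\<mu> l) (\<lambda>x. g x - h x))))\<^sup>2))"
      by (simp add: ennreal_power)
  qed
  also have "\<dots> = 2 * (\<integral>\<^sup>+l. (ennreal ((cmod (l2inner f (tfs (\<mu> l) h)))\<^sup>2) + ennreal ((cmod (l2inner f (tfs (\<mu> l) (\<lambda>x. g x - h x))))\<^sup>2)) \<partial>count_space \<Lambda>)"
    by (rule nn_integral_cmult) simp
  finally show ?thesis by (simp add: nn_integral_count_space_add)
qed

lemma cmod_stft_gauss: "cmod (stft gauss f z) = cmod (gstft f z)"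
  unfolding stft_def gstft_def wp_def by (simp add: l2inner_scale_right norm_mult)

lemma M1_gstft_integrable: "M1 f \<Longrightarrow> integrable lborel (gstft f)"
  using borel_measurable_gstft[of f] unfolding M1_def cmod_stft_gauss
  by (auto simp: integrable_norm_iff)

text \<open>By the reproducing formula the coefficients of the error are bounded by the tail of
  \<open>gstft g\<close> convolved with a Gaussian, so their L^1 norm is at most the constant k
  times the L^1 norm of the tail, which dominated convergence makes small.\<close>

lemma truncation_small:
  fixes g :: "'a::euclidean_space \<Rightarrow> complex"
  assumes g: "sq_int g" and i: "integrable lborel (gstft g)" and \<eta>: "\<eta> > 0"
  obtains Q where "Q \<ge> 0"
    "(NNBINT p. ennreal (cmod (gstft (\<lambda>x. g x - synth (\<lambda>q. indicator (cball 0 Q) q *\<^sub>R gstft g q) x) p))) \<le> ennreal \<eta>"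
proof -
  have [measurable]: "gstft g \<in> borel_measurable borel" by (rule borel_measurable_gstft[OF g])
  obtain k where k: "k \<ge> 0" "(NNBINT p. ennreal (gexp (pi / 2) (p::'a \<times> 'a))) = ennreal k"
    using nn_integral_gexp_real[of "pi / 2", where 'b="'a \<times> 'a"] by auto
  have [measurable]: "cball (0 :: 'a \<times> 'a) (real n) \<in> sets borel" for n by simp
  define T where "T n q = (1 - indicator (cball 0 (real n)) q) *\<^sub>R gstft g q" for n and q :: "'a \<times> 'a"
  have Tm [measurable]: "T n \<in> borel_measurable borel" for n unfolding T_def by measurable
  have "(\<lambda>n. (LBINT q. cmod (T n q))) \<longlonglongrightarrow> (\<integral>q. 0 \<partial>(lborel :: ('a \<times> 'a) measure))"
  proof (rule integral_dominated_convergence[where w="\<lambda>q. cmod (gstft g q)"])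
    show "integrable lborel (\<lambda>q. cmod (gstft g q))" using i by auto
    show "AE q in lborel. (\<lambda>n. cmod (T n q)) \<longlonglongrightarrow> 0"
    proof (rule AE_I2)
      fix q :: "'a \<times> 'a"
      have "\<forall>\<^sub>F n in sequentially. norm q \<le> real n" by real_asymp
      then show "(\<lambda>n. cmod (T n q)) \<longlonglongrightarrow> 0"
        by (intro tendsto_eventually, elim eventually_mono) (simp add: T_def)
    qed
    show "AE q in lborel. norm (cmod (T n q)) \<le> cmod (gstft g q)" for n
      by (intro AE_I2) (auto simp: T_def indicator_def)
  qed auto
  then have "(\<lambda>n. k * (LBINT q. cmod (T n q))) \<longlonglongrightarrow> k * 0"
    by (intro tendsto_intros) simp
  then have "\<forall>\<^sub>F n in sequentially. k * (LBINT q. cmod (T n q)) < \<eta>"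
    by (rule order_tendstoD(2)) (use \<eta> in simp)
  then obtain n where n: "k * (LBINT q. cmod (T n q)) < \<eta>" by (meson eventually_sequentially order_refl)
  define H where "H q = indicator (cball 0 (real n)) q *\<^sub>R gstft g q" for q :: "'a \<times> 'a"
  have H: "integrable lborel H" unfolding H_def[abs_def]
    by (rule Bochner_Integration.integrable_bound[OF i]) (auto simp: indicator_def)
  have Ti: "integrable lborel (T n)"
    by (rule Bochner_Integration.integrable_bound[OF i]) (auto simp: T_def indicator_def)
  have ptw: "ennreal (cmod (gstft (\<lambda>x. g x - synth H x) p)) \<le> (NNBINT q. ennreal (cmod (T n q)) * ennreal (gexp (pi / 2) (p - q)))" for p
  proof -
    have i1: "integrable lborel (\<lambda>q. gstft g q * cnj (gstft (wp p) q))"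
      by (rule sq_int_mult_integrable[OF sq_int_gstft[OF g] sq_int_gstft[OF sq_int_wp]])
    have i2: "integrable lborel (\<lambda>q. H q * cnj (gstft (wp p) q))"
    proof (rule Bochner_Integration.integrable_bound[OF i1])
      have [measurable]: "gstft (wp p) \<in> borel_measurable borel" by (rule borel_measurable_gstft[OF sq_int_wp])
      show "(\<lambda>q. H q * cnj (gstft (wp p) q)) \<in> borel_measurable lborel" unfolding H_def by measurable
    qed (auto simp: H_def norm_mult indicator_def)
    have "gstft (\<lambda>x. g x - synth H x) p = (LBINT q. gstft g q * cnj (gstft (wp p) q)) - (LBINT q. H q * cnj (gstft (wp p) q))"
      unfolding gstft_diff[OF g sq_int_synth[OF H]] gstft_def[of _ p]
      by (simp only: l2inner_eq_gstft[OF g sq_int_wp] l2inner_synth[OF H sq_int_wp])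
    also have "\<dots> = (LBINT q. T n q * cnj (gstft (wp p) q))"
      using i1 i2 by (subst Bochner_Integration.integral_diff[symmetric])
        (auto simp: T_def H_def algebra_simps intro!: Bochner_Integration.integral_cong)
    finally have "ennreal (cmod (gstft (\<lambda>x. g x - synth H x) p)) \<le> (NNBINT q. ennreal (cmod (T n q * cnj (gstft (wp p) q))))"
      by (simp only: norm_integral_le_nn)
    then show ?thesis by (simp add: norm_mult gstft_def l2inner_wp_wp_gexp ennreal_mult)
  qed
  have "(NNBINT p. ennreal (cmod (gstft (\<lambda>x. g x - synth H x) p)))
     \<le> (NNBINT p. (NNBINT q. ennreal (cmod (T n q)) * ennreal (gexp (pi / 2) (p - q))))"
    by (intro nn_integral_mono ptw)
  also have "\<dots> = (NNBINT q. (NNBINT p. ennreal (cmod (T n q)) * ennreal (gexp (pi / 2) (p - q))))"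
    by (rule lborel_pair.Fubini') measurable
  also have "\<dots> = (NNBINT q. ennreal (cmod (T n q)) * ennreal k)"
    by (intro nn_integral_cong, subst nn_integral_cmult, measurable) (simp add: nn_integral_gexp_translate k(2))
  also have "\<dots> = (NNBINT q. ennreal (cmod (T n q))) * ennreal k" by (rule nn_integral_multc) measurable
  also have "(NNBINT q. ennreal (cmod (T n q))) = ennreal (LBINT q. cmod (T n q))"
    using Ti by (intro nn_integral_eq_integral) auto
  also have "\<dots> * ennreal k = ennreal (k * (LBINT q. cmod (T n q)))"
    using k by (simp add: ennreal_mult mult.commute)
  also have "\<dots> \<le> ennreal \<eta>" using n by (intro ennreal_leI) simp
  finally show thesis by (intro that[of "real n"]) (simp_all add: H_def[abs_def])
qed

lemma ennreal_double_add:
  assumes "s \<ge> 0" "q \<ge> 0"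
  shows "2 * (ennreal s + ennreal q) = ennreal (2 * (s + q))"
proof -
  have "ennreal (2 * (s + q)) = ennreal 2 * ennreal (s + q)" by (rule ennreal_mult) (use assms in auto)
  then show ?thesis using assms by (simp only: ennreal_plus) simp
qed

text \<open>The window is truncated first; the deformation theorem is applied to the truncated
  window, whose coefficients decay like a Gaussian; finally that window is exchanged for
  \<open>h\<close>. Both exchanges cost a Bessel bound, uniform over the deformations since the
  point count is.\<close>

theorem gabor_frame_stability:
  fixes g :: "'a::euclidean_space \<Rightarrow> complex"
  assumes M1: "M1 g" and frame: "gabor_frame g \<Lambda>"
  obtains \<delta> where "\<delta> > 0"
    "\<And>\<Psi> h. (\<And>z w. norm ((\<Psi> z - z) - (\<Psi> w - w)) \<le> \<delta> * norm (z - w)) \<Longrightarrow> sq_int h \<Longrightarrow>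
      (NNBINT p. ennreal (cmod (gstft (\<lambda>x. h x - g x) p))) \<le> ennreal \<delta> \<Longrightarrow> gabor_frame h (\<Psi> ` \<Lambda>)"
proof -
  obtain A B where g: "sq_int g" and AB: "A > 0" "B > 0"
    and fr: "\<And>f. sq_int f \<Longrightarrow> ennreal (A * (l2norm f)\<^sup>2) \<le> (\<integral>\<^sup>+l. ennreal ((cmod (l2inner f (tfs l g)))\<^sup>2) \<partial>count_space \<Lambda>)"
      "\<And>f. sq_int f \<Longrightarrow> (\<integral>\<^sup>+l. ennreal ((cmod (l2inner f (tfs l g)))\<^sup>2) \<partial>count_space \<Lambda>) \<le> ennreal (B * (l2norm f)\<^sup>2)"
    using frame unfolding gabor_frame_def by blast
  have ig: "integrable lborel (gstft g)" by (rule M1_gstft_integrable[OF M1])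
  have [measurable]: "gstft g \<in> borel_measurable borel" by (rule borel_measurable_gstft[OF g])
  obtain r M where r: "r > 0" and cnt: "ball_count_le id \<Lambda> r M"
    using gabor_frame_ball_count[OF frame] by blast
  note countable = ball_count_le_countable[OF cnt r]
  have r4: "r / 4 > 0" and pi2: "pi / 2 > 0" using r by auto
  obtain K where K: "K \<ge> 0"
    "\<And>(\<mu> :: 'a \<times> 'a \<Rightarrow> 'a \<times> 'a) \<Lambda> v. ball_count_le \<mu> \<Lambda> (r / 4) M \<Longrightarrow>
       (\<integral>\<^sup>+l. ennreal (gexp (pi / 2) (v - \<mu> l)) \<partial>count_space \<Lambda>) \<le> ennreal K"
    using overlap_bound[OF r4 pi2] by metis
  obtain k where k: "k \<ge> 0" "(NNBINT p. ennreal (gexp (pi / 2) (p::'a \<times> 'a))) = ennreal k"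
    using nn_integral_gexp_real[OF pi2] by metis
  have bessel: "(\<integral>\<^sup>+l. ennreal ((cmod (l2inner f (tfs (\<mu> l) w)))\<^sup>2) \<partial>count_space \<Lambda>) \<le> ennreal (k * K * \<nu>\<^sup>2 * (l2norm f)\<^sup>2)"
    if c: "ball_count_le \<mu> \<Lambda> (r / 4) M" and f: "sq_int f" and w: "sq_int w" and \<nu>: "\<nu> \<ge> 0"
      "(NNBINT p. ennreal (cmod (gstft w p))) \<le> ennreal \<nu>" for \<mu> :: "'a \<times> 'a \<Rightarrow> 'a \<times> 'a" and f w :: "'a \<Rightarrow> complex" and \<nu>
  proof -
    have "(\<integral>\<^sup>+l. ennreal ((cmod (l2inner f (tfs (\<mu> l) w)))\<^sup>2) \<partial>count_space \<Lambda>)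
      \<le> ennreal k * ennreal K * (NNBINT p. ennreal (cmod (gstft w p)))\<^sup>2 * ennreal ((l2norm f)\<^sup>2)"
      unfolding k(2)[symmetric]
    proof (rule bessel_bound[OF countable f w])
      show "(\<integral>\<^sup>+l. ennreal (gexp (pi / 2) (v - \<mu> l)) \<partial>count_space \<Lambda>) \<le> ennreal K" for v by (rule K(2)[OF c])
    qed
    also have "\<dots> \<le> ennreal k * ennreal K * (ennreal \<nu>)\<^sup>2 * ennreal ((l2norm f)\<^sup>2)"
      by (intro mult_right_mono mult_left_mono power_mono \<nu>(2)) auto
    also have "\<dots> = ennreal (k * K * \<nu>\<^sup>2 * (l2norm f)\<^sup>2)"
      using k(1) K(1) \<nu>(1) by (simp add: ennreal_mult ennreal_power)
    finally show ?thesis .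
  qed
  \<comment> \<open>Each use of \<open>coefficient_sum_split\<close> costs a factor 2 and a Bessel
    error: A becomes A / 4 for the truncated window, A / 64 after the deformation and A / 256 for
    \<open>h\<close>. The value A / 1024 is what the last exchange can afford, the windows there
    being 2 \<eta> apart. The added 1 covers k K = 0.\<close>
  define \<eta> where "\<eta> = sqrt (A / (1024 * (k * K + 1)))"
  have kK: "k * K \<ge> 0" using k K by simp
  have \<eta>: "\<eta> > 0" using AB kK by (simp add: \<eta>_def add_nonneg_pos)
  have k\<eta>: "k * K * \<eta>\<^sup>2 \<le> A / 1024"
  proof -
    have "k * K * \<eta>\<^sup>2 \<le> (k * K + 1) * \<eta>\<^sup>2" by (intro mult_right_mono) auto
    also have "\<dots> = A / 1024"
    proof -
      define D where "D = k * K + 1"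
      have "D > 0" using kK by (simp add: D_def)
      then show ?thesis using AB by (simp add: \<eta>_def D_def[symmetric])
    qed
    finally show ?thesis .
  qed
  obtain Q where Q: "Q \<ge> 0" "(NNBINT p. ennreal (cmod (gstft (\<lambda>x. g x - synth (\<lambda>q. indicator (cball 0 Q) q *\<^sub>R gstft g q) x) p))) \<le> ennreal \<eta>"
    using truncation_small[OF g ig \<eta>] by blast
  define H where "H q = indicator (cball 0 Q) q *\<^sub>R gstft g q" for q :: "'a \<times> 'a"
  define \<gamma> where "\<gamma> = synth H"
  have H: "integrable lborel H"
  proof (rule Bochner_Integration.integrable_bound[OF ig])
    have [measurable]: "cball (0 :: 'a \<times> 'a) Q \<in> sets borel" by simp
    show "H \<in> borel_measurable lborel" unfolding H_def[abs_def] by measurable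
  qed (auto simp: H_def indicator_def)
  have \<gamma>: "sq_int \<gamma>" unfolding \<gamma>_def by (rule sq_int_synth[OF H])
  have g\<gamma>: "(NNBINT p. ennreal (cmod (gstft (\<lambda>x. g x - \<gamma> x) p))) \<le> ennreal \<eta>"
    using Q(2) by (simp add: \<gamma>_def H_def[abs_def])
  obtain C where C: "C \<ge> 0" "\<And>p. cmod (gstft \<gamma> p) \<le> C * gexp (pi / 8) p"
    "\<And>\<epsilon> p. cmod (gstft (\<lambda>x. \<gamma> x - tfs \<epsilon> \<gamma> x) p) \<le> C * norm \<epsilon> * (gexp (pi / 8) p + gexp (pi / 8) (p - \<epsilon>))"
    unfolding \<gamma>_def using truncated_window[OF H Q(1)] by (auto simp: H_def)
  \<comment> \<open>Uniformity in the translation is covariance: shifting \<open>\<Lambda>\<close>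
    by s amounts to replacing \<open>f\<close> by a time-frequency shift of itself, up to
    phases.\<close>
  have low: "ennreal (A / 4 * (l2norm f)\<^sup>2) \<le> (\<integral>\<^sup>+l. ennreal ((cmod (l2inner f (tfs (l + s) \<gamma>)))\<^sup>2) \<partial>count_space \<Lambda>)" (is "_ \<le> ?S")
    if f: "sq_int f" for s f
  proof -
    have c: "ball_count_le (\<lambda>l. l + s) \<Lambda> (r / 4) M"
      by (rule near_identity_ball_count[where \<delta>=0, OF _ _ cnt]) auto
    have "ennreal (A * (l2norm (tfs (- s) f))\<^sup>2) \<le> (\<integral>\<^sup>+l. ennreal ((cmod (l2inner (tfs (- s) f) (tfs l g)))\<^sup>2) \<partial>count_space \<Lambda>)"
      by (rule fr(1)[OF sq_int_tfs[OF f]])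
    also have "\<dots> = (\<integral>\<^sup>+l. ennreal ((cmod (l2inner f (tfs (l + s) g)))\<^sup>2) \<partial>count_space \<Lambda>)"
    proof (intro nn_integral_cong)
      fix l
      have "l2inner (tfs (- s) f) (tfs l g) = cnj (cis (pi * sympl s l)) * l2inner f (tfs (l + s) g)"
        by (simp add: l2inner_tfs_left tfs_tfs l2inner_scale_right add.commute)
      then show "ennreal ((cmod (l2inner (tfs (- s) f) (tfs l g)))\<^sup>2) = ennreal ((cmod (l2inner f (tfs (l + s) g)))\<^sup>2)"
        by (simp add: norm_mult)
    qed
    also have "\<dots> \<le> 2 * (?S + (\<integral>\<^sup>+l. ennreal ((cmod (l2inner f (tfs (l + s) (\<lambda>x. g x - \<gamma> x))))\<^sup>2) \<partial>count_space \<Lambda>))"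
      by (rule coefficient_sum_split[OF f g \<gamma>])
    also have "\<dots> \<le> 2 * (?S + ennreal (k * K * \<eta>\<^sup>2 * (l2norm f)\<^sup>2))"
      using bessel[OF c f sq_int_diff[OF g \<gamma>] less_imp_le[OF \<eta>] g\<gamma>] by (intro mult_left_mono add_left_mono) auto
    also have "\<dots> \<le> 2 * (?S + ennreal (A / 1024 * (l2norm f)\<^sup>2))"
      using k\<eta> by (intro mult_left_mono add_left_mono ennreal_leI mult_right_mono) auto
    finally have le: "ennreal (A * (l2norm f)\<^sup>2) \<le> 2 * (?S + ennreal (A / 1024 * (l2norm f)\<^sup>2))" by simp
    show ?thesis
    proof (cases ?S)
      case (real s)
      have "ennreal (A * (l2norm f)\<^sup>2) \<le> ennreal (2 * (s + A / 1024 * (l2norm f)\<^sup>2))"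
      proof -
        have "2 * (ennreal s + ennreal (A / 1024 * (l2norm f)\<^sup>2)) = ennreal (2 * (s + A / 1024 * (l2norm f)\<^sup>2))"
          using real AB by (intro ennreal_double_add) auto
        then show ?thesis using le real by simp
      qed
      then have "A * (l2norm f)\<^sup>2 \<le> 2 * (s + A / 1024 * (l2norm f)\<^sup>2)"
        using real AB by (subst (asm) ennreal_le_iff) auto
      moreover have "A * (l2norm f)\<^sup>2 \<ge> 0" using AB by simp
      ultimately have "A / 4 * (l2norm f)\<^sup>2 \<le> s" by (simp add: field_simps)
      then show ?thesis using real by (simp add: ennreal_leI)
    qed simp
  qed
  have A4: "A / 4 > 0" and pi8: "pi / 8 > 0" using AB by auto
  obtain \<delta>1 where \<delta>1: "\<delta>1 > 0" "\<delta>1 \<le> 1 / 2"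
    "\<And>\<Psi> f. (\<And>z w. norm ((\<Psi> z - z) - (\<Psi> w - w)) \<le> \<delta>1 * norm (z - w)) \<Longrightarrow> sq_int f \<Longrightarrow>
       ennreal (A / 4 / 16 * (l2norm f)\<^sup>2) \<le> (\<integral>\<^sup>+l. ennreal ((cmod (l2inner f (tfs (\<Psi> l) \<gamma>)))\<^sup>2) \<partial>count_space \<Lambda>)"
    using deformed_lower_bound[OF \<gamma> C(1) pi8 C(2,3) A4 low cnt r] by blast
  define \<delta> where "\<delta> = min \<delta>1 \<eta>"
  have \<delta>0: "\<delta> > 0" using \<delta>1 \<eta> by (simp add: \<delta>_def)
  show thesis
  proof (rule that[OF \<delta>0])
    fix \<Psi> :: "'a \<times> 'a \<Rightarrow> 'a \<times> 'a" and h
    assume L: "\<And>z w. norm ((\<Psi> z - z) - (\<Psi> w - w)) \<le> \<delta> * norm (z - w)" and h: "sq_int h"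
      and hg: "(NNBINT p. ennreal (cmod (gstft (\<lambda>x. h x - g x) p))) \<le> ennreal \<delta>"
    have L1: "norm ((\<Psi> z - z) - (\<Psi> w - w)) \<le> \<delta>1 * norm (z - w)" for z w
      by (rule order_trans[OF L mult_right_mono]) (auto simp: \<delta>_def)
    have c: "ball_count_le \<Psi> \<Lambda> (r / 4) M"
      by (rule near_identity_ball_count[of \<Psi>, OF L1 \<delta>1(2) cnt])
    \<comment> \<open>The frame sum runs over the image set, the estimates over the indices;
      injectivity identifies the two.\<close>
    have inj: "inj_on \<Psi> \<Lambda>"
    proof (rule inj_onI)
      fix z w assume "\<Psi> z = \<Psi> w"
      then show "z = w" using near_identity_expand[of \<Psi>, OF L1 \<delta>1(2), of z w] by simp
    qed
    have sums: "(\<integral>\<^sup>+l. ennreal ((cmod (l2inner f (tfs l h)))\<^sup>2) \<partial>count_space (\<Psi> ` \<Lambda>)) = (\<integral>\<^sup>+l. ennreal ((cmod (l2inner f (tfs (\<Psi> l) h)))\<^sup>2) \<partial>count_space \<Lambda>)" for f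
      by (rule nn_integral_bij_count_space[symmetric]) (rule inj_on_imp_bij_betw[OF inj])
    define hd where "hd = (\<lambda>x. h x - g x)"
    have hd: "sq_int hd" unfolding hd_def by (rule sq_int_diff[OF h g])
    have [measurable]: "gstft hd \<in> borel_measurable borel" "gstft h \<in> borel_measurable borel" "gstft \<gamma> \<in> borel_measurable borel"
      using hd h \<gamma> by (auto intro: borel_measurable_gstft)
    have hd\<eta>: "(NNBINT p. ennreal (cmod (gstft hd p))) \<le> ennreal \<eta>"
      unfolding hd_def by (rule order_trans[OF hg ennreal_leI]) (simp add: \<delta>_def)
    \<comment> \<open>The truncated window and \<open>h\<close> are each within \<eta> of
      \<open>g\<close>.\<close>
    have two: "(NNBINT p. ennreal (cmod (gstft (\<lambda>x. \<gamma> x - h x) p))) \<le> ennreal (2 * \<eta>)"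
    proof -
      have [measurable]: "gstft (\<lambda>x. g x - \<gamma> x) \<in> borel_measurable borel"
        by (rule borel_measurable_gstft[OF sq_int_diff[OF g \<gamma>]])
      have "(NNBINT p. ennreal (cmod (gstft (\<lambda>x. \<gamma> x - h x) p))) \<le> (NNBINT p. ennreal (cmod (gstft hd p)) + ennreal (cmod (gstft (\<lambda>x. g x - \<gamma> x) p)))"
      proof (intro nn_integral_mono)
        fix p
        have "gstft (\<lambda>x. \<gamma> x - h x) p = - gstft hd p - gstft (\<lambda>x. g x - \<gamma> x) p"
          by (simp add: hd_def gstft_diff h g \<gamma>)
        then have "cmod (gstft (\<lambda>x. \<gamma> x - h x) p) \<le> cmod (- gstft hd p) + cmod (gstft (\<lambda>x. g x - \<gamma> x) p)"
          by (simp only: norm_triangle_ineq4)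
        then show "ennreal (cmod (gstft (\<lambda>x. \<gamma> x - h x) p)) \<le> ennreal (cmod (gstft hd p)) + ennreal (cmod (gstft (\<lambda>x. g x - \<gamma> x) p))"
          by (simp flip: ennreal_plus)
      qed
      also have "\<dots> = (NNBINT p. ennreal (cmod (gstft hd p))) + (NNBINT p. ennreal (cmod (gstft (\<lambda>x. g x - \<gamma> x) p)))"
        by (rule nn_integral_add) measurable
      also have "\<dots> \<le> ennreal \<eta> + ennreal \<eta>" by (intro add_mono hd\<eta> g\<gamma>)
      also have "\<dots> = ennreal (2 * \<eta>)" using \<eta> by (simp flip: ennreal_plus)
      finally show ?thesis .
    qed
    define Ng where "Ng = (LBINT p. cmod (gstft g p))"
    have Ng: "(NNBINT p. ennreal (cmod (gstft g p))) = ennreal Ng" "Ng \<ge> 0"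
      unfolding Ng_def using ig by (auto intro!: nn_integral_eq_integral)
    have Nh: "(NNBINT p. ennreal (cmod (gstft h p))) \<le> ennreal (\<eta> + Ng)"
    proof -
      have "(NNBINT p. ennreal (cmod (gstft h p))) \<le> (NNBINT p. ennreal (cmod (gstft hd p)) + ennreal (cmod (gstft g p)))"
      proof (intro nn_integral_mono)
        fix p
        have "gstft h p = gstft hd p + gstft g p" by (simp add: hd_def gstft_diff h g)
        then have "cmod (gstft h p) \<le> cmod (gstft hd p) + cmod (gstft g p)" by (simp only: norm_triangle_ineq)
        then show "ennreal (cmod (gstft h p)) \<le> ennreal (cmod (gstft hd p)) + ennreal (cmod (gstft g p))"
          by (simp flip: ennreal_plus)
      qed
      also have "\<dots> = (NNBINT p. ennreal (cmod (gstft hd p))) + (NNBINT p. ennreal (cmod (gstft g p)))"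
        by (rule nn_integral_add) measurable
      also have "\<dots> \<le> ennreal \<eta> + ennreal Ng" by (intro add_mono hd\<eta>) (simp add: Ng)
      finally show ?thesis using \<eta> Ng by (simp flip: ennreal_plus)
    qed
    have lower: "ennreal (A / 256 * (l2norm f)\<^sup>2) \<le> (\<integral>\<^sup>+l. ennreal ((cmod (l2inner f (tfs (\<Psi> l) h)))\<^sup>2) \<partial>count_space \<Lambda>)" (is "_ \<le> ?S")
      if f: "sq_int f" for f
    proof -
      have "ennreal (A / 4 / 16 * (l2norm f)\<^sup>2) \<le> (\<integral>\<^sup>+l. ennreal ((cmod (l2inner f (tfs (\<Psi> l) \<gamma>)))\<^sup>2) \<partial>count_space \<Lambda>)"
        by (rule \<delta>1(3)[of \<Psi>, OF L1 f])
      also have "\<dots> \<le> 2 * (?S + (\<integral>\<^sup>+l. ennreal ((cmod (l2inner f (tfs (\<Psi> l) (\<lambda>x. \<gamma> x - h x))))\<^sup>2) \<partial>count_space \<Lambda>))"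
        by (rule coefficient_sum_split[OF f \<gamma> h])
      also have "\<dots> \<le> 2 * (?S + ennreal (k * K * (2 * \<eta>)\<^sup>2 * (l2norm f)\<^sup>2))"
        using bessel[OF c f sq_int_diff[OF \<gamma> h] _ two] \<eta> by (intro mult_left_mono add_left_mono) auto
      also have "\<dots> \<le> 2 * (?S + ennreal (A / 256 * (l2norm f)\<^sup>2))"
      proof (intro mult_left_mono add_left_mono ennreal_leI mult_right_mono)
        show "k * K * (2 * \<eta>)\<^sup>2 \<le> A / 256" using k\<eta> by (simp add: power_mult_distrib)
      qed auto
      finally have le: "ennreal (A / 64 * (l2norm f)\<^sup>2) \<le> 2 * (?S + ennreal (A / 256 * (l2norm f)\<^sup>2))" by simp
      show ?thesis
      proof (cases ?S)
        case (real s)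
        have "ennreal (A / 64 * (l2norm f)\<^sup>2) \<le> ennreal (2 * (s + A / 256 * (l2norm f)\<^sup>2))"
        proof -
          have "2 * (ennreal s + ennreal (A / 256 * (l2norm f)\<^sup>2)) = ennreal (2 * (s + A / 256 * (l2norm f)\<^sup>2))"
            using real AB by (intro ennreal_double_add) auto
          then show ?thesis using le real by simp
        qed
        then have "A / 64 * (l2norm f)\<^sup>2 \<le> 2 * (s + A / 256 * (l2norm f)\<^sup>2)"
          using real AB by (subst (asm) ennreal_le_iff) auto
        then have "A / 256 * (l2norm f)\<^sup>2 \<le> s" by (simp add: field_simps)
        then show ?thesis using real by (simp add: ennreal_leI)
      qed simp
    qed
    \<comment> \<open>The added 1 makes the upper frame bound strictly positive.\<close>
    have upper: "(\<integral>\<^sup>+l. ennreal ((cmod (l2inner f (tfs (\<Psi> l) h)))\<^sup>2) \<partial>count_space \<Lambda>) \<le> ennreal ((k * K * (\<eta> + Ng)\<^sup>2 + 1) * (l2norm f)\<^sup>2)"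
      if f: "sq_int f" for f
    proof -
      have "(\<integral>\<^sup>+l. ennreal ((cmod (l2inner f (tfs (\<Psi> l) h)))\<^sup>2) \<partial>count_space \<Lambda>) \<le> ennreal (k * K * (\<eta> + Ng)\<^sup>2 * (l2norm f)\<^sup>2)"
        using \<eta> Ng by (intro bessel[OF c f h _ Nh]) auto
      also have "\<dots> \<le> ennreal ((k * K * (\<eta> + Ng)\<^sup>2 + 1) * (l2norm f)\<^sup>2)"
        by (intro ennreal_leI mult_right_mono) auto
      finally show ?thesis .
    qed
    show "gabor_frame h (\<Psi> ` \<Lambda>)"
      unfolding gabor_frame_def sums
    proof (intro conjI h exI allI impI)
      show "A / 256 > 0" using AB by simp
      show "k * K * (\<eta> + Ng)\<^sup>2 + 1 > 0" using kK by (intro add_nonneg_pos) auto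
    qed (use lower upper in auto)
  qed
qed

section \<open>Linear flows and transport of integrable densities\<close>

text \<open>Uniqueness of the translation-invariant measure, without determinants. The factor is the
  integral of a mass-one Gaussian composed with \<open>S\<close>, and comparing that with Gaussians
  of rates a^2 and b^2 gives the two bounds, which tend to 1 when \<open>S\<close> tends to the
  identity.\<close>

lemma linear_change_of_variables:
  fixes S :: "'b::euclidean_space \<Rightarrow> 'b"
  assumes S: "linear S" and a: "a > 0" and lo: "\<And>w. a * norm w \<le> norm (S w)" and hi: "\<And>w. norm (S w) \<le> b * norm w"
  obtains c where "(1 / b) ^ DIM('b) \<le> c" "c \<le> (1 / a) ^ DIM('b)"
    "\<And>h. h \<in> borel_measurable borel \<Longrightarrow> (NNBINT w. h (S w)) = ennreal c * (NNBINT w. h w)"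
proof -
  have inj: "inj S"
  proof (rule injI)
    fix x y assume "S x = S y"
    then have "S (x - y) = 0" using linear_diff[OF S, of x y] by simp
    then show "x = y" using lo[of "x - y"] a by (simp add: mult_le_0_iff)
  qed
  then have surj: "surj S" using S linear_injective_imp_surjective by blast
  have [measurable]: "S \<in> borel_measurable borel"
    using linear_continuous_on[OF linear_conv_bounded_linear[THEN iffD1, OF S]] by (rule borel_measurable_continuous_onI)
  obtain x0 :: 'b where x0: "norm x0 = 1" using vector_choose_size[of 1] by auto
  have ab: "a \<le> b" using lo[of x0] hi[of x0] x0 by simp
  then have b: "b > 0" using a by simp
  define k where "k (x::'b) = ennreal (exp (- pi * 1 * (norm x)\<^sup>2))" for x
  have [measurable]: "k \<in> borel_measurable borel" unfolding k_def by measurable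
  have k1: "(NNBINT x. k x) = 1"
    unfolding k_def using gauss_integral[of 1, where 'a='b] by (subst nn_integral_eq_integral) auto
  define c where "c = (NNBINT w. k (S w))"
  have g2: "(NNBINT w. ennreal (exp (- pi * r\<^sup>2 * (norm (w::'b))\<^sup>2))) = ennreal ((1 / r) ^ DIM('b))" if "r > 0" for r
    using gauss_integral[of "r\<^sup>2", where 'a='b] that by (subst nn_integral_eq_integral) auto
  have c_le: "c \<le> ennreal ((1 / a) ^ DIM('b))"
    unfolding c_def g2[OF a, symmetric]
  proof (intro nn_integral_mono)
    fix w
    have "(a * norm w)\<^sup>2 \<le> (norm (S w))\<^sup>2" using a by (intro power_mono lo) auto
    then show "k (S w) \<le> ennreal (exp (- pi * a\<^sup>2 * (norm w)\<^sup>2))"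
      unfolding k_def by (intro ennreal_leI) (simp add: power_mult_distrib mult_left_mono mult.assoc)
  qed
  have c_ge: "ennreal ((1 / b) ^ DIM('b)) \<le> c"
    unfolding c_def g2[OF b, symmetric]
  proof (intro nn_integral_mono)
    fix w
    have "(norm (S w))\<^sup>2 \<le> (b * norm w)\<^sup>2" by (intro power_mono hi) auto
    then show "ennreal (exp (- pi * b\<^sup>2 * (norm w)\<^sup>2)) \<le> k (S w)"
      unfolding k_def by (intro ennreal_leI) (simp add: power_mult_distrib mult_left_mono mult.assoc)
  qed
  have tr: "(NNBINT w. h (S w + y)) = (NNBINT w. h (S w))" if [measurable]: "h \<in> borel_measurable borel" for h :: "'b \<Rightarrow> ennreal" and y
  proof -
    obtain u where u: "y = S u" using surj by (metis surjD)
    have "(NNBINT w. h (S w + y)) = (NNBINT w. h (S (w + u)))" by (simp add: u linear_add[OF S])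
    also have "\<dots> = (NNBINT w. h (S w))"
      by (rule nn_integral_lborel_translate) measurable
    finally show ?thesis .
  qed
  have main: "(NNBINT w. h (S w)) = c * (NNBINT w. h w)" if hm [measurable]: "h \<in> borel_measurable borel" for h :: "'b \<Rightarrow> ennreal"
  proof -
    \<comment> \<open>A free Gaussian variable y is inserted and added to S w, which does not change
      the inner integral by \<open>tr\<close>; after substituting in y and exchanging the integrals,
      \<open>S\<close> sits in the Gaussian alone and \<open>h\<close> is left bare.\<close>
    have "(NNBINT w. h (S w)) = (NNBINT y. k y) * (NNBINT w. h (S w))" by (simp add: k1)
    also have "\<dots> = (NNBINT y. k y * (NNBINT w. h (S w)))" by (rule nn_integral_multc[symmetric]) measurable
    also have "\<dots> = (NNBINT y. (NNBINT w. k y * h (S w + y)))"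
      by (rule nn_integral_cong, subst nn_integral_cmult, measurable) (simp add: tr)
    also have "\<dots> = (NNBINT w. (NNBINT y. k y * h (S w + y)))"
      by (rule lborel_pair.Fubini') measurable
    also have "\<dots> = (NNBINT w. (NNBINT y. k (S w + - y) * h y))"
    proof (rule nn_integral_cong)
      fix w
      have "(NNBINT y. k (S w + - y) * h y) = (NNBINT y. k (S w + - (y + S w)) * h (y + S w))"
        by (rule nn_integral_lborel_translate[symmetric, of "\<lambda>y. k (S w + - y) * h y" "S w"]) measurable
      then show "(NNBINT y. k y * h (S w + y)) = (NNBINT y. k (S w + - y) * h y)"
        by (simp add: k_def add.commute)
    qed
    also have "\<dots> = (NNBINT y. (NNBINT w. k (S w + - y) * h y))"
      by (rule lborel_pair.Fubini') measurable
    also have "\<dots> = (NNBINT y. c * h y)"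
      by (rule nn_integral_cong, subst nn_integral_multc, measurable) (simp only: tr[of k, OF \<open>k \<in> borel_measurable borel\<close>] c_def[symmetric])
    also have "\<dots> = c * (NNBINT w. h w)" by (rule nn_integral_cmult) measurable
    finally show ?thesis .
  qed
  obtain c' where c': "c = ennreal c'" "c' \<ge> 0" using c_le by (cases c) (auto simp: top_unique)
  show thesis
  proof (rule that[of c'])
    show "(1 / b) ^ DIM('b) \<le> c'" using c_ge c' b by (simp add: ennreal_le_iff)
    show "c' \<le> (1 / a) ^ DIM('b)" using c_le c' a by (simp add: ennreal_le_iff)
  qed (use main c' in auto)
qed

text \<open>A short-time substitute for Gronwall: if M is the maximum of norm (D s) for |s| \<le>
  |t|, the mean value theorem gives M \<le> norm (D 0) + K |t| M, hence M \<le> 2 norm (D 0). It is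
  symmetric in the sign of t.\<close>

lemma small_time_growth:
  fixes D :: "real \<Rightarrow> 'b::real_normed_vector"
  assumes D: "\<And>s. (D has_vector_derivative D' s) (at s)" and K: "\<And>s. norm (D' s) \<le> K * norm (D s)" "K \<ge> 0"
    and t: "K * \<bar>t\<bar> \<le> 1 / 2"
  shows "norm (D t - D 0) \<le> 2 * K * \<bar>t\<bar> * norm (D 0)"
proof -
  define I where "I = {- \<bar>t\<bar>..\<bar>t\<bar>}"
  have cont: "continuous_on I (\<lambda>s. norm (D s))"
    by (intro continuous_on_norm continuous_at_imp_continuous_on ballI) (rule has_vector_derivative_continuous[OF D])
  have "compact I" "I \<noteq> {}" by (auto simp: I_def)
  then obtain s0 where s0: "s0 \<in> I" "\<And>s. s \<in> I \<Longrightarrow> norm (D s) \<le> norm (D s0)"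
    using continuous_attains_sup[OF _ _ cont] by blast
  define M where "M = norm (D s0)"
  have bound: "norm (D s - D 0) \<le> K * M * \<bar>t\<bar>" if s: "s \<in> I" for s
  proof -
    have "norm (D s - D 0) \<le> K * M * norm (s - 0)"
    proof (rule differentiable_bound[of I D "\<lambda>s h. h *\<^sub>R D' s"])
      show "convex I" by (simp add: I_def)
      show "(D has_derivative (\<lambda>h. h *\<^sub>R D' x)) (at x within I)" if "x \<in> I" for x
        using D[of x] unfolding has_vector_derivative_def by (rule has_derivative_at_withinI)
      show "onorm (\<lambda>h. h *\<^sub>R D' x) \<le> K * M" if "x \<in> I" for x
      proof (rule onorm_le)
        fix h :: real
        have "norm (D' x) \<le> K * M" using K s0(2)[OF that] by (intro order_trans[OF K(1)] mult_left_mono) (auto simp: M_def)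
        then show "norm (h *\<^sub>R D' x) \<le> K * M * norm h" by (simp add: mult.commute mult_left_mono)
      qed
      show "s \<in> I" "0 \<in> I" using s by (auto simp: I_def)
    qed
    also have "\<dots> \<le> K * M * \<bar>t\<bar>" using s K(2) by (intro mult_left_mono) (auto simp: I_def M_def)
    finally show ?thesis .
  qed
  have "M \<le> norm (D 0) + norm (D s0 - D 0)" unfolding M_def using norm_triangle_ineq[of "D 0" "D s0 - D 0"] by simp
  also have "\<dots> \<le> norm (D 0) + K * \<bar>t\<bar> * M" using bound[OF s0(1)] by (simp add: ac_simps)
  also have "\<dots> \<le> norm (D 0) + 1 / 2 * M" using t by (intro add_left_mono mult_right_mono) (auto simp: M_def)
  finally have M: "M \<le> 2 * norm (D 0)" by simp
  have "norm (D t - D 0) \<le> K * M * \<bar>t\<bar>" by (rule bound) (auto simp: I_def)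
  also have "\<dots> \<le> K * (2 * norm (D 0)) * \<bar>t\<bar>" using M K(2) by (intro mult_right_mono mult_left_mono) auto
  finally show ?thesis by (simp add: ac_simps)
qed

text \<open>The exponential series of \<open>t * L\<close>, applied vector by vector.\<close>

lemma linear_flow_exists:
  fixes L :: "'b::euclidean_space \<Rightarrow> 'b"
  assumes L: "linear L"
  obtains S :: "real \<Rightarrow> 'b \<Rightarrow> 'b" where "\<And>t. linear (S t)" "\<And>w. S 0 w = w"
    "\<And>t w. ((\<lambda>t. S t w) has_vector_derivative L (S t w)) (at t)"
proof -
  have bl: "bounded_linear L" using L by (simp add: linear_conv_bounded_linear)
  then obtain K where K: "K > 0" "\<And>x. norm (L x) \<le> norm x * K" using bounded_linear.pos_bounded by blast
  have pw: "norm ((L ^^ n) w) \<le> K ^ n * norm w" for n w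
  proof (induction n)
    case (Suc n)
    have "norm ((L ^^ Suc n) w) \<le> norm ((L ^^ n) w) * K" using K(2) by simp
    also have "\<dots> \<le> (K ^ n * norm w) * K" using Suc K(1) by (intro mult_right_mono) auto
    finally show ?case by (simp add: ac_simps)
  qed simp
  define T where "T t w n = (t ^ n / fact n) *\<^sub>R (L ^^ n) w" for t w n
  have nT: "norm (T t w n) \<le> norm w * (\<bar>t\<bar> * K) ^ n / fact n" for t w n
    using mult_left_mono[OF pw[of n w], of "\<bar>t\<bar> ^ n / fact n"]
    by (simp add: T_def power_abs power_mult_distrib ac_simps)
  have sm: "summable (T t w)" for t w
  proof (rule summable_comparison_test'[where N=0])
    show "summable (\<lambda>n. norm w * (\<bar>t\<bar> * K) ^ n / fact n)"
      using summable_mult[OF summable_exp[of "\<bar>t\<bar> * K"], of "norm w"] by (simp add: divide_inverse ac_simps)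
    show "norm (T t w n) \<le> norm w * (\<bar>t\<bar> * K) ^ n / fact n" for n by (rule nT)
  qed
  define S where "S t w = (\<Sum>n. T t w n)" for t w
  have Lpow: "linear (L ^^ n)" for n
    by (induction n) (auto intro: linear_compose[unfolded o_def] L linear_id[unfolded id_def] simp: o_def id_def)
  have linS: "linear (S t)" for t
  proof (rule linearI)
    show "S t (x + y) = S t x + S t y" for x y
    proof -
      have "T t (x + y) = (\<lambda>n. T t x n + T t y n)" by (simp add: fun_eq_iff T_def linear_add[OF Lpow] scaleR_add_right)
      then show ?thesis by (simp add: S_def suminf_add[OF sm sm])
    qed
    show "S t (r *\<^sub>R x) = r *\<^sub>R S t x" for r x
    proof -
      have "T t (r *\<^sub>R x) = (\<lambda>n. r *\<^sub>R T t x n)" by (simp add: fun_eq_iff T_def linear_scale[OF Lpow] mult.commute)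
      then show ?thesis by (simp add: S_def bounded_linear.suminf[OF bounded_linear_scaleR_right sm])
    qed
  qed
  have S0: "S 0 w = w" for w
  proof -
    have "S 0 w = (\<Sum>n\<in>{0}. T 0 w n)" unfolding S_def by (rule suminf_finite) (auto simp: T_def)
    then show ?thesis by (simp add: T_def)
  qed
  have LS: "L (S t w) = S t (L w)" for t w
  proof -
    have "L (S t w) = (\<Sum>n. L (T t w n))" unfolding S_def by (rule bounded_linear.suminf[OF bl sm])
    also have "(\<lambda>n. L (T t w n)) = T t (L w)"
      by (simp add: fun_eq_iff T_def linear_scale[OF L] funpow_swap1)
    also have "suminf (T t (L w)) = S t (L w)" by (simp add: S_def)
    finally show ?thesis .
  qed
  \<comment> \<open>Each coordinate is a real power series in t, so scalar termwise differentiation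
    applies; shifting the coefficients by \<open>diffs\<close> replaces w by L w.\<close>
  have comp: "((\<lambda>t. S t w \<bullet> i) has_real_derivative (S t (L w) \<bullet> i)) (at t)" for t w i
  proof -
    define c where "c n = ((L ^^ n) w \<bullet> i) / fact n" for n
    have e: "S t w \<bullet> i = (\<Sum>n. c n * t ^ n)" for t
    proof -
      have "S t w \<bullet> i = (\<Sum>n. T t w n \<bullet> i)" unfolding S_def
        by (rule bounded_linear.suminf[OF bounded_linear_inner_left sm])
      then show ?thesis by (simp add: T_def c_def mult.commute)
    qed
    have sc: "summable (\<lambda>n. c n * t ^ n)" for t
      using bounded_linear.summable[OF bounded_linear_inner_left[of i] sm[of t w]] by (simp add: T_def c_def mult.commute)
    have d: "S t (L w) \<bullet> i = (\<Sum>n. diffs c n * t ^ n)" for t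
    proof -
      have "S t (L w) \<bullet> i = (\<Sum>n. T t (L w) n \<bullet> i)" unfolding S_def
        by (rule bounded_linear.suminf[OF bounded_linear_inner_left sm])
      moreover have "T t (L w) n \<bullet> i = diffs c n * t ^ n" for n
        by (simp add: T_def c_def diffs_def funpow_swap1 field_simps del: of_nat_Suc)
      ultimately show ?thesis by simp
    qed
    show ?thesis unfolding e d
      by (rule termdiffs_strong_converges_everywhere[OF sc])
  qed
  have der: "((\<lambda>t. S t w) has_vector_derivative L (S t w)) (at t)" for t w
  proof -
    have "((\<lambda>t. \<Sum>i\<in>Basis. (S t w \<bullet> i) *\<^sub>R i) has_vector_derivative (\<Sum>i\<in>Basis. (S t (L w) \<bullet> i) *\<^sub>R i)) (at t)"
      using comp by (intro has_vector_derivative_sum)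
        (auto simp: has_real_derivative_iff_has_vector_derivative intro!: has_vector_derivative_scaleR[where g="\<lambda>_. _", OF _ has_vector_derivative_const, simplified])
    then show ?thesis by (simp add: euclidean_representation LS)
  qed
  from that[OF linS S0 der] show thesis .
qed

text \<open>The L^1 norm of \<open>G t\<close> might be infinite, so a Gronwall inequality for it
  could not be rearranged. Instead the supremum is taken over all times and all weights with values
  at most 1 and mass at most R; it is finite, and the transposed kernel maps such weights to
  multiples of such weights. The bound obtained does not depend on R, and the weights may increase
  to 1.\<close>

lemma transport_L1_bound:
  fixes G :: "real \<Rightarrow> 'b::euclidean_space \<Rightarrow> real" and S :: "real \<Rightarrow> 'b \<Rightarrow> 'b" and \<Theta> :: "'b \<Rightarrow> ennreal"
  assumes \<tau>: "\<tau> > 0"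
    and Gm [measurable]: "(\<lambda>(s, v). G s v) \<in> borel_measurable (borel \<Otimes>\<^sub>M borel)"
    and Sm [measurable]: "(\<lambda>(s, v). S s v) \<in> borel_measurable (borel \<Otimes>\<^sub>M borel)"
    and \<Theta>m [measurable]: "\<Theta> \<in> borel_measurable borel"
    and G0: "\<And>s v. 0 \<le> G s v" and GB: "\<And>s v. G s v \<le> B"
    and cv: "\<And>t h. t \<in> {0..\<tau>} \<Longrightarrow> h \<in> borel_measurable borel \<Longrightarrow> (NNBINT w. h (S t w)) = ennreal (c t) * (NNBINT w. h w)"
    and ab: "a > 0" "\<And>t. t \<in> {0..\<tau>} \<Longrightarrow> a \<le> c t" "\<And>t. t \<in> {0..\<tau>} \<Longrightarrow> c t \<le> b"
    and \<theta>: "(NNBINT v. \<Theta> v) = ennreal \<theta>" "\<theta> > 0"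
    and duhamel: "\<And>t w. t \<in> {0..\<tau>} \<Longrightarrow> ennreal (G t (S t w)) \<le> ennreal (G 0 w)
        + (NNBINT s. indicator {0..t} s * (NNBINT v. ennreal (G s v) * \<Theta> (S s w - v)))"
    and n0: "(NNBINT v. ennreal (G 0 v)) = ennreal n0" "n0 \<ge> 0"
    and small: "\<tau> * (b * \<theta>) < a" and t: "t \<in> {0..\<tau>}"
  shows "(NNBINT v. ennreal (G t v)) \<le> ennreal (n0 / (a - \<tau> * (b * \<theta>)))"
proof -
  have b: "b > 0" using ab(1) ab(2)[of 0] ab(3)[of 0] \<tau> by simp
  define \<beta> where "\<beta> = b * \<theta>"
  have b\<theta>: "\<beta> > 0" using b \<theta> by (simp add: \<beta>_def)
  have \<beta>E: "ennreal \<beta> = ennreal b * ennreal \<theta>" using b \<theta> by (simp add: \<beta>_def ennreal_mult)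
  have [measurable]: "G s \<in> borel_measurable borel" "S s \<in> borel_measurable borel" for s
  proof -
    have "(\<lambda>v. case (s, v) of (s, v) \<Rightarrow> G s v) \<in> borel_measurable borel" by measurable
    then show "G s \<in> borel_measurable borel" by simp
    have "(\<lambda>v. case (s, v) of (s, v) \<Rightarrow> S s v) \<in> borel_measurable borel" by measurable
    then show "S s \<in> borel_measurable borel" by simp
  qed
  \<comment> \<open>Bounded and of bounded mass: the sup bound by 1 is what reproduces the integral
    of \<open>G 0\<close>, the mass bound is what makes the supremum finite.\<close>
  define adm where "adm R k \<longleftrightarrow> k \<in> borel_measurable borel \<and> (\<forall>v. k v \<le> 1) \<and> (NNBINT v. k v) \<le> ennreal R" for R and k :: "'b \<Rightarrow> ennreal"
  have key: "(NNBINT v. ennreal (G t v) * k v) \<le> ennreal (n0 / (a - \<tau> * \<beta>))" if R: "R \<ge> 0" and k: "adm R k" and t: "t \<in> {0..\<tau>}" for R k t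
  proof -
    \<comment> \<open>Finite, at most B R, because \<open>G\<close> is bounded by \<open>B\<close>.
      Only the finiteness is used.\<close>
    define X where "X = (SUP (s, k) \<in> {0..\<tau>} \<times> Collect (adm R). (NNBINT v. ennreal (G s v) * k v))"
    have X_ge: "(NNBINT v. ennreal (G s v) * k v) \<le> X" if "s \<in> {0..\<tau>}" "adm R k" for s k
      unfolding X_def using that by (intro SUP_upper2[of "(s, k)"]) auto
    have B0: "B \<ge> 0" using G0 GB order_trans by blast
    have "X \<le> ennreal (B * R)"
      unfolding X_def
    proof (rule SUP_least, clarify)
      fix s k assume "adm R k"
      then have [measurable]: "k \<in> borel_measurable borel" and kR: "(NNBINT v. k v) \<le> ennreal R" by (auto simp: adm_def)
      have "(NNBINT v. ennreal (G s v) * k v) \<le> (NNBINT v. ennreal B * k v)"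
        by (intro nn_integral_mono mult_right_mono ennreal_leI GB) auto
      also have "\<dots> = ennreal B * (NNBINT v. k v)" by (rule nn_integral_cmult) measurable
      also have "\<dots> \<le> ennreal B * ennreal R" by (intro mult_left_mono kR) auto
      finally show "(NNBINT v. ennreal (G s v) * k v) \<le> ennreal (B * R)" using B0 R by (simp add: ennreal_mult)
    qed
    then obtain x where x: "X = ennreal x" "x \<ge> 0" by (cases X) (auto simp: top_unique)
    have step: "ennreal a * (NNBINT v. ennreal (G t v) * k v) \<le> ennreal (n0 + \<tau> * \<beta> * x)" if k: "adm R k" and t: "t \<in> {0..\<tau>}" for k t
    proof -
      have [measurable]: "k \<in> borel_measurable borel" and k1: "\<And>v. k v \<le> 1" and kR: "(NNBINT v. k v) \<le> ennreal R" using k by (auto simp: adm_def)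
      define W where "W s w = (NNBINT v. ennreal (G s v) * \<Theta> (S s w - v))" for s w
      have Wm [measurable]: "(\<lambda>(s, w). W s w) \<in> borel_measurable (borel \<Otimes>\<^sub>M borel)" unfolding W_def by measurable
      have inner: "(NNBINT w. W s w * k (S t w)) \<le> ennreal \<beta> * X" if s: "s \<in> {0..\<tau>}" for s
      proof -
        \<comment> \<open>The Duhamel kernel transposed onto the weight. Its values are at most
          \<beta> by substituting along \<open>S s\<close> in \<Theta>, and its mass is at most
          \<beta> R by integrating v first and then substituting along \<open>S t\<close>; so kt /
          \<beta> is admissible with the same R.\<close>
        define kt where "kt v = (NNBINT w. \<Theta> (S s w - v) * k (S t w))" for v
        have [measurable]: "kt \<in> borel_measurable borel" unfolding kt_def by measurable
        have "(NNBINT w. W s w * k (S t w)) = (NNBINT w. (NNBINT v. ennreal (G s v) * \<Theta> (S s w - v) * k (S t w)))"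
          unfolding W_def by (rule nn_integral_cong, rule nn_integral_multc[symmetric]) measurable
        also have "\<dots> = (NNBINT v. (NNBINT w. ennreal (G s v) * \<Theta> (S s w - v) * k (S t w)))"
          by (rule lborel_pair.Fubini') measurable
        also have "\<dots> = (NNBINT v. ennreal (G s v) * kt v)"
          unfolding kt_def mult.assoc by (rule nn_integral_cong, rule nn_integral_cmult) measurable
        also have "\<dots> = (NNBINT v. ennreal \<beta> * (ennreal (G s v) * (ennreal (1 / \<beta>) * kt v)))"
        proof (intro nn_integral_cong)
          fix v
          have "ennreal \<beta> * ennreal (1 / \<beta>) = 1" using b\<theta> by (simp add: ennreal_mult[symmetric])
          moreover have "ennreal \<beta> * (ennreal (G s v) * (ennreal (1 / \<beta>) * kt v)) = (ennreal \<beta> * ennreal (1 / \<beta>)) * (ennreal (G s v) * kt v)"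
            by (simp only: ac_simps)
          ultimately show "ennreal (G s v) * kt v = ennreal \<beta> * (ennreal (G s v) * (ennreal (1 / \<beta>) * kt v))"
            by (simp only: mult_1)
        qed
        also have "\<dots> = ennreal \<beta> * (NNBINT v. ennreal (G s v) * (ennreal (1 / \<beta>) * kt v))"
          by (rule nn_integral_cmult) measurable
        also have "\<dots> \<le> ennreal \<beta> * X"
        proof (intro mult_left_mono X_ge s)
          have kt1: "kt v \<le> ennreal \<beta>" for v
          proof -
            have "kt v \<le> (NNBINT w. \<Theta> (S s w - v))"
              unfolding kt_def by (intro nn_integral_mono) (use mult_left_mono[OF k1] in fastforce)
            also have "\<dots> = ennreal (c s) * (NNBINT w. \<Theta> (w + - v))"
              using cv[OF s, of "\<lambda>w. \<Theta> (w - v)"] by simp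
            also have "(NNBINT w. \<Theta> (w + - v)) = ennreal \<theta>"
              using nn_integral_lborel_translate[of \<Theta> "- v"] \<theta>(1) by simp
            also have "ennreal (c s) * ennreal \<theta> \<le> ennreal b * ennreal \<theta>"
              by (intro mult_right_mono ennreal_leI ab(3) s) auto
            finally show ?thesis by (simp only: \<beta>E)
          qed
          have ktR: "(NNBINT v. kt v) \<le> ennreal \<beta> * ennreal R"
          proof -
            have "(NNBINT v. kt v) = (NNBINT w. (NNBINT v. \<Theta> (S s w - v) * k (S t w)))"
              unfolding kt_def by (rule lborel_pair.Fubini') measurable
            also have "\<dots> = (NNBINT w. ennreal \<theta> * k (S t w))"
              by (rule nn_integral_cong, subst nn_integral_multc, measurable) (simp add: nn_integral_lborel_reflect \<theta>)
            also have "\<dots> = ennreal \<theta> * (NNBINT w. k (S t w))" by (rule nn_integral_cmult) measurable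
            also have "(NNBINT w. k (S t w)) = ennreal (c t) * (NNBINT w. k w)"
              by (rule cv[OF t]) measurable
            also have "ennreal \<theta> * (ennreal (c t) * (NNBINT w. k w)) \<le> ennreal \<theta> * (ennreal b * ennreal R)"
              by (intro mult_left_mono mult_mono ennreal_leI ab(3) t kR) auto
            finally show ?thesis by (simp only: \<beta>E ac_simps)
          qed
          show "adm R (\<lambda>v. ennreal (1 / \<beta>) * kt v)"
            unfolding adm_def
          proof (intro conjI allI)
            have one: "ennreal (1 / \<beta>) * ennreal \<beta> = 1" using b\<theta> by (simp add: ennreal_mult[symmetric])
            show "ennreal (1 / \<beta>) * kt v \<le> 1" for v
              unfolding one[symmetric] by (intro mult_left_mono kt1) auto
            have "(NNBINT v. ennreal (1 / \<beta>) * kt v) = ennreal (1 / \<beta>) * (NNBINT v. kt v)"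
              by (rule nn_integral_cmult) measurable
            also have "\<dots> \<le> ennreal (1 / \<beta>) * (ennreal \<beta> * ennreal R)" by (intro mult_left_mono ktR) auto
            also have "\<dots> = ennreal R" by (simp only: mult.assoc[symmetric] one mult_1)
            finally show "(NNBINT v. ennreal (1 / \<beta>) * kt v) \<le> ennreal R" .
          qed measurable
        qed auto
        finally show ?thesis .
      qed
      \<comment> \<open>Passing to coordinates moving with the flow costs the Jacobian, bounded
        below by a; in these coordinates the Duhamel inequality applies pointwise.\<close>
      have "ennreal a * (NNBINT v. ennreal (G t v) * k v) \<le> ennreal (c t) * (NNBINT v. ennreal (G t v) * k v)"
        by (intro mult_right_mono ennreal_leI ab(2) t) auto
      also have "\<dots> = (NNBINT w. ennreal (G t (S t w)) * k (S t w))"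
        by (rule cv[OF t, symmetric]) measurable
      also have "\<dots> \<le> (NNBINT w. ennreal (G 0 w) + (NNBINT s. indicator {0..t} s * (W s w * k (S t w))))"
      proof (intro nn_integral_mono)
        fix w
        have "ennreal (G t (S t w)) * k (S t w) \<le> (ennreal (G 0 w) + (NNBINT s. indicator {0..t} s * W s w)) * k (S t w)"
          unfolding W_def by (intro mult_right_mono duhamel t) auto
        also have "\<dots> = ennreal (G 0 w) * k (S t w) + (NNBINT s. indicator {0..t} s * W s w) * k (S t w)"
          by (rule distrib_right)
        also have "(NNBINT s. indicator {0..t} s * W s w) * k (S t w) = (NNBINT s. indicator {0..t} s * (W s w * k (S t w)))"
          unfolding mult.assoc[symmetric] by (rule nn_integral_multc[symmetric]) measurable
        also have "ennreal (G 0 w) * k (S t w) + (NNBINT s. indicator {0..t} s * (W s w * k (S t w))) \<le> ennreal (G 0 w) + (NNBINT s. indicator {0..t} s * (W s w * k (S t w)))"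
          using mult_left_mono[OF k1[of "S t w"], of "ennreal (G 0 w)"] by (intro add_right_mono) simp
        finally show "ennreal (G t (S t w)) * k (S t w) \<le> ennreal (G 0 w) + (NNBINT s. indicator {0..t} s * (W s w * k (S t w)))" .
      qed
      also have "\<dots> = (NNBINT w. ennreal (G 0 w)) + (NNBINT w. (NNBINT s. indicator {0..t} s * (W s w * k (S t w))))"
        by (rule nn_integral_add) measurable
      also have "(NNBINT w. (NNBINT s. indicator {0..t} s * (W s w * k (S t w)))) = (NNBINT s. (NNBINT w. indicator {0..t} s * (W s w * k (S t w))))"
        by (rule lborel_pair.Fubini') measurable
      also have "\<dots> \<le> (NNBINT s. indicator {0..t} s * (ennreal \<beta> * X))"
      proof (intro nn_integral_mono)
        fix s
        have "(NNBINT w. indicator {0..t} s * (W s w * k (S t w))) = indicator {0..t} s * (NNBINT w. W s w * k (S t w))"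
          by (rule nn_integral_cmult) measurable
        also have "\<dots> \<le> indicator {0..t} s * (ennreal \<beta> * X)"
          using inner[of s] t by (cases "s \<in> {0..t}") auto
        finally show "(NNBINT w. indicator {0..t} s * (W s w * k (S t w))) \<le> indicator {0..t} s * (ennreal \<beta> * X)" .
      qed
      also have "(NNBINT s. indicator {0..t} s * (ennreal \<beta> * X)) = ennreal t * (ennreal \<beta> * X)"
        using t by (simp add: nn_integral_multc)
      also have "ennreal t * (ennreal \<beta> * X) \<le> ennreal \<tau> * (ennreal \<beta> * X)"
        using t by (intro mult_right_mono ennreal_leI) auto
      also have "(NNBINT w. ennreal (G 0 w)) + ennreal \<tau> * (ennreal \<beta> * X) = ennreal (n0 + \<tau> * \<beta> * x)"
      proof -
        have "ennreal \<tau> * (ennreal \<beta> * X) = ennreal (\<tau> * \<beta> * x)"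
          using \<tau> b\<theta> x by (simp add: ennreal_mult mult.assoc)
        then show ?thesis using \<tau> b\<theta> x n0 by (simp add: ennreal_plus)
      qed
      finally show ?thesis by (simp add: add_left_mono)
    qed
    have le2: "(NNBINT v. ennreal (G t v) * k v) \<le> ennreal ((n0 + \<tau> * \<beta> * x) / a)" if "adm R k" "t \<in> {0..\<tau>}" for k t
    proof -
      have "(NNBINT v. ennreal (G t v) * k v) = ennreal (1 / a) * (ennreal a * (NNBINT v. ennreal (G t v) * k v))"
        unfolding mult.assoc[symmetric] using ab(1) by (simp add: ennreal_mult[symmetric])
      also have "\<dots> \<le> ennreal (1 / a) * ennreal (n0 + \<tau> * \<beta> * x)" by (intro mult_left_mono step that) auto
      also have "\<dots> = ennreal ((1 / a) * (n0 + \<tau> * \<beta> * x))" using ab(1) n0 \<tau> b\<theta> x by (intro ennreal_mult[symmetric]) auto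
      finally show ?thesis by simp
    qed
    have "X \<le> ennreal ((n0 + \<tau> * \<beta> * x) / a)"
      unfolding X_def by (rule SUP_least, clarify) (rule le2, auto)
    \<comment> \<open>X being finite, the term with x can be moved to the left; \<open>small\<close>
      makes the coefficient a - \<tau> \<beta> positive.\<close>
    then have "x \<le> (n0 + \<tau> * \<beta> * x) / a"
      using x ab(1) n0 \<tau> b\<theta> by (subst (asm) x(1), subst (asm) ennreal_le_iff) auto
    then have "x * (a - \<tau> * \<beta>) \<le> n0" using ab(1) by (simp add: field_simps)
    then have "x \<le> n0 / (a - \<tau> * \<beta>)" using small[folded \<beta>_def] by (simp add: field_simps)
    then have "X \<le> ennreal (n0 / (a - \<tau> * \<beta>))" unfolding x(1) by (rule ennreal_leI)
    with X_ge[OF t k] show ?thesis by (rule order_trans)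
  qed
  \<comment> \<open>Indicators of growing balls are admissible, each with its own R; monotone
    convergence removes them.\<close>
  define I where "I n = (indicator (ball 0 (real n)) :: 'b \<Rightarrow> ennreal)" for n :: nat
  have Im [measurable]: "I n \<in> borel_measurable borel" for n
    unfolding I_def by (rule borel_measurable_indicator) simp
  have "(\<lambda>n. (NNBINT v. ennreal (G t v) * I n v)) \<longlonglongrightarrow> (NNBINT v. ennreal (G t v))"
  proof (rule nn_integral_LIMSEQ)
    show "incseq (\<lambda>n v. ennreal (G t v) * I n v)"
      by (auto simp: incseq_def le_fun_def I_def indicator_def intro!: mult_left_mono)
    show "(\<lambda>n. ennreal (G t v) * I n v) \<longlonglongrightarrow> ennreal (G t v)" for v
    proof (rule tendsto_eventually)
      have "\<forall>\<^sub>F n in sequentially. norm v < real n" by real_asymp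
      then show "\<forall>\<^sub>F n in sequentially. ennreal (G t v) * I n v = ennreal (G t v)"
        by eventually_elim (simp add: I_def)
    qed
  qed measurable
  then show ?thesis unfolding \<beta>_def[symmetric]
  proof (rule LIMSEQ_le_const2)
    have "(NNBINT v. ennreal (G t v) * I n v) \<le> ennreal (n0 / (a - \<tau> * \<beta>))" for n
    proof (rule key[OF _ _ t])
      show "measure lborel (ball (0::'b) (real n)) \<ge> 0" by simp
      have "(NNBINT v. I n v) = emeasure lborel (ball (0::'b) (real n))" by (simp add: I_def)
      also have "\<dots> = ennreal (measure lborel (ball (0::'b) (real n)))"
        using emeasure_lborel_ball_finite[of "0::'b" "real n"] by (intro emeasure_eq_ennreal_measure) simp
      finally have "(NNBINT v. I n v) \<le> ennreal (measure lborel (ball (0::'b) (real n)))" by simp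
      moreover have "I n v \<le> 1" for v by (simp add: I_def indicator_def)
      ultimately show "adm (measure lborel (ball (0::'b) (real n))) (I n)"
        using Im by (simp add: adm_def)
    qed
    then show "\<exists>N. \<forall>n\<ge>N. (NNBINT v. ennreal (G t v) * I n v) \<le> ennreal (n0 / (a - \<tau> * \<beta>))" by blast
  qed
qed

text \<open>Only upper bounds \<open>u n\<close> of the norms are required to converge to the norm
  of the limit, since the norms themselves are known through inequalities only.\<close>

lemma Scheffe_complex:
  fixes F :: "'b \<Rightarrow> complex" and Fn :: "nat \<Rightarrow> 'b \<Rightarrow> complex"
  assumes [measurable]: "\<And>n. Fn n \<in> borel_measurable M" and F: "integrable M F"
    and lim: "\<And>x. (\<lambda>n. Fn n x) \<longlonglongrightarrow> F x"
    and bound: "\<And>n. (\<integral>\<^sup>+x. ennreal (cmod (Fn n x)) \<partial>M) \<le> ennreal (u n)" "\<And>n. u n \<ge> 0" "u \<longlonglongrightarrow> (\<integral>x. cmod (F x) \<partial>M)"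
  shows "(\<lambda>n. \<integral>x. cmod (Fn n x - F x) \<partial>M) \<longlonglongrightarrow> 0" and "\<And>n. integrable M (Fn n)"
proof -
  have [measurable]: "F \<in> borel_measurable M" using F by auto
  have Fi: "integrable M (Fn n)" for n
    using bound(1)[of n] by (intro integrableI_bounded) (auto simp: le_less_trans)
  then show "\<And>n. integrable M (Fn n)" .
  have Fu: "(\<integral>x. cmod (Fn n x) \<partial>M) \<le> u n" for n
  proof -
    have "ennreal (\<integral>x. cmod (Fn n x) \<partial>M) = (\<integral>\<^sup>+x. ennreal (cmod (Fn n x)) \<partial>M)"
      using Fi by (intro nn_integral_eq_integral[symmetric]) auto
    then have "ennreal (\<integral>x. cmod (Fn n x) \<partial>M) \<le> ennreal (u n)" using bound(1)[of n] by simp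
    then show ?thesis using bound(2)[of n] ennreal_le_iff by blast
  qed
  \<comment> \<open>Takes values between 0 and 2 |F| and tends to 0 pointwise, so dominated
    convergence applies although no majorant of the sequence itself is available.\<close>
  define d where "d n x = cmod (Fn n x - F x) + cmod (F x) - cmod (Fn n x)" for n x
  have "(\<lambda>n. \<integral>x. d n x \<partial>M) \<longlonglongrightarrow> (\<integral>x. 0 \<partial>M)"
  proof (rule integral_dominated_convergence[where w="\<lambda>x. 2 * cmod (F x)"])
    show "AE x in M. (\<lambda>n. d n x) \<longlonglongrightarrow> 0"
    proof (rule AE_I2)
      fix x
      have "(\<lambda>n. d n x) \<longlonglongrightarrow> cmod (F x - F x) + cmod (F x) - cmod (F x)"
        unfolding d_def by (intro tendsto_intros lim)
      then show "(\<lambda>n. d n x) \<longlonglongrightarrow> 0" by simp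
    qed
    show "AE x in M. norm (d n x) \<le> 2 * cmod (F x)" for n
    proof (rule AE_I2)
      fix x
      have "cmod (Fn n x) \<le> cmod (Fn n x - F x) + cmod (F x)" using norm_triangle_ineq[of "Fn n x - F x" "F x"] by simp
      moreover have "cmod (Fn n x - F x) \<le> cmod (Fn n x) + cmod (F x)" by (rule norm_triangle_ineq4)
      ultimately show "norm (d n x) \<le> 2 * cmod (F x)" by (simp add: d_def)
    qed
    show "d n \<in> borel_measurable M" for n unfolding d_def by measurable
  qed (use F in auto)
  then have "(\<lambda>n. (\<integral>x. d n x \<partial>M) + (u n - (\<integral>x. cmod (F x) \<partial>M))) \<longlonglongrightarrow> 0 + ((\<integral>x. cmod (F x) \<partial>M) - (\<integral>x. cmod (F x) \<partial>M))"
    by (intro tendsto_intros bound(3)) simp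
  then have up: "(\<lambda>n. (\<integral>x. d n x \<partial>M) + (u n - (\<integral>x. cmod (F x) \<partial>M))) \<longlonglongrightarrow> 0" by simp
  show "(\<lambda>n. \<integral>x. cmod (Fn n x - F x) \<partial>M) \<longlonglongrightarrow> 0"
  proof (rule tendsto_sandwich[OF _ _ tendsto_const up])
    have "(\<integral>x. cmod (Fn n x - F x) \<partial>M) \<le> (\<integral>x. d n x \<partial>M) + (u n - (\<integral>x. cmod (F x) \<partial>M))" for n
    proof -
      have "(\<integral>x. d n x \<partial>M) = (\<integral>x. cmod (Fn n x - F x) \<partial>M) + (\<integral>x. cmod (F x) \<partial>M) - (\<integral>x. cmod (Fn n x) \<partial>M)"
        unfolding d_def using Fi[of n] F by simp
      then show ?thesis using Fu[of n] by simp
    qed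
    then show "\<forall>\<^sub>F n in sequentially. (\<integral>x. cmod (Fn n x - F x) \<partial>M) \<le> (\<integral>x. d n x \<partial>M) + (u n - (\<integral>x. cmod (F x) \<partial>M))"
      by (intro always_eventually allI)
  qed simp
qed

section \<open>Weyl forms of wave packets\<close>

text \<open>Complex polynomials in the coordinates, as a closure class: what is needed is stability
  under coordinate derivatives and polynomial growth.\<close>

inductive polyfun :: "(real^'n \<Rightarrow> complex) \<Rightarrow> bool" where
  const: "polyfun (\<lambda>x. c)"
| coord: "polyfun (\<lambda>x. complex_of_real (x $ i))"
| add: "polyfun p \<Longrightarrow> polyfun q \<Longrightarrow> polyfun (\<lambda>x. p x + q x)"
| mult: "polyfun p \<Longrightarrow> polyfun q \<Longrightarrow> polyfun (\<lambda>x. p x * q x)"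

lemma polyfun_directional_derivative:
  fixes p :: "real^'n \<Rightarrow> complex"
  assumes "polyfun p"
  shows "\<exists>q. polyfun q \<and> (\<forall>x. ((\<lambda>t. p (x + t *\<^sub>R axis i 1)) has_vector_derivative q x) (at 0))"
  using assms
proof induction
  case (const c)
  then show ?case by (intro exI[of _ "\<lambda>x. 0"]) (auto intro: polyfun.const)
next
  case (coord j)
  define d :: complex where "d = (if i = j then 1 else 0)"
  have "((\<lambda>t. complex_of_real ((x + t *\<^sub>R axis i 1) $ j)) has_vector_derivative d) (at 0)" for x :: "real^'n"
  proof -
    have "((\<lambda>t. complex_of_real (x $ j) + t *\<^sub>R d) has_vector_derivative 0 + 1 *\<^sub>R d) (at 0)"
      by (intro derivative_intros has_vector_derivative_scaleR[where g="\<lambda>_. d" and g'=0, simplified] DERIV_ident)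
    moreover have "(\<lambda>t. complex_of_real ((x + t *\<^sub>R axis i 1) $ j)) = (\<lambda>t. complex_of_real (x $ j) + t *\<^sub>R d)"
      by (auto simp: fun_eq_iff axis_def d_def scaleR_conv_of_real[where 'a=complex])
    ultimately show ?thesis by simp
  qed
  then show ?case by (intro exI[of _ "\<lambda>x. d"]) (auto intro: polyfun.const)
next
  case (add p q)
  then obtain p' q' where pq: "polyfun p'" "polyfun q'"
    "\<And>x. ((\<lambda>t. p (x + t *\<^sub>R axis i 1)) has_vector_derivative p' x) (at 0)"
    "\<And>x. ((\<lambda>t. q (x + t *\<^sub>R axis i 1)) has_vector_derivative q' x) (at 0)" by blast
  then show ?case
    by (intro exI[of _ "\<lambda>x. p' x + q' x"]) (auto intro: polyfun.add has_vector_derivative_add)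
next
  case (mult p q)
  then obtain p' q' where pq: "polyfun p'" "polyfun q'"
    "\<And>x. ((\<lambda>t. p (x + t *\<^sub>R axis i 1)) has_vector_derivative p' x) (at 0)"
    "\<And>x. ((\<lambda>t. q (x + t *\<^sub>R axis i 1)) has_vector_derivative q' x) (at 0)" by blast
  have "((\<lambda>t. p (x + t *\<^sub>R axis i 1) * q (x + t *\<^sub>R axis i 1)) has_vector_derivative p x * q' x + p' x * q x) (at 0)" for x
    using has_vector_derivative_mult[OF pq(3) pq(4)[of x]] by simp
  moreover have "polyfun (\<lambda>x. p x * q' x + p' x * q x)"
    using mult.hyps pq(1,2) by (intro polyfun.add polyfun.mult)
  ultimately show ?case by blast
qed

lemma polyfun_growth:
  fixes p :: "real^'n \<Rightarrow> complex"
  assumes "polyfun p"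
  shows "\<exists>C N. C \<ge> 0 \<and> (\<forall>x. cmod (p x) \<le> C * (1 + norm x) ^ N)"
  using assms
proof induction
  case (const c)
  then show ?case by (intro exI[of _ "cmod c"] exI[of _ 0]) auto
next
  case (coord i)
  have "cmod (complex_of_real (x $ i)) \<le> 1 * (1 + norm x) ^ 1" for x :: "real^'n"
    using component_le_norm_cart[of x i] by simp
  then show ?case using zero_le_one by blast
next
  case (add p q)
  then obtain C N C' N' where c: "C \<ge> 0" "C' \<ge> 0" "\<And>x. cmod (p x) \<le> C * (1 + norm x) ^ N" "\<And>x. cmod (q x) \<le> C' * (1 + norm x) ^ N'" by blast
  have "cmod (p x + q x) \<le> (C + C') * (1 + norm x) ^ (N + N')" for x
  proof -
    have "cmod (p x + q x) \<le> C * (1 + norm x) ^ N + C' * (1 + norm x) ^ N'"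
      by (rule order_trans[OF norm_triangle_ineq add_mono[OF c(3,4)]])
    also have "\<dots> \<le> C * (1 + norm x) ^ (N + N') + C' * (1 + norm x) ^ (N + N')"
      using c by (intro add_mono mult_left_mono power_increasing) auto
    finally show ?thesis by (simp add: distrib_right)
  qed
  then show ?case using c by (intro exI[of _ "C + C'"] exI[of _ "N + N'"]) auto
next
  case (mult p q)
  then obtain C N C' N' where c: "C \<ge> 0" "C' \<ge> 0" "\<And>x. cmod (p x) \<le> C * (1 + norm x) ^ N" "\<And>x. cmod (q x) \<le> C' * (1 + norm x) ^ N'" by blast
  have "cmod (p x * q x) \<le> (C * C') * (1 + norm x) ^ (N + N')" for x
  proof -
    have "cmod (p x * q x) \<le> (C * (1 + norm x) ^ N) * (C' * (1 + norm x) ^ N')"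
      unfolding norm_mult using c by (intro mult_mono c(3,4)) auto
    then show ?thesis by (simp add: power_add ac_simps)
  qed
  then show ?case using c by (intro exI[of _ "C * C'"] exI[of _ "N + N'"]) auto
qed

lemma wp_eq_exp:
  fixes z :: "'a::euclidean_space \<times> 'a"
  shows "wp z x = complex_of_real (2 powr (real DIM('a) / 4)) *
    exp (\<i> * complex_of_real (- pi * (fst z \<bullet> snd z) + 2 * pi * (snd z \<bullet> x)) + complex_of_real (- pi * (norm (x - fst z))\<^sup>2))"
  unfolding wp_def tfs_def gauss_def cis_conv_exp
  by (simp only: of_real_mult exp_of_real[symmetric] of_real_add distrib_left exp_add ac_simps)

lemma norm_wp: "cmod (wp z x) = 2 powr (real DIM('a) / 4) * gexp pi (x - fst z)" for z :: "'a::euclidean_space \<times> 'a"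
  by (simp add: wp_def gauss_def gexp_def norm_mult)

lemma wp_directional_derivative:
  fixes z :: "(real^'n) \<times> (real^'n)"
  shows "((\<lambda>t. wp z (x + t *\<^sub>R axis i 1)) has_vector_derivative
    (\<i> * complex_of_real (2 * pi * snd z $ i) + complex_of_real (- 2 * pi * (x $ i - fst z $ i))) * wp z x) (at 0)"
proof -
  define A where "A t = - pi * (fst z \<bullet> snd z) + 2 * pi * (snd z \<bullet> (x + t *\<^sub>R axis i 1))" for t
  define Q where "Q t = - pi * (norm (x + t *\<^sub>R axis i 1 - fst z))\<^sup>2" for t
  have A: "(A has_real_derivative 2 * pi * snd z $ i) (at 0)"
  proof -
    have "A = (\<lambda>t. - pi * (fst z \<bullet> snd z) + 2 * pi * (snd z \<bullet> x) + t * (2 * pi * snd z $ i))"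
      by (simp add: fun_eq_iff A_def inner_add_right inner_axis algebra_simps)
    then show ?thesis by (auto intro!: derivative_eq_intros)
  qed
  have Q: "(Q has_real_derivative - 2 * pi * (x $ i - fst z $ i)) (at 0)"
  proof -
    have "Q = (\<lambda>t. - pi * ((x - fst z) \<bullet> (x - fst z) + 2 * t * (x $ i - fst z $ i) + t * t))"
    proof
      fix t
      have "x + t *\<^sub>R axis i 1 - fst z = (x - fst z) + t *\<^sub>R axis i 1" by simp
      then have "(norm (x + t *\<^sub>R axis i 1 - fst z))\<^sup>2 = ((x - fst z) + t *\<^sub>R axis i 1) \<bullet> ((x - fst z) + t *\<^sub>R axis i 1)"
        by (simp only: power2_norm_eq_inner)
      also have "\<dots> = (x - fst z) \<bullet> (x - fst z) + 2 * t * ((x - fst z) \<bullet> axis i 1) + t * t * (axis i 1 \<bullet> (axis i 1 :: real^'n))"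
        by (simp only: inner_add_left inner_add_right inner_scaleR_left inner_scaleR_right inner_commute[of "axis i 1" "x - fst z"]) (simp add: algebra_simps)
      also have "\<dots> = (x - fst z) \<bullet> (x - fst z) + 2 * t * (x $ i - fst z $ i) + t * t"
        by (simp add: inner_axis inner_axis_axis)
      finally show "Q t = - pi * ((x - fst z) \<bullet> (x - fst z) + 2 * t * (x $ i - fst z $ i) + t * t)" by (simp add: Q_def)
    qed
    then show ?thesis by (auto intro!: derivative_eq_intros)
  qed
  define c where "c = complex_of_real (2 powr (real DIM(real^'n) / 4))"
  have "((\<lambda>t. \<i> * complex_of_real (A t) + complex_of_real (Q t)) has_vector_derivative
     \<i> * complex_of_real (2 * pi * snd z $ i) + complex_of_real (- 2 * pi * (x $ i - fst z $ i))) (at 0)"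
    using A Q by (intro has_vector_derivative_add has_vector_derivative_mult_right has_vector_derivative_of_real)
  then have "((\<lambda>t. exp (\<i> * complex_of_real (A t) + complex_of_real (Q t))) has_vector_derivative
     (\<i> * complex_of_real (2 * pi * snd z $ i) + complex_of_real (- 2 * pi * (x $ i - fst z $ i))) * exp (\<i> * complex_of_real (A 0) + complex_of_real (Q 0))) (at 0)"
    using field_vector_diff_chain_at[OF _ DERIV_exp] by (simp add: o_def)
  then have "((\<lambda>t. c * exp (\<i> * complex_of_real (A t) + complex_of_real (Q t))) has_vector_derivative
     c * ((\<i> * complex_of_real (2 * pi * snd z $ i) + complex_of_real (- 2 * pi * (x $ i - fst z $ i))) * exp (\<i> * complex_of_real (A 0) + complex_of_real (Q 0)))) (at 0)"
    by (rule has_vector_derivative_mult_right)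
  moreover have "wp z (x + t *\<^sub>R axis i 1) = c * exp (\<i> * complex_of_real (A t) + complex_of_real (Q t))" for t
    unfolding wp_eq_exp c_def A_def Q_def ..
  moreover from this[of 0] have "wp z x = c * exp (\<i> * complex_of_real (A 0) + complex_of_real (Q 0))" by simp
  ultimately show ?thesis by (simp only: mult.left_commute mult.assoc)
qed

text \<open>Every iterated partial derivative of a wave packet is a polynomial times the packet.
  This is what allows wave packets in the generator condition of
  \<open>schrodinger_propagator\<close>, which speaks of Schwartz functions only.\<close>

lemma schwartz_wp:
  fixes z :: "(real^'n) \<times> (real^'n)"
  shows "schwartz (wp z)"
proof -
  have step: "\<exists>q. polyfun q \<and> (\<forall>x. ((\<lambda>t. p (x + t *\<^sub>R axis i 1) * wp z (x + t *\<^sub>R axis i 1)) has_vector_derivative q x * wp z x) (at 0))"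
    if p: "polyfun p" for p i
  proof -
    obtain p' where p': "polyfun p'" "\<And>x. ((\<lambda>t. p (x + t *\<^sub>R axis i 1)) has_vector_derivative p' x) (at 0)"
      using polyfun_directional_derivative[OF p] by blast
    define d where "d x = \<i> * complex_of_real (2 * pi * snd z $ i) + complex_of_real (- 2 * pi) * (complex_of_real (x $ i) + complex_of_real (- fst z $ i))" for x :: "real^'n"
    have d: "polyfun d" unfolding d_def[abs_def] by (intro polyfun.add polyfun.mult polyfun.const polyfun.coord)
    have "((\<lambda>t. p (x + t *\<^sub>R axis i 1) * wp z (x + t *\<^sub>R axis i 1)) has_vector_derivative (p x * d x + p' x) * wp z x) (at 0)" for x
    proof -
      have "d x = \<i> * complex_of_real (2 * pi * snd z $ i) + complex_of_real (- 2 * pi * (x $ i - fst z $ i))"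
        by (simp add: d_def algebra_simps)
      then have eq: "(p x * d x + p' x) * wp z x = p x * ((\<i> * complex_of_real (2 * pi * snd z $ i) + complex_of_real (- 2 * pi * (x $ i - fst z $ i))) * wp z x) + p' x * wp z x"
        by (simp only: distrib_right mult.assoc)
      show ?thesis unfolding eq
        using has_vector_derivative_mult[OF p'(2)[of x] wp_directional_derivative[of z x i]]
        by (simp only: scaleR_zero_left add_0_right)
    qed
    moreover have "polyfun (\<lambda>x. p x * d x + p' x)" using p d p'(1) by (intro polyfun.add polyfun.mult)
    ultimately show ?thesis by blast
  qed
  have iter: "\<exists>q. polyfun q \<and> iter_partial is (wp z) = (\<lambda>x. q x * wp z x)" for "is"
  proof (induction "is")
    case Nil
    then show ?case by (intro exI[of _ "\<lambda>x. 1"]) (auto intro: polyfun.const)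
  next
    case (Cons i "is")
    then obtain p where p: "polyfun p" "iter_partial is (wp z) = (\<lambda>x. p x * wp z x)" by blast
    obtain q where q: "polyfun q" "\<And>x. ((\<lambda>t. p (x + t *\<^sub>R axis i 1) * wp z (x + t *\<^sub>R axis i 1)) has_vector_derivative q x * wp z x) (at 0)"
      using step[OF p(1)] by blast
    have "iter_partial (i # is) (wp z) = (\<lambda>x. q x * wp z x)"
      by (simp add: fun_eq_iff partial_dir_def p(2) vector_derivative_at[OF q(2)])
    then show ?case using q(1) by blast
  qed
  show ?thesis
    unfolding schwartz_def
  proof (intro conjI allI)
    fix "is" :: "'n list" and x i
    obtain p where p: "polyfun p" "iter_partial is (wp z) = (\<lambda>x. p x * wp z x)" using iter by blast
    then show "(\<lambda>t. iter_partial is (wp z) (x + t *\<^sub>R axis i 1)) differentiable (at 0)"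
      using step[OF p(1), of i] by (auto simp: p(2) intro: differentiableI_vector)
  next
    fix "is" :: "'n list" and k :: nat
    obtain p where p: "polyfun p" "iter_partial is (wp z) = (\<lambda>x. p x * wp z x)" using iter by blast
    obtain C N where CN: "C \<ge> 0" "\<And>x. cmod (p x) \<le> C * (1 + norm x) ^ N" using polyfun_growth[OF p(1)] by blast
    define c where "c = 2 powr (real DIM(real^'n) / 4)"
    have "norm ((1 + norm x) ^ k * cmod (iter_partial is (wp z) x)) \<le> C * (1 + norm (fst z)) ^ (k + N) * c * exp ((real (k + N))\<^sup>2 / (2 * pi))" for x
    proof -
      have "1 + norm x \<le> (1 + norm (fst z)) * (1 + norm (x - fst z))"
      proof -
        have "norm x \<le> norm (x - fst z) + norm (fst z)" using norm_triangle_ineq[of "x - fst z" "fst z"] by simp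
        moreover have "0 \<le> norm (fst z) * norm (x - fst z)" by simp
        ultimately show ?thesis unfolding distrib_left distrib_right by linarith
      qed
      then have n: "(1 + norm x) ^ (k + N) \<le> ((1 + norm (fst z)) * (1 + norm (x - fst z))) ^ (k + N)"
        by (intro power_mono) auto
      have "norm ((1 + norm x) ^ k * cmod (iter_partial is (wp z) x)) = (1 + norm x) ^ k * cmod (p x) * (c * gexp pi (x - fst z))"
        by (simp add: p(2) norm_mult norm_wp c_def)
      also have "\<dots> \<le> (1 + norm x) ^ k * (C * (1 + norm x) ^ N) * (c * gexp pi (x - fst z))"
        by (intro mult_right_mono mult_left_mono CN) (auto simp: c_def)
      also have "\<dots> = C * c * ((1 + norm x) ^ (k + N) * gexp pi (x - fst z))" by (simp add: power_add ac_simps)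
      also have "\<dots> \<le> C * c * (((1 + norm (fst z)) * (1 + norm (x - fst z))) ^ (k + N) * gexp pi (x - fst z))"
        using CN(1) by (intro mult_left_mono mult_right_mono n) (auto simp: c_def)
      also have "\<dots> = C * (1 + norm (fst z)) ^ (k + N) * c * ((1 + norm (x - fst z)) ^ (k + N) * gexp pi (x - fst z))"
        by (simp add: power_mult_distrib ac_simps)
      also have "\<dots> \<le> C * (1 + norm (fst z)) ^ (k + N) * c * (exp ((real (k + N))\<^sup>2 / (2 * pi)) * 1)"
        using CN(1) by (intro mult_left_mono order_trans[OF norm_add_gexp_le] mult_mono gexp_le_1) (auto simp: c_def)
      finally show ?thesis by simp
    qed
    then show "bounded (range (\<lambda>x. (1 + norm x) ^ k * cmod (iter_partial is (wp z) x)))"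
      by (intro boundedI) auto
  qed
qed

text \<open>The cross-Wigner function of two packets is a Gaussian at the midpoint of their centres,
  oscillating with frequency \<open>sympl_J (z - w)\<close>. Centres and distance thus enter
  separately, which is what lets the Weyl form be estimated through z - w.\<close>

lemma wigner_wp:
  fixes z w :: "(real^'n) \<times> (real^'n)"
  shows "wigner (wp z) (wp w) ((1 / 2) *\<^sub>R (z + w) + u) =
    complex_of_real (sqrt 2 ^ DIM((real^'n) \<times> (real^'n))) * cis (pi * sympl z w) * (complex_of_real (exp (- pi * 2 * (norm u)\<^sup>2)) * cis (2 * pi * (sympl_J (z - w) \<bullet> u)))"
proof -
  obtain x0 \<xi>0 where z: "z = (x0, \<xi>0)" by (cases z)
  obtain x1 \<xi>1 where w: "w = (x1, \<xi>1)" by (cases w)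
  obtain U \<Upsilon> where u: "u = (U, \<Upsilon>)" by (cases u)
  define X where "X = (1 / 2) *\<^sub>R (x0 + x1) + U"
  define \<Xi> where "\<Xi> = (1 / 2) *\<^sub>R (\<xi>0 + \<xi>1) + \<Upsilon>"
  have \<zeta>: "(1 / 2) *\<^sub>R (z + w) + u = (X, \<Xi>)" by (simp add: z w u X_def \<Xi>_def)
  \<comment> \<open>Shifting t by the difference of the positions makes both Gaussian arguments
    symmetric, U + t / 2 and U - t / 2, so that they decouple.\<close>
  define \<delta> where "\<delta> = x0 - x1"
  define k where "k = (2 powr (real DIM(real^'n) / 4))\<^sup>2"
  define \<kappa> where "\<kappa> = complex_of_real (k * exp (- pi * 2 * (norm U)\<^sup>2)) * cis (pi * sympl z w + 2 * pi * (sympl_J (z - w) \<bullet> u))"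
  have eq: "wp z (X + (1 / 2) *\<^sub>R (t + \<delta>)) * cnj (wp w (X - (1 / 2) *\<^sub>R (t + \<delta>))) * cis (- 2 * pi * ((t + \<delta>) \<bullet> \<Xi>))
     = \<kappa> * (complex_of_real (exp (- pi * (1 / 2) * (norm t)\<^sup>2)) * cis (2 * pi * (- \<Upsilon> \<bullet> t)))" for t
  proof -
    have v1: "X + (1 / 2) *\<^sub>R (t + \<delta>) - x0 = U + (1 / 2) *\<^sub>R t" and v2: "X - (1 / 2) *\<^sub>R (t + \<delta>) - x1 = U - (1 / 2) *\<^sub>R t"
      by (simp_all add: X_def \<delta>_def vec_eq_iff field_simps)
    have e: "(norm (U + (1 / 2) *\<^sub>R t))\<^sup>2 + (norm (U - (1 / 2) *\<^sub>R t))\<^sup>2 = 2 * (norm U)\<^sup>2 + (1 / 2) * (norm t)\<^sup>2"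
      unfolding power2_norm_eq_inner
      by (simp add: inner_add_left inner_add_right inner_diff_left inner_diff_right inner_commute field_simps)
    have r: "exp (- pi * (norm (U + (1 / 2) *\<^sub>R t))\<^sup>2) * exp (- pi * (norm (U - (1 / 2) *\<^sub>R t))\<^sup>2) = exp (- pi * 2 * (norm U)\<^sup>2) * exp (- pi * (1 / 2) * (norm t)\<^sup>2)"
    proof -
      have "exp (- pi * (norm (U + (1 / 2) *\<^sub>R t))\<^sup>2) * exp (- pi * (norm (U - (1 / 2) *\<^sub>R t))\<^sup>2) = exp (- pi * ((norm (U + (1 / 2) *\<^sub>R t))\<^sup>2 + (norm (U - (1 / 2) *\<^sub>R t))\<^sup>2))"
        by (simp add: exp_add[symmetric] distrib_left)
      then show ?thesis unfolding e by (simp add: exp_add[symmetric] algebra_simps)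
    qed
    define p where "p = cis (- pi * (x0 \<bullet> \<xi>0)) * cis (2 * pi * (\<xi>0 \<bullet> (X + (1 / 2) *\<^sub>R (t + \<delta>)))) *
       cnj (cis (- pi * (x1 \<bullet> \<xi>1)) * cis (2 * pi * (\<xi>1 \<bullet> (X - (1 / 2) *\<^sub>R (t + \<delta>))))) * cis (- 2 * pi * ((t + \<delta>) \<bullet> \<Xi>))"
    have p: "p = cis (pi * sympl z w + 2 * pi * (sympl_J (z - w) \<bullet> u)) * cis (2 * pi * (- \<Upsilon> \<bullet> t))"
      unfolding p_def cis_mult cis_cnj
      by (rule cis_cong, simp only: X_def \<Xi>_def \<delta>_def z w u sympl_def sympl_J_def fst_conv snd_conv diff_Pair inner_Pair inner_add_left inner_add_right
        inner_diff_left inner_diff_right inner_scaleR_left inner_scaleR_right inner_minus_left inner_minus_right)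
        (simp add: inner_commute field_simps)
    have "wp z (X + (1 / 2) *\<^sub>R (t + \<delta>)) * cnj (wp w (X - (1 / 2) *\<^sub>R (t + \<delta>))) * cis (- 2 * pi * ((t + \<delta>) \<bullet> \<Xi>))
      = complex_of_real (k * (exp (- pi * (norm (U + (1 / 2) *\<^sub>R t))\<^sup>2) * exp (- pi * (norm (U - (1 / 2) *\<^sub>R t))\<^sup>2))) * p"
      unfolding p_def wp_def tfs_def gauss_def z w fst_conv snd_conv v1 v2 k_def power2_eq_square[of "2 powr _"]
      by (simp only: complex_cnj_mult complex_cnj_complex_of_real of_real_mult ac_simps)
    then show ?thesis unfolding r p \<kappa>_def by (simp only: of_real_mult ac_simps)
  qed
  have "wigner (wp z) (wp w) (X, \<Xi>) = (LBINT t. wp z (X + (1 / 2) *\<^sub>R (t + \<delta>)) * cnj (wp w (X - (1 / 2) *\<^sub>R (t + \<delta>))) * cis (- 2 * pi * ((t + \<delta>) \<bullet> \<Xi>)))"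
    unfolding wigner_def fst_conv snd_conv
    by (rule integral_lborel_translate[symmetric])
  also have "\<dots> = \<kappa> * complex_of_real ((1 / sqrt (1 / 2)) ^ DIM(real^'n) * exp (- pi * (norm (- \<Upsilon>))\<^sup>2 / (1 / 2)))"
    unfolding eq integral_mult_right_zero by (subst gauss_FT(2)) auto
  also have "\<dots> = complex_of_real ((k * (1 / sqrt (1 / 2)) ^ DIM(real^'n)) * (exp (- pi * 2 * (norm U)\<^sup>2) * exp (- pi * 2 * (norm \<Upsilon>)\<^sup>2))) * cis (pi * sympl z w + 2 * pi * (sympl_J (z - w) \<bullet> u))"
    unfolding \<kappa>_def by (simp add: mult.assoc)
  also have "exp (- pi * 2 * (norm U)\<^sup>2) * exp (- pi * 2 * (norm \<Upsilon>)\<^sup>2) = exp (- pi * 2 * (norm u)\<^sup>2)"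
    by (simp add: exp_add[symmetric] norm_prod_sq u algebra_simps)
  also have "k * (1 / sqrt (1 / 2)) ^ DIM(real^'n) = sqrt 2 ^ DIM((real^'n) \<times> (real^'n))"
  proof -
    have s: "1 / sqrt (1 / 2) = sqrt 2" by (simp add: real_sqrt_divide)
    have "k * (1 / sqrt 2) ^ DIM(real^'n) = 1" unfolding k_def by (rule gauss_normalize)
    then have "k = sqrt 2 ^ DIM(real^'n)" by (simp add: power_divide field_simps)
    then show ?thesis unfolding s by (simp add: power_add)
  qed
  finally show ?thesis unfolding \<zeta> cis_mult[symmetric] by (simp only: of_real_mult ac_simps)
qed

section \<open>Gaussian moments by differentiation under the integral sign\<close>

lemma DERIV_sequential_quotient:
  fixes f :: "'a::real_normed_field \<Rightarrow> 'a"
  assumes "(f has_field_derivative D) (at x)"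
  shows "(\<lambda>n. (f (x + of_real (1 / (real n + 1))) - f x) * of_real (real n + 1)) \<longlonglongrightarrow> D"
proof -
  have "((\<lambda>h. (f (x + h) - f x) / h) \<longlongrightarrow> D) (at 0)" using assms by (rule DERIV_D)
  moreover have "filterlim (\<lambda>n. of_real (1 / (real n + 1)) :: 'a) (at 0) sequentially"
  proof (rule filterlim_atI)
    have "(\<lambda>n. 1 / (real n + 1)) \<longlonglongrightarrow> 0" by real_asymp
    then show "(\<lambda>n. of_real (1 / (real n + 1)) :: 'a) \<longlonglongrightarrow> 0" using tendsto_of_real[of "\<lambda>n. 1 / (real n + 1)" 0 sequentially, where 'a='a] by (simp only: of_real_0)
    show "\<forall>\<^sub>F n in sequentially. of_real (1 / (real n + 1)) \<noteq> (0::'a)"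
      by (intro always_eventually allI) (simp only: of_real_eq_0_iff, simp)
  qed
  ultimately have "(\<lambda>n. (f (x + of_real (1 / (real n + 1))) - f x) / of_real (1 / (real n + 1))) \<longlonglongrightarrow> D"
    by (rule filterlim_compose)
  then show ?thesis by (simp add: divide_inverse flip: of_real_inverse)
qed

text \<open>Difference quotients in the frequency are dominated through |cis s - 1| \<le> |s|, so
  one integrable moment of \<open>p\<close> is enough. Comparing with the explicit transform yields
  the next moment.\<close>

lemma modulated_integral_derivative:
  fixes p :: "'b::euclidean_space \<Rightarrow> complex"
  assumes [measurable]: "p \<in> borel_measurable borel" and ip: "integrable lborel p" and i1: "integrable lborel (\<lambda>u. norm u * cmod (p u))"
  shows "(\<lambda>n. ((LBINT u. p u * cis (2 * pi * ((b + (1 / (real n + 1)) *\<^sub>R e) \<bullet> u))) - (LBINT u. p u * cis (2 * pi * (b \<bullet> u)))) * of_real (real n + 1))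
    \<longlonglongrightarrow> (LBINT u. p u * cis (2 * pi * (b \<bullet> u)) * (\<i> * of_real (2 * pi * (e \<bullet> u))))"
proof -
  have ic: "integrable lborel (\<lambda>u. p u * cis (2 * pi * (x \<bullet> u)))" for x :: 'b
    by (rule Bochner_Integration.integrable_bound[OF ip]) (auto simp: norm_mult)
  define q where "q n u = p u * cis (2 * pi * (b \<bullet> u)) * ((cis (2 * pi * (e \<bullet> u) * (1 / (real n + 1))) - 1) * of_real (real n + 1))" for n u
  have eq: "((LBINT u. p u * cis (2 * pi * ((b + (1 / (real n + 1)) *\<^sub>R e) \<bullet> u))) - (LBINT u. p u * cis (2 * pi * (b \<bullet> u)))) * of_real (real n + 1) = (LBINT u. q n u)" for n
  proof -
    have "p u * cis (2 * pi * ((b + (1 / (real n + 1)) *\<^sub>R e) \<bullet> u)) - p u * cis (2 * pi * (b \<bullet> u)) = p u * cis (2 * pi * (b \<bullet> u)) * (cis (2 * pi * (e \<bullet> u) * (1 / (real n + 1))) - 1)" for u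
    proof -
      have "cis (2 * pi * ((b + (1 / (real n + 1)) *\<^sub>R e) \<bullet> u)) = cis (2 * pi * (b \<bullet> u)) * cis (2 * pi * (e \<bullet> u) * (1 / (real n + 1)))"
        unfolding cis_mult by (rule cis_cong) (simp add: inner_add_left distrib_left)
      then show ?thesis by (simp only: right_diff_distrib mult.assoc mult_1_right)
    qed
    then have "(LBINT u. q n u) = (LBINT u. (p u * cis (2 * pi * ((b + (1 / (real n + 1)) *\<^sub>R e) \<bullet> u)) - p u * cis (2 * pi * (b \<bullet> u))) * of_real (real n + 1))"
      unfolding q_def by (simp only: mult.assoc)
    then show ?thesis using ic by (simp only: integral_mult_left_zero Bochner_Integration.integral_diff)
  qed
  show ?thesis unfolding eq
  proof (rule integral_dominated_convergence[where w="\<lambda>u. 2 * pi * norm e * (norm u * cmod (p u))"])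
    show "integrable lborel (\<lambda>u. 2 * pi * norm e * (norm u * cmod (p u)))" using i1 by simp
    show "AE u in lborel. (\<lambda>n. q n u) \<longlonglongrightarrow> p u * cis (2 * pi * (b \<bullet> u)) * (\<i> * of_real (2 * pi * (e \<bullet> u)))"
    proof (rule AE_I2)
      fix u
      define c where "c = 2 * pi * (e \<bullet> u)"
      have "((\<lambda>z. exp (\<i> * of_real c * z)) has_field_derivative (\<i> * of_real c)) (at 0)"
        by (auto intro!: derivative_eq_intros)
      from DERIV_sequential_quotient[OF this]
      have "(\<lambda>n. (exp (\<i> * of_real c * (0 + of_real (1 / (real n + 1)))) - exp (\<i> * of_real c * 0)) * of_real (real n + 1)) \<longlonglongrightarrow> \<i> * of_real c" .
      moreover have "exp (\<i> * of_real c * (0 + of_real (1 / (real n + 1)))) - exp (\<i> * of_real c * 0) = cis (c * (1 / (real n + 1))) - 1" for n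
        by (simp add: cis_conv_exp)
      ultimately have "(\<lambda>n. (cis (c * (1 / (real n + 1))) - 1) * of_real (real n + 1)) \<longlonglongrightarrow> \<i> * of_real c"
        by (simp only:)
      then show "(\<lambda>n. q n u) \<longlonglongrightarrow> p u * cis (2 * pi * (b \<bullet> u)) * (\<i> * of_real (2 * pi * (e \<bullet> u)))"
        unfolding q_def c_def by (rule tendsto_mult_left)
    qed
    show "AE u in lborel. norm (q n u) \<le> 2 * pi * norm e * (norm u * cmod (p u))" for n
    proof (rule AE_I2)
      fix u
      have "cmod ((cis (2 * pi * (e \<bullet> u) * (1 / (real n + 1))) - 1) * of_real (real n + 1)) \<le> \<bar>2 * pi * (e \<bullet> u) * (1 / (real n + 1))\<bar> * (real n + 1)"
      proof -
        define \<theta> where "\<theta> = 2 * pi * (e \<bullet> u) * (1 / (real n + 1))"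
        have "cmod (cis \<theta> - 1) \<le> \<bar>\<theta>\<bar>" using norm_1_minus_cis_le[of \<theta>] by (simp only: norm_minus_commute)
        then have "cmod (cis \<theta> - 1) * (real n + 1) \<le> \<bar>\<theta>\<bar> * (real n + 1)" by (intro mult_right_mono) auto
        moreover have "\<bar>real n + 1\<bar> = real n + 1" by simp
        ultimately show ?thesis unfolding \<theta>_def[symmetric] by (simp only: norm_mult norm_of_real)
      qed
      also have "\<dots> = 2 * pi * \<bar>e \<bullet> u\<bar>" by (simp add: abs_mult)
      also have "\<dots> \<le> 2 * pi * (norm e * norm u)" using Cauchy_Schwarz_ineq2[of e u] by simp
      finally have "cmod (p u) * cmod ((cis (2 * pi * (e \<bullet> u) * (1 / (real n + 1))) - 1) * of_real (real n + 1)) \<le> cmod (p u) * (2 * pi * (norm e * norm u))"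
        by (intro mult_left_mono) auto
      then show "norm (q n u) \<le> 2 * pi * norm e * (norm u * cmod (p u))"
        unfolding q_def norm_mult norm_cis by (simp add: ac_simps)
    qed
    show "q n \<in> borel_measurable lborel" for n unfolding q_def by measurable
  qed measurable
qed

text \<open>The Gaussian profile of the cross-Wigner function of two wave packets;
  \<open>gau2_hat\<close> is its Fourier transform.\<close>

definition gau2 :: "'b::euclidean_space \<Rightarrow> real" where
  "gau2 u = exp (- pi * 2 * (norm u)\<^sup>2)"

definition gau2_hat :: "'b::euclidean_space \<Rightarrow> real" where
  "gau2_hat b = (1 / sqrt 2) ^ DIM('b) * exp (- (pi / 2) * (norm b)\<^sup>2)"

lemma borel_measurable_gau2 [measurable]: "gau2 \<in> borel_measurable borel"
  unfolding gau2_def by measurable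

lemma gau2_pos [simp]: "gau2 u > 0" "gau2 u \<ge> 0" by (simp_all add: gau2_def)

lemma integrable_power_gau2: "integrable lborel (\<lambda>u::'b::euclidean_space. (1 + norm u) ^ k * gau2 u)"
  using integrable_power_exp_norm_sq[of "2 * pi" k, where 'a='b] by (simp add: gau2_def mult.assoc mult.left_commute)

lemma integrable_gau2_bound:
  fixes f :: "'b::euclidean_space \<Rightarrow> complex"
  assumes "f \<in> borel_measurable borel" "\<And>u. cmod (f u) \<le> C * ((1 + norm u) ^ k * gau2 u)"
  shows "integrable lborel f"
  by (rule Bochner_Integration.integrable_bound[OF integrable_mult_right[OF integrable_power_gau2, of C k]])
    (use assms in \<open>auto intro!: AE_I2 order_trans[OF assms(2) abs_ge_self]\<close>)

lemma gau2_moment0: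
  fixes b :: "'b::euclidean_space"
  shows "(LBINT u. of_real (gau2 u) * cis (2 * pi * (b \<bullet> u))) = complex_of_real (gau2_hat b)"
  unfolding gau2_def gau2_hat_def using gauss_FT(2)[of 2 b] by simp

lemma gau2_hat_line_derivative:
  fixes b e :: "'b::euclidean_space"
  shows "((\<lambda>t. gau2_hat (b + t *\<^sub>R e)) has_real_derivative - pi * (b \<bullet> e) * gau2_hat b) (at 0)"
proof -
  define \<kappa> where "\<kappa> = (1 / sqrt 2) ^ DIM('b)"
  have "(\<lambda>t. gau2_hat (b + t *\<^sub>R e)) = (\<lambda>t. \<kappa> * exp (- (pi / 2) * (b \<bullet> b + 2 * t * (b \<bullet> e) + t * t * (e \<bullet> e))))"
  proof
    fix t
    have "(norm (b + t *\<^sub>R e))\<^sup>2 = b \<bullet> b + 2 * t * (b \<bullet> e) + t * t * (e \<bullet> e)"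
      unfolding power2_norm_eq_inner by (simp add: inner_add_left inner_add_right inner_commute[of e b] algebra_simps)
    then show "gau2_hat (b + t *\<^sub>R e) = \<kappa> * exp (- (pi / 2) * (b \<bullet> b + 2 * t * (b \<bullet> e) + t * t * (e \<bullet> e)))"
      by (simp add: gau2_hat_def \<kappa>_def)
  qed
  moreover have "((\<lambda>t. \<kappa> * exp (- (pi / 2) * (b \<bullet> b + 2 * t * (b \<bullet> e) + t * t * (e \<bullet> e)))) has_real_derivative
     - pi * (b \<bullet> e) * (\<kappa> * exp (- (pi / 2) * (b \<bullet> b)))) (at 0)"
    by (auto intro!: derivative_eq_intros)
  moreover have "\<kappa> * exp (- (pi / 2) * (b \<bullet> b)) = gau2_hat b"
    by (simp add: gau2_hat_def \<kappa>_def power2_norm_eq_inner)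
  ultimately show ?thesis by simp
qed

lemma two_pi_i_cancel:
  "complex_of_real (2 * pi) * \<i> * I = complex_of_real (- pi * x) \<Longrightarrow> I = \<i> / 2 * complex_of_real x"
  "complex_of_real (2 * pi) * \<i> * I = \<i> / 2 * complex_of_real x \<Longrightarrow> I = complex_of_real (x / (4 * pi))"
  by (auto simp: complex_eq_iff field_simps)

text \<open>The derivative of \<open>gau2_moment0\<close> along e, computed under the integral and
  on the closed form; \<open>gau2_moment2\<close> repeats this with the first moment.\<close>

lemma gau2_moment1:
  fixes b e :: "'b::euclidean_space"
  shows "(LBINT u. of_real ((e \<bullet> u) * gau2 u) * cis (2 * pi * (b \<bullet> u))) = \<i> / 2 * of_real ((b \<bullet> e) * gau2_hat b)"
proof -
  define D where "D = (LBINT u. of_real (gau2 u) * cis (2 * pi * (b \<bullet> u)) * (\<i> * of_real (2 * pi * (e \<bullet> u))))"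
  have "(\<lambda>n. ((LBINT u. of_real (gau2 u) * cis (2 * pi * ((b + (1 / (real n + 1)) *\<^sub>R e) \<bullet> u))) - (LBINT u. of_real (gau2 u) * cis (2 * pi * (b \<bullet> u)))) * complex_of_real (real n + 1)) \<longlonglongrightarrow> D"
    unfolding D_def
  proof (rule modulated_integral_derivative)
    show "integrable lborel (\<lambda>u. complex_of_real (gau2 (u::'b)))"
      by (rule integrable_gau2_bound[where C=1 and k=0]) auto
    show "integrable lborel (\<lambda>u. norm (u::'b) * cmod (complex_of_real (gau2 u)))"
      by (rule Bochner_Integration.integrable_bound[OF integrable_power_gau2[where k=1]]) (auto intro!: AE_I2 mult_right_mono)
  qed measurable
  then have lim1: "(\<lambda>n. complex_of_real ((gau2_hat (b + (0 + (1 / (real n + 1))) *\<^sub>R e) - gau2_hat (b + 0 *\<^sub>R e)) * (real n + 1))) \<longlonglongrightarrow> D"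
    by (simp only: gau2_moment0 of_real_diff of_real_mult add_0 scaleR_zero_left add_0_right)
  have "(\<lambda>n. (gau2_hat (b + (0 + (1 / (real n + 1))) *\<^sub>R e) - gau2_hat (b + 0 *\<^sub>R e)) * (real n + 1)) \<longlonglongrightarrow> - pi * (b \<bullet> e) * gau2_hat b"
    using DERIV_sequential_quotient[OF gau2_hat_line_derivative[of b e]] by (simp only: of_real_eq_id id_apply)
  then have "D = complex_of_real (- pi * (b \<bullet> e) * gau2_hat b)"
    using LIMSEQ_unique[OF lim1 tendsto_of_real] by blast
  moreover have "D = (2 * pi * \<i>) * (LBINT u. of_real ((e \<bullet> u) * gau2 u) * cis (2 * pi * (b \<bullet> u)))"
    unfolding D_def integral_mult_right_zero[symmetric] by (intro Bochner_Integration.integral_cong) auto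
  ultimately show ?thesis using two_pi_i_cancel(1)[of _ "(b \<bullet> e) * gau2_hat b"] by (simp only: mult.assoc)
qed

lemma gau2_moment2:
  fixes b e e' :: "'b::euclidean_space"
  shows "(LBINT u. of_real ((e \<bullet> u) * (e' \<bullet> u) * gau2 u) * cis (2 * pi * (b \<bullet> u)))
    = complex_of_real ((e \<bullet> e' - pi * (b \<bullet> e) * (b \<bullet> e')) / (4 * pi) * gau2_hat b)"
proof -
  define p where "p u = complex_of_real ((e' \<bullet> u) * gau2 u)" for u
  define D where "D = (LBINT u. p u * cis (2 * pi * (b \<bullet> u)) * (\<i> * of_real (2 * pi * (e \<bullet> u))))"
  have pb: "cmod (p u) \<le> norm e' * ((1 + norm u) ^ 1 * gau2 u)" for u
  proof -
    have "cmod (p u) = \<bar>e' \<bullet> u\<bar> * gau2 u" by (simp add: p_def abs_mult norm_mult)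
    also have "\<dots> \<le> (norm e' * (1 + norm u)) * gau2 u"
      by (intro mult_right_mono order_trans[OF Cauchy_Schwarz_ineq2] mult_left_mono) auto
    finally show ?thesis by simp
  qed
  have pm [measurable]: "p \<in> borel_measurable borel" unfolding p_def by measurable
  have "(\<lambda>n. ((LBINT u. p u * cis (2 * pi * ((b + (1 / (real n + 1)) *\<^sub>R e) \<bullet> u))) - (LBINT u. p u * cis (2 * pi * (b \<bullet> u)))) * complex_of_real (real n + 1)) \<longlonglongrightarrow> D"
    unfolding D_def
  proof (rule modulated_integral_derivative)
    show "integrable lborel p" by (rule integrable_gau2_bound[OF pm pb])
    show "integrable lborel (\<lambda>u. norm u * cmod (p u))"
    proof (rule Bochner_Integration.integrable_bound)
      show "integrable lborel (\<lambda>u::'b. norm e' * ((1 + norm u) ^ 2 * gau2 u))" by (intro integrable_mult_right integrable_power_gau2)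
      show "AE u in lborel. norm (norm u * cmod (p u)) \<le> norm (norm e' * ((1 + norm u) ^ 2 * gau2 u))"
      proof (rule AE_I2)
        fix u :: 'b
        have "norm u * cmod (p u) \<le> (1 + norm u) * (norm e' * ((1 + norm u) ^ 1 * gau2 u))" by (intro mult_mono pb) auto
        then show "norm (norm u * cmod (p u)) \<le> norm (norm e' * ((1 + norm u) ^ 2 * gau2 u))"
          by (simp add: abs_mult power2_eq_square ac_simps)
      qed
    qed measurable
  qed measurable
  moreover have m1: "(LBINT u. p u * cis (2 * pi * (x \<bullet> u))) = \<i> / 2 * of_real ((x \<bullet> e') * gau2_hat x)" for x
    unfolding p_def by (rule gau2_moment1)
  ultimately have "(\<lambda>n. (\<i> / 2 * of_real (((b + (1 / (real n + 1)) *\<^sub>R e) \<bullet> e') * gau2_hat (b + (1 / (real n + 1)) *\<^sub>R e)) - \<i> / 2 * of_real ((b \<bullet> e') * gau2_hat b)) * complex_of_real (real n + 1)) \<longlonglongrightarrow> D"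
    by (simp only: m1)
  then have lim1: "(\<lambda>n. \<i> / 2 * complex_of_real (((((b + (0 + 1 / (real n + 1)) *\<^sub>R e) \<bullet> e') * gau2_hat (b + (0 + 1 / (real n + 1)) *\<^sub>R e)) - ((b + 0 *\<^sub>R e) \<bullet> e') * gau2_hat (b + 0 *\<^sub>R e)) * (real n + 1))) \<longlonglongrightarrow> D"
    by (simp only: of_real_diff of_real_mult add_0 scaleR_zero_left add_0_right right_diff_distrib left_diff_distrib mult.assoc)
  have "((\<lambda>t. (b + t *\<^sub>R e) \<bullet> e') has_real_derivative (e \<bullet> e')) (at 0)"
    unfolding inner_add_left inner_scaleR_left by (auto intro!: derivative_eq_intros)
  from DERIV_mult[OF this gau2_hat_line_derivative[of b e]]
  have "((\<lambda>t. ((b + t *\<^sub>R e) \<bullet> e') * gau2_hat (b + t *\<^sub>R e)) has_real_derivative (e \<bullet> e' - pi * (b \<bullet> e) * (b \<bullet> e')) * gau2_hat b) (at 0)"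
    by (simp add: algebra_simps)
  from DERIV_sequential_quotient[OF this]
  have "(\<lambda>n. ((((b + (0 + 1 / (real n + 1)) *\<^sub>R e) \<bullet> e') * gau2_hat (b + (0 + 1 / (real n + 1)) *\<^sub>R e)) - ((b + 0 *\<^sub>R e) \<bullet> e') * gau2_hat (b + 0 *\<^sub>R e)) * (real n + 1)) \<longlonglongrightarrow> (e \<bullet> e' - pi * (b \<bullet> e) * (b \<bullet> e')) * gau2_hat b"
    by (simp only: of_real_eq_id id_apply)
  then have "(\<lambda>n. \<i> / 2 * complex_of_real (((((b + (0 + 1 / (real n + 1)) *\<^sub>R e) \<bullet> e') * gau2_hat (b + (0 + 1 / (real n + 1)) *\<^sub>R e)) - ((b + 0 *\<^sub>R e) \<bullet> e') * gau2_hat (b + 0 *\<^sub>R e)) * (real n + 1)))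
     \<longlonglongrightarrow> \<i> / 2 * complex_of_real ((e \<bullet> e' - pi * (b \<bullet> e) * (b \<bullet> e')) * gau2_hat b)"
    by (rule tendsto_mult_left[OF tendsto_of_real])
  from LIMSEQ_unique[OF lim1 this]
  have "D = \<i> / 2 * complex_of_real ((e \<bullet> e' - pi * (b \<bullet> e) * (b \<bullet> e')) * gau2_hat b)" .
  moreover have "D = (2 * pi * \<i>) * (LBINT u. of_real ((e \<bullet> u) * (e' \<bullet> u) * gau2 u) * cis (2 * pi * (b \<bullet> u)))"
    unfolding D_def p_def integral_mult_right_zero[symmetric] by (intro Bochner_Integration.integral_cong) auto
  ultimately have "(LBINT u. of_real ((e \<bullet> u) * (e' \<bullet> u) * gau2 u) * cis (2 * pi * (b \<bullet> u))) = complex_of_real ((e \<bullet> e' - pi * (b \<bullet> e) * (b \<bullet> e')) * gau2_hat b / (4 * pi))"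
    using two_pi_i_cancel(2) by (simp only:)
  then show ?thesis by simp
qed

text \<open>Expanding around m in the basis leaves moments of order at most two. The trace comes
  from the diagonal of the second moment; the only terms that can grow with m are \<beta> m m and
  the imaginary \<beta> m b, exactly those that the moving packet has to cancel.\<close>

lemma gau2_quadratic:
  fixes \<beta> :: "'b::euclidean_space \<Rightarrow> 'b \<Rightarrow> real"
  assumes lin: "\<And>z. linear (\<beta> z)" and sym: "\<And>z w. \<beta> z w = \<beta> w z"
  shows "integrable lborel (\<lambda>u. of_real (\<beta> (m + u) (m + u)) * (of_real (gau2 u) * cis (2 * pi * (b \<bullet> u))))"
    and "(LBINT u. of_real (\<beta> (m + u) (m + u)) * (of_real (gau2 u) * cis (2 * pi * (b \<bullet> u))))
      = (of_real (\<beta> m m + (\<Sum>i\<in>Basis. \<beta> i i) / (4 * pi) - \<beta> b b / 4) + \<i> * of_real (\<beta> m b)) * complex_of_real (gau2_hat b)"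
proof -
  have exp1: "\<beta> z x = (\<Sum>i\<in>Basis. (i \<bullet> x) * \<beta> z i)" for z x
  proof -
    have "\<beta> z x = \<beta> z (\<Sum>i\<in>Basis. (x \<bullet> i) *\<^sub>R i)" by (simp add: euclidean_representation)
    also have "\<dots> = (\<Sum>i\<in>Basis. (i \<bullet> x) * \<beta> z i)"
      by (simp add: linear_sum[OF lin] linear_scale[OF lin] inner_commute)
    finally show ?thesis .
  qed
  have exp2: "\<beta> x x = (\<Sum>i\<in>Basis. \<Sum>j\<in>Basis. (i \<bullet> x) * (j \<bullet> x) * \<beta> i j)" for x
  proof -
    have "\<beta> x x = (\<Sum>i\<in>Basis. (i \<bullet> x) * \<beta> i x)" by (subst exp1) (simp add: sym)
    also have "\<dots> = (\<Sum>i\<in>Basis. (i \<bullet> x) * (\<Sum>j\<in>Basis. (j \<bullet> x) * \<beta> i j))" by (simp only: exp1[of _ x])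
    finally show ?thesis by (simp add: sum_distrib_left mult.assoc)
  qed
  have expand: "\<beta> (m + u) (m + u) = \<beta> m m + (\<Sum>i\<in>Basis. 2 * \<beta> m i * (i \<bullet> u)) + (\<Sum>i\<in>Basis. \<Sum>j\<in>Basis. \<beta> i j * ((i \<bullet> u) * (j \<bullet> u)))" for u
  proof -
    have "\<beta> (m + u) (m + u) = \<beta> m m + 2 * \<beta> m u + \<beta> u u"
      by (simp add: linear_add[OF lin] sym[of "m + u"] sym[of u m])
    then show ?thesis by (simp only: exp1[of m u] exp2[of u]) (simp add: sum_distrib_left ac_simps)
  qed
  define g where "g u = of_real (gau2 u) * cis (2 * pi * (b \<bullet> u))" for u
  have gm [measurable]: "g \<in> borel_measurable borel" unfolding g_def by measurable
  have ng: "cmod (g u) = gau2 u" for u by (simp add: g_def norm_mult)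
  have i0: "integrable lborel g"
    by (rule integrable_gau2_bound[OF gm, where C=1 and k=0]) (simp add: ng)
  have i1: "integrable lborel (\<lambda>u. of_real (e \<bullet> u) * g u)" for e
  proof (rule integrable_gau2_bound[where C="norm e" and k=1])
    show "cmod (of_real (e \<bullet> u) * g u) \<le> norm e * ((1 + norm u) ^ 1 * gau2 u)" for u
    proof -
      have "\<bar>e \<bullet> u\<bar> \<le> norm e * (1 + norm u)"
        by (intro order_trans[OF Cauchy_Schwarz_ineq2] mult_left_mono) auto
      from mult_right_mono[OF this, of "gau2 u"] show ?thesis by (simp add: norm_mult ng)
    qed
  qed measurable
  have i2: "integrable lborel (\<lambda>u. of_real ((e \<bullet> u) * (e' \<bullet> u)) * g u)" for e e'
  proof (rule integrable_gau2_bound[where C="norm e * norm e'" and k=2])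
    show "cmod (of_real ((e \<bullet> u) * (e' \<bullet> u)) * g u) \<le> norm e * norm e' * ((1 + norm u) ^ 2 * gau2 u)" for u
    proof -
      have "\<bar>e \<bullet> u\<bar> * \<bar>e' \<bullet> u\<bar> \<le> (norm e * (1 + norm u)) * (norm e' * (1 + norm u))"
        by (intro mult_mono order_trans[OF Cauchy_Schwarz_ineq2] mult_left_mono) auto
      from mult_right_mono[OF this, of "gau2 u"] show ?thesis by (simp add: norm_mult ng abs_mult power2_eq_square ac_simps)
    qed
  qed measurable
  have eq: "of_real (\<beta> (m + u) (m + u)) * g u = of_real (\<beta> m m) * g u + (\<Sum>i\<in>Basis. of_real (2 * \<beta> m i) * (of_real (i \<bullet> u) * g u))
     + (\<Sum>i\<in>Basis. \<Sum>j\<in>Basis. of_real (\<beta> i j) * (of_real ((i \<bullet> u) * (j \<bullet> u)) * g u))" for u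
    unfolding expand by (simp only: of_real_add of_real_sum distrib_right sum_distrib_right of_real_mult mult.assoc)
  have int: "integrable lborel (\<lambda>u. of_real (\<beta> (m + u) (m + u)) * g u)"
    unfolding eq using i0 i1 i2 by (intro Bochner_Integration.integrable_add Bochner_Integration.integrable_sum integrable_mult_right) auto
  then show "integrable lborel (\<lambda>u. of_real (\<beta> (m + u) (m + u)) * (of_real (gau2 u) * cis (2 * pi * (b \<bullet> u))))"
    by (simp add: g_def)
  have m0: "(LBINT u. g u) = of_real (gau2_hat b)" unfolding g_def by (rule gau2_moment0)
  have m1: "(LBINT u. of_real (e \<bullet> u) * g u) = \<i> / 2 * of_real ((e \<bullet> b) * gau2_hat b)" for e
    using gau2_moment1[of e b] by (simp add: g_def mult.assoc inner_commute)
  have m2: "(LBINT u. of_real ((e \<bullet> u) * (e' \<bullet> u)) * g u) = complex_of_real ((e \<bullet> e' - pi * (e \<bullet> b) * (e' \<bullet> b)) / (4 * pi) * gau2_hat b)" for e e'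
    using gau2_moment2[of e e' b] by (simp add: g_def mult.assoc inner_commute)
  have "(LBINT u. of_real (\<beta> (m + u) (m + u)) * g u) = of_real (\<beta> m m) * of_real (gau2_hat b)
     + (\<Sum>i\<in>Basis. of_real (2 * \<beta> m i) * (\<i> / 2 * of_real ((i \<bullet> b) * gau2_hat b)))
     + (\<Sum>i\<in>Basis. \<Sum>j\<in>Basis. of_real (\<beta> i j) * complex_of_real ((i \<bullet> j - pi * (i \<bullet> b) * (j \<bullet> b)) / (4 * pi) * gau2_hat b))"
  proof -
    have j1: "integrable lborel (\<lambda>u. \<Sum>i\<in>Basis. of_real (2 * \<beta> m i) * (of_real (i \<bullet> u) * g u))"
      using i1 by (intro Bochner_Integration.integrable_sum integrable_mult_right)
    have j2: "integrable lborel (\<lambda>u. \<Sum>j\<in>Basis. of_real (\<beta> i j) * (of_real ((i \<bullet> u) * (j \<bullet> u)) * g u))" for i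
      by (intro Bochner_Integration.integrable_sum integrable_mult_right i2)
    have s1: "(LBINT u. (\<Sum>i\<in>Basis. of_real (2 * \<beta> m i) * (of_real (i \<bullet> u) * g u))) = (\<Sum>i\<in>Basis. of_real (2 * \<beta> m i) * (\<i> / 2 * of_real ((i \<bullet> b) * gau2_hat b)))"
      unfolding m1[symmetric] integral_mult_right_zero[symmetric] by (intro Bochner_Integration.integral_sum integrable_mult_right i1)
    have s2: "(LBINT u. (\<Sum>i\<in>Basis. \<Sum>j\<in>Basis. of_real (\<beta> i j) * (of_real ((i \<bullet> u) * (j \<bullet> u)) * g u)))
       = (\<Sum>i\<in>Basis. \<Sum>j\<in>Basis. of_real (\<beta> i j) * complex_of_real ((i \<bullet> j - pi * (i \<bullet> b) * (j \<bullet> b)) / (4 * pi) * gau2_hat b))"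
    proof -
      have "(LBINT u. (\<Sum>j\<in>Basis. of_real (\<beta> i j) * (of_real ((i \<bullet> u) * (j \<bullet> u)) * g u)))
        = (\<Sum>j\<in>Basis. of_real (\<beta> i j) * complex_of_real ((i \<bullet> j - pi * (i \<bullet> b) * (j \<bullet> b)) / (4 * pi) * gau2_hat b))" for i
        unfolding m2[symmetric] integral_mult_right_zero[symmetric] by (intro Bochner_Integration.integral_sum integrable_mult_right i2)
      then show ?thesis using Bochner_Integration.integral_sum[OF j2, of "\<lambda>i. i" Basis] by (simp only:)
    qed
    have "(LBINT u. of_real (\<beta> m m) * g u) = of_real (\<beta> m m) * of_real (gau2_hat b)" by (simp only: integral_mult_right_zero m0)
    then show ?thesis unfolding eq s1[symmetric] s2[symmetric]
      using integrable_mult_right[OF i0, of "of_real (\<beta> m m)"] j1 Bochner_Integration.integrable_sum[OF j2, of "\<lambda>i. i" Basis]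
      by (simp only: Bochner_Integration.integral_add Bochner_Integration.integrable_add)
  qed
  also have "(\<Sum>i\<in>Basis. of_real (2 * \<beta> m i) * (\<i> / 2 * of_real ((i \<bullet> b) * gau2_hat b))) = \<i> * of_real (\<beta> m b) * of_real (gau2_hat b)"
    by (subst (2) exp1) (simp add: sum_distrib_left sum_distrib_right ac_simps)
  also have "(\<Sum>i\<in>Basis. \<Sum>j\<in>Basis. of_real (\<beta> i j) * complex_of_real ((i \<bullet> j - pi * (i \<bullet> b) * (j \<bullet> b)) / (4 * pi) * gau2_hat b))
     = of_real (((\<Sum>i\<in>Basis. \<beta> i i) / (4 * pi) - \<beta> b b / 4) * gau2_hat b)"
  proof -
    have "(\<Sum>i\<in>Basis. \<Sum>j\<in>Basis. \<beta> i j * ((i \<bullet> j - pi * (i \<bullet> b) * (j \<bullet> b)) / (4 * pi) * gau2_hat b))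
      = (\<Sum>i\<in>Basis. \<Sum>j\<in>Basis. \<beta> i j * (i \<bullet> j) / (4 * pi) * gau2_hat b - (i \<bullet> b) * (j \<bullet> b) * \<beta> i j / 4 * gau2_hat b)"
      by (intro sum.cong refl) (simp add: field_simps)
    also have "\<dots> = (\<Sum>i\<in>Basis. \<Sum>j\<in>Basis. \<beta> i j * (i \<bullet> j) / (4 * pi) * gau2_hat b) - \<beta> b b / 4 * gau2_hat b"
      by (subst exp2) (simp add: sum_subtractf sum_distrib_right sum_divide_distrib)
    also have "(\<Sum>i\<in>Basis. \<Sum>j\<in>Basis. \<beta> i j * (i \<bullet> j) / (4 * pi) * gau2_hat b) = (\<Sum>i\<in>Basis. \<beta> i i) / (4 * pi) * gau2_hat b"
    proof -
      have "(\<Sum>j\<in>Basis. \<beta> i j * (i \<bullet> j) / (4 * pi) * gau2_hat b) = \<beta> i i / (4 * pi) * gau2_hat b" if "i \<in> Basis" for i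
      proof -
        have "(\<Sum>j\<in>Basis. \<beta> i j * (i \<bullet> j) / (4 * pi) * gau2_hat b) = (\<Sum>j\<in>Basis. if j = i then \<beta> i i / (4 * pi) * gau2_hat b else 0)"
          using that by (intro sum.cong refl) (auto simp: inner_Basis)
        then show ?thesis using that by simp
      qed
      then show ?thesis by (simp add: sum_distrib_right sum_divide_distrib)
    qed
    finally show ?thesis by (simp only: of_real_mult[symmetric] of_real_sum[symmetric] left_diff_distrib)
  qed
  finally show "(LBINT u. of_real (\<beta> (m + u) (m + u)) * (of_real (gau2 u) * cis (2 * pi * (b \<bullet> u))))
      = (of_real (\<beta> m m + (\<Sum>i\<in>Basis. \<beta> i i) / (4 * pi) - \<beta> b b / 4) + \<i> * of_real (\<beta> m b)) * complex_of_real (gau2_hat b)"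
    by (simp add: g_def algebra_simps)
qed

section \<open>The Weyl symbol tested on wave packets: quadratic and Sjoestrand parts\<close>

lemma quad_hom_poly_bilinear:
  assumes "quad_hom_poly a"
  obtains \<beta> :: "(real^'n) \<times> (real^'n) \<Rightarrow> (real^'n) \<times> (real^'n) \<Rightarrow> real"
  where "\<And>z. linear (\<beta> z)" "\<And>z w. \<beta> z w = \<beta> w z" "\<And>z. a z = \<beta> z z"
proof -
  obtain A B C :: "'n \<Rightarrow> 'n \<Rightarrow> real" where abc: "\<And>x p. a (x, p) = (\<Sum>i\<in>UNIV. \<Sum>j\<in>UNIV. A i j * x$i * x$j + B i j * x$i * p$j + C i j * p$i * p$j)"
    using assms unfolding quad_hom_poly_def by blast
  define \<beta> :: "(real^'n) \<times> (real^'n) \<Rightarrow> (real^'n) \<times> (real^'n) \<Rightarrow> real" where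
    "\<beta> z w = (\<Sum>i\<in>UNIV. \<Sum>j\<in>UNIV. A i j * (fst z$i * fst w$j + fst w$i * fst z$j) / 2
      + B i j * (fst z$i * snd w$j + fst w$i * snd z$j) / 2 + C i j * (snd z$i * snd w$j + snd w$i * snd z$j) / 2)" for z w
  show thesis
  proof (rule that[of \<beta>])
    show "linear (\<beta> z)" for z
    proof (rule linearI)
      show "\<beta> z (x + y) = \<beta> z x + \<beta> z y" for x y
        unfolding \<beta>_def sum.distrib[symmetric] by (intro sum.cong refl) (simp add: field_simps)
      show "\<beta> z (r *\<^sub>R x) = r *\<^sub>R \<beta> z x" for r x
        unfolding \<beta>_def real_scaleR_def sum_distrib_left by (intro sum.cong refl) (simp add: field_simps)
    qed
    show "\<beta> z w = \<beta> w z" for z w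
      unfolding \<beta>_def by (intro sum.cong refl) (simp add: field_simps)
    show "a z = \<beta> z z" for z
    proof -
      have "a z = a (fst z, snd z)" by simp
      also have "\<dots> = \<beta> z z" unfolding abc \<beta>_def by (intro sum.cong refl) (simp add: field_simps)
      finally show ?thesis .
    qed
  qed
qed

text \<open>A change of window. The class is defined with the window exp (- pi |u|^2), whereas the
  cross-Wigner function carries exp (- 2 pi |u|^2). The narrower Gaussian is the product of two
  copies of the wider one; writing one copy as its own Fourier transform turns the new windowed
  transform into a Gaussian average of the old one over frequencies.\<close>

lemma sjostrand_kernel:
  fixes \<sigma> :: "'b::euclidean_space \<Rightarrow> real"
  assumes sj: "sjostrand (\<lambda>z. complex_of_real (\<sigma> z))"
  obtains T :: "'b \<Rightarrow> ennreal" where "T \<in> borel_measurable borel" "(NNBINT b. T b) < \<infinity>"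
    "\<And>m b. integrable lborel (\<lambda>u. complex_of_real (\<sigma> (m + u)) * (of_real (gau2 u) * cis (2 * pi * (b \<bullet> u))))"
    "\<And>m b. ennreal (cmod (LBINT u. complex_of_real (\<sigma> (m + u)) * (of_real (gau2 u) * cis (2 * pi * (b \<bullet> u))))) \<le> T b"
proof -
  define \<kappa> where "\<kappa> = 2 powr (real DIM('b) / 4)"
  have \<kappa>: "\<kappa> > 0" by (simp add: \<kappa>_def)
  have sm [measurable]: "(\<lambda>z. complex_of_real (\<sigma> z)) \<in> borel_measurable borel"
    and sint: "\<And>z. integrable lborel (\<lambda>w. complex_of_real (\<sigma> w) * cnj (cis (pi * (fst z \<bullet> snd z)) * tfs z gauss w))"
    and sfin: "(NNBINT \<zeta>. (SUP z. ennreal (cmod (stft gauss (\<lambda>z. complex_of_real (\<sigma> z)) (z, \<zeta>))))) < \<infinity>"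
    using sj unfolding sjostrand_def by auto
  define f where "f m u = complex_of_real (\<sigma> (m + u)) * of_real (gexp pi u)" for m u
  have fm [measurable]: "f m \<in> borel_measurable borel" for m unfolding f_def by measurable
  have ker: "complex_of_real (\<sigma> (u + m)) * cnj (cis (pi * (m \<bullet> \<zeta>)) * tfs (m, \<zeta>) gauss (u + m)) = of_real \<kappa> * cis (- 2 * pi * (\<zeta> \<bullet> m)) * (f m u * cis (2 * pi * (- \<zeta> \<bullet> u)))" for m \<zeta> u
  proof -
    have "cis (pi * (m \<bullet> \<zeta>)) * (cis (- pi * (m \<bullet> \<zeta>)) * cis (2 * pi * (\<zeta> \<bullet> (u + m)))) = cis (2 * pi * (\<zeta> \<bullet> m)) * cis (2 * pi * (\<zeta> \<bullet> u))"
      unfolding cis_mult by (rule cis_cong) (simp add: inner_add_right distrib_left)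
    then have "cis (pi * (m \<bullet> \<zeta>)) * tfs (m, \<zeta>) gauss (u + m) = cis (2 * pi * (\<zeta> \<bullet> m)) * cis (2 * pi * (\<zeta> \<bullet> u)) * (of_real \<kappa> * of_real (gexp pi u))"
      unfolding tfs_def gauss_def fst_conv snd_conv \<kappa>_def gexp_def by (simp add: mult.assoc[symmetric])
    then show ?thesis unfolding f_def by (simp add: cis_cnj add.commute ac_simps)
  qed
  have fi: "integrable lborel (f m)" for m
  proof -
    have "integrable lborel (\<lambda>u. complex_of_real (\<sigma> (u + m)) * cnj (cis (pi * (m \<bullet> 0)) * tfs (m, 0) gauss (u + m)))"
      using integrable_lborel_translate[OF sint[of "(m, 0)"], of m] by (simp only: fst_conv snd_conv)
    then have "integrable lborel (\<lambda>u. of_real \<kappa> * f m u)" unfolding ker by simp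
    then have "integrable lborel (\<lambda>u. of_real (1 / \<kappa>) * (of_real \<kappa> * f m u))" by (rule integrable_mult_right)
    then show ?thesis using \<kappa> by simp
  qed
  define v where "v m \<zeta> = (LBINT u. f m u * cis (2 * pi * (\<zeta> \<bullet> u)))" for m \<zeta>
  have stft_v: "cmod (stft gauss (\<lambda>z. complex_of_real (\<sigma> z)) (m, \<zeta>)) = \<kappa> * cmod (v m (- \<zeta>))" for m \<zeta>
  proof -
    have "stft gauss (\<lambda>z. complex_of_real (\<sigma> z)) (m, \<zeta>) = (LBINT u. complex_of_real (\<sigma> (u + m)) * cnj (cis (pi * (m \<bullet> \<zeta>)) * tfs (m, \<zeta>) gauss (u + m)))"
      unfolding stft_def l2inner_def fst_conv snd_conv by (rule integral_lborel_translate[symmetric])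
    also have "\<dots> = of_real \<kappa> * cis (- 2 * pi * (\<zeta> \<bullet> m)) * v m (- \<zeta>)"
      unfolding ker v_def by (rule integral_mult_right_zero)
    finally show ?thesis using \<kappa> by (simp add: norm_mult)
  qed
  \<comment> \<open>The frequency sign is reversed between \<open>stft\<close> and \<open>v\<close>,
    which explains the minus signs from here on.\<close>
  define Su where "Su \<zeta> = (SUP m. ennreal (\<kappa> * cmod (v m (- \<zeta>))))" for \<zeta>
  have Sfin: "(NNBINT \<zeta>. Su \<zeta>) < \<infinity>" using sfin unfolding stft_v Su_def .
  have vcont: "continuous_on UNIV (v m)" for m
  proof -
    have "isCont (v m) \<zeta>" for \<zeta>
      unfolding isCont_def
    proof (subst tendsto_at_iff_sequentially, intro allI impI)
      fix X assume X: "\<forall>i. X i \<in> UNIV - {\<zeta>}" "X \<longlonglongrightarrow> \<zeta>"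
      have "(\<lambda>n. v m (X n)) \<longlonglongrightarrow> v m \<zeta>"
        unfolding v_def
      proof (rule integral_dominated_convergence[where w="\<lambda>u. cmod (f m u)"])
        show "integrable lborel (\<lambda>u. cmod (f m u))" using fi by auto
        show "AE u in lborel. (\<lambda>n. f m u * cis (2 * pi * (X n \<bullet> u))) \<longlonglongrightarrow> f m u * cis (2 * pi * (\<zeta> \<bullet> u))"
          by (intro AE_I2 tendsto_intros X)
        show "AE u in lborel. norm (f m u * cis (2 * pi * (X n \<bullet> u))) \<le> cmod (f m u)" for n
          by (simp add: norm_mult)
      qed measurable
      then show "(v m \<circ> X) \<longlonglongrightarrow> v m \<zeta>" by (simp add: o_def)
    qed
    then show ?thesis by (simp add: continuous_at_imp_continuous_on)
  qed
  \<comment> \<open>A supremum over uncountably many m; it is measurable because a supremum of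
    continuous functions is lower semicontinuous.\<close>
  have Sm [measurable]: "Su \<in> borel_measurable borel"
  proof (rule borel_measurableI_greater)
    fix y :: ennreal
    have "{\<zeta>. y < Su \<zeta>} = (\<Union>m. {\<zeta>. y < ennreal (\<kappa> * cmod (v m (- \<zeta>)))})"
      by (auto simp: Su_def less_SUP_iff)
    moreover have "open {\<zeta>. y < ennreal (\<kappa> * cmod (v m (- \<zeta>)))}" for m
    proof -
      have "continuous_on UNIV (\<lambda>\<zeta>. ennreal (\<kappa> * cmod (v m (- \<zeta>))))"
        by (intro continuous_on_ennreal continuous_intros continuous_on_compose2[OF vcont]) auto
      from open_Collect_less[OF continuous_on_const this] show ?thesis by simp
    qed
    ultimately have "open {\<zeta>. y < Su \<zeta>}" by auto
    then show "{\<zeta> \<in> space borel. y < Su \<zeta>} \<in> sets borel" by simp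
  qed
  \<comment> \<open>The envelope convolved with the Gaussian coming from the change of window; 1 /
    \<kappa> undoes the normalization of \<open>gauss\<close>.\<close>
  define T where "T b = ennreal (1 / \<kappa>) * (NNBINT \<eta>. ennreal (gexp pi \<eta>) * Su (- (b + \<eta>)))" for b
  have Tm: "T \<in> borel_measurable borel" unfolding T_def by measurable
  have "(NNBINT b. T b) < \<infinity>"
  proof -
    have "(NNBINT b. T b) = ennreal (1 / \<kappa>) * (NNBINT b. (NNBINT \<eta>. ennreal (gexp pi \<eta>) * Su (- (b + \<eta>))))"
      unfolding T_def by (rule nn_integral_cmult) measurable
    also have "(NNBINT b. (NNBINT \<eta>. ennreal (gexp pi \<eta>) * Su (- (b + \<eta>)))) = (NNBINT \<eta>. (NNBINT b. ennreal (gexp pi \<eta>) * Su (- (b + \<eta>))))"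
      by (rule lborel_pair.Fubini') measurable
    also have "\<dots> = (NNBINT \<eta>. ennreal (gexp pi (\<eta> :: 'b)) * (NNBINT b. Su b))"
    proof (rule nn_integral_cong)
      fix \<eta> :: 'b
      have "(NNBINT b. ennreal (gexp pi \<eta>) * Su (- (b + \<eta>))) = ennreal (gexp pi \<eta>) * (NNBINT b. Su (- (b + \<eta>)))"
        by (rule nn_integral_cmult) measurable
      also have "(NNBINT b. Su (- (b + \<eta>))) = (NNBINT b. Su b)"
        using nn_integral_lborel_translate[of "\<lambda>b. Su (- b)" \<eta>] nn_integral_lborel_uminus[of Su] by simp
      finally show "(NNBINT b. ennreal (gexp pi \<eta>) * Su (- (b + \<eta>))) = ennreal (gexp pi \<eta>) * (NNBINT b. Su b)" .
    qed
    also have "\<dots> = (NNBINT \<eta>. ennreal (gexp pi (\<eta> :: 'b))) * (NNBINT b. Su b)" by (rule nn_integral_multc) measurable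
    finally show ?thesis using Sfin nn_integral_gexp_finite[of pi, where 'b='b] by (simp add: ennreal_mult_less_top)
  qed
  moreover have gi: "integrable lborel (\<lambda>u. complex_of_real (\<sigma> (m + u)) * (of_real (gau2 u) * cis (2 * pi * (b \<bullet> u))))" for m b
  proof (rule Bochner_Integration.integrable_bound[OF fi[of m]])
    have "gau2 u \<le> gexp pi u" for u :: 'b
      by (simp add: gau2_def gexp_def)
    then show "AE u in lborel. norm (complex_of_real (\<sigma> (m + u)) * (of_real (gau2 u) * cis (2 * pi * (b \<bullet> u)))) \<le> norm (f m u)"
      by (intro AE_I2) (auto simp: f_def norm_mult intro!: mult_left_mono)
  qed measurable
  moreover have "ennreal (cmod (LBINT u. complex_of_real (\<sigma> (m + u)) * (of_real (gau2 u) * cis (2 * pi * (b \<bullet> u))))) \<le> T b" for m b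
  proof -
    have g2: "of_real (gau2 u) = complex_of_real (gexp pi u) * (LBINT \<eta>. of_real (gexp pi \<eta>) * cis (2 * pi * (u \<bullet> \<eta>)))" for u :: 'b
    proof -
      have "(LBINT \<eta>. of_real (gexp pi \<eta>) * cis (2 * pi * (u \<bullet> \<eta>))) = complex_of_real (gexp pi u)"
        unfolding gexp_def by (rule gauss_FT_unit(2))
      moreover have "gau2 u = gexp pi u * gexp pi u" by (simp add: gau2_def gexp_def exp_add[symmetric])
      ultimately show ?thesis by simp
    qed
    have "(LBINT u. complex_of_real (\<sigma> (m + u)) * (of_real (gau2 u) * cis (2 * pi * (b \<bullet> u))))
       = (LBINT u. (LBINT \<eta>. f m u * (of_real (gexp pi \<eta>) * cis (2 * pi * ((b + \<eta>) \<bullet> u)))))"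
    proof (rule Bochner_Integration.integral_cong[OF refl])
      fix u :: 'b
      have "f m u * (of_real (gexp pi \<eta>) * cis (2 * pi * ((b + \<eta>) \<bullet> u))) = f m u * cis (2 * pi * (b \<bullet> u)) * (of_real (gexp pi \<eta>) * cis (2 * pi * (u \<bullet> \<eta>)))" for \<eta>
      proof -
        have "cis (2 * pi * ((b + \<eta>) \<bullet> u)) = cis (2 * pi * (b \<bullet> u)) * cis (2 * pi * (u \<bullet> \<eta>))"
          unfolding cis_mult by (rule cis_cong) (simp add: inner_add_left inner_commute[of u \<eta>] distrib_left)
        then show ?thesis by (simp only: ac_simps)
      qed
      then have e: "(LBINT \<eta>. f m u * (of_real (gexp pi \<eta>) * cis (2 * pi * ((b + \<eta>) \<bullet> u)))) = f m u * cis (2 * pi * (b \<bullet> u)) * (LBINT \<eta>. of_real (gexp pi \<eta>) * cis (2 * pi * (u \<bullet> \<eta>)))"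
        by (simp only: integral_mult_right_zero)
      show "complex_of_real (\<sigma> (m + u)) * (of_real (gau2 u) * cis (2 * pi * (b \<bullet> u))) = (LBINT \<eta>. f m u * (of_real (gexp pi \<eta>) * cis (2 * pi * ((b + \<eta>) \<bullet> u))))"
        unfolding e unfolding g2 f_def by (simp only: ac_simps)
    qed
    also have "\<dots> = (LBINT \<eta>. (LBINT u. f m u * (of_real (gexp pi \<eta>) * cis (2 * pi * ((b + \<eta>) \<bullet> u)))))"
    proof (rule Fubini_complex[where w="\<lambda>u. cmod (f m u) * (LBINT \<eta>. gexp pi (\<eta>::'b))"])
      have ge: "integrable lborel (gexp pi :: 'b \<Rightarrow> real)"
        unfolding gexp_def[abs_def] by (rule integrable_exp_norm_sq) simp
      show "integrable lborel (\<lambda>u. cmod (f m u) * (LBINT \<eta>. gexp pi (\<eta>::'b)))" using fi[of m] by auto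
      show "integrable lborel (\<lambda>\<eta>. f m u * (of_real (gexp pi \<eta>) * cis (2 * pi * ((b + \<eta>) \<bullet> u))))" for u
        by (intro integrable_mult_right, rule Bochner_Integration.integrable_bound[OF ge]) (auto simp: norm_mult)
      show "(LBINT \<eta>. cmod (f m u * (of_real (gexp pi \<eta>) * cis (2 * pi * ((b + \<eta>) \<bullet> u))))) \<le> cmod (f m u) * (LBINT \<eta>. gexp pi (\<eta>::'b))" for u
        by (simp add: norm_mult)
    qed measurable
    also have "\<dots> = (LBINT \<eta>. of_real (gexp pi \<eta>) * v m (b + \<eta>))"
      unfolding v_def by (simp only: mult.left_commute[of "f m _"] integral_mult_right_zero)
    finally have "ennreal (cmod (LBINT u. complex_of_real (\<sigma> (m + u)) * (of_real (gau2 u) * cis (2 * pi * (b \<bullet> u))))) \<le> (NNBINT \<eta>. ennreal (cmod (of_real (gexp pi \<eta>) * v m (b + \<eta>))))"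
      by (simp only: norm_integral_le_nn)
    also have "\<dots> \<le> (NNBINT \<eta>. ennreal (1 / \<kappa>) * (ennreal (gexp pi \<eta>) * Su (- (b + \<eta>))))"
    proof (rule nn_integral_mono)
      fix \<eta>
      have "ennreal (\<kappa> * cmod (v m (- (- (b + \<eta>))))) \<le> Su (- (b + \<eta>))" unfolding Su_def by (rule SUP_upper) simp
      then have "ennreal (1 / \<kappa>) * (ennreal (gexp pi \<eta>) * ennreal (\<kappa> * cmod (v m (b + \<eta>)))) \<le> ennreal (1 / \<kappa>) * (ennreal (gexp pi \<eta>) * Su (- (b + \<eta>)))"
        by (intro mult_left_mono) (simp_all only: minus_minus zero_le)
      moreover have "ennreal (1 / \<kappa>) * (ennreal (gexp pi \<eta>) * ennreal (\<kappa> * cmod (v m (b + \<eta>)))) = ennreal (cmod (of_real (gexp pi \<eta>) * v m (b + \<eta>)))"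
        using \<kappa> by (simp add: ennreal_mult[symmetric] norm_mult)
      ultimately show "ennreal (cmod (of_real (gexp pi \<eta>) * v m (b + \<eta>))) \<le> ennreal (1 / \<kappa>) * (ennreal (gexp pi \<eta>) * Su (- (b + \<eta>)))" by simp
    qed
    also have "\<dots> = T b" unfolding T_def by (rule nn_integral_cmult) measurable
    finally show ?thesis .
  qed
  ultimately show thesis using that Tm by blast
qed

lemma bilinear_form_bound:
  fixes \<beta> :: "'b::euclidean_space \<Rightarrow> 'b \<Rightarrow> real"
  assumes lin: "\<And>z. linear (\<beta> z)" and sym: "\<And>z w. \<beta> z w = \<beta> w z"
  obtains B where "B \<ge> 0" "\<And>x y. \<bar>\<beta> x y\<bar> \<le> B * norm x * norm y"
proof -
  have "linear (\<lambda>x. \<beta> x y)" for y using lin[of y] by (simp only: sym[of _ y])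
  then have "bilinear \<beta>" using lin by (simp add: bilinear_def)
  then obtain B where "B > 0" "\<And>x y. norm (\<beta> x y) \<le> B * norm x * norm y"
    using bilinear_bounded_pos by blast
  then show thesis using that[of B] by auto
qed

text \<open>Centred at the midpoint, the cross-Wigner function is a constant times a modulated
  Gaussian. The quadratic part is then explicit and factors through the overlap of the two packets;
  the \<sigma>-part is left as the integral bounded by \<open>sjostrand_kernel\<close>.\<close>

lemma weyl_wp:
  fixes \<beta> :: "(real^'n) \<times> (real^'n) \<Rightarrow> (real^'n) \<times> (real^'n) \<Rightarrow> real"
  assumes lin: "\<And>z. linear (\<beta> z)" and sym: "\<And>z w. \<beta> z w = \<beta> w z"
    and \<sigma>: "\<And>m b. integrable lborel (\<lambda>u. complex_of_real (\<sigma> (m + u)) * (of_real (gau2 u) * cis (2 * pi * (b \<bullet> u))))"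
  defines "tr \<equiv> (\<Sum>i\<in>Basis. \<beta> i i) / (4 * pi)"
  shows "weyl_form (\<lambda>z. \<beta> z z + \<sigma> z) (wp z) (wp w)
    = l2inner (wp z) (wp w) * (of_real (\<beta> ((1/2) *\<^sub>R (z + w)) ((1/2) *\<^sub>R (z + w)) + tr - \<beta> (sympl_J (z - w)) (sympl_J (z - w)) / 4) + \<i> * of_real (\<beta> ((1/2) *\<^sub>R (z + w)) (sympl_J (z - w))))
    + of_real (sqrt 2 ^ DIM((real^'n) \<times> (real^'n))) * cis (pi * sympl z w) *
      (LBINT u. complex_of_real (\<sigma> ((1/2) *\<^sub>R (z + w) + u)) * (of_real (gau2 u) * cis (2 * pi * (sympl_J (z - w) \<bullet> u))))"
proof -
  define m where "m = (1/2) *\<^sub>R (z + w)"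
  define b where "b = sympl_J (z - w)"
  define K where "K = complex_of_real (sqrt 2 ^ DIM((real^'n) \<times> (real^'n))) * cis (pi * sympl z w)"
  define g where "g u = of_real (gau2 u) * cis (2 * pi * (b \<bullet> u))" for u
  have W: "wigner (wp z) (wp w) (m + u) = K * g u" for u
    unfolding m_def K_def g_def b_def gau2_def by (rule wigner_wp)
  have "weyl_form (\<lambda>z. \<beta> z z + \<sigma> z) (wp z) (wp w) = (LBINT u. complex_of_real (\<beta> (u + m) (u + m) + \<sigma> (u + m)) * wigner (wp z) (wp w) (u + m))"
    unfolding weyl_form_def by (rule integral_lborel_translate[symmetric])
  also have "\<dots> = (LBINT u. K * (of_real (\<beta> (m + u) (m + u)) * g u + of_real (\<sigma> (m + u)) * g u))"
  proof (rule Bochner_Integration.integral_cong[OF refl])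
    fix u
    show "complex_of_real (\<beta> (u + m) (u + m) + \<sigma> (u + m)) * wigner (wp z) (wp w) (u + m) = K * (of_real (\<beta> (m + u) (m + u)) * g u + of_real (\<sigma> (m + u)) * g u)"
      unfolding add.commute[of u m] W of_real_add distrib_left distrib_right by (simp only: ac_simps)
  qed
  also have "\<dots> = K * ((LBINT u. of_real (\<beta> (m + u) (m + u)) * g u) + (LBINT u. of_real (\<sigma> (m + u)) * g u))"
    unfolding integral_mult_right_zero
    by (subst Bochner_Integration.integral_add) (use gau2_quadratic(1)[OF lin sym, of m b] \<sigma>[of m b] in \<open>auto simp: g_def\<close>)
  also have "(LBINT u. of_real (\<beta> (m + u) (m + u)) * g u) = (of_real (\<beta> m m + tr - \<beta> b b / 4) + \<i> * of_real (\<beta> m b)) * complex_of_real (gau2_hat b)"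
    unfolding g_def tr_def by (rule gau2_quadratic(2)[OF lin sym])
  also have "K * ((of_real (\<beta> m m + tr - \<beta> b b / 4) + \<i> * of_real (\<beta> m b)) * complex_of_real (gau2_hat b) + (LBINT u. of_real (\<sigma> (m + u)) * g u))
    = (K * complex_of_real (gau2_hat b)) * (of_real (\<beta> m m + tr - \<beta> b b / 4) + \<i> * of_real (\<beta> m b)) + K * (LBINT u. of_real (\<sigma> (m + u)) * g u)"
    by (simp only: distrib_left ac_simps)
  also have "K * complex_of_real (gau2_hat b) = l2inner (wp z) (wp w)"
  proof -
    have "sqrt 2 ^ DIM((real^'n) \<times> (real^'n)) * gau2_hat b = exp (- (pi / 2) * (norm (z - w))\<^sup>2)"
      unfolding gau2_hat_def b_def by (simp add: power_divide)
    then have "complex_of_real (sqrt 2 ^ DIM((real^'n) \<times> (real^'n))) * complex_of_real (gau2_hat b) = complex_of_real (exp (- (pi / 2) * (norm (z - w))\<^sup>2))"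
      by (simp only: of_real_mult[symmetric])
    moreover have "K * complex_of_real (gau2_hat b) = cis (pi * sympl z w) * (complex_of_real (sqrt 2 ^ DIM((real^'n) \<times> (real^'n))) * complex_of_real (gau2_hat b))"
      unfolding K_def by (simp only: ac_simps)
    ultimately show ?thesis unfolding l2inner_wp_wp by (simp only:)
  qed
  finally show ?thesis unfolding K_def g_def m_def b_def by (simp only: mult.assoc)
qed

text \<open>The unbounded terms of the Weyl symbol cancel against those of the derivative of the
  wave packet along the linear Hamiltonian vector field; only functions of \<open>z - w\<close> remain.\<close>

lemma residual_identity:
  fixes \<beta> :: "'a::euclidean_space \<times> 'a \<Rightarrow> 'a \<times> 'a \<Rightarrow> real"
  assumes lin: "\<And>z. linear (\<beta> z)" and sym: "\<And>z w. \<beta> z w = \<beta> w z"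
    and L: "\<And>z d. \<beta> z d = - pi * sympl (L z) d"
  shows "\<i> * (of_real (\<beta> ((1/2) *\<^sub>R (z + w)) ((1/2) *\<^sub>R (z + w)) + tr - \<beta> (sympl_J (z - w)) (sympl_J (z - w)) / 4) + \<i> * of_real (\<beta> ((1/2) *\<^sub>R (z + w)) (sympl_J (z - w))))
      + (\<i> * of_real (pi * sympl (L z) w) - of_real (pi * ((z - w) \<bullet> L z)))
    = \<i> * of_real (\<beta> (z - w) (z - w) / 4 + tr - \<beta> (sympl_J (z - w)) (sympl_J (z - w)) / 4) + of_real (\<beta> (z - w) (sympl_J (z - w)) / 2)"
proof -
  define \<delta> where "\<delta> = z - w"
  define b where "b = sympl_J \<delta>"
  have m: "(1/2) *\<^sub>R (z + w) = z - (1/2) *\<^sub>R \<delta>"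
    by (simp add: \<delta>_def algebra_simps) (metis scaleR_half_double scaleR_right_distrib)
  have lr: "\<beta> x (y - y') = \<beta> x y - \<beta> x y'" "\<beta> (y - y') x = \<beta> y x - \<beta> y' x"
    "\<beta> x (c *\<^sub>R y) = c * \<beta> x y" "\<beta> (c *\<^sub>R y) x = c * \<beta> y x" for x y y' c
    using linear_diff[OF lin] linear_scale[OF lin] by (simp_all add: sym[of _ x])
  have mm: "\<beta> (z - (1/2) *\<^sub>R \<delta>) (z - (1/2) *\<^sub>R \<delta>) = \<beta> z z - \<beta> z \<delta> + \<beta> \<delta> \<delta> / 4"
    by (simp add: lr sym[of \<delta> z] algebra_simps)
  have mb: "\<beta> (z - (1/2) *\<^sub>R \<delta>) b = \<beta> z b - \<beta> \<delta> b / 2" by (simp add: lr)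
  have s1: "pi * sympl (L z) w = - \<beta> z z + \<beta> z \<delta>"
  proof -
    have "\<beta> z \<delta> = \<beta> z z - \<beta> z w" by (simp add: \<delta>_def lr)
    then show ?thesis using L[of z w] by simp
  qed
  have s2: "pi * (\<delta> \<bullet> L z) = - \<beta> z b"
    using L[of z b] by (simp add: b_def sympl_eq_inner sympl_J_inner inner_commute)
  show ?thesis unfolding \<delta>_def[symmetric] b_def[symmetric] m mm mb s1 s2
    by (simp add: complex_eq_iff)
qed

section \<open>Wave packets moving along a curve, differentiated in L^2\<close>

definition wpdot :: "'a::euclidean_space \<times> 'a \<Rightarrow> 'a \<times> 'a \<Rightarrow> 'a \<Rightarrow> complex" where
  "wpdot z v x = (\<i> * of_real (- pi * (fst z \<bullet> snd v + fst v \<bullet> snd z) + 2 * pi * (snd v \<bullet> x)) + of_real (2 * pi * ((x - fst z) \<bullet> fst v))) * wp z x"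

lemma wp_curve_derivative:
  assumes c: "(c has_vector_derivative v) (at t)"
  shows "((\<lambda>s. wp (c s) x) has_vector_derivative wpdot (c t) v x) (at t)"
proof -
  have f: "((\<lambda>s. fst (c s)) has_vector_derivative fst v) (at t)" and g: "((\<lambda>s. snd (c s)) has_vector_derivative snd v) (at t)"
    using bounded_linear.has_vector_derivative[OF bounded_linear_fst c] bounded_linear.has_vector_derivative[OF bounded_linear_snd c] by auto
  have fx: "((\<lambda>s. x - fst (c s)) has_vector_derivative - fst v) (at t)"
    using has_vector_derivative_diff[OF has_vector_derivative_const f] by simp
  note inn = bounded_bilinear.has_vector_derivative[OF bounded_bilinear_inner]
  have 1: "((\<lambda>s. fst (c s) \<bullet> snd (c s)) has_real_derivative fst (c t) \<bullet> snd v + fst v \<bullet> snd (c t)) (at t)"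
    unfolding has_real_derivative_iff_has_vector_derivative by (rule inn[OF f g])
  have 2: "((\<lambda>s. snd (c s) \<bullet> x) has_real_derivative snd v \<bullet> x) (at t)"
    unfolding has_real_derivative_iff_has_vector_derivative using inn[OF g has_vector_derivative_const[of x]] by simp
  have 3: "((\<lambda>s. (norm (x - fst (c s)))\<^sup>2) has_real_derivative - 2 * ((x - fst (c t)) \<bullet> fst v)) (at t)"
    unfolding has_real_derivative_iff_has_vector_derivative power2_norm_eq_inner
    using inn[OF fx fx] by (simp add: inner_commute)
  define A where "A s = - pi * (fst (c s) \<bullet> snd (c s)) + 2 * pi * (snd (c s) \<bullet> x)" for s
  define Q where "Q s = - pi * (norm (x - fst (c s)))\<^sup>2" for s
  have A: "(A has_real_derivative - pi * (fst (c t) \<bullet> snd v + fst v \<bullet> snd (c t)) + 2 * pi * (snd v \<bullet> x)) (at t)"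
    unfolding A_def by (intro DERIV_add DERIV_cmult 1 2)
  have "(Q has_real_derivative - pi * (- 2 * ((x - fst (c t)) \<bullet> fst v))) (at t)"
    unfolding Q_def by (intro DERIV_cmult 3)
  then have Q: "(Q has_real_derivative 2 * pi * ((x - fst (c t)) \<bullet> fst v)) (at t)" by (simp add: ac_simps)
  define k where "k = complex_of_real (2 powr (real DIM('a) / 4))"
  define d where "d = \<i> * of_real (- pi * (fst (c t) \<bullet> snd v + fst v \<bullet> snd (c t)) + 2 * pi * (snd v \<bullet> x)) + complex_of_real (2 * pi * ((x - fst (c t)) \<bullet> fst v))"
  have "((\<lambda>s. \<i> * of_real (A s) + complex_of_real (Q s)) has_vector_derivative d) (at t)"
    unfolding d_def using A Q by (intro has_vector_derivative_add has_vector_derivative_mult_right has_vector_derivative_of_real)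
  then have "((\<lambda>s. exp (\<i> * of_real (A s) + complex_of_real (Q s))) has_vector_derivative d * exp (\<i> * of_real (A t) + complex_of_real (Q t))) (at t)"
    using field_vector_diff_chain_at[OF _ DERIV_exp] by (simp add: o_def)
  then have "((\<lambda>s. k * exp (\<i> * of_real (A s) + complex_of_real (Q s))) has_vector_derivative k * (d * exp (\<i> * of_real (A t) + complex_of_real (Q t)))) (at t)"
    by (rule has_vector_derivative_mult_right)
  moreover have wpe: "wp (c s) x = k * exp (\<i> * of_real (A s) + complex_of_real (Q s))" for s
    unfolding wp_eq_exp k_def A_def Q_def ..
  ultimately show ?thesis unfolding wpdot_def d_def[symmetric] wpe by (simp only: mult.left_commute)
qed

text \<open>Uniform over all centres in a ball, because the difference quotient of a moving packet
  is dominated by the mean value theorem along a whole segment of centres.\<close>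

lemma wpdot_bound:
  fixes z v :: "'a::euclidean_space \<times> 'a"
  assumes z: "norm z \<le> \<rho>"
  shows "cmod (wpdot z v x) \<le> norm v * (2 powr (real DIM('a) / 4) * exp (pi * \<rho>\<^sup>2) * (6 * pi * (1 + \<rho>))) * ((1 + norm x) * gexp (pi / 2) x)"
proof -
  have \<rho>: "\<rho> \<ge> 0" using z norm_ge_zero order_trans by blast
  have fz: "norm (fst z) \<le> \<rho>" "norm (snd z) \<le> \<rho>" using z norm_fst_le[of "fst z" "snd z"] norm_snd_le[of "snd z" "fst z"] by auto
  have fv: "norm (fst v) \<le> norm v" "norm (snd v) \<le> norm v" using norm_fst_le[of "fst v" "snd v"] norm_snd_le[of "snd v" "fst v"] by auto
  have in1: "\<bar>fst z \<bullet> snd v\<bar> \<le> \<rho> * norm v" "\<bar>fst v \<bullet> snd z\<bar> \<le> norm v * \<rho>" "\<bar>snd v \<bullet> x\<bar> \<le> norm v * norm x"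
    using fz fv \<rho> by (auto intro!: order_trans[OF Cauchy_Schwarz_ineq2] mult_mono)
  have in2: "\<bar>(x - fst z) \<bullet> fst v\<bar> \<le> (norm x + \<rho>) * norm v"
  proof (rule order_trans[OF Cauchy_Schwarz_ineq2], rule mult_mono)
    show "norm (x - fst z) \<le> norm x + \<rho>" using norm_triangle_ineq4[of x "fst z"] fz by simp
  qed (use fv \<rho> in auto)
  have "cmod (\<i> * of_real (- pi * (fst z \<bullet> snd v + fst v \<bullet> snd z) + 2 * pi * (snd v \<bullet> x)) + of_real (2 * pi * ((x - fst z) \<bullet> fst v)))
     \<le> \<bar>- pi * (fst z \<bullet> snd v + fst v \<bullet> snd z) + 2 * pi * (snd v \<bullet> x)\<bar> + \<bar>2 * pi * ((x - fst z) \<bullet> fst v)\<bar>"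
    by (rule order_trans[OF norm_triangle_ineq]) (simp add: norm_mult del: of_real_add of_real_mult)
  also have "\<dots> \<le> (pi * (\<bar>fst z \<bullet> snd v\<bar> + \<bar>fst v \<bullet> snd z\<bar>) + 2 * pi * \<bar>snd v \<bullet> x\<bar>) + 2 * pi * \<bar>(x - fst z) \<bullet> fst v\<bar>"
  proof (intro add_mono)
    have "\<bar>- pi * (fst z \<bullet> snd v + fst v \<bullet> snd z) + 2 * pi * (snd v \<bullet> x)\<bar> \<le> \<bar>- pi * (fst z \<bullet> snd v + fst v \<bullet> snd z)\<bar> + \<bar>2 * pi * (snd v \<bullet> x)\<bar>"
      by (rule abs_triangle_ineq)
    also have "\<dots> = pi * \<bar>fst z \<bullet> snd v + fst v \<bullet> snd z\<bar> + 2 * pi * \<bar>snd v \<bullet> x\<bar>" by (simp add: abs_mult)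
    also have "\<dots> \<le> pi * (\<bar>fst z \<bullet> snd v\<bar> + \<bar>fst v \<bullet> snd z\<bar>) + 2 * pi * \<bar>snd v \<bullet> x\<bar>"
      by (intro add_right_mono mult_left_mono abs_triangle_ineq) simp
    finally show "\<bar>- pi * (fst z \<bullet> snd v + fst v \<bullet> snd z) + 2 * pi * (snd v \<bullet> x)\<bar> \<le> pi * (\<bar>fst z \<bullet> snd v\<bar> + \<bar>fst v \<bullet> snd z\<bar>) + 2 * pi * \<bar>snd v \<bullet> x\<bar>" .
  qed (simp add: abs_mult)
  also have "\<dots> \<le> (pi * (\<rho> * norm v + norm v * \<rho>) + 2 * pi * (norm v * norm x)) + 2 * pi * ((norm x + \<rho>) * norm v)"
    by (intro add_mono mult_left_mono in1 in2) auto
  also have "\<dots> = norm v * (pi * (4 * \<rho> + 4 * norm x))" by (simp add: algebra_simps)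
  also have "\<dots> \<le> norm v * (6 * pi * (1 + \<rho>) * (1 + norm x))"
  proof (rule mult_left_mono)
    have "4 * \<rho> + 4 * norm x \<le> 6 * ((1 + \<rho>) * (1 + norm x))"
      using \<rho> mult_nonneg_nonneg[OF \<rho> norm_ge_zero[of x]] norm_ge_zero[of x] unfolding distrib_left distrib_right by linarith
    from mult_left_mono[OF this pi_ge_zero] show "pi * (4 * \<rho> + 4 * norm x) \<le> 6 * pi * (1 + \<rho>) * (1 + norm x)" by (simp only: ac_simps)
  qed simp
  finally have f1: "cmod (\<i> * of_real (- pi * (fst z \<bullet> snd v + fst v \<bullet> snd z) + 2 * pi * (snd v \<bullet> x)) + of_real (2 * pi * ((x - fst z) \<bullet> fst v))) \<le> norm v * (6 * pi * (1 + \<rho>) * (1 + norm x))" .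
  have f2: "cmod (wp z x) \<le> 2 powr (real DIM('a) / 4) * (exp (pi * \<rho>\<^sup>2) * gexp (pi / 2) x)"
  proof -
    have "norm x \<le> norm (x - fst z) + \<rho>" using norm_triangle_ineq[of "x - fst z" "fst z"] fz by simp
    then have "(norm x)\<^sup>2 \<le> (norm (x - fst z) + \<rho>)\<^sup>2" by (intro power_mono) auto
    also have "\<dots> \<le> 2 * (norm (x - fst z))\<^sup>2 + 2 * \<rho>\<^sup>2"
      using zero_le_power2[of "norm (x - fst z) - \<rho>"] by (simp add: power2_eq_square algebra_simps)
    finally have "pi / 2 * (norm x)\<^sup>2 \<le> pi / 2 * (2 * (norm (x - fst z))\<^sup>2 + 2 * \<rho>\<^sup>2)" by (intro mult_left_mono) auto
    then have "gexp pi (x - fst z) \<le> exp (pi * \<rho>\<^sup>2) * gexp (pi / 2) x"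
      by (simp add: gexp_def exp_add[symmetric] algebra_simps)
    then show ?thesis unfolding norm_wp by (intro mult_left_mono) auto
  qed
  have "cmod (wpdot z v x) \<le> norm v * (6 * pi * (1 + \<rho>) * (1 + norm x)) * (2 powr (real DIM('a) / 4) * (exp (pi * \<rho>\<^sup>2) * gexp (pi / 2) x))"
    unfolding wpdot_def norm_mult using \<rho> by (intro mult_mono f1[unfolded norm_mult] f2) auto
  then show ?thesis by (simp add: ac_simps)
qed

lemma borel_measurable_wpdot [measurable]: "wpdot z v \<in> borel_measurable borel"
  unfolding wpdot_def by measurable

lemma integrable_sq_norm_gexp: "integrable lborel (\<lambda>x::'a::euclidean_space. ((1 + norm x) * gexp (pi / 2) x)\<^sup>2)"
proof -
  have "((1 + norm x) * gexp (pi / 2) x)\<^sup>2 = (1 + norm x) ^ 2 * exp (- pi * (norm x)\<^sup>2)" for x :: 'a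
    by (simp add: gexp_def power_mult_distrib power2_eq_square[of "exp _"] exp_add[symmetric])
  then show ?thesis using integrable_power_exp_norm_sq[of pi 2, where 'a='a] by simp
qed

lemma sq_int_wpdot: "sq_int (wpdot z v)" for z v :: "'a::euclidean_space \<times> 'a"
  unfolding sq_int_def
proof
  define M where "M = norm v * (2 powr (real DIM('a) / 4) * exp (pi * (norm z)\<^sup>2) * (6 * pi * (1 + norm z)))"
  show "integrable lborel (\<lambda>x. (cmod (wpdot z v x))\<^sup>2)"
  proof (rule Bochner_Integration.integrable_bound)
    show "integrable lborel (\<lambda>x::'a. M\<^sup>2 * ((1 + norm x) * gexp (pi / 2) x)\<^sup>2)"
      by (intro integrable_mult_right integrable_sq_norm_gexp)
    show "AE x in lborel. norm ((cmod (wpdot z v x))\<^sup>2) \<le> norm (M\<^sup>2 * ((1 + norm x) * gexp (pi / 2) x)\<^sup>2)"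
      using wpdot_bound[OF order_refl, of z v] by (intro AE_I2) (simp add: M_def flip: power_mult_distrib)
  qed measurable
qed measurable

text \<open>The pointwise derivative is upgraded by dominated convergence; the work lies in a
  majorant of the difference quotients that does not depend on n.\<close>

lemma wp_L2_derivative:
  fixes c :: "real \<Rightarrow> 'a::euclidean_space \<times> 'a"
  assumes c: "(c has_vector_derivative v) (at t)" and h: "h \<longlonglongrightarrow> 0" "\<And>n. h n \<noteq> 0"
  shows "(\<lambda>n. l2norm (\<lambda>x. (wp (c (t + h n)) x - wp (c t) x) / of_real (h n) - wpdot (c t) v x)) \<longlonglongrightarrow> 0"
proof -
  define \<rho> where "\<rho> = norm (c t) + norm v + 1"
  define M where "M = 2 powr (real DIM('a) / 4) * exp (pi * \<rho>\<^sup>2) * (6 * pi * (1 + \<rho>))"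
  define dom where "dom x = (1 + norm x) * gexp (pi / 2) x" for x :: 'a
  have \<rho>0: "\<rho> \<ge> 0" by (simp add: \<rho>_def)
  have M0: "M \<ge> 0" using \<rho>0 by (simp add: M_def)
  have lim1: "((\<lambda>s. norm (c (t + s) - c t - s *\<^sub>R v) / norm s) \<longlongrightarrow> 0) (at 0)"
    using c unfolding has_vector_derivative_def has_derivative_at by simp
  then have "\<forall>\<^sub>F s in at 0. norm (c (t + s) - c t - s *\<^sub>R v) / norm s < 1"
    by (rule order_tendstoD(2)) simp
  moreover have fl: "filterlim h (at 0) sequentially" using h by (intro filterlim_atI) auto
  ultimately have "\<forall>\<^sub>F n in sequentially. norm (c (t + h n) - c t - h n *\<^sub>R v) / norm (h n) < 1"
    unfolding filterlim_iff by blast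
  moreover have "\<forall>\<^sub>F n in sequentially. \<bar>h n\<bar> < 1"
    using order_tendstoD(2)[OF tendsto_rabs_zero[OF h(1)], of 1] by simp
  ultimately have "\<forall>\<^sub>F n in sequentially. norm (c (t + h n) - c t) \<le> (norm v + 1) * \<bar>h n\<bar> \<and> \<bar>h n\<bar> < 1"
  proof eventually_elim
    case (elim n)
    then have "norm (c (t + h n) - c t - h n *\<^sub>R v) \<le> \<bar>h n\<bar>" using h(2)[of n] by (simp add: field_simps)
    moreover have "norm (c (t + h n) - c t) \<le> norm (c (t + h n) - c t - h n *\<^sub>R v) + norm (h n *\<^sub>R v)"
      using norm_triangle_ineq[of "c (t + h n) - c t - h n *\<^sub>R v" "h n *\<^sub>R v"] by simp
    ultimately show ?case using elim by (simp add: algebra_simps)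
  qed
  then obtain N where N: "\<And>n. n \<ge> N \<Longrightarrow> norm (c (t + h n) - c t) \<le> (norm v + 1) * \<bar>h n\<bar> \<and> \<bar>h n\<bar> < 1"
    unfolding eventually_sequentially by blast
  \<comment> \<open>A tail of the step sequence, on which the increments of the curve are at most a
    fixed multiple of the step; the discarded terms do not affect the limit.\<close>
  define k where "k n = h (n + N)" for n
  have k: "k \<longlonglongrightarrow> 0" "\<And>n. k n \<noteq> 0" unfolding k_def using h LIMSEQ_ignore_initial_segment[OF h(1), of N] by auto
  have kb: "norm (c (t + k n) - c t) \<le> (norm v + 1) * \<bar>k n\<bar>" "\<bar>k n\<bar> < 1" for n using N[of "n + N"] by (auto simp: k_def)
  define q where "q n x = (wp (c (t + k n)) x - wp (c t) x) / of_real (k n)" for n x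
  have qb: "cmod (q n x) \<le> (norm v + 1) * M * dom x" for n x
  proof -
    \<comment> \<open>The mean value theorem is used along the straight segment between the two
      centres, as the curve itself is assumed differentiable only at t.\<close>
    define d where "d = c (t + k n) - c t"
    have der: "((\<lambda>s. wp (c t + s *\<^sub>R d) x) has_vector_derivative wpdot (c t + s *\<^sub>R d) d x) (at s)" for s
    proof (rule wp_curve_derivative)
      have "((\<lambda>s. s *\<^sub>R d) has_vector_derivative 1 *\<^sub>R d) (at s)"
        using has_vector_derivative_scaleR[OF DERIV_ident has_vector_derivative_const[of d]] by simp
      then show "((\<lambda>s. c t + s *\<^sub>R d) has_vector_derivative d) (at s)"
        using has_vector_derivative_add[OF has_vector_derivative_const] by fastforce
    qed
    have "norm (wp (c t + 1 *\<^sub>R d) x - wp (c t + 0 *\<^sub>R d) x) \<le> (norm d * M * dom x) * norm (1 - (0::real))"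
    proof (rule differentiable_bound[of "{0..1}" "\<lambda>s. wp (c t + s *\<^sub>R d) x" "\<lambda>s r. r *\<^sub>R wpdot (c t + s *\<^sub>R d) d x"])
      show "((\<lambda>s. wp (c t + s *\<^sub>R d) x) has_derivative (\<lambda>r. r *\<^sub>R wpdot (c t + s *\<^sub>R d) d x)) (at s within {0..1})" for s
        using der[of s] unfolding has_vector_derivative_def by (rule has_derivative_at_withinI)
      fix s :: real assume s: "s \<in> {0..1}"
      have "norm (c t + s *\<^sub>R d) \<le> norm (c t) + \<bar>s\<bar> * norm d" using norm_triangle_ineq[of "c t" "s *\<^sub>R d"] by simp
      also have "\<dots> \<le> norm (c t) + 1 * ((norm v + 1) * 1)"
      proof (intro add_left_mono mult_mono)
        have "(norm v + 1) * \<bar>k n\<bar> \<le> (norm v + 1) * 1" using kb(2)[of n] by (intro mult_left_mono) auto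
        then show "norm d \<le> (norm v + 1) * 1" unfolding d_def using kb(1)[of n] by (rule order_trans[rotated])
      qed (use s in auto)
      finally have "norm (c t + s *\<^sub>R d) \<le> \<rho>" by (simp add: \<rho>_def)
      from wpdot_bound[OF this, of d x] have b: "norm (wpdot (c t + s *\<^sub>R d) d x) \<le> norm d * M * dom x" by (simp add: M_def dom_def mult.assoc)
      show "onorm (\<lambda>r. r *\<^sub>R wpdot (c t + s *\<^sub>R d) d x) \<le> norm d * M * dom x"
      proof (rule onorm_le)
        show "norm (r *\<^sub>R wpdot (c t + s *\<^sub>R d) d x) \<le> norm d * M * dom x * norm r" for r :: real
          using mult_left_mono[OF b, of "\<bar>r\<bar>"] by (simp add: ac_simps)
      qed
    qed auto
    then have "cmod (wp (c (t + k n)) x - wp (c t) x) \<le> norm d * M * dom x" by (simp add: d_def)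
    also have "\<dots> \<le> ((norm v + 1) * \<bar>k n\<bar>) * M * dom x"
      using kb(1)[of n] M0 by (intro mult_right_mono) (auto simp: d_def dom_def)
    finally show ?thesis using k(2)[of n] by (simp add: q_def norm_divide field_simps)
  qed
  have vb: "cmod (wpdot (c t) v x) \<le> (norm v + 1) * M * dom x" for x
  proof -
    have "norm (c t) \<le> \<rho>" by (simp add: \<rho>_def)
    from wpdot_bound[OF this, of v x] have "cmod (wpdot (c t) v x) \<le> norm v * M * dom x" by (simp add: M_def dom_def mult.assoc)
    also have "\<dots> \<le> (norm v + 1) * M * dom x" using M0 by (intro mult_right_mono) (auto simp: dom_def)
    finally show ?thesis .
  qed
  have ptw: "(\<lambda>n. q n x) \<longlonglongrightarrow> wpdot (c t) v x" for x
  proof -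
    have "((\<lambda>s. norm (wp (c (t + s)) x - wp (c t) x - s *\<^sub>R wpdot (c t) v x) / norm s) \<longlongrightarrow> 0) (at 0)"
      using wp_curve_derivative[OF c, of x] unfolding has_vector_derivative_def has_derivative_at by simp
    moreover have "filterlim k (at 0) sequentially" using k by (intro filterlim_atI) auto
    ultimately have "(\<lambda>n. norm (wp (c (t + k n)) x - wp (c t) x - k n *\<^sub>R wpdot (c t) v x) / norm (k n)) \<longlonglongrightarrow> 0"
      by (rule filterlim_compose)
    moreover have "norm (wp (c (t + k n)) x - wp (c t) x - k n *\<^sub>R wpdot (c t) v x) / norm (k n) = norm (q n x - wpdot (c t) v x)" for n
    proof -
      have "q n x - wpdot (c t) v x = (wp (c (t + k n)) x - wp (c t) x - k n *\<^sub>R wpdot (c t) v x) / of_real (k n)"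
        using k(2)[of n] by (simp add: q_def scaleR_conv_of_real field_simps)
      then show ?thesis by (simp add: norm_divide)
    qed
    ultimately show ?thesis by (simp add: LIM_zero_iff tendsto_norm_zero_iff)
  qed
  define C where "C = 2 * ((norm v + 1) * M)"
  have "(\<lambda>n. (LBINT x. (cmod (q n x - wpdot (c t) v x))\<^sup>2)) \<longlonglongrightarrow> (\<integral>x. 0 \<partial>(lborel :: 'a measure))"
  proof (rule integral_dominated_convergence[where w="\<lambda>x. C\<^sup>2 * (dom x)\<^sup>2"])
    show "integrable lborel (\<lambda>x. C\<^sup>2 * (dom x)\<^sup>2)" unfolding dom_def by (intro integrable_mult_right integrable_sq_norm_gexp)
    show "AE x in lborel. (\<lambda>n. (cmod (q n x - wpdot (c t) v x))\<^sup>2) \<longlonglongrightarrow> 0"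
    proof (rule AE_I2)
      fix x
      have "(\<lambda>n. (cmod (q n x - wpdot (c t) v x))\<^sup>2) \<longlonglongrightarrow> (cmod (wpdot (c t) v x - wpdot (c t) v x))\<^sup>2"
        by (intro tendsto_intros ptw)
      then show "(\<lambda>n. (cmod (q n x - wpdot (c t) v x))\<^sup>2) \<longlonglongrightarrow> 0" by simp
    qed
    show "AE x in lborel. norm ((cmod (q n x - wpdot (c t) v x))\<^sup>2) \<le> C\<^sup>2 * (dom x)\<^sup>2" for n
    proof (rule AE_I2)
      fix x
      have "cmod (q n x - wpdot (c t) v x) \<le> C * dom x"
        using norm_triangle_ineq4[of "q n x" "wpdot (c t) v x"] qb[of n x] vb[of x] by (simp add: C_def)
      then have "(cmod (q n x - wpdot (c t) v x))\<^sup>2 \<le> (C * dom x)\<^sup>2" by (intro power_mono) auto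
      then show "norm ((cmod (q n x - wpdot (c t) v x))\<^sup>2) \<le> C\<^sup>2 * (dom x)\<^sup>2" by (simp add: power_mult_distrib)
    qed
    show "(\<lambda>x. (cmod (q n x - wpdot (c t) v x))\<^sup>2) \<in> borel_measurable lborel" for n unfolding q_def by measurable
  qed measurable
  then have "(\<lambda>n. (l2norm (\<lambda>x. q n x - wpdot (c t) v x))\<^sup>2) \<longlonglongrightarrow> 0" by (simp add: l2norm_sq)
  from tendsto_real_sqrt[OF this] have "(\<lambda>n. l2norm (\<lambda>x. q n x - wpdot (c t) v x)) \<longlonglongrightarrow> 0" by simp
  then show ?thesis unfolding q_def k_def by (rule LIMSEQ_offset)
qed

lemma l2inner_tendsto:
  assumes F: "\<And>n. sq_int (F n)" "sq_int F'" "(\<lambda>n. l2norm (\<lambda>x. F n x - F' x)) \<longlonglongrightarrow> 0"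
    and G: "\<And>n. sq_int (G n)" "sq_int G'" "(\<lambda>n. l2norm (\<lambda>x. G n x - G' x)) \<longlonglongrightarrow> 0"
  shows "(\<lambda>n. l2inner (F n) (G n)) \<longlonglongrightarrow> l2inner F' G'"
proof (rule Lim_null_comparison[THEN LIM_zero_cancel])
  define f g where "f n = l2norm (\<lambda>x. F n x - F' x)" and "g n = l2norm (\<lambda>x. G n x - G' x)" for n
  show "\<forall>\<^sub>F n in sequentially. norm (l2inner (F n) (G n) - l2inner F' G') \<le> f n * (g n + l2norm G') + l2norm F' * g n"
  proof (rule always_eventually, rule allI)
    fix n
    have Gn: "l2norm (G n) \<le> g n + l2norm G'"
      using l2norm_triangle[OF sq_int_diff[OF G(1)[of n] G(2)] G(2)] by (simp add: g_def)
    have "l2inner (F n) (G n) - l2inner F' G' = l2inner (\<lambda>x. F n x - F' x) (G n) + l2inner F' (\<lambda>x. G n x - G' x)"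
      using F G by (simp add: l2inner_diff_left l2inner_diff_right)
    then have "norm (l2inner (F n) (G n) - l2inner F' G') \<le> cmod (l2inner (\<lambda>x. F n x - F' x) (G n)) + cmod (l2inner F' (\<lambda>x. G n x - G' x))"
      by (simp only: norm_triangle_ineq)
    also have "\<dots> \<le> f n * l2norm (G n) + l2norm F' * g n"
      unfolding f_def g_def by (intro add_mono l2_Cauchy_Schwarz sq_int_diff F G)
    also have "\<dots> \<le> f n * (g n + l2norm G') + l2norm F' * g n"
      using Gn by (intro add_right_mono mult_left_mono) (auto simp: f_def)
    finally show "norm (l2inner (F n) (G n) - l2inner F' G') \<le> f n * (g n + l2norm G') + l2norm F' * g n" .
  qed
  have "(\<lambda>n. f n * (g n + l2norm G') + l2norm F' * g n) \<longlonglongrightarrow> 0 * (0 + l2norm G') + l2norm F' * 0"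
    using F(3) G(3) unfolding f_def g_def by (intro tendsto_intros)
  then show "(\<lambda>n. f n * (g n + l2norm G') + l2norm F' * g n) \<longlonglongrightarrow> 0" by simp
qed

text \<open>No integral is computed: the pairing is the derivative, along the straight line with
  velocity v, of the explicit overlap \<open>l2inner_wp_wp\<close>.\<close>

lemma l2inner_wpdot_wp:
  "l2inner (wpdot z v) (wp w) = (\<i> * of_real (pi * sympl v w) - of_real (pi * ((z - w) \<bullet> v))) * l2inner (wp z) (wp w)"
proof -
  define h where "h n = 1 / (real n + 1)" for n :: nat
  have h: "h \<longlonglongrightarrow> 0" "\<And>n. h n \<noteq> 0" unfolding h_def by real_asymp (simp add: add_nonneg_eq_0_iff)
  define c where "c s = z + s *\<^sub>R v" for s :: real
  have c: "(c has_vector_derivative v) (at 0)"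
  proof -
    have "((\<lambda>s. s *\<^sub>R v) has_vector_derivative 1 *\<^sub>R v) (at 0)"
      using has_vector_derivative_scaleR[OF DERIV_ident has_vector_derivative_const[of v], of 0] by simp
    then show ?thesis unfolding c_def using has_vector_derivative_add[OF has_vector_derivative_const] by fastforce
  qed
  define q where "q n x = (1 / of_real (h n)) * (wp (c (h n)) x - wp z x)" for n x
  have sq: "sq_int (q n)" for n unfolding q_def[abs_def] by (intro sq_int_scale sq_int_diff sq_int_wp)
  have "(\<lambda>n. l2norm (\<lambda>x. q n x - wpdot z v x)) \<longlonglongrightarrow> 0"
    using wp_L2_derivative[OF c h] by (simp add: q_def c_def)
  then have l1: "(\<lambda>n. l2inner (q n) (wp w)) \<longlonglongrightarrow> l2inner (wpdot z v) (wp w)"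
    by (intro l2inner_tendsto sq sq_int_wpdot sq_int_wp) (auto simp: l2norm_def)
  \<comment> \<open>The overlap along the line, as the exponential of a quadratic polynomial in a
    complex parameter, so that field derivatives apply.\<close>
  define E where "E s = exp (\<i> * of_real (pi * sympl z w) - of_real (pi / 2 * (norm (z - w))\<^sup>2) + (\<i> * of_real (pi * sympl v w) - of_real (pi * ((z - w) \<bullet> v))) * s - of_real (pi / 2 * (norm v)\<^sup>2) * s * s)" for s :: complex
  have kE: "l2inner (wp (c r)) (wp w) = E (of_real r)" for r
  proof -
    have n: "(norm (c r - w))\<^sup>2 = (norm (z - w))\<^sup>2 + 2 * r * ((z - w) \<bullet> v) + r * r * (norm v)\<^sup>2"
    proof -
      have "c r - w = (z - w) + r *\<^sub>R v" by (simp add: c_def)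
      then show ?thesis unfolding power2_norm_eq_inner
        by (simp only: inner_add_left inner_add_right inner_scaleR_left inner_scaleR_right inner_commute[of v "z - w"]) (simp add: algebra_simps)
    qed
    have "l2inner (wp (c r)) (wp w) = exp (\<i> * of_real (pi * sympl (c r) w)) * exp (complex_of_real (- (pi / 2) * (norm (c r - w))\<^sup>2))"
      unfolding l2inner_wp_wp cis_conv_exp exp_of_real ..
    also have "\<dots> = E (of_real r)"
      unfolding E_def n exp_add[symmetric] by (rule arg_cong[where f=exp]) (simp add: c_def sympl_simps algebra_simps)
    finally show ?thesis .
  qed
  have "(E has_field_derivative (\<i> * of_real (pi * sympl v w) - of_real (pi * ((z - w) \<bullet> v))) * E 0) (at 0)"
    unfolding E_def by (auto intro!: derivative_eq_intros)
  from DERIV_sequential_quotient[OF this]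
  have l2: "(\<lambda>n. (E (of_real (h n)) - E 0) * of_real (real n + 1)) \<longlonglongrightarrow> (\<i> * of_real (pi * sympl v w) - of_real (pi * ((z - w) \<bullet> v))) * E 0"
    by (simp only: h_def add_0)
  have "l2inner (q n) (wp w) = (E (of_real (h n)) - E 0) * of_real (real n + 1)" for n
  proof -
    have "l2inner (q n) (wp w) = (1 / of_real (h n)) * (l2inner (wp (c (h n))) (wp w) - l2inner (wp (c 0)) (wp w))"
      unfolding q_def l2inner_scale_left by (simp add: l2inner_diff_left sq_int_wp c_def)
    also have "\<dots> = (1 / of_real (h n)) * (E (of_real (h n)) - E 0)" unfolding kE by simp
    also have "1 / complex_of_real (h n) = of_real (real n + 1)" by (simp add: h_def)
    finally show ?thesis by (simp only: mult.commute)
  qed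
  with l1 l2 have "l2inner (wpdot z v) (wp w) = (\<i> * of_real (pi * sympl v w) - of_real (pi * ((z - w) \<bullet> v))) * E 0"
    using LIMSEQ_unique by (simp only:)
  moreover have "E 0 = l2inner (wp z) (wp w)" using kE[of 0] by (simp add: c_def)
  ultimately show ?thesis by simp
qed

section \<open>Wave packet coefficients along the Schroedinger evolution\<close>

lemma nn_integral_pos_of_pos:
  fixes f :: "'b::euclidean_space \<Rightarrow> ennreal"
  assumes [measurable]: "f \<in> borel_measurable borel" and pos: "\<And>x. f x > 0"
  shows "(NNBINT x. f x) > 0"
proof (rule ccontr)
  assume "\<not> (NNBINT x. f x) > 0"
  then have "(NNBINT x. f x) = 0" by (simp add: zero_less_iff_neq_zero)
  then have "AE x in (lborel :: 'b measure). f x = 0" by (subst (asm) nn_integral_0_iff_AE) auto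
  then have "AE x in (lborel :: 'b measure). False" by eventually_elim (use pos in \<open>simp add: zero_less_iff_neq_zero\<close>)
  then have "emeasure lborel (UNIV :: 'b set) = 0" using trivial_limit_def ae_filter_eq_bot_iff[of "lborel :: 'b measure"] by (simp add: eventually_False)
  then show False by (simp add: emeasure_lborel_UNIV)
qed

lemma linear_sympl_J: "linear sympl_J"
  by (rule linearI) (simp_all add: sympl_J_def)

text \<open>\<open>sympl_J\<close> is a linear isometry, so both bounds for the Jacobian factor
  equal 1.\<close>

lemma nn_integral_sympl_J:
  fixes f :: "'a::euclidean_space \<times> 'a \<Rightarrow> ennreal"
  assumes f: "f \<in> borel_measurable borel"
  shows "(NNBINT z. f (sympl_J z)) = (NNBINT z. f z)"
proof -
  obtain c where c: "(1 / 1) ^ DIM('a \<times> 'a) \<le> c" "c \<le> (1 / 1) ^ DIM('a \<times> 'a)"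
    and cv: "\<And>h. h \<in> borel_measurable borel \<Longrightarrow> (NNBINT z. h (sympl_J (z :: 'a \<times> 'a))) = ennreal c * (NNBINT w. h w)"
    by (rule linear_change_of_variables[OF linear_sympl_J, of 1 1]) auto
  have "c = 1" using c by simp
  then show ?thesis using cv[OF f] by simp
qed

lemma borel_measurable_sympl_J [measurable]: "sympl_J \<in> borel_measurable borel"
  using linear_continuous_on[OF linear_conv_bounded_linear[THEN iffD1, OF linear_sympl_J]] by (rule borel_measurable_continuous_onI)

text \<open>The function \<open>k\<close> stands for the Hamiltonian applied to the packet at z.
  Adding the motion of the packet along L removes all growth in z
  (\<open>residual_identity\<close>): the quadratic part leaves a polynomial in z - w times the
  Gaussian overlap, and \<sigma> contributes the integrable kernel of
  \<open>sjostrand_kernel\<close>.\<close>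

lemma weyl_residual_kernel:
  fixes \<beta> :: "(real^'n) \<times> (real^'n) \<Rightarrow> (real^'n) \<times> (real^'n) \<Rightarrow> real"
  assumes lin: "\<And>z. linear (\<beta> z)" and sym: "\<And>z w. \<beta> z w = \<beta> w z"
    and sj: "sjostrand (\<lambda>z. complex_of_real (\<sigma> z))"
    and L: "\<And>z d. \<beta> z d = - pi * sympl (L z) d"
  obtains \<Theta> :: "(real^'n) \<times> (real^'n) \<Rightarrow> ennreal" and \<theta> where "\<Theta> \<in> borel_measurable borel"
    "(NNBINT v. \<Theta> v) = ennreal \<theta>" "\<theta> > 0"
    "\<And>k z w. sq_int k \<Longrightarrow> l2inner k (wp w) = weyl_form (\<lambda>z. \<beta> z z + \<sigma> z) (wp z) (wp w) \<Longrightarrow>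
       ennreal (cmod (gstft (\<lambda>x. \<i> * k x + wpdot z (L z) x) w)) \<le> \<Theta> (z - w)"
proof -
  obtain T :: "(real^'n) \<times> (real^'n) \<Rightarrow> ennreal" where T [measurable]: "T \<in> borel_measurable borel" and Tfin: "(NNBINT b. T b) < \<infinity>"
    and Ti: "\<And>m b. integrable lborel (\<lambda>u. complex_of_real (\<sigma> (m + u)) * (of_real (gau2 u) * cis (2 * pi * (b \<bullet> u))))"
    and Tb: "\<And>m b. ennreal (cmod (LBINT u. complex_of_real (\<sigma> (m + u)) * (of_real (gau2 u) * cis (2 * pi * (b \<bullet> u))))) \<le> T b"
    using sjostrand_kernel[OF sj] by blast
  obtain B where B: "B \<ge> 0" "\<And>x y. \<bar>\<beta> x y\<bar> \<le> B * norm x * norm y"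
    using bilinear_form_bound[OF lin sym] by blast
  define tr where "tr = (\<Sum>i\<in>Basis. \<beta> i i) / (4 * pi)"
  define K where "K = sqrt 2 ^ DIM((real^'n) \<times> (real^'n))"
  have K: "K \<ge> 0" by (simp add: K_def)
  \<comment> \<open>The added 1 keeps \<Theta> strictly positive even for a vanishing symbol, so
    that \<theta> > 0, as \<open>transport_L1_bound\<close> requires.\<close>
  define C where "C = \<bar>tr\<bar> + B + 1"
  have C: "C > 0" using B(1) by (simp add: C_def)
  define R where "R \<delta> = C * ((1 + norm \<delta>) ^ 2 * gexp (pi / 2) \<delta>)" for \<delta> :: "(real^'n) \<times> (real^'n)"
  have [measurable]: "R \<in> borel_measurable borel" unfolding R_def by measurable
  define \<Theta> where "\<Theta> \<delta> = ennreal (R \<delta>) + ennreal K * T (sympl_J \<delta>)" for \<delta>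
  have \<Theta>m [measurable]: "\<Theta> \<in> borel_measurable borel" unfolding \<Theta>_def by measurable
  have Rpos: "R \<delta> > 0" for \<delta>
    unfolding R_def using C by (intro mult_pos_pos zero_less_power gexp_pos add_pos_nonneg) auto
  have Ri: "integrable lborel R"
    unfolding R_def gexp_def using integrable_power_exp_norm_sq[of "pi / 2" 2, where 'a="(real^'n) \<times> (real^'n)"] by (intro integrable_mult_right) auto
  have "(NNBINT v. ennreal (R v)) < \<infinity>"
    using nn_integral_eq_integral[OF Ri] Rpos by (simp add: less_imp_le)
  moreover have "ennreal K * (NNBINT b. T b) < \<infinity>" using Tfin by (simp add: ennreal_mult_less_top)
  moreover have "(NNBINT v. \<Theta> v) = (NNBINT v. ennreal (R v)) + ennreal K * (NNBINT b. T b)"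
    unfolding \<Theta>_def using nn_integral_sympl_J[of T] by (subst nn_integral_add) (simp_all add: nn_integral_cmult)
  ultimately have fin: "(NNBINT v. \<Theta> v) < \<infinity>" by simp
  have pos: "(NNBINT v. \<Theta> v) > 0"
    by (rule nn_integral_pos_of_pos) (use Rpos in \<open>auto simp: \<Theta>_def add_pos_nonneg\<close>)
  show thesis
  proof (rule that)
    show "\<Theta> \<in> borel_measurable borel" by (rule \<Theta>m)
    show "(NNBINT v. \<Theta> v) = ennreal (enn2real (NNBINT v. \<Theta> v))" using fin by simp
    show "enn2real (NNBINT v. \<Theta> v) > 0" using fin pos by (simp add: enn2real_positive_iff)
    fix k :: "real^'n \<Rightarrow> complex" and z w :: "(real^'n) \<times> (real^'n)"
    assume k: "sq_int k" and kw: "l2inner k (wp w) = weyl_form (\<lambda>z. \<beta> z z + \<sigma> z) (wp z) (wp w)"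
    define \<delta> where "\<delta> = z - w"
    define b where "b = sympl_J \<delta>"
    define m where "m = (1/2) *\<^sub>R (z + w)"
    define I where "I = l2inner (wp z) (wp w)"
    define A where "A = complex_of_real (\<beta> m m + tr - \<beta> b b / 4) + \<i> * of_real (\<beta> m b)"
    define D where "D = \<i> * complex_of_real (pi * sympl (L z) w) - of_real (pi * (\<delta> \<bullet> L z))"
    define s where "s = (LBINT u. complex_of_real (\<sigma> (m + u)) * (of_real (gau2 u) * cis (2 * pi * (b \<bullet> u))))"
    define E where "E = \<i> * complex_of_real (\<beta> \<delta> \<delta> / 4 + tr - \<beta> b b / 4) + of_real (\<beta> \<delta> b / 2)"
    have W: "l2inner k (wp w) = I * A + of_real K * cis (pi * sympl z w) * s"
      unfolding kw I_def A_def K_def s_def b_def \<delta>_def m_def tr_def by (rule weyl_wp[OF lin sym Ti])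
    have dW: "l2inner (wpdot z (L z)) (wp w) = D * I"
      unfolding D_def I_def \<delta>_def by (rule l2inner_wpdot_wp)
    have res: "\<i> * A + D = E"
      unfolding A_def D_def E_def b_def \<delta>_def m_def by (rule residual_identity[OF lin sym L])
    have "gstft (\<lambda>x. \<i> * k x + wpdot z (L z) x) w = \<i> * l2inner k (wp w) + l2inner (wpdot z (L z)) (wp w)"
      unfolding gstft_def by (subst l2inner_add_left) (simp_all add: k sq_int_scale sq_int_wpdot sq_int_wp l2inner_scale_left)
    also have "\<dots> = I * (\<i> * A + D) + \<i> * (of_real K * cis (pi * sympl z w) * s)"
      unfolding W dW by (simp add: algebra_simps)
    also have "cmod \<dots> \<le> cmod I * cmod E + K * cmod s"
      unfolding res by (rule order_trans[OF norm_triangle_ineq]) (simp add: norm_mult K)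
    also have "cmod I = gexp (pi / 2) \<delta>"
      unfolding I_def l2inner_wp_wp gexp_def \<delta>_def by (simp add: norm_mult)
    also have "gexp (pi / 2) \<delta> * cmod E \<le> R \<delta>"
    proof -
      have n: "norm b = norm \<delta>" by (simp add: b_def)
      have "cmod E \<le> \<bar>\<beta> \<delta> \<delta> / 4 + tr - \<beta> b b / 4\<bar> + \<bar>\<beta> \<delta> b / 2\<bar>"
        unfolding E_def by (rule order_trans[OF norm_triangle_ineq]) (simp add: norm_mult del: of_real_add of_real_diff of_real_divide)
      also have "\<dots> \<le> \<bar>tr\<bar> + B * (norm \<delta> * norm \<delta>)"
        using B(2)[of \<delta> \<delta>] B(2)[of b b] B(2)[of \<delta> b] unfolding n mult.assoc by linarith
      also have "\<dots> \<le> C * (1 + norm \<delta>)\<^sup>2"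
      proof -
        have "(1 + norm \<delta>)\<^sup>2 \<ge> 1" "(1 + norm \<delta>)\<^sup>2 \<ge> norm \<delta> * norm \<delta>" by (simp_all add: power2_eq_square algebra_simps)
        then have "\<bar>tr\<bar> * 1 + B * (norm \<delta> * norm \<delta>) \<le> \<bar>tr\<bar> * (1 + norm \<delta>)\<^sup>2 + B * (1 + norm \<delta>)\<^sup>2"
          using B(1) by (intro add_mono mult_left_mono) auto
        also have "\<dots> \<le> C * (1 + norm \<delta>)\<^sup>2" by (simp add: C_def algebra_simps)
        finally show ?thesis by simp
      qed
      finally have "gexp (pi / 2) \<delta> * cmod E \<le> gexp (pi / 2) \<delta> * (C * (1 + norm \<delta>)\<^sup>2)" by (intro mult_left_mono) auto
      then show ?thesis by (simp only: R_def ac_simps)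
    qed
    finally have "cmod (gstft (\<lambda>x. \<i> * k x + wpdot z (L z) x) w) \<le> R \<delta> + K * cmod s" by simp
    then have "ennreal (cmod (gstft (\<lambda>x. \<i> * k x + wpdot z (L z) x) w)) \<le> ennreal (R \<delta> + K * cmod s)" by (rule ennreal_leI)
    also have "\<dots> = ennreal (R \<delta>) + ennreal K * ennreal (cmod s)"
      using K Rpos[of \<delta>] by (simp add: ennreal_plus ennreal_mult)
    also have "\<dots> \<le> \<Theta> \<delta>" unfolding \<Theta>_def b_def[symmetric] s_def by (intro add_left_mono mult_left_mono Tb) auto
    finally show "ennreal (cmod (gstft (\<lambda>x. \<i> * k x + wpdot z (L z) x) w)) \<le> \<Theta> (z - w)" by (simp only: \<delta>_def)
  qed
qed

section \<open>The propagator tested against wave packets\<close>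

lemma propagator_sq_int: "schrodinger_propagator H U \<Longrightarrow> sq_int f \<Longrightarrow> sq_int (U t f)"
  and propagator_norm: "schrodinger_propagator H U \<Longrightarrow> sq_int f \<Longrightarrow> l2norm (U t f) = l2norm f"
  and propagator_0: "schrodinger_propagator H U \<Longrightarrow> sq_int f \<Longrightarrow> AE x in lborel. U 0 f x = f x"
  and propagator_add: "schrodinger_propagator H U \<Longrightarrow> sq_int f \<Longrightarrow> AE x in lborel. U (s + t) f x = U s (U t f) x"
  and propagator_linear: "schrodinger_propagator H U \<Longrightarrow> sq_int f \<Longrightarrow> sq_int g \<Longrightarrow> AE x in lborel. U t (\<lambda>y. f y + c * g y) x = U t f x + c * U t g x"
  unfolding schrodinger_propagator_def by blast+

lemma propagator_tendsto:
  assumes P: "schrodinger_propagator H U" and f: "sq_int f" and X: "(X \<longlongrightarrow> s) F"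
  shows "((\<lambda>n. l2norm (\<lambda>x. U (X n) f x - U s f x)) \<longlongrightarrow> 0) F"
proof -
  have "((\<lambda>t. l2norm (\<lambda>x. U t f x - U s f x)) \<longlongrightarrow> 0) (at s)"
    using P f unfolding schrodinger_propagator_def by blast
  moreover have "l2norm (\<lambda>x. U s f x - U s f x) = 0" by (simp add: l2norm_def)
  ultimately have "isCont (\<lambda>t. l2norm (\<lambda>x. U t f x - U s f x)) s" by (simp add: isCont_def)
  from isCont_tendsto_compose[OF this X] show ?thesis by (simp add: l2norm_def)
qed

text \<open>Polarization, with linearity holding almost everywhere only; the factors 1 and \<i>
  suffice.\<close>

lemma propagator_unitary:
  assumes P: "schrodinger_propagator H U" and f: "sq_int f" and g: "sq_int g"
  shows "l2inner (U t f) (U t g) = l2inner f g"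
proof -
  have Uf: "sq_int (U t f)" and Ug: "sq_int (U t g)" using propagator_sq_int[OF P] f g by auto
  have *: "Re (cnj c * l2inner (U t f) (U t g)) = Re (cnj c * l2inner f g)" for c
  proof -
    have s: "sq_int (\<lambda>x. f x + c * g x)" "sq_int (\<lambda>x. U t f x + c * U t g x)"
      by (intro sq_int_add sq_int_scale f g Uf Ug)+
    have "l2norm (\<lambda>x. f x + c * g x) = l2norm (U t (\<lambda>x. f x + c * g x))"
      using propagator_norm[OF P s(1)] by simp
    also have "\<dots> = l2norm (\<lambda>x. U t f x + c * U t g x)"
      by (rule l2norm_cong_AE[OF propagator_linear[OF P f g]]) (use propagator_sq_int[OF P s(1)] s(2) in \<open>auto dest: sq_intD\<close>)
    finally have "(l2norm (\<lambda>x. f x + c * g x))\<^sup>2 = (l2norm (\<lambda>x. U t f x + c * U t g x))\<^sup>2" by simp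
    then show ?thesis
      unfolding l2norm_add_sq[OF f sq_int_scale[OF g]] l2norm_add_sq[OF Uf sq_int_scale[OF Ug]]
      by (simp add: l2norm_scale propagator_norm[OF P] f g l2inner_scale_right)
  qed
  from *[of 1] *[of \<i>] show ?thesis by (simp add: complex_eq_iff)
qed

text \<open>Lets a time step be moved from an arbitrary L^2 function to a wave packet, where the
  generator is known.\<close>

lemma propagator_adjoint:
  assumes P: "schrodinger_propagator H U" and f: "sq_int f" and g: "sq_int g"
  shows "l2inner (U t f) g = l2inner f (U (- t) g)"
proof -
  have "AE x in lborel. U (t + - t) g x = U t (U (- t) g) x" by (rule propagator_add[OF P g])
  moreover have "AE x in lborel. U 0 g x = g x" by (rule propagator_0[OF P g])
  ultimately have "AE x in lborel. g x = U t (U (- t) g) x" by (auto elim: eventually_elim2)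
  then have "l2inner (U t f) g = l2inner (U t f) (U t (U (- t) g))"
    by (intro l2inner_cong_AE) (auto intro!: sq_intD(1) propagator_sq_int[OF P] f g)
  also have "\<dots> = l2inner f (U (- t) g)" by (rule propagator_unitary[OF P f propagator_sq_int[OF P g]])
  finally show ?thesis .
qed

lemma has_vector_derivative_sequentialI:
  fixes f :: "real \<Rightarrow> 'b::real_normed_vector"
  assumes "\<And>h. h \<longlonglongrightarrow> 0 \<Longrightarrow> (\<And>n. h n \<noteq> 0) \<Longrightarrow> (\<lambda>n. (1 / h n) *\<^sub>R (f (t + h n) - f t)) \<longlonglongrightarrow> d"
  shows "(f has_vector_derivative d) (at t)"
proof -
  have "((\<lambda>h. norm (f (t + h) - f t - h *\<^sub>R d) / norm h) \<longlongrightarrow> 0) (at 0)"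
    unfolding tendsto_at_iff_sequentially
  proof (intro allI impI)
    fix h :: "nat \<Rightarrow> real" assume h0: "\<forall>i. h i \<in> UNIV - {0}" and h: "h \<longlonglongrightarrow> 0"
    have "(\<lambda>n. norm ((1 / h n) *\<^sub>R (f (t + h n) - f t) - d)) \<longlonglongrightarrow> norm (d - d)"
      using assms[OF h] h0 by (intro tendsto_intros) auto
    moreover have "norm ((1 / h n) *\<^sub>R (f (t + h n) - f t) - d) = norm (f (t + h n) - f t - h n *\<^sub>R d) / norm (h n)" for n
    proof -
      have "(1 / h n) *\<^sub>R (f (t + h n) - f t) - d = (1 / h n) *\<^sub>R (f (t + h n) - f t - h n *\<^sub>R d)"
        using h0 by (simp add: scaleR_diff_right)
      then show ?thesis by simp
    qed
    ultimately show "((\<lambda>h. norm (f (t + h) - f t - h *\<^sub>R d) / norm h) \<circ> h) \<longlonglongrightarrow> 0" by (simp add: o_def)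
  qed
  then show ?thesis unfolding has_vector_derivative_def has_derivative_at
    by (simp add: bounded_linear_scaleR_left)
qed

text \<open>A product rule in which \<open>g\<close> is merely in L^2 and \<open>s\<close> to
  \<open>U s g\<close> need not be differentiable. The time step is moved to the packet by the
  adjoint, so only the packet is differentiated, once through its centre and once through the
  evolution.\<close>

lemma wave_packet_coefficient_derivative:
  fixes H :: "(real^'n) \<times> (real^'n) \<Rightarrow> real"
  assumes P: "schrodinger_propagator H U" and g: "sq_int g"
    and c: "(c has_vector_derivative v) (at t)"
  obtains k where "sq_int k" "\<And>w. l2inner k (wp w) = weyl_form H (wp (c t)) (wp w)"
    "((\<lambda>s. gstft (U s g) (c s)) has_vector_derivative l2inner (U t g) (\<lambda>x. \<i> * k x + wpdot (c t) v x)) (at t)"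
proof -
  define \<psi> where "\<psi> = wp (c t)"
  have \<psi>: "sq_int \<psi>" by (simp add: \<psi>_def sq_int_wp)
  have "schwartz f \<Longrightarrow> \<exists>k. sq_int k \<and> (\<forall>h. schwartz h \<longrightarrow> l2inner k h = weyl_form H f h) \<and>
      ((\<lambda>t. l2norm (\<lambda>x. (U t f x - f x) / complex_of_real t + \<i> * k x)) \<longlongrightarrow> 0) (at 0)" for f
    using P unfolding schrodinger_propagator_def by (elim conjE) simp
  from this[OF schwartz_wp[of "c t"]]
  obtain k where k: "sq_int k" "\<And>h. schwartz h \<Longrightarrow> l2inner k h = weyl_form H \<psi> h"
    and klim: "((\<lambda>t. l2norm (\<lambda>x. (U t \<psi> x - \<psi> x) / complex_of_real t + \<i> * k x)) \<longlongrightarrow> 0) (at 0)"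
    unfolding \<psi>_def by blast
  define F where "F = U t g"
  have F: "sq_int F" by (simp add: F_def propagator_sq_int[OF P g])
  note Us = propagator_sq_int[OF P]
  show thesis
  proof (rule that[OF k(1)])
    show "l2inner k (wp w) = weyl_form H (wp (c t)) (wp w)" for w using k(2)[OF schwartz_wp] by (simp add: \<psi>_def)
    show "((\<lambda>s. gstft (U s g) (c s)) has_vector_derivative l2inner (U t g) (\<lambda>x. \<i> * k x + wpdot (c t) v x)) (at t)"
    proof (rule has_vector_derivative_sequentialI)
      fix h :: "nat \<Rightarrow> real" assume h: "h \<longlonglongrightarrow> 0" "\<And>n. h n \<noteq> 0"
      \<comment> \<open>Two quotients: \<open>q\<close> moves the centre, paired with the advanced
        state; \<open>r\<close> evolves the packet backwards, paired with the state at time t. Their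
        sum is exactly the difference quotient of the coefficient.\<close>
      define q where "q n x = (1 / of_real (h n)) * (wp (c (t + h n)) x - \<psi> x)" for n x
      define r where "r n x = (1 / of_real (h n)) * (U (- h n) \<psi> x - \<psi> x)" for n x
      have q: "sq_int (q n)" for n unfolding q_def[abs_def] by (intro sq_int_scale sq_int_diff sq_int_wp \<psi>)
      have r: "sq_int (r n)" for n unfolding r_def[abs_def] by (intro sq_int_scale sq_int_diff Us \<psi>)
      have "(\<lambda>n. l2norm (\<lambda>x. q n x - wpdot (c t) v x)) \<longlonglongrightarrow> 0"
        using wp_L2_derivative[OF c h] by (simp add: q_def \<psi>_def)
      moreover have "(\<lambda>n. l2norm (\<lambda>x. U (h n) F x - F x)) \<longlonglongrightarrow> 0"
      proof -
        have "l2norm (\<lambda>x. U (h n) F x - F x) = l2norm (\<lambda>x. U (h n) F x - U 0 F x)" for n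
          by (rule l2norm_cong_AE) (use propagator_0[OF P F] in \<open>auto intro!: sq_intD(1) sq_int_diff Us F elim: eventually_mono\<close>)
        then show ?thesis using propagator_tendsto[OF P F h(1)] by simp
      qed
      ultimately have l1: "(\<lambda>n. l2inner (U (h n) F) (q n)) \<longlonglongrightarrow> l2inner F (wpdot (c t) v)"
        by (intro l2inner_tendsto Us F q sq_int_wpdot)
      have "(\<lambda>n. l2norm (\<lambda>x. r n x - \<i> * k x)) \<longlonglongrightarrow> 0"
      proof -
        have "(\<lambda>n. - h n) \<longlonglongrightarrow> 0" using tendsto_minus[OF h(1)] by simp
        then have "filterlim (\<lambda>n. - h n) (at 0) sequentially" using h(2) by (simp add: filterlim_at)
        from filterlim_compose[OF klim this]
        have "(\<lambda>n. l2norm (\<lambda>x. (U (- h n) \<psi> x - \<psi> x) / complex_of_real (- h n) + \<i> * k x)) \<longlonglongrightarrow> 0" .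
        moreover have "(U (- h n) \<psi> x - \<psi> x) / complex_of_real (- h n) + \<i> * k x = (-1) * (r n x - \<i> * k x)" for n x
          by (simp add: r_def)
        ultimately show ?thesis by (simp add: l2norm_minus[of "\<lambda>x. \<i> * k x"])
      qed
      then have l2: "(\<lambda>n. l2inner F (r n)) \<longlonglongrightarrow> l2inner F (\<lambda>x. \<i> * k x)"
        by (intro l2inner_tendsto F r sq_int_scale k(1)) (auto simp: l2norm_def)
      have "(1 / h n) *\<^sub>R (gstft (U (t + h n) g) (c (t + h n)) - gstft (U t g) (c t)) = l2inner (U (h n) F) (q n) + l2inner F (r n)" for n
      proof -
        have "gstft (U (t + h n) g) (c (t + h n)) = l2inner (U (h n) F) (wp (c (t + h n)))"
          unfolding gstft_def F_def add.commute[of t]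
          by (rule l2inner_cong_AE[OF propagator_add[OF P g]]) (auto intro!: sq_intD(1) Us g sq_int_wp)
        moreover have "l2inner (U (h n) F) \<psi> = l2inner F (U (- h n) \<psi>)" by (rule propagator_adjoint[OF P F \<psi>])
        moreover have "l2inner (U (h n) F) (q n) = (1 / of_real (h n)) * (l2inner (U (h n) F) (wp (c (t + h n))) - l2inner (U (h n) F) \<psi>)"
          unfolding q_def l2inner_scale_right by (simp add: l2inner_diff_right Us F sq_int_wp \<psi>)
        moreover have "l2inner F (r n) = (1 / of_real (h n)) * (l2inner F (U (- h n) \<psi>) - l2inner F \<psi>)"
          unfolding r_def l2inner_scale_right by (simp add: l2inner_diff_right Us F \<psi>)
        moreover have "gstft (U t g) (c t) = l2inner F \<psi>" by (simp add: gstft_def F_def \<psi>_def)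
        ultimately show ?thesis by (simp add: scaleR_conv_of_real right_diff_distrib add_divide_distrib diff_divide_distrib)
      qed
      moreover have "l2inner F (wpdot (c t) v) + l2inner F (\<lambda>x. \<i> * k x) = l2inner (U t g) (\<lambda>x. \<i> * k x + wpdot (c t) v x)"
        by (subst l2inner_add_right) (auto simp: F_def[symmetric] F sq_int_wpdot sq_int_scale k(1))
      ultimately show "(\<lambda>n. (1 / h n) *\<^sub>R (gstft (U (t + h n) g) (c (t + h n)) - gstft (U t g) (c t)))
          \<longlonglongrightarrow> l2inner (U t g) (\<lambda>x. \<i> * k x + wpdot (c t) v x)"
        using tendsto_add[OF l1 l2] by simp
    qed
  qed
qed

text \<open>No regularity of \<open>f'\<close> is assumed: the fundamental theorem for the gauge
  integral makes it integrable. Only the majorant has to be measurable and bounded, so that its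
  gauge and Lebesgue integrals agree.\<close>

lemma integral_bound_of_derivative_bound:
  fixes f :: "real \<Rightarrow> complex"
  assumes f: "\<And>s. (f has_vector_derivative f' s) (at s)"
    and b [measurable]: "b \<in> borel_measurable borel" and fb: "\<And>s. ennreal (cmod (f' s)) \<le> b s"
    and bM: "\<And>s. b s \<le> ennreal M" and t: "0 \<le> t"
  shows "ennreal (cmod (f t)) \<le> ennreal (cmod (f 0)) + (NNBINT s. indicator {0..t} s * b s)"
proof -
  define r where "r s = enn2real (b s)" for s
  have [measurable]: "r \<in> borel_measurable borel" unfolding r_def by measurable
  have br: "b s = ennreal (r s)" for s using le_less_trans[OF bM[of s] ennreal_less_top] by (simp add: r_def)
  have r0: "0 \<le> r s" for s by (simp add: r_def)
  have rM: "r s \<le> \<bar>M\<bar>" for s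
  proof -
    have "ennreal (r s) \<le> ennreal \<bar>M\<bar>" using bM[of s] by (simp add: br ennreal_leI order_trans)
    then show ?thesis by simp
  qed
  have si: "set_integrable lborel {0..t} r"
    unfolding set_integrable_def
  proof (rule Bochner_Integration.integrable_bound)
    show "integrable lborel (\<lambda>s. indicator {0..t} s *\<^sub>R \<bar>M\<bar>)" using t by auto
  qed (use rM r0 in \<open>auto simp: indicator_def\<close>)
  have FTC: "(f' has_integral (f t - f 0)) {0..t}"
    by (rule fundamental_theorem_of_calculus[OF t]) (rule has_vector_derivative_at_within[OF f])
  have ri: "r integrable_on {0..t}" "integral {0..t} r = set_lebesgue_integral lborel {0..t} r"
    using set_borel_integral_eq_integral[OF si] by auto
  have "cmod (f t - f 0) = cmod (integral {0..t} f')" using FTC by (simp add: integral_unique)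
  also have "\<dots> \<le> integral {0..t} r"
    by (rule integral_norm_bound_integral) (use FTC ri fb in \<open>auto simp: has_integral_integrable br ennreal_le_iff[OF r0]\<close>)
  finally have "cmod (f t) \<le> cmod (f 0) + set_lebesgue_integral lborel {0..t} r"
    using norm_triangle_ineq2[of "f t" "f 0"] ri(2) by simp
  then have "ennreal (cmod (f t)) \<le> ennreal (cmod (f 0) + set_lebesgue_integral lborel {0..t} r)" by (rule ennreal_leI)
  also have "\<dots> = ennreal (cmod (f 0)) + ennreal (set_lebesgue_integral lborel {0..t} r)"
    by (rule ennreal_plus) (auto simp: set_lebesgue_integral_def r0 intro!: integral_nonneg_AE)
  also have "ennreal (set_lebesgue_integral lborel {0..t} r) = (NNBINT s. ennreal (indicator {0..t} s *\<^sub>R r s))"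
    unfolding set_lebesgue_integral_def using si[unfolded set_integrable_def] by (intro nn_integral_eq_integral[symmetric]) (auto simp: r0)
  also have "\<dots> = (NNBINT s. indicator {0..t} s * b s)"
    by (rule nn_integral_cong) (simp add: br indicator_def)
  finally show ?thesis .
qed

text \<open>Joint continuity, from strong continuity of the group and L^2 continuity of the packets
  in their centre; Tonelli in time and phase space needs joint measurability.\<close>

lemma borel_measurable_gstft_propagator:
  fixes g :: "real^'n \<Rightarrow> complex"
  assumes P: "schrodinger_propagator H U" and g: "sq_int g"
  shows "(\<lambda>(s, v). gstft (U (\<epsilon> * s) g) v) \<in> borel_measurable (borel \<Otimes>\<^sub>M borel)"
proof -
  have "continuous_on UNIV (\<lambda>p. gstft (U (\<epsilon> * fst p) g) (snd p))"
  proof (rule continuous_on_sequentiallyI)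
    fix u :: "nat \<Rightarrow> real \<times> (real^'n) \<times> (real^'n)" and p assume u: "u \<longlonglongrightarrow> p"
    have "(\<lambda>n. l2norm (\<lambda>x. U (\<epsilon> * fst (u n)) g x - U (\<epsilon> * fst p) g x)) \<longlonglongrightarrow> 0"
      by (intro propagator_tendsto[OF P g] tendsto_intros u)
    moreover have "(\<lambda>n. l2norm (\<lambda>x. wp (snd (u n)) x - wp (snd p) x)) \<longlonglongrightarrow> 0"
    proof -
      have "isCont (\<lambda>z. l2norm (\<lambda>x. wp z x - wp (snd p) x)) (snd p)"
        using l2norm_wp_diff_tendsto[of "snd p"] by (simp add: isCont_def l2norm_def)
      from isCont_tendsto_compose[OF this tendsto_snd[OF u]] show ?thesis by (simp add: l2norm_def)
    qed
    ultimately show "(\<lambda>n. gstft (U (\<epsilon> * fst (u n)) g) (snd (u n))) \<longlonglongrightarrow> gstft (U (\<epsilon> * fst p) g) (snd p)"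
      unfolding gstft_def by (intro l2inner_tendsto propagator_sq_int[OF P g] sq_int_wp)
  qed
  then show ?thesis unfolding borel_prod case_prod_unfold by (rule borel_measurable_continuous_onI)
qed

lemma borel_measurable_linear_flow:
  fixes S :: "real \<Rightarrow> 'b::euclidean_space \<Rightarrow> 'b"
  assumes lin: "\<And>t. linear (S t)" and d: "\<And>t w. ((\<lambda>t. S t w) has_vector_derivative S' t w) (at t)"
  shows "(\<lambda>(s, w). S (\<epsilon> * s) w) \<in> borel_measurable (borel \<Otimes>\<^sub>M borel)"
proof -
  have "continuous_on UNIV (\<lambda>t. S t i)" for i
    by (intro continuous_at_imp_continuous_on ballI) (rule has_vector_derivative_continuous[OF d])
  then have [measurable]: "(\<lambda>t. S t i) \<in> borel_measurable borel" for i by (rule borel_measurable_continuous_onI)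
  have rep: "S t w = (\<Sum>i\<in>Basis. (w \<bullet> i) *\<^sub>R S t i)" for t w
  proof -
    have "S t w = S t (\<Sum>i\<in>Basis. (w \<bullet> i) *\<^sub>R i)" by (simp add: euclidean_representation)
    then show ?thesis by (simp add: linear_sum[OF lin] linear_scale[OF lin])
  qed
  have "(\<lambda>p. S (\<epsilon> * fst p) (snd p)) = (\<lambda>p. \<Sum>i\<in>Basis. (snd p \<bullet> i) *\<^sub>R S (\<epsilon> * fst p) i)"
    by (rule ext) (rule rep)
  then show ?thesis by (simp add: case_prod_unfold)
qed

text \<open>\<open>transport_L1_bound\<close> for the absolute coefficients. As \<tau> tends to 0
  both Jacobian bounds tend to 1, so the right-hand side tends to the norm of \<open>g\<close>
  itself; a bound up to a fixed constant would not do for Scheffe's lemma.\<close>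

lemma propagator_M1_bound:
  fixes g :: "real^'n \<Rightarrow> complex"
  assumes P: "schrodinger_propagator (\<lambda>z. \<beta> z z + \<sigma> z) U" and M1: "M1 g"
    and \<Theta>m [measurable]: "\<Theta> \<in> borel_measurable borel" and \<theta>: "(NNBINT v. \<Theta> v) = ennreal \<theta>" "\<theta> > 0"
    and ker: "\<And>k z w. sq_int k \<Longrightarrow> l2inner k (wp w) = weyl_form (\<lambda>z. \<beta> z z + \<sigma> z) (wp z) (wp w) \<Longrightarrow>
       ennreal (cmod (gstft (\<lambda>x. \<i> * k x + wpdot z (L z) x) w)) \<le> \<Theta> (z - w)"
    and S: "\<And>t. linear (S t)" "\<And>w. S 0 w = w" "\<And>t w. ((\<lambda>t. S t w) has_vector_derivative L (S t w)) (at t)"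
    and L: "\<And>w. norm (L w) \<le> K * norm w" "K \<ge> 0"
    and \<tau>: "\<tau> > 0" "2 * K * \<tau> < 1"
    and small: "\<tau> * ((1 / (1 - 2 * K * \<tau>)) ^ DIM((real^'n) \<times> (real^'n)) * \<theta>) < (1 / (1 + 2 * K * \<tau>)) ^ DIM((real^'n) \<times> (real^'n))"
    and t: "\<bar>t\<bar> \<le> \<tau>"
  shows "(NNBINT v. ennreal (cmod (gstft (U t g) v)))
    \<le> ennreal ((LBINT v. cmod (gstft g v)) / ((1 / (1 + 2 * K * \<tau>)) ^ DIM((real^'n) \<times> (real^'n)) - \<tau> * ((1 / (1 - 2 * K * \<tau>)) ^ DIM((real^'n) \<times> (real^'n)) * \<theta>)))"
proof -
  have g: "sq_int g" using M1 by (simp add: M1_def)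
  have gi: "integrable lborel (gstft g)" by (rule M1_gstft_integrable[OF M1])
  note Us = propagator_sq_int[OF P]
  \<comment> \<open>The sign of t: backward evolution is treated as forward evolution with time
    reversed in both \<open>U\<close> and \<open>S\<close>.\<close>
  define \<epsilon> :: real where "\<epsilon> = (if t < 0 then -1 else 1)"
  have \<epsilon>: "\<bar>\<epsilon>\<bar> = 1" "\<epsilon> * \<bar>t\<bar> = t" by (auto simp: \<epsilon>_def)
  define G where "G s v = cmod (gstft (U (\<epsilon> * s) g) v)" for s v
  define S' where "S' s = S (\<epsilon> * s)" for s
  have Gm [measurable]: "(\<lambda>(s, v). G s v) \<in> borel_measurable (borel \<Otimes>\<^sub>M borel)"
  proof -
    note [measurable] = borel_measurable_gstft_propagator[OF P g, of \<epsilon>]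
    show ?thesis unfolding G_def by measurable
  qed
  have Sm [measurable]: "(\<lambda>(s, v). S' s v) \<in> borel_measurable (borel \<Otimes>\<^sub>M borel)"
    unfolding S'_def by (rule borel_measurable_linear_flow[OF S(1,3)])
  have GB: "G s v \<le> l2norm g" for s v
    unfolding G_def using cmod_gstft_le[OF Us[OF g]] propagator_norm[OF P g] by metis
  define D where "D = DIM((real^'n) \<times> (real^'n))"
  have gU0: "gstft (U 0 g) v = gstft g v" for v
    unfolding gstft_def by (rule l2inner_cong_AE[OF propagator_0[OF P g]]) (auto intro!: sq_intD(1) Us g sq_int_wp)
  \<comment> \<open>For times up to \<tau> the flow distorts norms by factors between 1 - 2 K \<tau>
    and 1 + 2 K \<tau>, which confines the Jacobian factor.\<close>
  have cvex: "\<exists>c. (1 / (1 + 2 * K * \<tau>)) ^ D \<le> c \<and> c \<le> (1 / (1 - 2 * K * \<tau>)) ^ D \<and>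
      (\<forall>h. h \<in> borel_measurable borel \<longrightarrow> (NNBINT w. h (S' s w)) = ennreal c * (NNBINT w. h w))" if s: "s \<in> {0..\<tau>}" for s
  proof -
    have se: "\<bar>\<epsilon> * s\<bar> \<le> \<tau>" using s \<epsilon>(1) by (simp add: abs_mult)
    then have Ks: "K * \<bar>\<epsilon> * s\<bar> \<le> K * \<tau>" using L(2) by (rule mult_left_mono)
    have gr: "norm (S (\<epsilon> * s) w - w) \<le> 2 * K * \<tau> * norm w" for w
    proof -
      have "norm (S (\<epsilon> * s) w - S 0 w) \<le> 2 * K * \<bar>\<epsilon> * s\<bar> * norm (S 0 w)"
        by (rule small_time_growth[OF S(3) L(1) L(2)]) (use Ks \<tau> in simp)
      also have "\<dots> \<le> 2 * K * \<tau> * norm w"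
        unfolding S(2) using Ks by (intro mult_right_mono) auto
      finally show ?thesis by (simp add: S(2))
    qed
    have lo: "(1 - 2 * K * \<tau>) * norm w \<le> norm (S' s w)" and hi: "norm (S' s w) \<le> (1 + 2 * K * \<tau>) * norm w" for w
      using gr[of w] norm_triangle_ineq2[of w "S (\<epsilon> * s) w"] norm_triangle_ineq2[of "S (\<epsilon> * s) w" w]
      by (simp_all add: S'_def left_diff_distrib distrib_right norm_minus_commute)
    show ?thesis unfolding D_def
      by (rule linear_change_of_variables[of "S' s" "1 - 2 * K * \<tau>" "1 + 2 * K * \<tau>"])
        (use S(1) \<tau>(2) lo hi in \<open>auto simp: S'_def\<close>)
  qed
  then obtain c where c: "\<And>s. s \<in> {0..\<tau>} \<Longrightarrow> (1 / (1 + 2 * K * \<tau>)) ^ D \<le> c s" "\<And>s. s \<in> {0..\<tau>} \<Longrightarrow> c s \<le> (1 / (1 - 2 * K * \<tau>)) ^ D"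
    "\<And>s h. s \<in> {0..\<tau>} \<Longrightarrow> h \<in> borel_measurable borel \<Longrightarrow> (NNBINT w. h (S' s w)) = ennreal (c s) * (NNBINT w. h w)"
    by metis
  \<comment> \<open>Along the flow the derivative of the coefficient pairs \<open>U r g\<close> with
    the residual of the packet; Moyal's identity turns that pairing into an integral of coefficients
    against \<Theta>.\<close>
  have duhamel: "ennreal (G s (S' s w)) \<le> ennreal (G 0 w)
      + (NNBINT r. indicator {0..s} r * (NNBINT v. ennreal (G r v) * \<Theta> (S' r w - v)))" if s: "0 \<le> s" for s w
  proof -
    define b where "b r = (NNBINT v. ennreal (G r v) * \<Theta> (S' r w - v))" for r
    have "\<exists>d. ((\<lambda>r. gstft (U (\<epsilon> * r) g) (S (\<epsilon> * r) w)) has_vector_derivative d) (at r) \<and> ennreal (cmod d) \<le> b r" for r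
    proof -
      obtain k where k: "sq_int k" "\<And>w'. l2inner k (wp w') = weyl_form (\<lambda>z. \<beta> z z + \<sigma> z) (wp (S (\<epsilon> * r) w)) (wp w')"
        and kd: "((\<lambda>r. gstft (U r g) (S r w)) has_vector_derivative l2inner (U (\<epsilon> * r) g) (\<lambda>x. \<i> * k x + wpdot (S (\<epsilon> * r) w) (L (S (\<epsilon> * r) w)) x)) (at (\<epsilon> * r))"
        using wave_packet_coefficient_derivative[OF P g S(3)[of w "\<epsilon> * r"]] by blast
      define \<eta> where "\<eta> = (\<lambda>x. \<i> * k x + wpdot (S (\<epsilon> * r) w) (L (S (\<epsilon> * r) w)) x)"
      have \<eta>: "sq_int \<eta>" unfolding \<eta>_def by (intro sq_int_add sq_int_scale k sq_int_wpdot)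
      have "((\<lambda>r. \<epsilon> * r) has_vector_derivative \<epsilon>) (at r)"
        unfolding has_real_derivative_iff_has_vector_derivative[symmetric] by (auto intro!: derivative_eq_intros)
      from vector_diff_chain_at[OF this kd]
      have "((\<lambda>r. gstft (U (\<epsilon> * r) g) (S (\<epsilon> * r) w)) has_vector_derivative \<epsilon> *\<^sub>R l2inner (U (\<epsilon> * r) g) \<eta>) (at r)"
        by (simp add: o_def \<eta>_def)
      moreover have "ennreal (cmod (\<epsilon> *\<^sub>R l2inner (U (\<epsilon> * r) g) \<eta>)) \<le> b r"
      proof -
        have "ennreal (cmod (\<epsilon> *\<^sub>R l2inner (U (\<epsilon> * r) g) \<eta>)) = ennreal (cmod (LBINT v. gstft (U (\<epsilon> * r) g) v * cnj (gstft \<eta> v)))"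
          using \<epsilon>(1) by (simp add: l2inner_eq_gstft[OF Us[OF g] \<eta>])
        also have "\<dots> \<le> (NNBINT v. ennreal (cmod (gstft (U (\<epsilon> * r) g) v * cnj (gstft \<eta> v))))" by (rule norm_integral_le_nn)
        also have "\<dots> \<le> b r"
          unfolding b_def
        proof (rule nn_integral_mono)
          fix v
          have "ennreal (cmod (gstft (U (\<epsilon> * r) g) v * cnj (gstft \<eta> v))) = ennreal (G r v) * ennreal (cmod (gstft \<eta> v))"
            by (simp add: norm_mult G_def ennreal_mult)
          also have "\<dots> \<le> ennreal (G r v) * \<Theta> (S' r w - v)"
            unfolding \<eta>_def S'_def by (intro mult_left_mono ker k) simp
          finally show "ennreal (cmod (gstft (U (\<epsilon> * r) g) v * cnj (gstft \<eta> v))) \<le> ennreal (G r v) * \<Theta> (S' r w - v)" .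
        qed
        finally show ?thesis .
      qed
      ultimately show ?thesis by blast
    qed
    then have "\<forall>r. \<exists>d. ((\<lambda>r. gstft (U (\<epsilon> * r) g) (S (\<epsilon> * r) w)) has_vector_derivative d) (at r) \<and> ennreal (cmod d) \<le> b r" ..
    from choice[OF this]
    obtain d where d: "\<And>r. ((\<lambda>r. gstft (U (\<epsilon> * r) g) (S (\<epsilon> * r) w)) has_vector_derivative d r) (at r)" "\<And>r. ennreal (cmod (d r)) \<le> b r"
      by blast
    have bm: "b \<in> borel_measurable borel"
    proof -
      have "(\<lambda>r. S' r w) \<in> borel_measurable borel" using measurable_compose[OF measurable_Pair2'[of w borel borel] Sm] by simp
      then have "(\<lambda>(r, v). ennreal (G r v) * \<Theta> (S' r w - v)) \<in> borel_measurable (borel \<Otimes>\<^sub>M lborel)"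
        unfolding case_prod_unfold using Gm[unfolded case_prod_unfold]
        by (intro borel_measurable_times_ennreal measurable_compose[OF _ \<Theta>m] borel_measurable_diff measurable_compose[OF _ measurable_ennreal] measurable_compose[OF measurable_fst]) auto
      then show ?thesis unfolding b_def by (rule lborel.borel_measurable_nn_integral)
    qed
    \<comment> \<open>Coefficients never exceed the conserved L^2 norm and \<Theta> has finite mass:
      a crude bound, used for integrability only.\<close>
    have bM: "b r \<le> ennreal (l2norm g * \<theta>)" for r
    proof -
      have "b r \<le> (NNBINT v. ennreal (l2norm g) * \<Theta> (S' r w - v))"
        unfolding b_def by (intro nn_integral_mono mult_right_mono ennreal_leI GB) simp
      also have "\<dots> = ennreal (l2norm g) * ennreal \<theta>"
        by (subst nn_integral_cmult) (simp_all add: nn_integral_lborel_reflect \<theta>(1))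
      finally show ?thesis using \<theta>(2) by (simp add: ennreal_mult)
    qed
    show ?thesis using integral_bound_of_derivative_bound[OF d(1) bm d(2) bM s]
      by (simp add: G_def S'_def b_def S(2))
  qed
  have n0: "(NNBINT v. ennreal (G 0 v)) = ennreal (LBINT v. cmod (gstft g v))"
    unfolding G_def using gi by (simp add: gU0 nn_integral_eq_integral)
  have apos: "(1 / (1 + 2 * K * \<tau>)) ^ D > 0" using L(2) \<tau>(1) by (simp add: add_pos_nonneg)
  have "(NNBINT v. ennreal (G \<bar>t\<bar> v)) \<le> ennreal ((LBINT v. cmod (gstft g v)) / ((1 / (1 + 2 * K * \<tau>)) ^ D - \<tau> * ((1 / (1 - 2 * K * \<tau>)) ^ D * \<theta>)))"
    by (rule transport_L1_bound[OF \<tau>(1) Gm Sm \<Theta>m _ GB c(3) apos c(1) c(2) \<theta> duhamel n0 _ small[folded D_def]])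
      (use t in \<open>auto simp: G_def\<close>)
  then show ?thesis by (simp add: G_def \<epsilon>(2) D_def)
qed

text \<open>By contradiction, along times tending to 0, since Scheffe's lemma is sequential:
  coefficients converge pointwise by strong continuity, and \<open>propagator_M1_bound\<close> keeps
  their L^1 norms asymptotically below that of \<open>g\<close>.\<close>

lemma propagator_M1_continuous:
  fixes g :: "real^'n \<Rightarrow> complex"
  assumes a: "quad_hom_poly a" and sj: "sjostrand (\<lambda>z. complex_of_real (\<sigma> z))"
    and P: "schrodinger_propagator (\<lambda>z. a z + \<sigma> z) U" and M1: "M1 g" and e: "e > 0"
  obtains \<tau> where "\<tau> > 0"
    "\<And>t. \<bar>t\<bar> \<le> \<tau> \<Longrightarrow> (NNBINT p. ennreal (cmod (gstft (\<lambda>x. U t g x - g x) p))) \<le> ennreal e"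
proof -
  have g: "sq_int g" using M1 by (simp add: M1_def)
  have gi: "integrable lborel (gstft g)" by (rule M1_gstft_integrable[OF M1])
  note Us = propagator_sq_int[OF P]
  obtain \<beta> :: "(real^'n) \<times> (real^'n) \<Rightarrow> (real^'n) \<times> (real^'n) \<Rightarrow> real"
    where \<beta>: "\<And>z. linear (\<beta> z)" "\<And>z w. \<beta> z w = \<beta> w z" "\<And>z. a z = \<beta> z z" using quad_hom_poly_bilinear[OF a] by blast
  \<comment> \<open>\<open>sympl_J\<close> of half the gradient of \<open>a\<close>, divided by pi:
    the Hamiltonian vector field of \<open>a\<close> divided by 2 pi.\<close>
  define L where "L z = (1 / pi) *\<^sub>R sympl_J (\<Sum>i\<in>Basis. \<beta> z i *\<^sub>R i)" for z
  have \<beta>L: "\<beta> z d = - pi * sympl (L z) d" for z d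
  proof -
    have JJ: "sympl_J (sympl_J x) = - x" for x :: "(real^'n) \<times> (real^'n)" by (cases x) (simp add: sympl_J_def)
    have "\<beta> z d = \<beta> z (\<Sum>i\<in>Basis. (d \<bullet> i) *\<^sub>R i)" by (simp add: euclidean_representation)
    also have "\<dots> = (\<Sum>i\<in>Basis. \<beta> z i *\<^sub>R i) \<bullet> d"
      by (simp add: linear_sum[OF \<beta>(1)] linear_scale[OF \<beta>(1)] inner_sum_left inner_commute[of d] mult.commute)
    also have "\<dots> = - pi * sympl (L z) d" unfolding L_def sympl_scale_left by (simp add: sympl_eq_inner JJ)
    finally show ?thesis .
  qed
  have linL: "linear L"
  proof (rule linearI)
    fix x y :: "(real^'n) \<times> (real^'n)" and r :: real
    have 1: "\<beta> (x + y) i = \<beta> x i + \<beta> y i" "\<beta> (r *\<^sub>R x) i = r * \<beta> x i" for i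
      using linear_add[OF \<beta>(1)[of i], of x y] linear_scale[OF \<beta>(1)[of i], of r x] by (simp_all add: \<beta>(2)[of _ i])
    show "L (x + y) = L x + L y"
      unfolding L_def 1 by (simp add: scaleR_left_distrib sum.distrib linear_add[OF linear_sympl_J] scaleR_right_distrib)
    show "L (r *\<^sub>R x) = r *\<^sub>R L x"
      unfolding L_def 1 scaleR_scaleR[symmetric] scaleR_sum_right[symmetric] linear_scale[OF linear_sympl_J] by (simp add: mult.commute)
  qed
  obtain K0 where K0: "\<And>w. norm (L w) \<le> norm w * K0" "K0 > 0"
    using bounded_linear.pos_bounded[OF linear_conv_bounded_linear[THEN iffD1, OF linL]] by blast
  obtain S :: "real \<Rightarrow> (real^'n) \<times> (real^'n) \<Rightarrow> (real^'n) \<times> (real^'n)"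
    where S: "\<And>t. linear (S t)" "\<And>w. S 0 w = w" "\<And>t w. ((\<lambda>t. S t w) has_vector_derivative L (S t w)) (at t)"
    using linear_flow_exists[OF linL] by blast
  obtain \<Theta> :: "(real^'n) \<times> (real^'n) \<Rightarrow> ennreal" and \<theta> where \<Theta>: "\<Theta> \<in> borel_measurable borel"
    and \<theta>: "(NNBINT v. \<Theta> v) = ennreal \<theta>" "\<theta> > 0"
    and ker: "\<And>k z w. sq_int k \<Longrightarrow> l2inner k (wp w) = weyl_form (\<lambda>z. \<beta> z z + \<sigma> z) (wp z) (wp w) \<Longrightarrow>
       ennreal (cmod (gstft (\<lambda>x. \<i> * k x + wpdot z (L z) x) w)) \<le> \<Theta> (z - w)"
    using weyl_residual_kernel[OF \<beta>(1,2) sj \<beta>L] by blast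
  define A where "A \<tau> = (1 / (1 + 2 * K0 * \<tau>)) ^ DIM((real^'n) \<times> (real^'n))" for \<tau>
  define B where "B \<tau> = (1 / (1 - 2 * K0 * \<tau>)) ^ DIM((real^'n) \<times> (real^'n))" for \<tau>
  define u where "u \<tau> = (LBINT v. cmod (gstft g v)) / (A \<tau> - \<tau> * (B \<tau> * \<theta>))" for \<tau>
  have bound: "(NNBINT v. ennreal (cmod (gstft (U t g) v))) \<le> ennreal (u \<tau>)"
    if "\<tau> > 0" "2 * K0 * \<tau> < 1" "\<tau> * (B \<tau> * \<theta>) < A \<tau>" "\<bar>t\<bar> \<le> \<tau>" for t \<tau>
    unfolding u_def A_def B_def
    by (rule propagator_M1_bound[where \<beta>=\<beta> and \<sigma>=\<sigma> and \<Theta>=\<Theta> and L=L and S=S and K=K0, OF P[unfolded \<beta>(3)] M1 \<Theta> \<theta> ker S _ _ that(1,2) that(3)[unfolded A_def B_def] that(4)])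
      (use K0 in \<open>auto simp: mult.commute\<close>)
  have A: "(A \<longlongrightarrow> 1) (at 0)" unfolding A_def by (auto intro!: tendsto_eq_intros)
  have B: "(B \<longlongrightarrow> 1) (at 0)" unfolding B_def by (auto intro!: tendsto_eq_intros)
  have AB: "((\<lambda>\<tau>. A \<tau> - \<tau> * (B \<tau> * \<theta>)) \<longlongrightarrow> 1) (at 0)" by (auto intro!: tendsto_eq_intros A B)
  have u: "(u \<longlongrightarrow> (LBINT v. cmod (gstft g v))) (at 0)"
    unfolding u_def using tendsto_divide[OF tendsto_const AB, of "(LBINT v. cmod (gstft g v))"] by simp
  have lin0: "((\<lambda>\<tau>. 2 * K0 * \<tau>) \<longlongrightarrow> 0) (at 0)" by (auto intro!: tendsto_eq_intros)
  have "\<forall>\<^sub>F \<tau> in at 0. 2 * K0 * \<tau> < 1 \<and> A \<tau> - \<tau> * (B \<tau> * \<theta>) > 0"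
    by (intro eventually_conj order_tendstoD(1)[OF AB] order_tendstoD(2)[OF lin0]) auto
  then obtain \<tau>0 where \<tau>0: "\<tau>0 > 0" "\<And>\<tau>. \<tau> \<noteq> 0 \<Longrightarrow> dist \<tau> 0 < \<tau>0 \<Longrightarrow> 2 * K0 * \<tau> < 1 \<and> A \<tau> - \<tau> * (B \<tau> * \<theta>) > 0"
    unfolding eventually_at by auto
  show thesis
  proof (rule ccontr)
    assume "\<not> thesis"
    with that have neg: "\<exists>t. \<bar>t\<bar> \<le> \<tau> \<and> \<not> (NNBINT p. ennreal (cmod (gstft (\<lambda>x. U t g x - g x) p))) \<le> ennreal e" if "\<tau> > 0" for \<tau>
      using \<open>\<tau> > 0\<close> by meson
    \<comment> \<open>The 2 keeps even the first term strictly below \<tau>0.\<close>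
    define \<tau> where "\<tau> n = \<tau>0 / (2 + real n)" for n
    have \<tau>pos: "\<tau> n > 0" for n using \<tau>0(1) by (simp add: \<tau>_def)
    have \<tau>lim: "\<tau> \<longlonglongrightarrow> 0" unfolding \<tau>_def by real_asymp
    have \<tau>d: "dist (\<tau> n) 0 < \<tau>0" for n using \<tau>0(1) by (simp add: \<tau>_def field_simps add_pos_nonneg)
    have \<tau>ok: "2 * K0 * \<tau> n < 1" "\<tau> n * (B (\<tau> n) * \<theta>) < A (\<tau> n)" for n
      using \<tau>0(2)[OF _ \<tau>d[of n]] \<tau>pos[of n] by auto
    from neg[OF \<tau>pos] have "\<forall>n. \<exists>t. \<bar>t\<bar> \<le> \<tau> n \<and> \<not> (NNBINT p. ennreal (cmod (gstft (\<lambda>x. U t g x - g x) p))) \<le> ennreal e" ..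
    from choice[OF this] obtain t where t: "\<And>n. \<bar>t n\<bar> \<le> \<tau> n"
      and te: "\<And>n. \<not> (NNBINT p. ennreal (cmod (gstft (\<lambda>x. U (t n) g x - g x) p))) \<le> ennreal e"
      by blast
    have tlim: "t \<longlonglongrightarrow> 0" by (rule Lim_null_comparison[OF _ \<tau>lim]) (use t in auto)
    have gU0: "gstft (U 0 g) v = gstft g v" for v
      unfolding gstft_def by (rule l2inner_cong_AE[OF propagator_0[OF P g]]) (auto intro!: sq_intD(1) Us g sq_int_wp)
    have m: "gstft (U (t n) g) \<in> borel_measurable lborel" for n using borel_measurable_gstft[OF Us[OF g]] by simp
    have lim: "(\<lambda>n. gstft (U (t n) g) v) \<longlonglongrightarrow> gstft g v" for v
    proof -
      have "(\<lambda>n. l2inner (U (t n) g) (wp v)) \<longlonglongrightarrow> l2inner (U 0 g) (wp v)"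
        by (intro l2inner_tendsto Us g sq_int_wp propagator_tendsto[OF P g tlim]) (auto simp: l2norm_def)
      then show ?thesis using gU0[of v] by (simp add: gstft_def)
    qed
    have ulim: "(\<lambda>n. u (\<tau> n)) \<longlonglongrightarrow> (LBINT v. cmod (gstft g v))"
      by (rule filterlim_compose[OF u]) (use \<tau>lim \<tau>pos in \<open>auto simp: filterlim_at less_imp_neq[symmetric] intro!: always_eventually\<close>)
    have u0: "u (\<tau> n) \<ge> 0" for n unfolding u_def using \<tau>ok(2)[of n] by (intro divide_nonneg_pos integral_nonneg) auto
    note Sch = Scheffe_complex[OF m gi lim bound[OF \<tau>pos \<tau>ok t] u0 ulim]
    have eq: "(NNBINT p. ennreal (cmod (gstft (\<lambda>x. U (t n) g x - g x) p))) = ennreal (LBINT v. cmod (gstft (U (t n) g) v - gstft g v))" for n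
      unfolding gstft_diff[OF Us[OF g] g] using Sch(2)[of n] gi by (intro nn_integral_eq_integral) auto
    have "e < (LBINT v. cmod (gstft (U (t n) g) v - gstft g v))" for n
      using te[of n] ennreal_leI[of "(LBINT v. cmod (gstft (U (t n) g) v - gstft g v))" e] unfolding eq by linarith
    moreover have "\<forall>\<^sub>F n in sequentially. (LBINT v. cmod (gstft (U (t n) g) v - gstft g v)) < e"
      using order_tendstoD(2)[OF Sch(1) e] .
    ultimately show False using eventually_happens'[OF sequentially_bot] less_asym by blast
  qed
qed

section \<open>The Hamiltonian flow and the conclusion\<close>

lemma norm_ham_vf_le:
  fixes D :: "(real^'n) \<times> (real^'n) \<Rightarrow> real"
  assumes D: "\<And>h. \<bar>D h\<bar> \<le> M * norm h"
  shows "norm (ham_vf D) \<le> 2 * real CARD('n) * M"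
proof -
  have D': "\<bar>D (0, axis i 1)\<bar> \<le> M" "\<bar>D (axis i 1, 0)\<bar> \<le> M" for i
    using D[of "(0, axis i 1)"] D[of "(axis i 1, 0)"] by (simp_all add: norm_Pair norm_axis_1)
  have "norm (\<chi> i. D (0, axis i 1)) \<le> (\<Sum>i\<in>(UNIV :: 'n set). M)"
    by (rule order_trans[OF norm_le_l1_cart sum_mono]) (simp add: D')
  moreover have "norm (\<chi> i. D (axis i 1, 0)) \<le> (\<Sum>i\<in>(UNIV :: 'n set). M)"
    by (rule order_trans[OF norm_le_l1_cart sum_mono]) (simp add: D')
  ultimately show ?thesis unfolding ham_vf_def by (intro order_trans[OF norm_Pair_le]) simp
qed

text \<open>Bounded second derivatives make the Hamiltonian vector field globally Lipschitz though
  not bounded. The difference of two trajectories therefore obeys a linear growth inequality, to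
  which \<open>small_time_growth\<close> applies; the displacement of a single point admits no
  uniform bound in general.\<close>

lemma hamiltonian_flow_lipschitz:
  fixes a \<sigma> :: "(real^'n) \<times> (real^'n) \<Rightarrow> real"
  assumes a: "quad_hom_poly a" and C2: "C2_bounded_second \<sigma>" and fl: "hamiltonian_flow (\<lambda>z. a z + \<sigma> z) \<Phi>"
  obtains K where "K \<ge> 0"
    "\<And>t z w. K * \<bar>t\<bar> \<le> 1 / 2 \<Longrightarrow> norm ((\<Phi> t z - z) - (\<Phi> t w - w)) \<le> 2 * K * \<bar>t\<bar> * norm (z - w)"
proof -
  obtain \<beta> :: "(real^'n) \<times> (real^'n) \<Rightarrow> (real^'n) \<times> (real^'n) \<Rightarrow> real"
    where \<beta>: "\<And>z. linear (\<beta> z)" "\<And>z w. \<beta> z w = \<beta> w z" "\<And>z. a z = \<beta> z z" using quad_hom_poly_bilinear[OF a] by blast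
  obtain D1 D2 where D1: "\<And>z. (\<sigma> has_derivative blinfun_apply (D1 z)) (at z)"
    and D2: "\<And>z. (D1 has_derivative blinfun_apply (D2 z)) (at z)" "bounded (range D2)"
    using C2 unfolding C2_bounded_second_def by blast
  obtain M where M: "\<And>z. norm (D2 z) \<le> M" using D2(2) by (auto simp: bounded_iff)
  have M0: "M \<ge> 0" using M[of 0] norm_ge_zero order_trans by blast
  obtain B where B: "B \<ge> 0" "\<And>x y. \<bar>\<beta> x y\<bar> \<le> B * norm x * norm y"
    using bilinear_form_bound[OF \<beta>(1,2)] by blast
  have D1L: "norm (D1 z - D1 w) \<le> M * norm (z - w)" for z w
    by (rule differentiable_bound[of UNIV D1 "\<lambda>z. blinfun_apply (D2 z)"]) (use D2(1) M in \<open>auto simp: norm_blinfun.rep_eq[symmetric]\<close>)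
  define V where "V z = ham_vf (\<lambda>h. (\<beta> z h + \<beta> h z) + D1 z h)" for z
  have bl: "bounded_bilinear \<beta>"
  proof -
    have "linear (\<lambda>x. \<beta> x y)" for y using \<beta>(1)[of y] by (simp only: \<beta>(2)[of _ y])
    then show ?thesis using \<beta>(1) by (simp add: bilinear_conv_bounded_bilinear[symmetric] bilinear_def)
  qed
  have der: "((\<lambda>z. a z + \<sigma> z) has_derivative (\<lambda>h. (\<beta> z h + \<beta> h z) + D1 z h)) (at z)" for z
    unfolding \<beta>(3) by (intro has_derivative_add D1 bounded_bilinear.FDERIV[OF bl] has_derivative_ident)
  have flow: "((\<lambda>s. \<Phi> s z) has_vector_derivative V (\<Phi> t z)) (at t)" for t z
  proof -
    obtain D where D: "((\<lambda>z. a z + \<sigma> z) has_derivative D) (at (\<Phi> t z))" "((\<lambda>s. \<Phi> s z) has_vector_derivative ham_vf D) (at t)"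
      using fl unfolding hamiltonian_flow_def by blast
    have "D = (\<lambda>h. (\<beta> (\<Phi> t z) h + \<beta> h (\<Phi> t z)) + D1 (\<Phi> t z) h)" by (rule has_derivative_unique[OF D(1) der])
    with D(2) show ?thesis by (simp add: V_def)
  qed
  define K where "K = 2 * real CARD('n) * (2 * B + M)"
  have K0: "K \<ge> 0" using B(1) M0 by (simp add: K_def)
  have VL: "norm (V z - V w) \<le> K * norm (z - w)" for z w
  proof -
    have "V z - V w = ham_vf (\<lambda>h. ((\<beta> z h + \<beta> h z) + D1 z h) - ((\<beta> w h + \<beta> h w) + D1 w h))"
      by (simp add: V_def ham_vf_def vec_eq_iff)
    also have "norm \<dots> \<le> 2 * real CARD('n) * ((2 * B + M) * norm (z - w))"
    proof (rule norm_ham_vf_le)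
      fix h
      have "((\<beta> z h + \<beta> h z) + D1 z h) - ((\<beta> w h + \<beta> h w) + D1 w h) = 2 * \<beta> h (z - w) + (D1 z - D1 w) h"
        by (simp add: \<beta>(2)[of _ h] linear_diff[OF \<beta>(1)] blinfun.diff_left)
      also have "\<bar>\<dots>\<bar> \<le> 2 * (B * norm h * norm (z - w)) + norm (D1 z - D1 w) * norm h"
        using B(2)[of h "z - w"] norm_blinfun[of "D1 z - D1 w" h] unfolding real_norm_def by linarith
      also have "\<dots> \<le> 2 * (B * norm h * norm (z - w)) + (M * norm (z - w)) * norm h"
        by (intro add_left_mono mult_right_mono D1L) auto
      finally show "\<bar>((\<beta> z h + \<beta> h z) + D1 z h) - ((\<beta> w h + \<beta> h w) + D1 w h)\<bar> \<le> (2 * B + M) * norm (z - w) * norm h"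
        by (simp add: algebra_simps)
    qed
    finally show ?thesis by (simp add: K_def mult.assoc)
  qed
  show thesis
  proof (rule that[OF K0])
    fix t z w assume t: "K * \<bar>t\<bar> \<le> 1 / 2"
    have \<Phi>0: "\<Phi> 0 z = z" for z using fl unfolding hamiltonian_flow_def by blast
    have "norm ((\<Phi> t z - \<Phi> t w) - (\<Phi> 0 z - \<Phi> 0 w)) \<le> 2 * K * \<bar>t\<bar> * norm (\<Phi> 0 z - \<Phi> 0 w)"
      by (rule small_time_growth[of "\<lambda>s. \<Phi> s z - \<Phi> s w", OF has_vector_derivative_diff[OF flow flow] VL K0 t])
    then show "norm ((\<Phi> t z - z) - (\<Phi> t w - w)) \<le> 2 * K * \<bar>t\<bar> * norm (z - w)" by (simp add: \<Phi>0 algebra_simps)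
  qed
qed

theorem theorem1p1:
  fixes a \<sigma> :: "(real^'n) \<times> (real^'n) \<Rightarrow> real"
    and g :: "real^'n \<Rightarrow> complex"
    and \<Lambda> :: "((real^'n) \<times> (real^'n)) set"
    and \<Phi> :: "real \<Rightarrow> (real^'n) \<times> (real^'n) \<Rightarrow> (real^'n) \<times> (real^'n)"
    and U :: "real \<Rightarrow> (real^'n \<Rightarrow> complex) \<Rightarrow> (real^'n \<Rightarrow> complex)"
  assumes "quad_hom_poly a"
    and "sjostrand (\<lambda>z. complex_of_real (\<sigma> z))"
    and "C2_bounded_second \<sigma>"
    and "hamiltonian_flow (\<lambda>z. a z + \<sigma> z) \<Phi>"
    and "schrodinger_propagator (\<lambda>z. a z + \<sigma> z) U"
    and "M1 g"
    and "gabor_frame g \<Lambda>"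
  shows "\<exists>t0>0. \<forall>t\<in>{-t0..t0}. gabor_frame (U t g) (\<Phi> t ` \<Lambda>)"
proof -
  obtain \<delta> where \<delta>: "\<delta> > 0" and stable: "\<And>\<Psi> h. (\<And>z w. norm ((\<Psi> z - z) - (\<Psi> w - w)) \<le> \<delta> * norm (z - w)) \<Longrightarrow> sq_int h \<Longrightarrow>
      (NNBINT p. ennreal (cmod (gstft (\<lambda>x. h x - g x) p))) \<le> ennreal \<delta> \<Longrightarrow> gabor_frame h (\<Psi> ` \<Lambda>)"
    using gabor_frame_stability[OF assms(6,7)] by blast
  obtain \<tau> where \<tau>: "\<tau> > 0"
    "\<And>t. \<bar>t\<bar> \<le> \<tau> \<Longrightarrow> (NNBINT p. ennreal (cmod (gstft (\<lambda>x. U t g x - g x) p))) \<le> ennreal \<delta>"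
    using propagator_M1_continuous[OF assms(1,2,5,6) \<delta>] by blast
  obtain K where K: "K \<ge> 0"
    "\<And>t z w. K * \<bar>t\<bar> \<le> 1 / 2 \<Longrightarrow> norm ((\<Phi> t z - z) - (\<Phi> t w - w)) \<le> 2 * K * \<bar>t\<bar> * norm (z - w)"
    using hamiltonian_flow_lipschitz[OF assms(1,3,4)] by blast
  \<comment> \<open>The minimum of 1 and \<delta> serves two conditions at once: K |t| \<le> 1/2,
    needed for the flow estimate, and 2 K |t| \<le> \<delta>. The added 1 covers K = 0.\<close>
  define t0 where "t0 = min \<tau> (min 1 \<delta> / (2 * (K + 1)))"
  have t0: "t0 > 0" using \<tau> \<delta> K(1) by (simp add: t0_def)
  have "gabor_frame (U t g) (\<Phi> t ` \<Lambda>)" if t: "t \<in> {-t0..t0}" for t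
  proof (rule stable)
    have t\<tau>: "\<bar>t\<bar> \<le> \<tau>" and t1: "\<bar>t\<bar> \<le> min 1 \<delta> / (2 * (K + 1))" using t by (auto simp: t0_def)
    have "K * \<bar>t\<bar> \<le> (K + 1) * \<bar>t\<bar>" by (intro mult_right_mono) auto
    also have "\<dots> \<le> min 1 \<delta> / 2" using t1 K(1) by (simp add: field_simps)
    finally have Kt: "K * \<bar>t\<bar> \<le> min 1 \<delta> / 2" .
    show "norm ((\<Phi> t z - z) - (\<Phi> t w - w)) \<le> \<delta> * norm (z - w)" for z w
    proof -
      have "norm ((\<Phi> t z - z) - (\<Phi> t w - w)) \<le> 2 * K * \<bar>t\<bar> * norm (z - w)" by (rule K(2)) (use Kt in linarith)
      also have "\<dots> \<le> \<delta> * norm (z - w)" using Kt by (intro mult_right_mono) auto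
      finally show ?thesis .
    qed
    show "sq_int (U t g)" using propagator_sq_int[OF assms(5)] assms(6) by (simp add: M1_def)
    show "(NNBINT p. ennreal (cmod (gstft (\<lambda>x. U t g x - g x) p))) \<le> ennreal \<delta>" by (rule \<tau>(2)[OF t\<tau>])
  qed
  with t0 show ?thesis by blast
qed

end
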